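(* Let $U\subset\mathbb{C}^n$ be a domain, let $\Omega\subset U\times\mathbb{C}^m$ be a family of bounded domains over $U$ that admits a plurisubharmonic defining function, and let $\varphi$ be a $C^2$ plurisubharmonic function defined on some neighborhood of $\overline\Omega$ in $U\times\mathbb{C}^m$. Assume that all fibers $\Omega_t$ ($t\in U$) are (connected) Reinhardt domains in $\mathbb{C}^m$ and that $\varphi(t,z)$ is $T^m$-invariant with respect to $z$. If $\varphi$ is strictly plurisubharmonic on some open subset $O$ of $\Omega$ such that $p(O)=U$, then for any nonnegative integers $k_1,\dots,k_m$, the function $\psi(t)$ defined by $$e^{-\psi(t)}=\int_{\Omega_t}|z_1^{k_1}\cdots z_m^{k_m}|^2e^{-\varphi_t}\,d\lambda_z,\qquad\varphi_t(z)=\varphi(t,z),$$ is a strictly plurisubharmonic function on $U$.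
   Context: Notation: $p:\mathbb{C}^n\times\mathbb{C}^m\to\mathbb{C}^n$ is the natural projection; for $A\subset\mathbb{C}^n\times\mathbb{C}^m$, $A_t=p^{-1}(t)\cap A$ is the fiber over $t$, regarded as a subset of $\mathbb{C}^m$. $d\lambda_z$ is Lebesgue measure on $\mathbb{C}^m$. Closures $\overline\Omega$ are taken in $U\times\mathbb{C}^m$. A family of domains of dimension $m$ over a domain $U\subset\mathbb{C}^n$ is a domain $\Omega\subset U\times\mathbb{C}^m$ with $p(\Omega)=U$; it is a family of bounded domains if every fiber $\Omega_t$ ($t\in U$) is bounded. It has $C^k$ boundary ($k\ge1$) if there is a $C^k$ real function $\rho(t,z)$ on some neighborhood of $\overline\Omega$ in $U\times\mathbb{C}^m$ such that $\Omega=\{\rho<0\}$ and, for every $t\in U$, the differential of $z\mapsto\rho(t,z)$ is nonzero at every point of $\partial\Omega_t$; such $\rho$ is called a defining function. A family with $C^2$ boundary has (admits) a plurisubharmonic defining function if it admits a ($C^2$) defining function that is plurisubharmonic on some neighborhood of $\overline\Omega$ in $U\times\mathbb{C}^m$. A $C^2$ function is strictly plurisubharmonic if its complex Hessian is positive definite everywhere. A domain $D\subset\mathbb{C}^m$ is Reinhardt if it is invariant under the action of the torus $T^m$ given by $(e^{i\theta_1},\dots,e^{i\theta_m})\cdot(z_1,\dots,z_m)=(e^{i\theta_1}z_1,\dots,e^{i\theta_m}z_m)$, $\theta_i\in\mathbb{R}$. *)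

theory Defs
  imports "HOL-Analysis.Analysis"
begin

definition is_domain :: "'a::topological_space set \<Rightarrow> bool" where
  "is_domain S \<longleftrightarrow> open S \<and> connected S \<and> S \<noteq> {}"

(* Meant for open S, where (as frechet_derivative f (at x) v is linear in v and there are only
   finitely many coordinate directions) it says that all partial derivatives up to order k exist
   and are continuous on S. *)
primrec Ck_on :: "nat \<Rightarrow> 'a::euclidean_space set \<Rightarrow> ('a \<Rightarrow> real) \<Rightarrow> bool" where
  "Ck_on 0 S f \<longleftrightarrow> continuous_on S f"
| "Ck_on (Suc k) S f \<longleftrightarrow> (\<forall>x\<in>S. f differentiable (at x)) \<and>
     (\<forall>v. Ck_on k S (\<lambda>x. frechet_derivative f (at x) v))"

(* Plurisubharmonicity of a real-valued function on an open set S: upper semicontinuity and the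
   sub-mean value inequality on every closed complex disc contained in S.  A real-valued
   plurisubharmonic function is bounded above on such a circle, and its circle mean is not
   -infinity as it dominates f a, so it is integrable there; integrability is required explicitly
   because the library's integral of a non-integrable function is 0. *)
definition plurisubharmonic_on :: "(complex ^ 'd) set \<Rightarrow> (complex ^ 'd \<Rightarrow> real) \<Rightarrow> bool" where
  "plurisubharmonic_on S f \<longleftrightarrow>
     (\<forall>c. openin (top_of_set S) {x \<in> S. f x < c}) \<and>
     (\<forall>a\<in>S. \<forall>b. (\<forall>\<zeta>. cmod \<zeta> \<le> 1 \<longrightarrow> a + \<zeta> *s b \<in> S) \<longrightarrow>
        set_integrable lborel {0..2*pi} (\<lambda>\<theta>. f (a + cis \<theta> *s b)) \<and>
        f a \<le> 1 / (2*pi) * (LINT \<theta>:{0..2*pi}|lborel. f (a + cis \<theta> *s b)))"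

(* The Wirtinger derivatives d/dz_j and d/d(conj z_j) *)
definition wirtinger :: "'d \<Rightarrow> (complex ^ 'd \<Rightarrow> complex) \<Rightarrow> complex ^ 'd \<Rightarrow> complex" where
  "wirtinger j g x =
     (frechet_derivative g (at x) (axis j 1) - \<i> * frechet_derivative g (at x) (axis j \<i>)) / 2"

definition wirtinger_bar :: "'d \<Rightarrow> (complex ^ 'd \<Rightarrow> complex) \<Rightarrow> complex ^ 'd \<Rightarrow> complex" where
  "wirtinger_bar j g x =
     (frechet_derivative g (at x) (axis j 1) + \<i> * frechet_derivative g (at x) (axis j \<i>)) / 2"

definition complex_Hessian :: "(complex ^ 'd \<Rightarrow> real) \<Rightarrow> complex ^ 'd \<Rightarrow> complex ^ 'd ^ 'd" where
  "complex_Hessian f x = (\<chi> j k. wirtinger j (wirtinger_bar k (\<lambda>u. complex_of_real (f u))) x)"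

definition positive_definite :: "complex ^ 'd ^ 'd \<Rightarrow> bool" where
  "positive_definite H \<longleftrightarrow>
     (\<forall>j k. H $ k $ j = cnj (H $ j $ k)) \<and>
     (\<forall>w. w \<noteq> 0 \<longrightarrow> 0 < Re (\<Sum>j\<in>UNIV. \<Sum>k\<in>UNIV. H $ j $ k * w $ j * cnj (w $ k)))"

definition strictly_plurisubharmonic_on ::
    "(complex ^ 'd) set \<Rightarrow> (complex ^ 'd \<Rightarrow> real) \<Rightarrow> bool" where
  "strictly_plurisubharmonic_on S f \<longleftrightarrow>
     Ck_on 2 S f \<and> (\<forall>x\<in>S. positive_definite (complex_Hessian f x))"

(* The library's product type carries no complex scalar multiplication, so complex notions on
   C^n x C^m are transported along the standard isomorphism from C^(n+m). *)
definition split_coords :: "complex ^ ('n + 'm) \<Rightarrow> (complex ^ 'n) \<times> (complex ^ 'm)" where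
  "split_coords x = (\<chi> i. x $ Inl i, \<chi> j. x $ Inr j)"

definition plurisubharmonic_prod_on ::
    "((complex ^ 'n) \<times> (complex ^ 'm)) set \<Rightarrow> ((complex ^ 'n) \<times> (complex ^ 'm) \<Rightarrow> real) \<Rightarrow> bool" where
  "plurisubharmonic_prod_on S f \<longleftrightarrow> plurisubharmonic_on (split_coords -` S) (f \<circ> split_coords)"

definition strictly_plurisubharmonic_prod_on ::
    "((complex ^ 'n) \<times> (complex ^ 'm)) set \<Rightarrow> ((complex ^ 'n) \<times> (complex ^ 'm) \<Rightarrow> real) \<Rightarrow> bool" where
  "strictly_plurisubharmonic_prod_on S f \<longleftrightarrow>
     strictly_plurisubharmonic_on (split_coords -` S) (f \<circ> split_coords)"

definition fiber :: "('a \<times> 'b) set \<Rightarrow> 'a \<Rightarrow> 'b set" where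
  "fiber A t = {z. (t, z) \<in> A}"

definition family_of_domains ::
    "(complex ^ 'n) set \<Rightarrow> ((complex ^ 'n) \<times> (complex ^ 'm)) set \<Rightarrow> bool" where
  "family_of_domains U \<Omega> \<longleftrightarrow>
     is_domain U \<and> is_domain \<Omega> \<and> \<Omega> \<subseteq> U \<times> UNIV \<and> fst ` \<Omega> = U"

definition family_of_bounded_domains ::
    "(complex ^ 'n) set \<Rightarrow> ((complex ^ 'n) \<times> (complex ^ 'm)) set \<Rightarrow> bool" where
  "family_of_bounded_domains U \<Omega> \<longleftrightarrow>
     family_of_domains U \<Omega> \<and> (\<forall>t\<in>U. bounded (fiber \<Omega> t))"

(* W is an open neighbourhood, in U x C^m, of the closure of Omega taken in U x C^m *)
definition closure_nhd ::
    "(complex ^ 'n) set \<Rightarrow> ((complex ^ 'n) \<times> (complex ^ 'm)) set \<Rightarrow>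
     ((complex ^ 'n) \<times> (complex ^ 'm)) set \<Rightarrow> bool" where
  "closure_nhd U \<Omega> W \<longleftrightarrow>
     open W \<and> closure \<Omega> \<inter> (U \<times> UNIV) \<subseteq> W \<and> W \<subseteq> U \<times> UNIV"

(* The set W on which the defining function lives is a parameter; values of rho outside W are
   irrelevant. *)
definition defining_function ::
    "nat \<Rightarrow> (complex ^ 'n) set \<Rightarrow> ((complex ^ 'n) \<times> (complex ^ 'm)) set \<Rightarrow>
     ((complex ^ 'n) \<times> (complex ^ 'm)) set \<Rightarrow> ((complex ^ 'n) \<times> (complex ^ 'm) \<Rightarrow> real) \<Rightarrow> bool" where
  "defining_function k U \<Omega> W \<rho> \<longleftrightarrow>
     closure_nhd U \<Omega> W \<and> Ck_on k W \<rho> \<and> \<Omega> = {x \<in> W. \<rho> x < 0} \<and>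
     (\<forall>t\<in>U. \<forall>z\<in>frontier (fiber \<Omega> t).
        frechet_derivative (\<lambda>z'. \<rho> (t, z')) (at z) \<noteq> (\<lambda>_. 0))"

definition has_psh_defining_function ::
    "(complex ^ 'n) set \<Rightarrow> ((complex ^ 'n) \<times> (complex ^ 'm)) set \<Rightarrow> bool" where
  "has_psh_defining_function U \<Omega> \<longleftrightarrow>
     (\<exists>W \<rho> W'. defining_function 2 U \<Omega> W \<rho> \<and>
        closure_nhd U \<Omega> W' \<and> W' \<subseteq> W \<and> plurisubharmonic_prod_on W' \<rho>)"

definition torus_act :: "real ^ 'm \<Rightarrow> complex ^ 'm \<Rightarrow> complex ^ 'm" where
  "torus_act \<theta> z = (\<chi> j. cis (\<theta> $ j) * z $ j)"

definition Reinhardt_domain :: "(complex ^ 'm) set \<Rightarrow> bool" where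
  "Reinhardt_domain D \<longleftrightarrow> is_domain D \<and> (\<forall>\<theta>. \<forall>z\<in>D. torus_act \<theta> z \<in> D)"

(* The domain of definition V of f need not itself be torus-invariant; values are compared
   whenever both points lie in V. *)
definition torus_invariant_on ::
    "((complex ^ 'n) \<times> (complex ^ 'm)) set \<Rightarrow> ((complex ^ 'n) \<times> (complex ^ 'm) \<Rightarrow> real) \<Rightarrow> bool" where
  "torus_invariant_on V f \<longleftrightarrow>
     (\<forall>t z \<theta>. (t, z) \<in> V \<and> (t, torus_act \<theta> z) \<in> V \<longrightarrow> f (t, torus_act \<theta> z) = f (t, z))"

end

theory Submission
  imports Defs
begin

text \<open>For a torus invariant plurisubharmonic \<open>\<phi>\<close> the integral \<open>I = exp (- \<psi>)\<close> reduces to one over the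
  variables \<open>u\<^sub>j = |z\<^sub>j|\<^sup>2\<close>. Writing real functions on the circle as real parts of polynomials produces
  holomorphic discs \<open>\<zeta> \<mapsto> (a + \<zeta> b, exp (Q \<zeta>))\<close>, which lie in \<open>\<Omega>\<close> as soon as their boundaries do, and along
  them a transport argument in the style of Prekopa, applied to one \<open>u\<^sub>j\<close> after the other, shows that the
  circle mean of \<open>ln I\<close> is at most its value at the centre. Since the boundary of \<open>\<Omega>\<close> is \<open>C\<^sup>2\<close> and
  transversal to the fibres, \<open>I\<close> is \<open>C\<^sup>2\<close>. For strictness at \<open>t\<^sub>0\<close>, replace \<open>\<phi>\<close> by
  \<open>\<phi> - \<epsilon> |t - t\<^sub>0|\<^sup>2 \<xi> z\<close> with a torus invariant bump function \<open>\<xi>\<close> supported where \<open>\<phi>\<close> is strictly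
  plurisubharmonic: for small \<open>\<epsilon>\<close> this is still plurisubharmonic on \<open>\<Omega>\<close> near \<open>t\<^sub>0\<close>, it does not change
  \<open>I t\<^sub>0\<close>, and it increases \<open>ln (I t)\<close> by at least a multiple of \<open>|t - t\<^sub>0|\<^sup>2\<close>, so that the mean value
  inequality for the perturbed integral bounds the Levi form of \<open>\<psi>\<close> at \<open>t\<^sub>0\<close> away from zero.\<close>

section \<open>Functions of class \<open>C\<^sup>k\<close>\<close>

text \<open>Plurisubharmonicity of \<open>\<phi>\<close> does not in general pass to minus the
  logarithm of a fibre integral; the torus symmetry is what saves it. In logarithmic coordinates the
  weight depends only on the real part of \<open>log z\<close>, so plurisubharmonicity acts there
  like convexity, and the transport can run with a circle mean in place of a midpoint. It returns
  merely continuous functions on the circle, so the inequality is stated for all continuous boundary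
  data, and polynomials serve only to verify it for the initial weight.

  Two obstacles shape the rest. The weight jumps at the boundary of \<open>\<Omega>\<close>, whereas
  the transport needs continuity: hence a cut-off factor built from \<open>\<rho>\<close>, minimised
  over the torus because \<open>\<rho>\<close> is not assumed invariant, and removed by a limit. And
  a disc with boundary in \<open>\<Omega>\<close> must stay in \<open>\<Omega>\<close>: here the
  plurisubharmonic \<open>\<rho>\<close> enters through the maximum principle, after connectedness
  of the fibres has given their logarithmic convexity.

  The mean value inequality alone yields a nonnegative Levi form. The perturbation gains a multiple
  of the squared radius on small circles around \<open>t0\<close>, which is exactly the order that
  the Levi form measures.\<close>

lemma Ck_on_imp_continuous_on: "Ck_on k S f \<Longrightarrow> continuous_on S f"
  by (cases k) (auto intro: differentiable_imp_continuous_on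
      simp: differentiable_on_def differentiable_at_withinI)

lemma Ck_on_Suc_imp: "Ck_on (Suc k) S f \<Longrightarrow> Ck_on k S f"
proof (induction k arbitrary: f)
  case 0
  then show ?case using Ck_on_imp_continuous_on[of "Suc 0" S f] by simp
next
  case (Suc k)
  then show ?case by (metis Ck_on.simps(2))
qed

lemma Ck_on_le: "Ck_on k S f \<Longrightarrow> j \<le> k \<Longrightarrow> Ck_on j S f"
proof (induction k)
  case (Suc k)
  then show ?case by (metis Ck_on_Suc_imp le_Suc_eq)
qed auto

lemma Ck_on_subset: "Ck_on k S f \<Longrightarrow> T \<subseteq> S \<Longrightarrow> Ck_on k T f"
  by (induction k arbitrary: f) (auto intro: continuous_on_subset)

lemma frechet_derivative_cong_open:
  assumes "open S" "x \<in> S" "\<And>y. y \<in> S \<Longrightarrow> f y = g y"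
  shows "frechet_derivative f (at x) = frechet_derivative g (at x)"
proof -
  have "(f has_derivative D) (at x) \<longleftrightarrow> (g has_derivative D) (at x)" for D
    using has_derivative_transform_within_open[of f D x UNIV S g]
      has_derivative_transform_within_open[of g D x UNIV S f] assms by auto
  then show ?thesis unfolding frechet_derivative_def by simp
qed

lemma Ck_on_cong:
  assumes "open S" "\<And>x. x \<in> S \<Longrightarrow> f x = g x" "Ck_on k S f"
  shows "Ck_on k S g"
  using assms(2,3)
proof (induction k arbitrary: f g)
  case 0
  then show ?case by (simp cong: continuous_on_cong)
next
  case (Suc k)
  have "g differentiable at x" if x: "x \<in> S" for x
  proof -
    obtain D where "(f has_derivative D) (at x)"
      using Suc.prems(2) x by (auto simp: differentiable_def)
    then have "(g has_derivative D) (at x)"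
      using has_derivative_transform_within_open[of f D x UNIV S g] assms(1) x Suc.prems(1) by auto
    then show ?thesis by (auto simp: differentiable_def)
  qed
  moreover have "Ck_on k S (\<lambda>x. frechet_derivative g (at x) v)" for v
  proof (rule Suc.IH)
    show "frechet_derivative f (at x) v = frechet_derivative g (at x) v" if "x \<in> S" for x
      using frechet_derivative_cong_open[OF assms(1) that Suc.prems(1)] by simp
  qed (use Suc.prems(2) in simp)
  ultimately show ?case by simp
qed

text \<open>Allows gluing: a function assembled from pieces on open sets, such as a product with a
  cut-off extended by zero, is checked piece by piece.\<close>

lemma Ck_on_local:
  assumes "\<And>x. x \<in> S \<Longrightarrow> \<exists>T. open T \<and> x \<in> T \<and> Ck_on k T f"
  shows "Ck_on k S f"
  using assms
proof (induction k arbitrary: f)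
  case 0
  have "isCont f x" if "x \<in> S" for x
    using 0[OF that] by (auto simp: continuous_on_eq_continuous_at)
  then show ?case by (simp add: continuous_at_imp_continuous_on)
next
  case (Suc k)
  have "f differentiable at x" if "x \<in> S" for x
    using Suc.prems[OF that] by auto
  moreover have "Ck_on k S (\<lambda>x. frechet_derivative f (at x) v)" for v
    using Suc.prems by (intro Suc.IH) (metis Ck_on.simps(2))
  ultimately show ?case by simp
qed

text \<open>The working rule for raising the order: it suffices to exhibit some derivative
  \<open>D\<close>, since by uniqueness it agrees with \<open>frechet_derivative\<close> on
  \<open>S\<close>.\<close>

lemma Ck_on_SucI:
  assumes "open S" "\<And>x. x \<in> S \<Longrightarrow> (f has_derivative D x) (at x)"
    "\<And>v. Ck_on k S (\<lambda>x. D x v)"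
  shows "Ck_on (Suc k) S f"
proof -
  have "frechet_derivative f (at x) = D x" if "x \<in> S" for x
    using assms(2)[OF that] frechet_derivative_at by metis
  then have "Ck_on k S (\<lambda>x. frechet_derivative f (at x) v)" for v
    by (intro Ck_on_cong[OF assms(1) _ assms(3)[of v]]) auto
  then show ?thesis using assms(2) by (auto simp: differentiable_def)
qed

lemma Ck_on_has_derivative:
  "Ck_on (Suc k) S f \<Longrightarrow> x \<in> S \<Longrightarrow> (f has_derivative frechet_derivative f (at x)) (at x)"
  by (simp add: frechet_derivative_works)

lemma Ck_on_SucD: "Ck_on (Suc k) S f \<Longrightarrow> Ck_on k S (\<lambda>x. frechet_derivative f (at x) v)"
  by simp

lemma Ck_on_const: "open S \<Longrightarrow> Ck_on k S (\<lambda>x. c)"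
proof (induction k arbitrary: c)
  case (Suc k)
  then show ?case by (intro Ck_on_SucI[where D = "\<lambda>x v. 0"]) auto
qed auto

lemma Ck_on_linear: "open S \<Longrightarrow> bounded_linear L \<Longrightarrow> Ck_on k S L"
proof (cases k)
  case (Suc j)
  assume "open S" "bounded_linear L"
  then show ?thesis unfolding Suc
    by (intro Ck_on_SucI[where D = "\<lambda>x. L"] Ck_on_const bounded_linear_imp_has_derivative) auto
qed (auto intro: linear_continuous_on)

lemma Ck_on_add:
  assumes "open S" "Ck_on k S f" "Ck_on k S g"
  shows "Ck_on k S (\<lambda>x. f x + g x)"
  using assms(2,3)
proof (induction k arbitrary: f g)
  case 0
  then show ?case by (auto intro: continuous_intros)
next
  case (Suc k)
  show ?case
  proof (rule Ck_on_SucI[OF assms(1)])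
    show "((\<lambda>x. f x + g x) has_derivative
        (\<lambda>v. frechet_derivative f (at x) v + frechet_derivative g (at x) v)) (at x)" if "x \<in> S" for x
      using Suc.prems that by (intro has_derivative_add Ck_on_has_derivative)
    show "Ck_on k S (\<lambda>x. frechet_derivative f (at x) v + frechet_derivative g (at x) v)" for v
      using Suc by simp
  qed
qed

lemma Ck_on_sum:
  assumes "open S" "\<And>i. i \<in> A \<Longrightarrow> Ck_on k S (f i)"
  shows "Ck_on k S (\<lambda>x. \<Sum>i\<in>A. f i x)"
  using assms(2)
proof (induction A rule: infinite_finite_induct)
  case (insert i A)
  then show ?case by (simp add: Ck_on_add[OF assms(1)])
qed (use Ck_on_const[OF assms(1)] in auto)

lemma Ck_on_mult:
  assumes "open S" "Ck_on k S f" "Ck_on k S g"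
  shows "Ck_on k S (\<lambda>x. f x * g x)"
  using assms(2,3)
proof (induction k arbitrary: f g)
  case 0
  then show ?case by (auto intro: continuous_intros)
next
  case (Suc k)
  show ?case
  proof (rule Ck_on_SucI[OF assms(1)])
    show "((\<lambda>x. f x * g x) has_derivative
        (\<lambda>v. f x * frechet_derivative g (at x) v + frechet_derivative f (at x) v * g x)) (at x)"
      if "x \<in> S" for x
      using Suc.prems that by (intro has_derivative_mult Ck_on_has_derivative)
    show "Ck_on k S (\<lambda>x. f x * frechet_derivative g (at x) v + frechet_derivative f (at x) v * g x)" for v
      using Suc.prems by (intro Ck_on_add[OF assms(1)] Suc.IH) (auto intro: Ck_on_Suc_imp)
  qed
qed

lemma Ck_on_uminus: "open S \<Longrightarrow> Ck_on k S f \<Longrightarrow> Ck_on k S (\<lambda>x. - f x)"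
  using Ck_on_mult[OF _ Ck_on_const, of S k f "-1"] by simp

lemma Ck_on_diff:
  "open S \<Longrightarrow> Ck_on k S f \<Longrightarrow> Ck_on k S g \<Longrightarrow> Ck_on k S (\<lambda>x. f x - g x)"
  using Ck_on_add[of S k f "\<lambda>x. - g x"] Ck_on_uminus[of S k g] by simp

lemma Ck_on_power: "open S \<Longrightarrow> Ck_on k S f \<Longrightarrow> Ck_on k S (\<lambda>x. f x ^ n)"
  by (induction n) (auto intro: Ck_on_const Ck_on_mult)

lemma Ck_on_prod:
  assumes "open S" "\<And>i. i \<in> A \<Longrightarrow> Ck_on k S (f i)"
  shows "Ck_on k S (\<lambda>x. \<Prod>i\<in>A. f i x)"
  using assms(2)
proof (induction A rule: infinite_finite_induct)
  case (insert i A)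
  then show ?case by (simp add: Ck_on_mult[OF assms(1)])
qed (use Ck_on_const[OF assms(1)] in auto)

text \<open>\<open>Ck_on\<close> speaks of real-valued functions, so a vector-valued map is measured
  by its coordinates.\<close>

definition Ck_map :: "nat \<Rightarrow> 'a::euclidean_space set \<Rightarrow> ('a \<Rightarrow> 'b::euclidean_space) \<Rightarrow> bool" where
  "Ck_map k S h \<longleftrightarrow> (\<forall>i\<in>Basis. Ck_on k S (\<lambda>x. h x \<bullet> i))"

lemma Ck_map_Suc_imp: "Ck_map (Suc k) S h \<Longrightarrow> Ck_map k S h"
  unfolding Ck_map_def using Ck_on_Suc_imp by blast

lemma Ck_map_has_derivative:
  assumes "Ck_map (Suc k) S h" "x \<in> S"
  shows "(h has_derivative (\<lambda>v. \<Sum>i\<in>Basis. frechet_derivative (\<lambda>x. h x \<bullet> i) (at x) v *\<^sub>R i)) (at x)"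
  unfolding has_derivative_componentwise_within[of h]
proof
  fix i :: 'b assume i: "i \<in> Basis"
  have "((\<lambda>x. h x \<bullet> i) has_derivative frechet_derivative (\<lambda>x. h x \<bullet> i) (at x)) (at x)"
    using assms i unfolding Ck_map_def by (intro Ck_on_has_derivative) auto
  moreover have "(\<Sum>j\<in>Basis. frechet_derivative (\<lambda>x. h x \<bullet> j) (at x) v *\<^sub>R j) \<bullet> i
    = frechet_derivative (\<lambda>x. h x \<bullet> i) (at x) v" for v
    using i by (simp add: inner_sum_left inner_Basis if_distrib sum.delta' cong: if_cong)
  ultimately show "((\<lambda>x. h x \<bullet> i) has_derivative
      (\<lambda>v. (\<Sum>j\<in>Basis. frechet_derivative (\<lambda>x. h x \<bullet> j) (at x) v *\<^sub>R j) \<bullet> i)) (at x)"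
    by simp
qed

lemma Ck_map_continuous_on: "Ck_map k S h \<Longrightarrow> continuous_on S h"
  unfolding Ck_map_def using Ck_on_imp_continuous_on continuous_on_componentwise by blast

text \<open>Each directional derivative of the composite is a finite sum of products of derivatives
  of \<open>h\<close> with partial derivatives of \<open>f\<close> taken at \<open>h x\<close>; the
  induction is over all \<open>f\<close> so that it applies to these partial derivatives.\<close>

lemma Ck_on_compose:
  assumes "open S" "Ck_on k T f" "Ck_map k S h" "h ` S \<subseteq> T"
  shows "Ck_on k S (\<lambda>x. f (h x))"
  using assms(2,3)
proof (induction k arbitrary: f)
  case 0
  then show ?case
    using assms(4) Ck_map_continuous_on[of 0 S h] by (auto intro: continuous_on_compose2)
next
  case (Suc k)
  let ?D = "\<lambda>x v. \<Sum>i\<in>Basis. frechet_derivative (\<lambda>x. h x \<bullet> i) (at x) v *\<^sub>R i"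
  show ?case
  proof (rule Ck_on_SucI[OF assms(1)])
    fix x assume x: "x \<in> S"
    then have "h x \<in> T" using assms(4) by auto
    note f' = Ck_on_has_derivative[OF Suc.prems(1) this]
    have lin: "linear (frechet_derivative f (at (h x)))"
      using f' has_derivative_linear by auto
    show "((\<lambda>x. f (h x)) has_derivative (\<lambda>v. \<Sum>i\<in>Basis.
        frechet_derivative (\<lambda>x. h x \<bullet> i) (at x) v * frechet_derivative f (at (h x)) i)) (at x)"
      using diff_chain_at[OF Ck_map_has_derivative[OF Suc.prems(2) x] f']
      by (simp add: o_def linear_sum[OF lin] linear_scale[OF lin])
  next
    fix v
    show "Ck_on k S (\<lambda>x. \<Sum>i\<in>Basis.
        frechet_derivative (\<lambda>x. h x \<bullet> i) (at x) v * frechet_derivative f (at (h x)) i)"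
      using Suc.prems Ck_map_Suc_imp[OF Suc.prems(2)]
      by (intro Ck_on_sum[OF assms(1)] Ck_on_mult[OF assms(1)] Suc.IH) (auto simp: Ck_map_def)
  qed
qed

lemma Ck_map_linear: "open S \<Longrightarrow> bounded_linear h \<Longrightarrow> Ck_map k S h"
  unfolding Ck_map_def
  by (auto intro!: Ck_on_linear bounded_linear_compose[OF bounded_linear_inner_left])

lemma Ck_map_const: "open S \<Longrightarrow> Ck_map k S (\<lambda>x. c)"
  unfolding Ck_map_def by (auto intro: Ck_on_const)

lemma Ck_map_real: "Ck_map k S (h :: _ \<Rightarrow> real) \<longleftrightarrow> Ck_on k S h"
  unfolding Ck_map_def by simp

lemma Ck_map_Pair:
  assumes "open S"
  shows "Ck_map k S f \<Longrightarrow> Ck_map k S g \<Longrightarrow> Ck_map k S (\<lambda>x. (f x, g x))"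
  unfolding Ck_map_def Basis_prod_def using Ck_on_const[OF assms] by (auto simp: inner_Pair)

lemma Ck_map_add: "open S \<Longrightarrow> Ck_map k S f \<Longrightarrow> Ck_map k S g \<Longrightarrow> Ck_map k S (\<lambda>x. f x + g x)"
  unfolding Ck_map_def by (auto simp: inner_add_left intro!: Ck_on_add)

lemma Ck_map_scaleR: "open S \<Longrightarrow> Ck_on k S f \<Longrightarrow> Ck_map k S g \<Longrightarrow> Ck_map k S (\<lambda>x. f x *\<^sub>R g x)"
  unfolding Ck_map_def by (auto intro!: Ck_on_mult)

lemma Ck_map_subset: "Ck_map k S f \<Longrightarrow> T \<subseteq> S \<Longrightarrow> Ck_map k T f"
  unfolding Ck_map_def using Ck_on_subset by blast

section \<open>Smoothness of the elementary real functions\<close>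

lemma Ck_on_real_SucI:
  fixes f :: "real \<Rightarrow> real"
  assumes "open S" "\<And>x. x \<in> S \<Longrightarrow> (f has_real_derivative f' x) (at x)" "Ck_on k S f'"
  shows "Ck_on (Suc k) S f"
proof (rule Ck_on_SucI[OF assms(1)])
  show "(f has_derivative (\<lambda>v. f' x * v)) (at x)" if "x \<in> S" for x
    using assms(2)[OF that] by (simp add: has_field_derivative_def)
  show "Ck_on k S (\<lambda>x. f' x * v)" for v
    using assms by (intro Ck_on_mult Ck_on_const)
qed

lemma Ck_on_exp_real: "Ck_on k UNIV (exp :: real \<Rightarrow> real)"
  by (induction k) (auto intro!: Ck_on_real_SucI continuous_intros DERIV_exp simp del: Ck_on.simps(2))

lemma Ck_on_inverse_real: "Ck_on k (- {0}) (inverse :: real \<Rightarrow> real)"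
proof (induction k)
  case (Suc k)
  have "Ck_on k (- {0}) (\<lambda>x::real. - (inverse x * inverse x))"
    using Suc by (intro Ck_on_uminus Ck_on_mult) auto
  then show ?case
    by (intro Ck_on_real_SucI[where f' = "\<lambda>x. - (inverse x * inverse x)"])
      (auto intro!: derivative_eq_intros simp: power2_eq_square)
qed (auto intro!: continuous_intros)

lemma Ck_on_ln_real: "Ck_on k {0<..} (ln :: real \<Rightarrow> real)"
proof (cases k)
  case (Suc j)
  have "Ck_on j {0<..} (inverse :: real \<Rightarrow> real)"
    using Ck_on_inverse_real by (rule Ck_on_subset) auto
  then show ?thesis unfolding Suc
    by (intro Ck_on_real_SucI[where f' = inverse]) (auto intro!: derivative_eq_intros simp: divide_inverse)
qed (auto intro!: continuous_intros)

lemma Ck_on_compose_real: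
  assumes "open S" "Ck_on k T f" "Ck_on k S h" "h ` S \<subseteq> T"
  shows "Ck_on k S (\<lambda>x. f (h x :: real))"
  using Ck_on_compose[of S k T f h] assms by (simp add: Ck_map_real)

lemma Ck_on_exp: "open S \<Longrightarrow> Ck_on k S f \<Longrightarrow> Ck_on k S (\<lambda>x. exp (f x))"
  by (rule Ck_on_compose_real[OF _ Ck_on_exp_real]) auto

lemma Ck_on_inverse:
  "open S \<Longrightarrow> Ck_on k S f \<Longrightarrow> (\<And>x. x \<in> S \<Longrightarrow> f x \<noteq> 0) \<Longrightarrow> Ck_on k S (\<lambda>x. inverse (f x))"
  by (rule Ck_on_compose_real[OF _ Ck_on_inverse_real]) auto

lemma Ck_on_divide:
  "open S \<Longrightarrow> Ck_on k S f \<Longrightarrow> Ck_on k S g \<Longrightarrow> (\<And>x. x \<in> S \<Longrightarrow> g x \<noteq> 0) \<Longrightarrow>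
    Ck_on k S (\<lambda>x. f x / g x)"
  unfolding divide_inverse by (intro Ck_on_mult Ck_on_inverse)

lemma Ck_on_ln:
  "open S \<Longrightarrow> Ck_on k S f \<Longrightarrow> (\<And>x. x \<in> S \<Longrightarrow> f x > 0) \<Longrightarrow> Ck_on k S (\<lambda>x. ln (f x))"
  by (rule Ck_on_compose_real[OF _ Ck_on_ln_real]) auto

text \<open>The lowest integer power of the positive part that is of class C^2, which is all the
  smoothness that the cut-offs and partitions of unity below require.\<close>

definition pos_cube :: "real \<Rightarrow> real" where
  "pos_cube x = (max 0 x) ^ 3"

text \<open>Only the point 0 needs an argument: there the difference quotient is at most
  \<open>\<bar>h\<bar> ^ n\<close> in absolute value, which tends to 0 as \<open>n\<close> is at
  least 1.\<close>

lemma pos_part_power_has_derivative: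
  assumes "n \<ge> 1"
  shows "((\<lambda>x. (max 0 x) ^ Suc n) has_real_derivative real (Suc n) * (max 0 x) ^ n) (at (x::real))"
proof -
  consider "x < 0" | "x = 0" | "x > 0" by linarith
  then show ?thesis
  proof cases
    case 1
    have "((\<lambda>x. (max 0 x) ^ Suc n) has_real_derivative 0) (at x)"
      by (rule has_field_derivative_transform_within_open[where f = "\<lambda>x. 0" and S = "{..<0}"])
        (use 1 in auto)
    moreover have "real (Suc n) * (max 0 x) ^ n = 0" using 1 assms by (simp add: max_def)
    ultimately show ?thesis by (simp only:)
  next
    case 2
    have "((\<lambda>h. (max 0 h) ^ Suc n / h) \<longlongrightarrow> 0) (at (0::real))"
    proof (rule Lim_null_comparison)
      show "\<forall>\<^sub>F h in at (0::real). norm ((max 0 h) ^ Suc n / h) \<le> \<bar>h\<bar> ^ n"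
        by (rule always_eventually) (auto simp: max_def abs_mult divide_simps mult_nonneg_nonpos)
      show "((\<lambda>h::real. \<bar>h\<bar> ^ n) \<longlongrightarrow> 0) (at 0)"
        using assms by (auto intro!: tendsto_eq_intros)
    qed
    moreover have "real (Suc n) * (max 0 x) ^ n = 0" using 2 assms by simp
    ultimately show ?thesis using 2 by (simp only: DERIV_def) simp
  next
    case 3
    have "((\<lambda>x. x ^ Suc n) has_real_derivative real (Suc n) * x ^ n) (at x)"
      using DERIV_pow[of "Suc n" x] by simp
    then have "((\<lambda>x. (max 0 x) ^ Suc n) has_real_derivative real (Suc n) * x ^ n) (at x)"
      by (rule has_field_derivative_transform_within_open[where S = "{0<..}"]) (use 3 in auto)
    moreover have "max 0 x = x" using 3 by simp
    ultimately show ?thesis by (simp only:)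
  qed
qed

lemma Ck_on_pos_cube: "open S \<Longrightarrow> Ck_on 2 S f \<Longrightarrow> Ck_on 2 S (\<lambda>x. pos_cube (f x))"
proof (rule Ck_on_compose_real[where f = pos_cube and T = UNIV])
  have 1: "Ck_on (Suc 0) UNIV (\<lambda>x::real. 3 * (max 0 x)\<^sup>2)"
    using pos_part_power_has_derivative[of 1]
    by (intro Ck_on_mult Ck_on_const Ck_on_real_SucI[where f' = "\<lambda>x. 2 * max 0 x"])
      (auto intro!: continuous_intros simp: numeral_2_eq_2)
  show "Ck_on 2 UNIV pos_cube"
    using Ck_on_real_SucI[OF _ _ 1, of pos_cube] pos_part_power_has_derivative[of 2]
    by (simp add: pos_cube_def[abs_def] numeral_2_eq_2 numeral_3_eq_3 del: Ck_on.simps(2))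
qed auto

lemma pos_cube_simps: "x \<le> 0 \<Longrightarrow> pos_cube x = 0" "0 < x \<Longrightarrow> 0 < pos_cube x" "0 \<le> pos_cube x"
  by (auto simp: pos_cube_def max_def)

lemma has_derivative_integral_param:
  fixes q :: "'a::euclidean_space \<times> 'b::euclidean_space \<Rightarrow> real"
  assumes "open T" "open S" "T \<times> cbox a b \<subseteq> S" "Ck_on (Suc k) S q" "t \<in> T"
  shows "((\<lambda>t. integral (cbox a b) (\<lambda>y. q (t, y))) has_derivative
    (\<lambda>v. integral (cbox a b) (\<lambda>y. frechet_derivative q (at (t, y)) (v, 0)))) (at t)"
proof -
  obtain r where r: "r > 0" "ball t r \<subseteq> T" using assms openE by blast
  let ?B = "ball t r"
  \<comment> \<open>The derivative in the parameter is packed into a bounded operator, the form in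
    which the Leibniz rule takes it; its continuity is checked on basis vectors.\<close>
  define fx where "fx = (\<lambda>x y. Blinfun (\<lambda>v. frechet_derivative q (at (x, y)) (v, 0)))"
  have der: "((\<lambda>x. q (x, y)) has_derivative (\<lambda>v. frechet_derivative q (at (x, y)) (v, 0))) (at x)"
    if "x \<in> ?B" "y \<in> cbox a b" for x y
  proof -
    have "(x, y) \<in> S" using that r assms(3) by auto
    then have "(q has_derivative frechet_derivative q (at (x, y))) (at (x, y))"
      by (rule Ck_on_has_derivative[OF assms(4)])
    moreover have "((\<lambda>x. (x, y)) has_derivative (\<lambda>v. (v, 0))) (at x)"
      by (auto intro!: derivative_eq_intros)
    ultimately show ?thesis
      using diff_chain_at[of "\<lambda>x. (x, y)" "\<lambda>v. (v, 0)" x q] by (simp add: o_def)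
  qed
  have app: "blinfun_apply (fx x y) = (\<lambda>v. frechet_derivative q (at (x, y)) (v, 0))"
    if "x \<in> ?B" "y \<in> cbox a b" for x y
    unfolding fx_def using has_derivative_bounded_linear[OF der[OF that]]
    by (rule bounded_linear_Blinfun_apply)
  have sub: "?B \<times> cbox a b \<subseteq> S" using r assms(3) by auto
  have contq: "continuous_on S q" using assms(4) by (rule Ck_on_imp_continuous_on)
  have cont: "continuous_on (?B \<times> cbox a b) (\<lambda>(x, y). fx x y)"
  proof (rule continuous_on_blinfun_componentwise)
    fix i :: 'a assume "i \<in> Basis"
    have "continuous_on S (\<lambda>x. frechet_derivative q (at x) (i, 0))"
      using Ck_on_SucD[OF assms(4)] by (rule Ck_on_imp_continuous_on)
    then have "continuous_on (?B \<times> cbox a b) (\<lambda>x. frechet_derivative q (at x) (i, 0))"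
      using sub by (rule continuous_on_subset)
    then show "continuous_on (?B \<times> cbox a b) (\<lambda>x. blinfun_apply (case x of (x, y) \<Rightarrow> fx x y) i)"
      by (rule continuous_on_eq) (auto simp: app split: prod.splits)
  qed
  have tB: "t \<in> ?B" using r by simp
  have "((\<lambda>x. integral (cbox a b) (\<lambda>y. q (x, y))) has_derivative integral (cbox a b) (fx t)) (at t within ?B)"
  proof (rule leibniz_rule[where f = "\<lambda>x y. q (x, y)" and fx = fx])
    show "((\<lambda>x. q (x, y)) has_derivative blinfun_apply (fx x y)) (at x within ?B)"
      if "x \<in> ?B" "y \<in> cbox a b" for x y
      using der[OF that] app[OF that] by (simp add: has_derivative_at_withinI)
    show "(\<lambda>y. q (x, y)) integrable_on cbox a b" if "x \<in> ?B" for x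
      using that sub by (intro integrable_continuous continuous_on_compose2[OF contq] continuous_intros) auto
  qed (use cont tB in auto)
  then have d: "((\<lambda>x. integral (cbox a b) (\<lambda>y. q (x, y))) has_derivative integral (cbox a b) (fx t)) (at t)"
    using tB by (simp add: at_within_open[of t "?B"])
  have "fx t integrable_on cbox a b"
    using tB cont
    by (intro integrable_continuous continuous_on_compose2[OF cont, of _ "\<lambda>y. (t, y)", simplified] continuous_intros) auto
  then have "blinfun_apply (integral (cbox a b) (fx t)) v =
      integral (cbox a b) (\<lambda>y. frechet_derivative q (at (t, y)) (v, 0))" for v
    using app[OF tB] by (subst blinfun_apply_integral) (auto intro!: integral_cong)
  then have "blinfun_apply (integral (cbox a b) (fx t)) = (\<lambda>v. integral (cbox a b) (\<lambda>y. frechet_derivative q (at (t, y)) (v, 0)))"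
    by auto
  then show ?thesis using d by simp
qed

text \<open>\<open>S\<close> is an open set around \<open>T \<times> cbox a b\<close>, so that
  derivatives of \<open>q\<close> make sense at the boundary of the box and differentiation under
  the integral can be iterated.\<close>

lemma Ck_on_integral:
  fixes q :: "'a::euclidean_space \<times> 'b::euclidean_space \<Rightarrow> real"
  assumes "open T" "open S" "T \<times> cbox a b \<subseteq> S" "Ck_on k S q"
  shows "Ck_on k T (\<lambda>t. integral (cbox a b) (\<lambda>y. q (t, y)))"
  using assms(4)
proof (induction k arbitrary: q)
  case 0
  have "continuous_on (T \<times> cbox a b) (\<lambda>(x, y). q (x, y))"
    using 0 assms(3) by (auto intro: continuous_on_subset)
  then show ?case by (auto intro: integral_continuous_on_param)
next
  case (Suc k)
  show ?case
    by (rule Ck_on_SucI[OF assms(1) has_derivative_integral_param[OF assms(1-3) Suc.prems]])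
      (use Suc.IH Ck_on_SucD[OF Suc.prems] in auto)
qed

section \<open>Second derivatives and the Levi form\<close>

definition D2 :: "('a::euclidean_space \<Rightarrow> real) \<Rightarrow> 'a \<Rightarrow> 'a \<Rightarrow> 'a \<Rightarrow> real" where
  "D2 f x v w = frechet_derivative (\<lambda>y. frechet_derivative f (at y) v) (at x) w"

lemma Ck_on_2_iff: "Ck_on 2 S f \<longleftrightarrow> Ck_on (Suc (Suc 0)) S f"
  by (simp add: numeral_2_eq_2)

lemma Ck_on_2_has_derivative:
  assumes "Ck_on 2 S f" "x \<in> S"
  shows "(f has_derivative frechet_derivative f (at x)) (at x)"
    "((\<lambda>y. frechet_derivative f (at y) v) has_derivative D2 f x v) (at x)"
proof -
  show "(f has_derivative frechet_derivative f (at x)) (at x)"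
    using assms Ck_on_has_derivative unfolding Ck_on_2_iff by blast
  have "Ck_on (Suc 0) S (\<lambda>y. frechet_derivative f (at y) v)"
    using assms Ck_on_SucD unfolding Ck_on_2_iff by blast
  then show "((\<lambda>y. frechet_derivative f (at y) v) has_derivative D2 f x v) (at x)"
    using Ck_on_has_derivative[of 0 S _ x] assms unfolding D2_def[abs_def] by blast
qed

lemma D2_continuous_on: "Ck_on 2 S f \<Longrightarrow> continuous_on S (\<lambda>x. D2 f x v w)"
  unfolding D2_def Ck_on_2_iff by (intro Ck_on_imp_continuous_on[of 0] Ck_on_SucD)

lemma frechet_derivative_linear_2: "Ck_on 2 S f \<Longrightarrow> x \<in> S \<Longrightarrow> linear (frechet_derivative f (at x))"
  using Ck_on_2_has_derivative(1) has_derivative_linear by blast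

lemma D2_linear_right: "Ck_on 2 S f \<Longrightarrow> x \<in> S \<Longrightarrow> linear (D2 f x v)"
  using Ck_on_2_has_derivative(2) has_derivative_linear by blast

text \<open>Linearity in the first direction holds for the first derivative at all nearby points, so
  it survives a second differentiation; this is where openness of \<open>S\<close> enters.\<close>

lemma D2_linear_left:
  assumes "open S" "Ck_on 2 S f" "x \<in> S"
  shows "linear (\<lambda>v. D2 f x v w)"
proof
  note lin = frechet_derivative_linear_2[OF assms(2)]
  fix v v' c
  have "((\<lambda>y. frechet_derivative f (at y) v + frechet_derivative f (at y) v') has_derivative
      (\<lambda>w. D2 f x v w + D2 f x v' w)) (at x)"
    using assms by (intro has_derivative_add Ck_on_2_has_derivative)
  then have "((\<lambda>y. frechet_derivative f (at y) (v + v')) has_derivative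
      (\<lambda>w. D2 f x v w + D2 f x v' w)) (at x)"
    by (rule has_derivative_transform_within_open[OF _ assms(1,3)]) (simp add: linear_add[OF lin])
  from fun_cong[OF frechet_derivative_at[OF this], of w]
  show "D2 f x (v + v') w = D2 f x v w + D2 f x v' w"
    by (subst D2_def) (rule sym)
  have "((\<lambda>y. c * frechet_derivative f (at y) v) has_derivative (\<lambda>w. c * D2 f x v w)) (at x)"
    using assms by (intro has_derivative_mult_right Ck_on_2_has_derivative)
  then have "((\<lambda>y. frechet_derivative f (at y) (c *\<^sub>R v)) has_derivative (\<lambda>w. c * D2 f x v w)) (at x)"
    by (rule has_derivative_transform_within_open[OF _ assms(1,3)]) (simp add: linear_scale[OF lin])
  from fun_cong[OF frechet_derivative_at[OF this], of w]
  show "D2 f x (c *\<^sub>R v) w = c *\<^sub>R D2 f x v w"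
    unfolding real_scaleR_def by (subst D2_def) (rule sym)
qed

lemma D2_cong_open:
  assumes "open S" "x \<in> S" "\<And>y. y \<in> S \<Longrightarrow> f y = g y"
  shows "D2 f x v w = D2 g x v w"
  unfolding D2_def
  by (rule arg_cong[where f = "\<lambda>D. D w"], rule frechet_derivative_cong_open[OF assms(1,2)])
    (use frechet_derivative_cong_open[OF assms(1) _ assms(3)] in auto)

lemma D2_eqI:
  assumes "open S" "x \<in> S" "\<And>y. y \<in> S \<Longrightarrow> (f has_derivative D y) (at y)"
    "((\<lambda>y. D y v) has_derivative E) (at x)"
  shows "D2 f x v w = E w"
proof -
  have "frechet_derivative f (at y) = D y" if "y \<in> S" for y
    using frechet_derivative_at[OF assms(3)[OF that]] by (rule sym)
  then have "frechet_derivative (\<lambda>y. frechet_derivative f (at y) v) (at x) = frechet_derivative (\<lambda>y. D y v) (at x)"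
    by (intro frechet_derivative_cong_open[OF assms(1,2)]) simp
  also have "\<dots> = E" using frechet_derivative_at[OF assms(4)] by (rule sym)
  finally show ?thesis by (simp add: D2_def)
qed

lemma D2_add:
  assumes "open S" "Ck_on 2 S f" "Ck_on 2 S g" "x \<in> S"
  shows "D2 (\<lambda>x. f x + g x) x v w = D2 f x v w + D2 g x v w"
  using assms by (intro D2_eqI[OF assms(1,4), where D =
      "\<lambda>y v. frechet_derivative f (at y) v + frechet_derivative g (at y) v"])
    (auto intro!: has_derivative_add Ck_on_2_has_derivative)

lemma D2_cmult:
  assumes "open S" "Ck_on 2 S f" "x \<in> S"
  shows "D2 (\<lambda>x. c * f x) x v w = c * D2 f x v w"
  using assms by (intro D2_eqI[OF assms(1,3), where D = "\<lambda>y v. c * frechet_derivative f (at y) v"])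
    (auto intro!: has_derivative_mult_right Ck_on_2_has_derivative)

lemma D2_compose_linear:
  assumes "open S" "Ck_on 2 S f" "bounded_linear L" "L x \<in> S"
  shows "D2 (\<lambda>y. f (L y)) x v w = D2 f (L x) (L v) (L w)"
proof (rule D2_eqI[where S = "L -` S" and D = "\<lambda>y v. frechet_derivative f (at (L y)) (L v)"])
  have cont: "continuous_on UNIV L" using assms(3) by (simp add: linear_continuous_on)
  show "open (L -` S)" using open_vimage[OF assms(1) cont] .
  note L = bounded_linear_imp_has_derivative[OF assms(3)]
  show "((\<lambda>y. f (L y)) has_derivative (\<lambda>v. frechet_derivative f (at (L y)) (L v))) (at y)"
    if "y \<in> L -` S" for y
    using diff_chain_at[OF L Ck_on_2_has_derivative(1)[OF assms(2)]] that by (simp add: o_def)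
  show "((\<lambda>y. frechet_derivative f (at (L y)) (L v)) has_derivative (\<lambda>w. D2 f (L x) (L v) (L w))) (at x)"
    using diff_chain_at[OF L Ck_on_2_has_derivative(2)[OF assms(2)], where v1 = "L v"] assms(4)
    by (simp add: o_def)
qed (use assms in simp)

lemma has_real_derivative_along_line:
  fixes f :: "'a::euclidean_space \<Rightarrow> real"
  assumes "(f has_derivative D) (at (x + s *\<^sub>R v))"
  shows "((\<lambda>s. f (x + s *\<^sub>R v)) has_real_derivative D v) (at s)"
proof -
  have "((\<lambda>s. x + s *\<^sub>R v) has_derivative (\<lambda>h. h *\<^sub>R v)) (at s)"
    by (auto intro!: derivative_eq_intros)
  from diff_chain_at[OF this assms] have "((\<lambda>s. f (x + s *\<^sub>R v)) has_derivative (\<lambda>h. D (h *\<^sub>R v))) (at s)"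
    by (simp add: o_def)
  moreover have "D (h *\<^sub>R v) = D v * h" for h
    using has_derivative_linear[OF assms] by (simp add: linear_scale)
  ultimately show ?thesis by (simp add: has_field_derivative_def)
qed

text \<open>Differentiate \<open>f (x + s v + t w) = f (x + s v) + \<integral>\<^sub>0\<^sup>t \<partial>\<^sub>w f (x + s v + \<tau> w) d\<tau>\<close> in \<open>s\<close>, then in \<open>t\<close>.\<close>
lemma D2_symmetric:
  fixes f :: "'a::euclidean_space \<Rightarrow> real"
  assumes "open S" "Ck_on 2 S f" "x \<in> S"
  shows "D2 f x v w = D2 f x w v"
proof -
  obtain e where e: "e > 0" "ball x e \<subseteq> S" using assms openE by blast
  \<comment> \<open>Small enough that \<open>x + s v + t w\<close> stays in the ball for
    \<open>s\<close> and \<open>t\<close> of absolute value at most \<open>d\<close>; the added 1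
    avoids a division by zero.\<close>
  define d where "d = e / (2 * (norm v + norm w + 1))"
  have nn: "2 * (norm v + norm w + 1) > 0" by (smt (verit) norm_ge_zero)
  then have d: "d > 0" using e by (simp add: d_def)
  have in_S: "x + s *\<^sub>R v + t *\<^sub>R w \<in> S" if "\<bar>s\<bar> \<le> d" "\<bar>t\<bar> \<le> d" for s t
  proof -
    have "norm (s *\<^sub>R v + t *\<^sub>R w) \<le> \<bar>s\<bar> * norm v + \<bar>t\<bar> * norm w"
      by (metis norm_scaleR norm_triangle_ineq)
    also have "\<dots> \<le> d * norm v + d * norm w" using that by (intro add_mono mult_right_mono) auto
    also have "\<dots> < d * (2 * (norm v + norm w + 1))"
      using d by (smt (verit) mult_strict_left_mono norm_ge_zero distrib_left)
    also have "\<dots> = e" using nn by (simp add: d_def)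
    finally have "norm (s *\<^sub>R v + t *\<^sub>R w) < e" .
    then have "x + (s *\<^sub>R v + t *\<^sub>R w) \<in> ball x e" unfolding mem_ball dist_commute[of x] by (simp add: dist_norm)
    then show ?thesis using e by (auto simp: add.assoc)
  qed
  define g where "g = (\<lambda>y. frechet_derivative f (at y) w)"
  have g: "Ck_on (Suc 0) S g" using assms(2) Ck_on_SucD unfolding Ck_on_2_iff g_def by blast
  have contg: "continuous_on S g" using g by (rule Ck_on_imp_continuous_on)
  have ftc: "f (x + s *\<^sub>R v + t *\<^sub>R w) - f (x + s *\<^sub>R v) = integral (cbox 0 t) (\<lambda>\<tau>. g (x + s *\<^sub>R v + \<tau> *\<^sub>R w))"
    if "\<bar>s\<bar> \<le> d" "0 \<le> t" "t \<le> d" for s t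
  proof -
    have "((\<lambda>\<tau>. g (x + s *\<^sub>R v + \<tau> *\<^sub>R w)) has_integral
        (f (x + s *\<^sub>R v + t *\<^sub>R w) - f (x + s *\<^sub>R v + 0 *\<^sub>R w))) {0..t}"
    proof (rule fundamental_theorem_of_calculus)
      fix \<tau> assume "\<tau> \<in> {0..t}"
      then have "x + s *\<^sub>R v + \<tau> *\<^sub>R w \<in> S" using that in_S by auto
      from has_real_derivative_along_line[OF Ck_on_2_has_derivative(1)[OF assms(2) this]]
      show "((\<lambda>\<tau>. f (x + s *\<^sub>R v + \<tau> *\<^sub>R w)) has_vector_derivative g (x + s *\<^sub>R v + \<tau> *\<^sub>R w)) (at \<tau> within {0..t})"
        unfolding g_def has_real_derivative_iff_has_vector_derivative
        by (rule has_vector_derivative_at_within)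
    qed (use that in auto)
    then show ?thesis by (simp add: integral_unique)
  qed
  have D: "frechet_derivative f (at (x + t *\<^sub>R w)) v - frechet_derivative f (at x) v
      = integral (cbox 0 t) (\<lambda>\<tau>. D2 f (x + \<tau> *\<^sub>R w) w v)" if t: "0 \<le> t" "t \<le> d" for t
  proof -
    have "((\<lambda>s. integral (cbox 0 t) (\<lambda>\<tau>. g (x + s *\<^sub>R v + \<tau> *\<^sub>R w))) has_real_derivative
        integral (cbox 0 t) (\<lambda>\<tau>. D2 f (x + 0 *\<^sub>R v + \<tau> *\<^sub>R w) w v)) (at 0 within {-d<..<d})"
    proof (rule leibniz_rule_field_derivative)
      fix s \<tau> assume "s \<in> {-d<..<d}" "\<tau> \<in> cbox 0 t"
      then have "x + s *\<^sub>R v + \<tau> *\<^sub>R w \<in> S" using in_S t by auto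
      then have "x + \<tau> *\<^sub>R w + s *\<^sub>R v \<in> S" by (simp add: add_ac)
      from has_real_derivative_along_line[OF Ck_on_2_has_derivative(2)[OF assms(2) this, of w]]
      have "((\<lambda>s. g (x + s *\<^sub>R v + \<tau> *\<^sub>R w)) has_real_derivative D2 f (x + s *\<^sub>R v + \<tau> *\<^sub>R w) w v) (at s)"
        unfolding g_def by (simp add: add_ac)
      then show "((\<lambda>s. g (x + s *\<^sub>R v + \<tau> *\<^sub>R w)) has_real_derivative D2 f (x + s *\<^sub>R v + \<tau> *\<^sub>R w) w v)
          (at s within {-d<..<d})" by (rule has_field_derivative_at_within)
    next
      fix s assume "s \<in> {-d<..<d}"
      then show "(\<lambda>\<tau>. g (x + s *\<^sub>R v + \<tau> *\<^sub>R w)) integrable_on cbox 0 t"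
        using in_S t by (intro integrable_continuous continuous_on_compose2[OF contg] continuous_intros) auto
    next
      show "continuous_on ({- d<..<d} \<times> cbox 0 t) (\<lambda>(s, \<tau>). D2 f (x + s *\<^sub>R v + \<tau> *\<^sub>R w) w v)"
        unfolding case_prod_beta using in_S t
        by (intro continuous_on_compose2[OF D2_continuous_on[OF assms(2)]] continuous_intros) auto
    qed (use d in auto)
    then have i: "((\<lambda>s. integral (cbox 0 t) (\<lambda>\<tau>. g (x + s *\<^sub>R v + \<tau> *\<^sub>R w))) has_real_derivative
        integral (cbox 0 t) (\<lambda>\<tau>. D2 f (x + \<tau> *\<^sub>R w) w v)) (at 0)"
      using d by (simp add: at_within_open[of 0 "{-d<..<d}"])
    have "x + t *\<^sub>R w + 0 *\<^sub>R v \<in> S" "x + 0 *\<^sub>R v \<in> S" using in_S[of 0 t] d t assms(3) by auto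
    note this[THEN Ck_on_2_has_derivative(1)[OF assms(2)], THEN has_real_derivative_along_line]
    from DERIV_diff[OF this(1) this(2)]
    have l: "((\<lambda>s. f (x + t *\<^sub>R w + s *\<^sub>R v) - f (x + s *\<^sub>R v)) has_real_derivative
        (frechet_derivative f (at (x + t *\<^sub>R w)) v - frechet_derivative f (at x) v)) (at 0)" by simp
    have "((\<lambda>s. integral (cbox 0 t) (\<lambda>\<tau>. g (x + s *\<^sub>R v + \<tau> *\<^sub>R w))) has_real_derivative
        (frechet_derivative f (at (x + t *\<^sub>R w)) v - frechet_derivative f (at x) v)) (at 0)"
      by (rule has_field_derivative_transform_within_open[OF l, of "{-d<..<d}"])
        (use d ftc t in \<open>auto simp: add_ac simp flip: interval_cbox\<close>)
    with i show ?thesis using DERIV_unique by blast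
  qed
  have "continuous_on {0..d} (\<lambda>\<tau>. D2 f (x + \<tau> *\<^sub>R w) w v)"
    using in_S[of 0] d
    by (intro continuous_on_compose2[OF D2_continuous_on[OF assms(2)]] continuous_intros) auto
  from integral_has_vector_derivative[OF this, of 0]
  have r: "((\<lambda>t. integral {0..t} (\<lambda>\<tau>. D2 f (x + \<tau> *\<^sub>R w) w v)) has_real_derivative D2 f x w v) (at 0 within {0..d})"
    using d by (simp add: has_real_derivative_iff_has_vector_derivative)
  have "((\<lambda>t. frechet_derivative f (at (x + t *\<^sub>R w)) v - frechet_derivative f (at x) v)
      has_real_derivative D2 f x v w - 0) (at 0)"
    using Ck_on_2_has_derivative(2)[OF assms(2,3)]
    by (intro DERIV_diff DERIV_const has_real_derivative_along_line[where s = 0]) auto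
  then have l: "((\<lambda>t. frechet_derivative f (at (x + t *\<^sub>R w)) v - frechet_derivative f (at x) v)
      has_real_derivative D2 f x v w) (at 0 within {0..d})"
    by (simp add: has_field_derivative_at_within)
  have "((\<lambda>t. integral {0..t} (\<lambda>\<tau>. D2 f (x + \<tau> *\<^sub>R w) w v)) has_real_derivative D2 f x v w) (at 0 within {0..d})"
    by (rule has_field_derivative_transform_within[OF l, of d]) (use d D in auto)
  \<comment> \<open>Two one-sided derivatives at 0 of the same function of \<open>t\<close>, hence
    equal.\<close>
  from has_real_derivative_iff_has_vector_derivative[THEN iffD1, OF this]
    has_real_derivative_iff_has_vector_derivative[THEN iffD1, OF r]
  show ?thesis
    by (intro vector_derivative_unique_within_closed_interval[of 0 d 0]) (use d in auto)
qed

text \<open>The regularity half of the implicit function theorem; the solution \<open>g\<close> is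
  given. By \<open>inj\<close> the map \<open>(x, s) \<mapsto> (x, \<Phi> (x, s))\<close> is
  injective, and its inverse at points \<open>(x, 0)\<close> yields the graph of \<open>g\<close>,
  so differentiating the inverse differentiates \<open>g\<close>.\<close>

lemma Ck_on_implicit:
  fixes \<Phi> :: "'a::euclidean_space \<times> real \<Rightarrow> real"
  assumes "open X" "open T" "Ck_on (Suc k) (X \<times> T) \<Phi>"
    and pos: "\<And>x s. x \<in> X \<Longrightarrow> s \<in> T \<Longrightarrow> frechet_derivative \<Phi> (at (x, s)) (0, 1) > 0"
    and inj: "\<And>x s s'. x \<in> X \<Longrightarrow> s \<in> T \<Longrightarrow> s' \<in> T \<Longrightarrow> \<Phi> (x, s) = \<Phi> (x, s') \<Longrightarrow> s = s'"
    and g: "\<And>x. x \<in> X \<Longrightarrow> g x \<in> T \<and> \<Phi> (x, g x) = 0"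
  shows "Ck_on (Suc k) X g"
proof -
  let ?D = "\<lambda>x. frechet_derivative \<Phi> (at (x, g x))"
  let ?g' = "\<lambda>x v. - ?D x (v, 0) / ?D x (0, 1)"
  have der: "(g has_derivative ?g' x) (at x)" if x: "x \<in> X" for x
  proof -
    define \<Psi> where "\<Psi> = (\<lambda>p. (fst p, \<Phi> p))"
    define G where "G = inv_into (X \<times> T) \<Psi>"
    have p: "(x, g x) \<in> X \<times> T" using g x by auto
    have inj\<Psi>: "inj_on \<Psi> (X \<times> T)"
      unfolding inj_on_def \<Psi>_def using inj by auto
    have GP: "G (\<Psi> p) = p" if "p \<in> X \<times> T" for p
      unfolding G_def using inv_into_f_f[OF inj\<Psi> that] .
    note D = Ck_on_has_derivative[OF assms(3) p]
    have lin: "linear (?D x)" using has_derivative_linear[OF D] .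
    have d0: "?D x (0, 1) > 0" using pos[OF x, of "g x"] p by auto
    have split: "?D x (v, s) = ?D x (v, 0) + s * ?D x (0, 1)" for v s
    proof -
      have "?D x ((v, 0) + s *\<^sub>R (0, 1)) = ?D x (v, 0) + s *\<^sub>R ?D x (0, 1)"
        by (simp only: linear_add[OF lin] linear_scale[OF lin])
      then show ?thesis by simp
    qed
    have "(G has_derivative (\<lambda>(v, r). (v, (r - ?D x (v, 0)) / ?D x (0, 1)))) (at (\<Psi> (x, g x)))"
    proof (rule has_derivative_inverse_strong[OF _ p])
      show "open (X \<times> T)" using assms by (simp add: open_Times)
      show "continuous_on (X \<times> T) \<Psi>"
        unfolding \<Psi>_def by (intro continuous_intros Ck_on_imp_continuous_on[OF assms(3)])
      show "(\<Psi> has_derivative (\<lambda>p. (fst p, ?D x p))) (at (x, g x))"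
        unfolding \<Psi>_def by (intro has_derivative_Pair has_derivative_fst has_derivative_ident D)
      show "(\<lambda>p. (fst p, ?D x p)) \<circ> (\<lambda>(v, r). (v, (r - ?D x (v, 0)) / ?D x (0, 1))) = id"
        using d0 by (auto simp: fun_eq_iff split[of _ "_ / _"])
    qed (use GP in auto)
    then have "(G has_derivative (\<lambda>(v, r). (v, (r - ?D x (v, 0)) / ?D x (0, 1)))) (at (x, 0))"
      using g[OF x] by (simp add: \<Psi>_def)
    moreover have "((\<lambda>y. (y, 0)) has_derivative (\<lambda>v. (v, 0::real))) (at x)"
      by (auto intro!: derivative_eq_intros)
    ultimately have "((\<lambda>y. G (y, 0)) has_derivative (\<lambda>v. (v, - ?D x (v, 0) / ?D x (0, 1)))) (at x)"
      using diff_chain_at[of "\<lambda>y. (y, 0::real)" "\<lambda>v. (v, 0)" x G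
        "\<lambda>(v, r). (v, (r - ?D x (v, 0)) / ?D x (0, 1))"] by (simp add: o_def)
    from has_derivative_snd[OF this]
    have "((\<lambda>y. snd (G (y, 0))) has_derivative ?g' x) (at x)" by simp
    then show ?thesis
    proof (rule has_derivative_transform_within_open[OF _ assms(1) x])
      fix y assume y: "y \<in> X"
      have "(y, 0) = \<Psi> (y, g y)" using g[OF y] by (simp add: \<Psi>_def)
      then have "G (y, 0) = (y, g y)" using GP[of "(y, g y)"] g[OF y] y by simp
      then show "snd (G (y, 0)) = g y" by simp
    qed
  qed
  have graph: "(\<lambda>x. (x, g x)) ` X \<subseteq> X \<times> T" using g by auto
  \<comment> \<open>Bootstrapping: the formula for the derivative contains \<open>g\<close> only
    through the point \<open>(x, g x)\<close>, so \<open>g\<close> of class C^j has derivatives of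
    class C^j as long as \<open>j\<close> is at most \<open>k\<close>.\<close>
  have "Ck_on j X g" if "j \<le> Suc k" for j
    using that
  proof (induction j)
    case 0
    show ?case using der by (auto simp: continuous_on_eq_continuous_at[OF assms(1)] intro: has_derivative_continuous)
  next
    case (Suc j)
    then have IH: "Ck_on j X g" and j: "j \<le> k" by auto
    have map: "Ck_map j X (\<lambda>x. (x, g x))"
      using assms(1) IH by (intro Ck_map_Pair Ck_map_linear[OF _ bounded_linear_ident]) (auto simp: Ck_map_real)
    have "Ck_on j X (\<lambda>x. ?D x w)" for w
      using Ck_on_compose[OF assms(1) Ck_on_le[OF Ck_on_SucD[OF assms(3)] j] map graph] .
    then show ?case using pos g
      by (intro Ck_on_SucI[OF assms(1) der] Ck_on_divide Ck_on_uminus assms(1)) (auto simp: less_imp_neq[symmetric])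
  qed
  then show ?thesis by blast
qed

section \<open>The Levi form and the complex Hessian\<close>

lemma frechet_derivative_of_real:
  assumes "(f has_derivative D) (at x)"
  shows "frechet_derivative (\<lambda>u. complex_of_real (f u)) (at x) = (\<lambda>v. complex_of_real (D v))"
  using frechet_derivative_at[OF has_derivative_of_real[OF assms]] by (rule sym)

lemma wirtinger_bar_of_real:
  assumes "Ck_on 2 S f" "x \<in> S"
  shows "wirtinger_bar k (\<lambda>u. complex_of_real (f u)) x =
    (complex_of_real (frechet_derivative f (at x) (axis k 1)) +
      \<i> * complex_of_real (frechet_derivative f (at x) (axis k \<i>))) / 2"
  unfolding wirtinger_bar_def frechet_derivative_of_real[OF Ck_on_2_has_derivative(1)[OF assms]] ..

text \<open>\<open>wirtinger_bar k\<close> is applied first, hence the directions of index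
  \<open>k\<close> come first in \<open>D2\<close>; each Wirtinger derivative contributes a factor
  1/2, whence the 4.\<close>

lemma complex_Hessian_eq:
  fixes f :: "complex ^ 'd \<Rightarrow> real"
  assumes "open S" "Ck_on 2 S f" "x \<in> S"
  shows "complex_Hessian f x $ j $ k =
    Complex (D2 f x (axis k 1) (axis j 1) + D2 f x (axis k \<i>) (axis j \<i>))
      (D2 f x (axis k \<i>) (axis j 1) - D2 f x (axis k 1) (axis j \<i>)) / 4"
proof -
  let ?g = "\<lambda>y. (complex_of_real (frechet_derivative f (at y) (axis k 1)) +
      \<i> * complex_of_real (frechet_derivative f (at y) (axis k \<i>))) / 2"
  let ?D = "\<lambda>w. (complex_of_real (D2 f x (axis k 1) w) + \<i> * complex_of_real (D2 f x (axis k \<i>) w)) / 2"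
  have "(?g has_derivative ?D) (at x)"
    by (intro bounded_linear.has_derivative[OF bounded_linear_divide] has_derivative_add
        has_derivative_mult_right has_derivative_of_real Ck_on_2_has_derivative(2)[OF assms(2,3)])
  moreover have "frechet_derivative (wirtinger_bar k (\<lambda>u. complex_of_real (f u))) (at x) = frechet_derivative ?g (at x)"
    using frechet_derivative_cong_open[OF assms(1,3), of "wirtinger_bar k (\<lambda>u. complex_of_real (f u))" ?g]
      wirtinger_bar_of_real[OF assms(2)] by simp
  ultimately have "frechet_derivative (wirtinger_bar k (\<lambda>u. complex_of_real (f u))) (at x) = ?D"
    using frechet_derivative_at[of ?g ?D x] by simp
  then show ?thesis
    unfolding complex_Hessian_def wirtinger_def by (simp add: complex_eq_iff)
qed

text \<open>The Laplacian at 0 of \<open>f\<close> along the complex line through \<open>x\<close>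
  in direction \<open>b\<close>, that is, four times the Hermitian form of the complex Hessian.
  Keeping \<open>J\<close> as a parameter treats C, C^n and the product alike.\<close>

definition levi :: "('a \<Rightarrow> 'a) \<Rightarrow> ('a::euclidean_space \<Rightarrow> real) \<Rightarrow> 'a \<Rightarrow> 'a \<Rightarrow> real" where
  "levi J f x b = D2 f x b b + D2 f x (J b) (J b)"

lemma complex_vec_sum_axis:
  fixes w :: "complex ^ 'd"
  shows "w = (\<Sum>j\<in>UNIV. Re (w $ j) *\<^sub>R axis j 1 + Im (w $ j) *\<^sub>R axis j \<i>)"
proof -
  have "(\<Sum>j\<in>UNIV. Re (w $ j) *\<^sub>R axis j 1 + Im (w $ j) *\<^sub>R axis j \<i>) $ i =
    (\<Sum>j\<in>UNIV. if j = i then w $ i else 0)" for i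
    unfolding sum_component by (rule sum.cong) (auto simp: axis_def complex_eq_iff)
  then show ?thesis by (simp add: vec_eq_iff)
qed

lemma bilinear_expand_complex:
  fixes B :: "complex ^ 'd \<Rightarrow> complex ^ 'd \<Rightarrow> real"
  assumes "\<And>v. linear (B v)" "\<And>w. linear (\<lambda>v. B v w)"
  shows "B w z = (\<Sum>j\<in>UNIV. \<Sum>k\<in>UNIV.
    Re (w $ k) * Re (z $ j) * B (axis k 1) (axis j 1) + Re (w $ k) * Im (z $ j) * B (axis k 1) (axis j \<i>)
    + Im (w $ k) * Re (z $ j) * B (axis k \<i>) (axis j 1) + Im (w $ k) * Im (z $ j) * B (axis k \<i>) (axis j \<i>))"
proof -
  have "B w z = B w (\<Sum>j\<in>UNIV. Re (z $ j) *\<^sub>R axis j 1 + Im (z $ j) *\<^sub>R axis j \<i>)"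
    by (rule arg_cong[OF complex_vec_sum_axis])
  also have "\<dots> = (\<Sum>j\<in>UNIV. Re (z $ j) * B w (axis j 1) + Im (z $ j) * B w (axis j \<i>))"
    by (simp add: linear_sum[OF assms(1)] linear_add[OF assms(1)] linear_scale[OF assms(1)])
  also have "B w u = (\<Sum>k\<in>UNIV. Re (w $ k) * B (axis k 1) u + Im (w $ k) * B (axis k \<i>) u)" for u
  proof -
    have "B w u = B (\<Sum>k\<in>UNIV. Re (w $ k) *\<^sub>R axis k 1 + Im (w $ k) *\<^sub>R axis k \<i>) u"
      by (rule arg_cong[where f = "\<lambda>v. B v u", OF complex_vec_sum_axis])
    then show ?thesis
      by (simp add: linear_sum[OF assms(2)] linear_add[OF assms(2)] linear_scale[OF assms(2)])
  qed
  then have "(\<Sum>j\<in>UNIV. Re (z $ j) * B w (axis j 1) + Im (z $ j) * B w (axis j \<i>)) =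
    (\<Sum>j\<in>UNIV. Re (z $ j) * (\<Sum>k\<in>UNIV. Re (w $ k) * B (axis k 1) (axis j 1) + Im (w $ k) * B (axis k \<i>) (axis j 1))
      + Im (z $ j) * (\<Sum>k\<in>UNIV. Re (w $ k) * B (axis k 1) (axis j \<i>) + Im (w $ k) * B (axis k \<i>) (axis j \<i>)))"
    by simp
  also have "\<dots> = (\<Sum>j\<in>UNIV. \<Sum>k\<in>UNIV.
    Re (w $ k) * Re (z $ j) * B (axis k 1) (axis j 1) + Re (w $ k) * Im (z $ j) * B (axis k 1) (axis j \<i>)
    + Im (w $ k) * Re (z $ j) * B (axis k \<i>) (axis j 1) + Im (w $ k) * Im (z $ j) * B (axis k \<i>) (axis j \<i>))"
    by (simp add: sum_distrib_left sum.distrib[symmetric] algebra_simps)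
  finally show ?thesis .
qed

lemma levi_eq_complex_Hessian:
  fixes f :: "complex ^ 'd \<Rightarrow> real"
  assumes "open S" "Ck_on 2 S f" "x \<in> S"
  shows "levi ((*s) \<i>) f x w =
    4 * Re (\<Sum>j\<in>UNIV. \<Sum>k\<in>UNIV. complex_Hessian f x $ j $ k * w $ j * cnj (w $ k))"
  unfolding levi_def
    bilinear_expand_complex[of "D2 f x" w w, OF D2_linear_right[OF assms(2,3)] D2_linear_left[OF assms]]
    bilinear_expand_complex[of "D2 f x" "\<i> *s w" "\<i> *s w", OF D2_linear_right[OF assms(2,3)] D2_linear_left[OF assms]]
    complex_Hessian_eq[OF assms] Re_sum sum_distrib_left sum.distrib[symmetric]
  by (intro sum.cong refl) (simp add: field_simps)

text \<open>The Hermitian half of positive definiteness follows from the symmetry of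
  \<open>D2\<close>; the other half is \<open>levi_eq_complex_Hessian\<close>.\<close>

lemma positive_definite_complex_Hessian_iff:
  fixes f :: "complex ^ 'd \<Rightarrow> real"
  assumes "open S" "Ck_on 2 S f" "x \<in> S"
  shows "positive_definite (complex_Hessian f x) \<longleftrightarrow> (\<forall>w. w \<noteq> 0 \<longrightarrow> levi ((*s) \<i>) f x w > 0)"
proof -
  have herm: "\<forall>j k. complex_Hessian f x $ k $ j = cnj (complex_Hessian f x $ j $ k)"
    unfolding complex_Hessian_eq[OF assms] D2_symmetric[OF assms, of "axis _ \<i>" "axis _ 1"]
    by (simp add: complex_eq_iff D2_symmetric[OF assms])
  have "levi ((*s) \<i>) f x w > 0 \<longleftrightarrow>
      0 < Re (\<Sum>j\<in>UNIV. \<Sum>k\<in>UNIV. complex_Hessian f x $ j $ k * w $ j * cnj (w $ k))" for w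
    unfolding levi_eq_complex_Hessian[OF assms] by simp
  then show ?thesis
    unfolding positive_definite_def by (intro iffI conjI herm) (blast | auto)+
qed

section \<open>Circle means and the Levi form\<close>

definition cmean :: "(complex \<Rightarrow> real) \<Rightarrow> real" where
  "cmean g = integral {0..2*pi} (\<lambda>\<theta>. g (cis \<theta>)) / (2 * pi)"

lemma continuous_on_circle:
  assumes "continuous_on (sphere 0 1) g"
  shows "continuous_on {0..2*pi} (\<lambda>\<theta>. g (cis \<theta>))"
  by (rule continuous_on_compose2[OF assms]) (auto intro!: continuous_intros)

lemma circle_integrable:
  fixes g :: "complex \<Rightarrow> real"
  assumes "continuous_on (sphere 0 1) g"
  shows "(\<lambda>\<theta>. g (cis \<theta>)) integrable_on {0..2*pi}"
  using continuous_on_circle[OF assms] by (rule integrable_continuous_real)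

lemma cmean_cong: "(\<And>\<zeta>. \<zeta> \<in> sphere 0 1 \<Longrightarrow> f \<zeta> = g \<zeta>) \<Longrightarrow> cmean f = cmean g"
  unfolding cmean_def by simp

lemma cmean_const [simp]: "cmean (\<lambda>_. c) = c"
  unfolding cmean_def by simp

lemma cmean_mono:
  assumes "continuous_on (sphere 0 1) f" "continuous_on (sphere 0 1) g"
    "\<And>\<zeta>. \<zeta> \<in> sphere 0 1 \<Longrightarrow> f \<zeta> \<le> g \<zeta>"
  shows "cmean f \<le> cmean g"
  unfolding cmean_def using assms
  by (intro divide_right_mono integral_le circle_integrable) auto

lemma cmean_add:
  assumes "continuous_on (sphere 0 1) f" "continuous_on (sphere 0 1) g"
  shows "cmean (\<lambda>\<zeta>. f \<zeta> + g \<zeta>) = cmean f + cmean g"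
  unfolding cmean_def using assms
  by (simp add: integral_add circle_integrable add_divide_distrib)

lemma cmean_cmult: "cmean (\<lambda>\<zeta>. c * f \<zeta>) = c * cmean f"
  unfolding cmean_def by simp

lemma cmean_uminus: "cmean (\<lambda>\<zeta>. - f \<zeta>) = - cmean f"
  using cmean_cmult[of "-1" f] by simp

lemma cmean_diff:
  assumes "continuous_on (sphere 0 1) f" "continuous_on (sphere 0 1) g"
  shows "cmean (\<lambda>\<zeta>. f \<zeta> - g \<zeta>) = cmean f - cmean g"
  using cmean_add[of f "\<lambda>\<zeta>. - g \<zeta>"] assms by (simp add: cmean_uminus continuous_on_minus)

lemma cmean_sum:
  assumes "\<And>i. i \<in> A \<Longrightarrow> continuous_on (sphere 0 1) (f i)"
  shows "cmean (\<lambda>\<zeta>. \<Sum>i\<in>A. f i \<zeta>) = (\<Sum>i\<in>A. cmean (f i))"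
  using assms
proof (induction A rule: infinite_finite_induct)
  case (insert i A)
  then show ?case by (simp add: cmean_add continuous_on_sum)
qed auto

lemma cmean_pos:
  assumes "continuous_on (sphere 0 1) f" "\<And>\<zeta>. \<zeta> \<in> sphere 0 1 \<Longrightarrow> f \<zeta> > 0"
  shows "cmean f > 0"
proof -
  have "compact (f ` sphere 0 1)" using assms(1) by (intro compact_continuous_image) auto
  moreover have "f ` sphere 0 1 \<noteq> {}"
    using norm_one[where 'a = complex] by (metis empty_iff image_is_empty mem_sphere_0)
  ultimately obtain \<zeta> where z: "\<zeta> \<in> sphere 0 1" "\<And>w. w \<in> sphere 0 1 \<Longrightarrow> f \<zeta> \<le> f w"
    using compact_attains_inf[of "f ` sphere 0 1"] by auto
  have "f \<zeta> \<le> cmean f" using cmean_mono[OF continuous_on_const assms(1) z(2)] by simp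
  then show ?thesis using assms(2)[OF z(1)] by simp
qed

text \<open>Jensen's inequality from the tangent line of \<open>ln\<close> at the mean
  \<open>m\<close>: after averaging, the tangent line takes the value \<open>ln m\<close>.\<close>

lemma exp_cmean_ln_le:
  assumes "continuous_on (sphere 0 1) f" "\<And>\<zeta>. \<zeta> \<in> sphere 0 1 \<Longrightarrow> f \<zeta> > 0"
  shows "exp (cmean (\<lambda>\<zeta>. ln (f \<zeta>))) \<le> cmean f"
proof -
  define m where "m = cmean f"
  have m: "m > 0" unfolding m_def using assms by (rule cmean_pos)
  have cl: "continuous_on (sphere 0 1) (\<lambda>\<zeta>. ln (f \<zeta>))"
    using assms(1) by (rule continuous_on_ln) (use assms(2) in force)
  have "ln (f \<zeta>) \<le> (1 / m) * f \<zeta> + (ln m - 1)" if "\<zeta> \<in> sphere 0 1" for \<zeta>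
    using ln_le_minus_one[of "f \<zeta> / m"] assms(2)[OF that] m by (simp add: ln_div)
  then have "cmean (\<lambda>\<zeta>. ln (f \<zeta>)) \<le> cmean (\<lambda>\<zeta>. (1 / m) * f \<zeta> + (ln m - 1))"
    using assms(1) by (intro cmean_mono cl continuous_on_add continuous_on_mult continuous_on_const)
  also have "\<dots> = (1 / m) * cmean f + (ln m - 1)"
    using cmean_add[of "\<lambda>\<zeta>. (1 / m) * f \<zeta>" "\<lambda>_. ln m - 1",
        OF continuous_on_mult[OF continuous_on_const assms(1)] continuous_on_const]
    by (simp only: cmean_cmult cmean_const)
  also have "\<dots> = ln m" using m by (simp add: m_def)
  finally show ?thesis using m unfolding m_def by (metis exp_le_cancel_iff exp_ln)
qed

lemma linear_eq_sum_Basis: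
  fixes f :: "'a::euclidean_space \<Rightarrow> real"
  assumes "linear f"
  shows "f w = (\<Sum>i\<in>Basis. (w \<bullet> i) * f i)"
proof -
  have "f w = f (\<Sum>i\<in>Basis. (w \<bullet> i) *\<^sub>R i)" by (simp add: euclidean_representation)
  then show ?thesis by (simp add: linear_sum[OF assms] linear_scale[OF assms])
qed

text \<open>Base point and direction move together; expanding the direction in the basis reduces
  this to the ordinary product rule.\<close>

lemma frechet_derivative_along_curve:
  fixes f :: "'a::euclidean_space \<Rightarrow> real"
  assumes "open S" "Ck_on 2 S f" "\<gamma> s \<in> S"
    "(\<gamma> has_vector_derivative \<gamma>') (at s)" "(\<eta> has_vector_derivative \<eta>') (at s)"
  shows "((\<lambda>s. frechet_derivative f (at (\<gamma> s)) (\<eta> s)) has_real_derivative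
    D2 f (\<gamma> s) (\<eta> s) \<gamma>' + frechet_derivative f (at (\<gamma> s)) \<eta>') (at s)"
proof -
  let ?F = "\<lambda>s i. frechet_derivative f (at (\<gamma> s)) i"
  have cont: "continuous (at s) \<gamma>" using assms(4) has_vector_derivative_continuous by blast
  have F: "((\<lambda>s. ?F s i) has_real_derivative D2 f (\<gamma> s) i \<gamma>') (at s)" for i
  proof -
    have "((\<lambda>y. frechet_derivative f (at y) i) has_derivative D2 f (\<gamma> s) i) (at (\<gamma> s))"
      using assms by (intro Ck_on_2_has_derivative)
    from diff_chain_at[OF assms(4)[unfolded has_vector_derivative_def] this]
    have "((\<lambda>s. ?F s i) has_derivative (\<lambda>h. D2 f (\<gamma> s) i (h *\<^sub>R \<gamma>'))) (at s)" by (simp add: o_def)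
    moreover have "D2 f (\<gamma> s) i (h *\<^sub>R \<gamma>') = D2 f (\<gamma> s) i \<gamma>' * h" for h
      using D2_linear_right[OF assms(2,3)] by (simp add: linear_scale)
    ultimately show ?thesis by (simp add: has_field_derivative_def)
  qed
  have E: "((\<lambda>s. \<eta> s \<bullet> i) has_real_derivative \<eta>' \<bullet> i) (at s)" for i
    using bounded_linear.has_vector_derivative[OF bounded_linear_inner_left assms(5)]
    by (simp add: has_real_derivative_iff_has_vector_derivative)
  have "((\<lambda>s. \<Sum>i\<in>Basis. (\<eta> s \<bullet> i) * ?F s i) has_real_derivative
      (\<Sum>i\<in>Basis. (\<eta>' \<bullet> i) * ?F s i + D2 f (\<gamma> s) i \<gamma>' * (\<eta> s \<bullet> i))) (at s)"
    by (intro DERIV_sum DERIV_mult E F)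
  moreover have "(\<Sum>i\<in>Basis. (\<eta>' \<bullet> i) * ?F s i + D2 f (\<gamma> s) i \<gamma>' * (\<eta> s \<bullet> i)) =
      D2 f (\<gamma> s) (\<eta> s) \<gamma>' + frechet_derivative f (at (\<gamma> s)) \<eta>'"
    using linear_eq_sum_Basis[OF frechet_derivative_linear_2[OF assms(2,3)], of \<eta>']
      linear_eq_sum_Basis[OF D2_linear_left[OF assms(1-3)], of "\<eta> s" \<gamma>']
    by (simp add: sum.distrib mult.commute)
  ultimately have d: "((\<lambda>s. \<Sum>i\<in>Basis. (\<eta> s \<bullet> i) * ?F s i) has_real_derivative
      D2 f (\<gamma> s) (\<eta> s) \<gamma>' + frechet_derivative f (at (\<gamma> s)) \<eta>') (at s)" by simp
  have "\<forall>\<^sub>F r in nhds s. \<gamma> r \<in> S"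
    using cont assms(1,3) by (simp add: continuous_at_open eventually_nhds)
  then have "\<forall>\<^sub>F r in nhds s. (\<Sum>i\<in>Basis. (\<eta> r \<bullet> i) * ?F r i) = ?F r (\<eta> r)"
    by eventually_elim (metis linear_eq_sum_Basis frechet_derivative_linear_2[OF assms(2)])
  from DERIV_cong_ev[OF refl this refl] d show ?thesis by blast
qed

text \<open>Rotation invariance of the Laplacian: the mixed terms coming from \<open>w\<close> and
  from \<open>\<i> * w\<close> cancel.\<close>

lemma levi_complex_scale:
  assumes "open S" "Ck_on 2 S v" "\<zeta> \<in> S"
  shows "D2 v \<zeta> w w + D2 v \<zeta> (\<i> * w) (\<i> * w) = (cmod w)\<^sup>2 * levi ((*) \<i>) v \<zeta> 1"
proof -
  note l = linear_eq_sum_Basis[OF D2_linear_right[OF assms(2,3)], unfolded Basis_complex_def]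
  note l2 = linear_eq_sum_Basis[OF D2_linear_left[OF assms], unfolded Basis_complex_def]
  have ne: "(1::complex) \<noteq> \<i>" by (simp add: complex_eq_iff)
  have "D2 v \<zeta> w w = Re w * (Re w * D2 v \<zeta> 1 1 + Im w * D2 v \<zeta> 1 \<i>) + Im w * (Re w * D2 v \<zeta> \<i> 1 + Im w * D2 v \<zeta> \<i> \<i>)" for w
    using ne l2[of w w] l[of 1 w] l[of \<i> w] by simp
  from this[of w] this[of "\<i> * w"] show ?thesis
    unfolding levi_def cmod_power2 by (simp add: algebra_simps power2_eq_square)
qed

text \<open>With \<open>M(r)\<close> the integral of \<open>v\<close> over the circle of radius \<open>r\<close>, \<open>h = r M'\<close> satisfies
  \<open>r h' = r\<^sup>2 \<integral> \<Delta> v \<ge> 0\<close>, because the angular part of the Laplacian integrates to zero.\<close>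
lemma submean_of_levi_nonneg:
  fixes v :: "complex \<Rightarrow> real"
  assumes "open S" "Ck_on 2 S v" "cball 0 1 \<subseteq> S"
    and levi: "\<And>\<zeta>. \<zeta> \<in> cball 0 1 \<Longrightarrow> levi ((*) \<i>) v \<zeta> 1 \<ge> 0"
  shows "v 0 \<le> cmean v"
proof -
  let ?z = "\<lambda>r \<theta>. of_real r * cis \<theta> :: complex"
  let ?D = "\<lambda>\<zeta>. frechet_derivative v (at \<zeta>)"
  define M where "M = (\<lambda>r. integral (cbox 0 (2*pi)) (\<lambda>\<theta>. v (?z r \<theta>)))"
  define M1 where "M1 = (\<lambda>r. integral (cbox 0 (2*pi)) (\<lambda>\<theta>. ?D (?z r \<theta>) (cis \<theta>)))"
  define M2 where "M2 = (\<lambda>r. integral (cbox 0 (2*pi)) (\<lambda>\<theta>. D2 v (?z r \<theta>) (cis \<theta>) (cis \<theta>)))"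
  have inS: "?z r \<theta> \<in> S" "?z r \<theta> \<in> cball 0 1" if "r \<in> {0..1}" for r \<theta>
    using that assms(3) by (auto simp: norm_mult subset_iff)
  have "continuous_on S v" using assms(2) by (rule Ck_on_imp_continuous_on)
  then have c0: "continuous_on ({0..1} \<times> cbox 0 (2*pi)) (\<lambda>(r, \<theta>). v (?z r \<theta>))"
    unfolding case_prod_beta by (rule continuous_on_compose2) (use inS in \<open>auto intro!: continuous_intros\<close>)
  have cD: "continuous_on S (\<lambda>\<zeta>. ?D \<zeta> i)" for i
    using Ck_on_SucD assms(2) unfolding Ck_on_2_iff by (blast intro: Ck_on_imp_continuous_on)
  have ne: "(1::complex) \<noteq> \<i>" by (simp add: complex_eq_iff)
  have lin: "?D \<zeta> w = Re w * ?D \<zeta> 1 + Im w * ?D \<zeta> \<i>" if "\<zeta> \<in> S" for \<zeta> w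
    using linear_eq_sum_Basis[OF frechet_derivative_linear_2[OF assms(2) that], of w] ne
    by (simp add: Basis_complex_def)
  have lin2: "D2 v \<zeta> w w = Re w * (Re w * D2 v \<zeta> 1 1 + Im w * D2 v \<zeta> 1 \<i>)
      + Im w * (Re w * D2 v \<zeta> \<i> 1 + Im w * D2 v \<zeta> \<i> \<i>)" if "\<zeta> \<in> S" for \<zeta> w
    using linear_eq_sum_Basis[OF D2_linear_left[OF assms(1,2) that], of w w]
      linear_eq_sum_Basis[OF D2_linear_right[OF assms(2) that], of 1 w]
      linear_eq_sum_Basis[OF D2_linear_right[OF assms(2) that], of \<i> w] ne
    by (simp add: Basis_complex_def)
  have lin_cis: "?D \<zeta> (cis \<theta>) = cos \<theta> * ?D \<zeta> 1 + sin \<theta> * ?D \<zeta> \<i>"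
    "D2 v \<zeta> (cis \<theta>) (cis \<theta>) = cos \<theta> * (cos \<theta> * D2 v \<zeta> 1 1 + sin \<theta> * D2 v \<zeta> 1 \<i>)
      + sin \<theta> * (cos \<theta> * D2 v \<zeta> \<i> 1 + sin \<theta> * D2 v \<zeta> \<i> \<i>)" if "\<zeta> \<in> S" for \<zeta> \<theta>
    using lin[OF that, of "cis \<theta>"] lin2[OF that, of "cis \<theta>"] by simp_all
  have c1: "continuous_on ({0..1} \<times> cbox 0 (2*pi)) (\<lambda>(r, \<theta>). ?D (?z r \<theta>) (cis \<theta>))"
  proof (rule continuous_on_eq)
    show "continuous_on ({0..1} \<times> cbox 0 (2*pi)) (\<lambda>p. Re (cis (snd p)) * ?D (?z (fst p) (snd p)) 1
        + Im (cis (snd p)) * ?D (?z (fst p) (snd p)) \<i>)"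
      by (intro continuous_intros continuous_on_compose2[OF cD]) (use inS in auto)
  qed (auto simp: lin_cis[OF inS(1)])
  have c2: "continuous_on ({0..1} \<times> cbox 0 (2*pi)) (\<lambda>(r, \<theta>). D2 v (?z r \<theta>) (cis \<theta>) (cis \<theta>))"
  proof (rule continuous_on_eq)
    let ?w = "\<lambda>p. cis (snd p)" and ?y = "\<lambda>p. ?z (fst p) (snd p)"
    show "continuous_on ({0..1} \<times> cbox 0 (2*pi)) (\<lambda>p. Re (?w p) * (Re (?w p) * D2 v (?y p) 1 1 + Im (?w p) * D2 v (?y p) 1 \<i>)
      + Im (?w p) * (Re (?w p) * D2 v (?y p) \<i> 1 + Im (?w p) * D2 v (?y p) \<i> \<i>))"
      by (intro continuous_intros continuous_on_compose2[OF D2_continuous_on[OF assms(2)]]) (use inS in auto)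
  qed (auto simp: lin_cis[OF inS(1)])
  have vd: "((\<lambda>r. ?z r \<theta>) has_vector_derivative cis \<theta>) (at r)" for r \<theta>
  proof -
    have "((\<lambda>r. r *\<^sub>R cis \<theta>) has_vector_derivative cis \<theta>) (at r)"
      unfolding has_vector_derivative_def by (auto intro!: derivative_eq_intros)
    then show ?thesis by (simp add: scaleR_conv_of_real)
  qed
  have dM: "(M has_real_derivative M1 r) (at r within {0..1})" if "r \<in> {0..1}" for r
    unfolding M_def M1_def
  proof (rule leibniz_rule_field_derivative)
    fix r \<theta> assume "r \<in> {0..1::real}" "\<theta> \<in> cbox 0 (2*pi)"
    from diff_chain_at[OF vd[unfolded has_vector_derivative_def] Ck_on_2_has_derivative(1)[OF assms(2) inS(1)[OF this(1)]]]
    have d: "((\<lambda>r. v (?z r \<theta>)) has_derivative (\<lambda>h. ?D (?z r \<theta>) (h *\<^sub>R cis \<theta>))) (at r)" by (simp add: o_def)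
    have "?D (?z r \<theta>) (h *\<^sub>R cis \<theta>) = ?D (?z r \<theta>) (cis \<theta>) * h" for h
      using frechet_derivative_linear_2[OF assms(2) inS(1)[OF \<open>r \<in> _\<close>]] by (simp add: linear_scale)
    with d show "((\<lambda>r. v (?z r \<theta>)) has_real_derivative ?D (?z r \<theta>) (cis \<theta>)) (at r within {0..1})"
      by (simp add: has_field_derivative_def has_derivative_at_withinI)
  next
    fix r :: real assume "r \<in> {0..1}"
    then show "(\<lambda>\<theta>. v (?z r \<theta>)) integrable_on cbox 0 (2*pi)"
      by (intro integrable_continuous continuous_on_compose2[OF c0, of _ "\<lambda>\<theta>. (r, \<theta>)", simplified] continuous_intros) auto
  qed (use that c1 in auto)
  have dM1: "(M1 has_real_derivative M2 r) (at r within {0..1})" if "r \<in> {0..1}" for r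
    unfolding M1_def M2_def
  proof (rule leibniz_rule_field_derivative)
    fix r \<theta> assume "r \<in> {0..1::real}" "\<theta> \<in> cbox 0 (2*pi)"
    from frechet_derivative_along_curve[OF assms(1,2) inS(1)[OF this(1)] vd has_vector_derivative_const[of "cis \<theta>"]]
    show "((\<lambda>r. ?D (?z r \<theta>) (cis \<theta>)) has_real_derivative D2 v (?z r \<theta>) (cis \<theta>) (cis \<theta>)) (at r within {0..1})"
      using linear_0[OF frechet_derivative_linear_2[OF assms(2) inS(1)[OF \<open>r \<in> _\<close>]]]
      by (simp add: has_field_derivative_at_within)
  next
    fix r :: real assume "r \<in> {0..1}"
    then show "(\<lambda>\<theta>. ?D (?z r \<theta>) (cis \<theta>)) integrable_on cbox 0 (2*pi)"
      by (intro integrable_continuous continuous_on_compose2[OF c1, of _ "\<lambda>\<theta>. (r, \<theta>)", simplified] continuous_intros) auto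
  qed (use that c2 in auto)
  have key: "M1 r + r * M2 r \<ge> 0" if r: "r \<in> {0<..1}" for r
  proof -
    have r': "r \<in> {0..1}" using r by auto
    have vdt: "((\<lambda>\<theta>. ?z r \<theta>) has_vector_derivative (\<i> * ?z r \<theta>)) (at \<theta>)" for \<theta>
      unfolding has_vector_derivative_def
      by (auto intro!: derivative_eq_intros simp: scaleR_conv_of_real fun_eq_iff)
    have vdt2: "((\<lambda>\<theta>. \<i> * ?z r \<theta>) has_vector_derivative (- ?z r \<theta>)) (at \<theta>)" for \<theta>
      using has_vector_derivative_mult_right[OF vdt, of \<i>] by simp
    \<comment> \<open>The second derivative of \<open>v\<close> along the circle; it is the
      derivative of a periodic function, so its integral over a full turn is 0.\<close>
    have "((\<lambda>\<theta>. D2 v (?z r \<theta>) (\<i> * ?z r \<theta>) (\<i> * ?z r \<theta>) + ?D (?z r \<theta>) (- ?z r \<theta>)) has_integral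
      (?D (?z r (2*pi)) (\<i> * ?z r (2*pi)) - ?D (?z r 0) (\<i> * ?z r 0))) {0..2*pi}"
    proof (rule fundamental_theorem_of_calculus)
      fix \<theta> assume "\<theta> \<in> {0..2*pi}"
      show "((\<lambda>\<theta>. ?D (?z r \<theta>) (\<i> * ?z r \<theta>)) has_vector_derivative
        D2 v (?z r \<theta>) (\<i> * ?z r \<theta>) (\<i> * ?z r \<theta>) + ?D (?z r \<theta>) (- ?z r \<theta>)) (at \<theta> within {0..2*pi})"
        using frechet_derivative_along_curve[OF assms(1,2) inS(1)[OF r'] vdt vdt2]
        unfolding has_real_derivative_iff_has_vector_derivative by (rule has_vector_derivative_at_within)
    qed simp
    then have a: "((\<lambda>\<theta>. D2 v (?z r \<theta>) (\<i> * ?z r \<theta>) (\<i> * ?z r \<theta>) + ?D (?z r \<theta>) (- ?z r \<theta>)) has_integral 0) (cbox 0 (2*pi))"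
      by simp
    have i1: "((\<lambda>\<theta>. ?D (?z r \<theta>) (cis \<theta>)) has_integral M1 r) (cbox 0 (2*pi))"
      unfolding M1_def using r'
      by (intro integrable_integral integrable_continuous continuous_on_compose2[OF c1, of _ "\<lambda>\<theta>. (r, \<theta>)", simplified] continuous_intros) auto
    have i2: "((\<lambda>\<theta>. D2 v (?z r \<theta>) (cis \<theta>) (cis \<theta>)) has_integral M2 r) (cbox 0 (2*pi))"
      unfolding M2_def using r'
      by (intro integrable_integral integrable_continuous continuous_on_compose2[OF c2, of _ "\<lambda>\<theta>. (r, \<theta>)", simplified] continuous_intros) auto
    have I: "((\<lambda>\<theta>. (D2 v (?z r \<theta>) (\<i> * ?z r \<theta>) (\<i> * ?z r \<theta>) + ?D (?z r \<theta>) (- ?z r \<theta>)) +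
        (r * ?D (?z r \<theta>) (cis \<theta>) + r\<^sup>2 * D2 v (?z r \<theta>) (cis \<theta>) (cis \<theta>))) has_integral
        (0 + (r * M1 r + r\<^sup>2 * M2 r))) (cbox 0 (2*pi))"
      by (intro has_integral_add a has_integral_mult_right i1 i2)
    have N: "(D2 v (?z r \<theta>) (\<i> * ?z r \<theta>) (\<i> * ?z r \<theta>) + ?D (?z r \<theta>) (- ?z r \<theta>)) +
        (r * ?D (?z r \<theta>) (cis \<theta>) + r\<^sup>2 * D2 v (?z r \<theta>) (cis \<theta>) (cis \<theta>)) \<ge> 0" for \<theta>
    proof -
      have S: "?z r \<theta> \<in> S" using inS(1)[OF r'] .
      note l1 = frechet_derivative_linear_2[OF assms(2) S]
      note l2 = D2_linear_right[OF assms(2) S] D2_linear_left[OF assms(1,2) S]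
      have "?D (?z r \<theta>) (- ?z r \<theta>) = - r * ?D (?z r \<theta>) (cis \<theta>)"
        using linear_scale[OF l1, of "-r" "cis \<theta>"] by (simp add: scaleR_conv_of_real)
      moreover have "D2 v (?z r \<theta>) (?z r \<theta>) (?z r \<theta>) = r\<^sup>2 * D2 v (?z r \<theta>) (cis \<theta>) (cis \<theta>)"
        using linear_scale[OF l2(1), of "?z r \<theta>" r "cis \<theta>"] linear_scale[OF l2(2), of r "cis \<theta>" "cis \<theta>"]
        by (simp add: scaleR_conv_of_real power2_eq_square)
      moreover have "D2 v (?z r \<theta>) (?z r \<theta>) (?z r \<theta>) + D2 v (?z r \<theta>) (\<i> * ?z r \<theta>) (\<i> * ?z r \<theta>) \<ge> 0"
        using levi_complex_scale[OF assms(1,2) inS(1)[OF r']] levi[OF inS(2)[OF r']] by simp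
      ultimately show ?thesis by linarith
    qed
    have "r * M1 r + r\<^sup>2 * M2 r \<ge> 0"
      using has_integral_nonneg[OF I N] by simp
    then have "r * (M1 r + r * M2 r) \<ge> 0" by (simp add: algebra_simps power2_eq_square)
    then show ?thesis using r by (simp add: zero_le_mult_iff)
  qed
  \<comment> \<open>\<open>r * M1 r\<close> has derivative \<open>M1 r + r * M2 r\<close> and
    vanishes at \<open>r = 0\<close>, whatever the value of \<open>M1 0\<close>.\<close>
  have h: "r * M1 r \<ge> 0" if r: "r \<in> {0..1}" for r
  proof -
    have "0 * M1 0 \<le> r * M1 r"
    proof (rule DERIV_nonneg_imp_increasing_open[of 0 r "\<lambda>r. r * M1 r"])
      show "\<And>x. 0 < x \<Longrightarrow> x < r \<Longrightarrow> \<exists>y. ((\<lambda>r. r * M1 r) has_real_derivative y) (at x) \<and> 0 \<le> y"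
      proof -
        fix x assume x: "0 < x" "x < r"
        then have x': "x \<in> {0..1}" "x \<in> interior {0..1}" using r by (auto simp: interior_atLeastAtMost_real)
        have "((\<lambda>r. r * M1 r) has_real_derivative 1 * M1 x + M2 x * x) (at x within {0..1})"
          by (rule DERIV_mult[OF DERIV_ident dM1[OF x'(1)]])
        then have "((\<lambda>r. r * M1 r) has_real_derivative M1 x + x * M2 x) (at x)"
          unfolding at_within_interior[OF x'(2)] by (simp add: mult.commute)
        then show "\<exists>y. ((\<lambda>r. r * M1 r) has_real_derivative y) (at x) \<and> 0 \<le> y"
          using key[of x] x r by auto
      qed
      have "continuous_on {0..1} M1" using dM1 by (meson DERIV_continuous_on)
      then show "continuous_on {0..r} (\<lambda>r. r * M1 r)"
        using r by (intro continuous_intros) (auto intro: continuous_on_subset)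
    qed (use r in auto)
    then show ?thesis by simp
  qed
  have "M 0 \<le> M 1"
  proof (rule DERIV_nonneg_imp_increasing_open[of 0 1 M])
    show "\<And>x. 0 < x \<Longrightarrow> x < 1 \<Longrightarrow> \<exists>y. (M has_real_derivative y) (at x) \<and> 0 \<le> y"
    proof -
      fix x :: real assume x: "0 < x" "x < 1"
      then have x': "x \<in> {0..1}" "x \<in> interior {0..1}" by (auto simp: interior_atLeastAtMost_real)
      have "M1 x \<ge> 0" using h[OF x'(1)] x by (simp add: zero_le_mult_iff)
      then show "\<exists>y. (M has_real_derivative y) (at x) \<and> 0 \<le> y"
        using dM[OF x'(1)] unfolding at_within_interior[OF x'(2)] by blast
    qed
    show "continuous_on {0..1} M" using dM by (meson DERIV_continuous_on)
  qed simp
  then show ?thesis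
    unfolding M_def cmean_def by (simp add: field_simps)
qed

section \<open>Complex structures and holomorphic curves\<close>

definition cplx_struct :: "('a::euclidean_space \<Rightarrow> 'a) \<Rightarrow> bool" where
  "cplx_struct J \<longleftrightarrow> bounded_linear J \<and> (\<forall>x. J (J x) = - x)"

definition cscale :: "('a::euclidean_space \<Rightarrow> 'a) \<Rightarrow> complex \<Rightarrow> 'a \<Rightarrow> 'a" where
  "cscale J \<zeta> b = Re \<zeta> *\<^sub>R b + Im \<zeta> *\<^sub>R J b"

text \<open>\<open>h1\<close> and \<open>h2\<close> are the first and second complex derivatives of
  \<open>h\<close>. Holomorphy is expressed by a complex linear derivative, and the continuous
  \<open>h2\<close> supplies class C^2 without any function theory.\<close>

definition holo_curve :: "('a::euclidean_space \<Rightarrow> 'a) \<Rightarrow> (complex \<Rightarrow> 'a) \<Rightarrow> (complex \<Rightarrow> 'a) \<Rightarrow> (complex \<Rightarrow> 'a) \<Rightarrow> bool" where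
  "holo_curve J h h1 h2 \<longleftrightarrow>
     (\<forall>\<zeta>. (h has_derivative (\<lambda>\<eta>. cscale J \<eta> (h1 \<zeta>))) (at \<zeta>)) \<and>
     (\<forall>\<zeta>. (h1 has_derivative (\<lambda>\<eta>. cscale J \<eta> (h2 \<zeta>))) (at \<zeta>)) \<and> continuous_on UNIV h2"

lemma holo_curve_Ck_map:
  assumes "cplx_struct J" "holo_curve J h h1 h2"
  shows "Ck_map 2 UNIV h"
  unfolding Ck_map_def
proof
  fix i :: 'a assume "i \<in> Basis"
  have J: "bounded_linear J" using assms(1) by (simp add: cplx_struct_def)
  have *: "((\<lambda>\<zeta>. cscale J \<eta> (g \<zeta>) \<bullet> i) has_derivative (\<lambda>\<mu>. cscale J \<eta> (cscale J \<mu> (g' \<zeta>)) \<bullet> i)) (at \<zeta>)"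
    if "\<And>\<zeta>. (g has_derivative (\<lambda>\<eta>. cscale J \<eta> (g' \<zeta>))) (at \<zeta>)" for g g' \<eta> \<zeta>
    unfolding cscale_def[of J \<eta>]
    by (intro has_derivative_inner_left has_derivative_add has_derivative_scaleR_right
        bounded_linear.has_derivative[OF J] that)
  have cont: "continuous_on UNIV (\<lambda>\<zeta>. cscale J \<eta> (cscale J \<mu> (h2 \<zeta>)) \<bullet> i)" for \<eta> \<mu>
    unfolding cscale_def using assms(2) unfolding holo_curve_def
    by (intro continuous_intros bounded_linear.continuous_on[OF J]) auto
  have h: "(h has_derivative (\<lambda>\<eta>. cscale J \<eta> (h1 \<zeta>))) (at \<zeta>)"
    "(h1 has_derivative (\<lambda>\<eta>. cscale J \<eta> (h2 \<zeta>))) (at \<zeta>)" for \<zeta>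
    using assms(2) by (auto simp: holo_curve_def)
  show "Ck_on 2 UNIV (\<lambda>\<zeta>. h \<zeta> \<bullet> i)"
    unfolding Ck_on_2_iff
  proof (intro Ck_on_SucI open_UNIV)
    show "((\<lambda>\<zeta>. h \<zeta> \<bullet> i) has_derivative (\<lambda>\<eta>. cscale J \<eta> (h1 \<zeta>) \<bullet> i)) (at \<zeta>)" for \<zeta>
      using h(1) by (rule has_derivative_inner_left)
    show "((\<lambda>\<zeta>. cscale J \<eta> (h1 \<zeta>) \<bullet> i) has_derivative (\<lambda>\<mu>. cscale J \<eta> (cscale J \<mu> (h2 \<zeta>)) \<bullet> i)) (at \<zeta>)" for \<eta> \<zeta>
      using h(2) by (rule *)
    show "Ck_on 0 UNIV (\<lambda>\<zeta>. cscale J \<eta> (cscale J \<mu> (h2 \<zeta>)) \<bullet> i)" for \<eta> \<mu>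
      using cont by simp
  qed
qed

text \<open>The chain rule also applies the derivative of \<open>f\<close> to
  \<open>h2 \<zeta>\<close> and to \<open>J (J (h2 \<zeta>)) = - h2 \<zeta>\<close>; these two terms
  cancel, so the Levi form sees only the velocity \<open>h1 \<zeta>\<close>.\<close>

lemma holo_curve_levi:
  assumes J: "cplx_struct J" and h: "holo_curve J h h1 h2"
    and "open S" "Ck_on 2 S f" "h \<zeta> \<in> S"
  shows "levi ((*) \<i>) (\<lambda>\<zeta>. f (h \<zeta>)) \<zeta> 1 = levi J f (h \<zeta>) (h1 \<zeta>)"
proof -
  have bJ: "bounded_linear J" and JJ: "J (J x) = - x" for x using J by (auto simp: cplx_struct_def)
  have hd: "(h has_derivative (\<lambda>\<eta>. cscale J \<eta> (h1 \<zeta>))) (at \<zeta>)"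
    "(h1 has_derivative (\<lambda>\<eta>. cscale J \<eta> (h2 \<zeta>))) (at \<zeta>)" for \<zeta>
    using h by (auto simp: holo_curve_def)
  have "continuous_on UNIV h"
    using hd(1) by (auto simp: continuous_on_eq_continuous_at intro: has_derivative_continuous)
  then have op: "open (h -` S)" using open_vimage assms(3) by blast
  have der: "((\<lambda>\<zeta>. f (h \<zeta>)) has_derivative (\<lambda>\<eta>. frechet_derivative f (at (h y)) (cscale J \<eta> (h1 y)))) (at y)"
    if "y \<in> h -` S" for y
    using diff_chain_at[OF hd(1) Ck_on_2_has_derivative(1)[OF assms(4)]] that by (simp add: o_def)
  have u: "Ck_on 2 (h -` S) (\<lambda>\<zeta>. f (h \<zeta>))"
    by (rule Ck_on_compose[OF op assms(4) Ck_map_subset[OF holo_curve_Ck_map[OF J h]]]) auto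
  have D2u: "D2 (\<lambda>\<zeta>. f (h \<zeta>)) \<zeta> \<eta> \<eta> = D2 f (h \<zeta>) (cscale J \<eta> (h1 \<zeta>)) (cscale J \<eta> (h1 \<zeta>))
      + frechet_derivative f (at (h \<zeta>)) (cscale J \<eta> (cscale J \<eta> (h2 \<zeta>)))" for \<eta>
  proof -
    have line: "((\<lambda>s. \<zeta> + s *\<^sub>R \<eta>) has_derivative (\<lambda>h. h *\<^sub>R \<eta>)) (at 0)"
      by (auto intro!: derivative_eq_intros)
    have a: "((\<lambda>s. h (\<zeta> + s *\<^sub>R \<eta>)) has_vector_derivative cscale J \<eta> (h1 \<zeta>)) (at 0)"
      using diff_chain_at[OF line hd(1)] unfolding has_vector_derivative_def
      by (simp add: o_def cscale_def algebra_simps)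
    have "((\<lambda>\<zeta>. cscale J \<eta> (h1 \<zeta>)) has_derivative (\<lambda>\<mu>. cscale J \<eta> (cscale J \<mu> (h2 \<zeta>)))) (at \<zeta>)"
      unfolding cscale_def[of J \<eta>]
      by (intro has_derivative_add has_derivative_scaleR_right bounded_linear.has_derivative[OF bJ] hd)
    then have "((\<lambda>\<zeta>. cscale J \<eta> (h1 \<zeta>)) has_derivative (\<lambda>\<mu>. cscale J \<eta> (cscale J \<mu> (h2 \<zeta>)))) (at (\<zeta> + 0 *\<^sub>R \<eta>))"
      by simp
    from diff_chain_at[OF line this]
    have b: "((\<lambda>s. cscale J \<eta> (h1 (\<zeta> + s *\<^sub>R \<eta>))) has_vector_derivative cscale J \<eta> (cscale J \<eta> (h2 \<zeta>))) (at 0)"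
      unfolding has_vector_derivative_def
      by (simp add: o_def cscale_def algebra_simps linear_add[OF bounded_linear.linear[OF bJ]]
          linear_scale[OF bounded_linear.linear[OF bJ]])
    have "h (\<zeta> + 0 *\<^sub>R \<eta>) \<in> S" using assms(5) by simp
    from frechet_derivative_along_curve[OF assms(3,4) this a b]
    have r: "((\<lambda>s. frechet_derivative f (at (h (\<zeta> + s *\<^sub>R \<eta>))) (cscale J \<eta> (h1 (\<zeta> + s *\<^sub>R \<eta>)))) has_real_derivative
       D2 f (h \<zeta>) (cscale J \<eta> (h1 \<zeta>)) (cscale J \<eta> (h1 \<zeta>))
       + frechet_derivative f (at (h \<zeta>)) (cscale J \<eta> (cscale J \<eta> (h2 \<zeta>)))) (at 0)" by simp
    have z: "\<zeta> \<in> h -` S" using assms(5) by simp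
    have d: "((\<lambda>s. frechet_derivative (\<lambda>\<zeta>. f (h \<zeta>)) (at (\<zeta> + s *\<^sub>R \<eta>)) \<eta>) has_real_derivative
       D2 (\<lambda>\<zeta>. f (h \<zeta>)) \<zeta> \<eta> \<eta>) (at 0)"
      using Ck_on_2_has_derivative(2)[OF u z] by (intro has_real_derivative_along_line) simp
    have ev: "\<forall>\<^sub>F s in nhds 0. frechet_derivative (\<lambda>\<zeta>. f (h \<zeta>)) (at (\<zeta> + s *\<^sub>R \<eta>)) \<eta> =
        frechet_derivative f (at (h (\<zeta> + s *\<^sub>R \<eta>))) (cscale J \<eta> (h1 (\<zeta> + s *\<^sub>R \<eta>)))"
    proof -
      have "open ((\<lambda>s. \<zeta> + s *\<^sub>R \<eta>) -` (h -` S))"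
        by (rule open_vimage[OF op]) (auto intro!: continuous_intros)
      then have "\<forall>\<^sub>F s in nhds 0. s \<in> (\<lambda>s. \<zeta> + s *\<^sub>R \<eta>) -` (h -` S)"
        using z by (intro eventually_nhds_in_open) auto
      then show ?thesis
      proof eventually_elim
        case (elim s)
        then have "\<zeta> + s *\<^sub>R \<eta> \<in> h -` S" by simp
        from fun_cong[OF frechet_derivative_at[OF der[OF this]], of \<eta>] show ?case by (rule sym)
      qed
    qed
    from DERIV_cong_ev[OF refl ev refl] d
    have "((\<lambda>s. frechet_derivative f (at (h (\<zeta> + s *\<^sub>R \<eta>))) (cscale J \<eta> (h1 (\<zeta> + s *\<^sub>R \<eta>)))) has_real_derivative
       D2 (\<lambda>\<zeta>. f (h \<zeta>)) \<zeta> \<eta> \<eta>) (at 0)"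
      by blast
    with r show ?thesis using DERIV_unique by blast
  qed
  have lin: "linear (frechet_derivative f (at (h \<zeta>)))"
    using frechet_derivative_linear_2[OF assms(4,5)] .
  show ?thesis
    unfolding levi_def D2u[of 1] D2u[of "\<i> * 1"] by (simp add: cscale_def JJ linear_neg[OF lin])
qed

lemma submean_holo_curve:
  assumes J: "cplx_struct J" and h: "holo_curve J h h1 h2"
    and "open S" "Ck_on 2 S f" and levi: "\<And>x b. x \<in> S \<Longrightarrow> levi J f x b \<ge> 0"
    and sub: "h ` cball 0 1 \<subseteq> S"
  shows "f (h 0) \<le> cmean (\<lambda>\<zeta>. f (h \<zeta>))"
proof -
  have cont: "continuous_on UNIV h" using holo_curve_Ck_map[OF J h] by (rule Ck_map_continuous_on)
  have op: "open (h -` S)" using open_vimage[OF assms(3) cont] .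
  have u: "Ck_on 2 (h -` S) (\<lambda>\<zeta>. f (h \<zeta>))"
    by (rule Ck_on_compose[OF op assms(4) Ck_map_subset[OF holo_curve_Ck_map[OF J h]]]) auto
  show ?thesis
  proof (rule submean_of_levi_nonneg[OF op u])
    fix \<zeta> :: complex assume "\<zeta> \<in> cball 0 1"
    then have "h \<zeta> \<in> S" using sub by auto
    then show "levi ((*) \<i>) (\<lambda>\<zeta>. f (h \<zeta>)) \<zeta> 1 \<ge> 0"
      unfolding holo_curve_levi[OF J h assms(3,4) \<open>h \<zeta> \<in> S\<close>] by (rule levi)
  qed (use sub in auto)
qed

lemma bounded_linear_cscale_left: "bounded_linear (\<lambda>\<zeta>. cscale J \<zeta> b)"
  unfolding cscale_def
  by (intro bounded_linear_add bounded_linear_compose[OF bounded_linear_scaleR_left bounded_linear_Re]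
      bounded_linear_compose[OF bounded_linear_scaleR_left bounded_linear_Im])

lemma holo_curve_affine:
  assumes "cplx_struct J"
  shows "holo_curve J (\<lambda>\<zeta>. a + cscale J \<zeta> b) (\<lambda>_. b) (\<lambda>_. 0)"
  unfolding holo_curve_def
proof (intro conjI allI)
  show "((\<lambda>\<zeta>. a + cscale J \<zeta> b) has_derivative (\<lambda>\<eta>. cscale J \<eta> b)) (at \<zeta>)" for \<zeta>
    using has_derivative_add[OF has_derivative_const bounded_linear_imp_has_derivative[OF bounded_linear_cscale_left]]
    by simp
  have "J 0 = 0" using assms by (simp add: cplx_struct_def linear_simps)
  then show "((\<lambda>_. b) has_derivative (\<lambda>\<eta>. cscale J \<eta> 0)) (at \<zeta>)" for \<zeta>
    by (simp add: cscale_def)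
qed auto

lemma levi_add:
  "open S \<Longrightarrow> Ck_on 2 S f \<Longrightarrow> Ck_on 2 S g \<Longrightarrow> x \<in> S \<Longrightarrow>
    levi J (\<lambda>x. f x + g x) x b = levi J f x b + levi J g x b"
  by (simp add: levi_def D2_add)

lemma levi_cmult: "open S \<Longrightarrow> Ck_on 2 S f \<Longrightarrow> x \<in> S \<Longrightarrow> levi J (\<lambda>x. c * f x) x b = c * levi J f x b"
  by (simp add: levi_def D2_cmult algebra_simps)

lemma levi_scaleR:
  assumes "cplx_struct J" "open S" "Ck_on 2 S f" "x \<in> S"
  shows "levi J f x (c *\<^sub>R b) = c\<^sup>2 * levi J f x b"
proof -
  have "J (c *\<^sub>R b) = c *\<^sub>R J b" using assms(1) by (simp add: cplx_struct_def linear_simps)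
  moreover have "D2 f x (c *\<^sub>R v) (c *\<^sub>R v) = c\<^sup>2 * D2 f x v v" for v
    by (simp add: linear_scale[OF D2_linear_right[OF assms(3,4)]] linear_scale[OF D2_linear_left[OF assms(2-4)]]
        power2_eq_square)
  ultimately show ?thesis by (simp add: levi_def algebra_simps)
qed

lemma cplx_struct_complex: "cplx_struct ((*) \<i>)"
  by (simp add: cplx_struct_def bounded_linear_mult_right)

lemma Ck_on_cmod_square: "open S \<Longrightarrow> Ck_on k S (\<lambda>\<zeta>::complex. (cmod \<zeta>)\<^sup>2)"
  unfolding cmod_power2 by (intro Ck_on_add Ck_on_power Ck_on_linear bounded_linear_Re bounded_linear_Im)

lemma levi_cmod_square: "levi ((*) \<i>) (\<lambda>\<zeta>. (cmod \<zeta>)\<^sup>2) \<zeta> 1 = 4"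
proof -
  have "D2 (\<lambda>\<zeta>. (cmod \<zeta>)\<^sup>2) \<zeta> v w = 2 * (Re v * Re w + Im v * Im w)" for v w
  proof (rule D2_eqI[OF open_UNIV UNIV_I, where D = "\<lambda>y v. 2 * (Re y * Re v + Im y * Im v)"])
    show "((\<lambda>\<zeta>. (cmod \<zeta>)\<^sup>2) has_derivative (\<lambda>v. 2 * (Re y * Re v + Im y * Im v))) (at y)" for y
      unfolding cmod_power2 by (auto intro!: derivative_eq_intros simp: algebra_simps)
    show "((\<lambda>y. 2 * (Re y * Re v + Im y * Im v)) has_derivative (\<lambda>w. 2 * (Re v * Re w + Im v * Im w))) (at \<zeta>)"
      by (auto intro!: derivative_eq_intros simp: algebra_simps)
  qed
  then show ?thesis by (simp add: levi_def)
qed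

lemma levi_continuous_on: "Ck_on 2 S f \<Longrightarrow> continuous_on S (\<lambda>y. levi J f y b)"
  unfolding levi_def by (intro continuous_on_add D2_continuous_on)

lemma norm_cscale_le: "cmod \<zeta> \<le> 1 \<Longrightarrow> norm (cscale J \<zeta> b) \<le> norm b + norm (J b)"
proof -
  assume z: "cmod \<zeta> \<le> 1"
  have "norm (cscale J \<zeta> b) \<le> \<bar>Re \<zeta>\<bar> * norm b + \<bar>Im \<zeta>\<bar> * norm (J b)"
    unfolding cscale_def by (metis norm_scaleR norm_triangle_ineq)
  also have "\<dots> \<le> 1 * norm b + 1 * norm (J b)"
    using abs_Re_le_cmod[of \<zeta>] abs_Im_le_cmod[of \<zeta>] z by (intro add_mono mult_right_mono) auto
  finally show ?thesis by simp
qed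

text \<open>If \<open>levi J f x b < 4 c\<close>, then \<open>\<kappa> |\<zeta>|\<^sup>2 - f\<close> is subharmonic on small discs for some \<open>\<kappa> < c\<close>,
  against the assumed mean value inequality.\<close>
lemma levi_ge_of_submean:
  assumes J: "cplx_struct J" and S: "open S" "Ck_on 2 S f" "x \<in> S" and d: "\<delta> > 0"
    and sub: "\<And>\<epsilon>. 0 < \<epsilon> \<Longrightarrow> \<epsilon> < \<delta> \<Longrightarrow> f x + c * \<epsilon>\<^sup>2 \<le> cmean (\<lambda>\<zeta>. f (x + cscale J \<zeta> (\<epsilon> *\<^sub>R b)))"
  shows "levi J f x b \<ge> 4 * c"
proof (rule ccontr)
  assume "\<not> levi J f x b \<ge> 4 * c"
  then obtain \<kappa> where k: "levi J f x b < 4 * \<kappa>" "\<kappa> < c"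
    using dense[of "levi J f x b / 4" c] by (auto simp: field_simps)
  have "open {y \<in> S. levi J f y b < 4 * \<kappa>}"
  proof -
    obtain A where "open A" "A \<inter> S = {y \<in> S. levi J f y b < 4 * \<kappa>}"
      using open_Collect_less_Int[OF levi_continuous_on[OF S(2), of J b] continuous_on_const] by blast
    then show ?thesis using S(1) by (metis open_Int)
  qed
  then obtain r where r: "r > 0" "ball x r \<subseteq> {y \<in> S. levi J f y b < 4 * \<kappa>}"
    using S(3) k(1) openE by (metis (no_types, lifting) mem_Collect_eq)
  have Jl: "J (c *\<^sub>R b) = c *\<^sub>R J b" for c using J by (simp add: cplx_struct_def linear_simps)
  define N where "N = norm b + norm (J b) + 1"
  have N: "N > 0" unfolding N_def by (smt (verit) norm_ge_zero)
  \<comment> \<open>Keeps the disc in the ball on which the Levi form in direction \<open>b\<close>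
    is below \<open>4 * \<kappa>\<close>, and \<open>\<epsilon>\<close> below
    \<open>\<delta>\<close>.\<close>
  define \<epsilon> where "\<epsilon> = min (\<delta> / 2) (r / (2 * N))"
  have e: "\<epsilon> > 0" "\<epsilon> < \<delta>" "\<epsilon> * N < r"
    using d r N by (auto simp: \<epsilon>_def min_def field_simps)
  define h where "h = (\<lambda>\<zeta>. x + cscale J \<zeta> (\<epsilon> *\<^sub>R b))"
  have hc: "holo_curve J h (\<lambda>_. \<epsilon> *\<^sub>R b) (\<lambda>_. 0)" unfolding h_def by (rule holo_curve_affine[OF J])
  have hb: "h \<zeta> \<in> ball x r" if "cmod \<zeta> \<le> 1" for \<zeta>
  proof -
    have "norm (cscale J \<zeta> (\<epsilon> *\<^sub>R b)) \<le> \<epsilon> * norm b + \<epsilon> * norm (J b)"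
      using norm_cscale_le[OF that, of J "\<epsilon> *\<^sub>R b"] e by (simp add: Jl)
    also have "\<dots> < \<epsilon> * N" using e by (simp add: N_def algebra_simps)
    finally show ?thesis using e by (simp add: h_def dist_norm)
  qed
  have cont: "continuous_on UNIV h" using holo_curve_Ck_map[OF J hc] by (rule Ck_map_continuous_on)
  define Z where "Z = h -` ball x r"
  have Z: "open Z" unfolding Z_def using open_vimage[OF open_ball cont] .
  have fb: "Ck_on 2 (ball x r) f" using r S(2) by (auto intro: Ck_on_subset)
  have fh: "Ck_on 2 Z (\<lambda>\<zeta>. f (h \<zeta>))"
    by (rule Ck_on_compose[OF Z fb Ck_map_subset[OF holo_curve_Ck_map[OF J hc]]]) (auto simp: Z_def)
  let ?u = "\<lambda>\<zeta>. (\<kappa> * \<epsilon>\<^sup>2) * (cmod \<zeta>)\<^sup>2 + (- 1) * f (h \<zeta>)"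
  have sq: "Ck_on 2 Z (\<lambda>\<zeta>. (cmod \<zeta>)\<^sup>2)" using Z by (rule Ck_on_cmod_square)
  have c1: "Ck_on 2 Z (\<lambda>\<zeta>. (\<kappa> * \<epsilon>\<^sup>2) * (cmod \<zeta>)\<^sup>2)" "Ck_on 2 Z (\<lambda>\<zeta>. (- 1) * f (h \<zeta>))"
    using Ck_on_mult[OF Z Ck_on_const[OF Z] sq] Ck_on_mult[OF Z Ck_on_const[OF Z] fh] by blast+
  have "?u 0 \<le> cmean ?u"
  proof (rule submean_of_levi_nonneg[OF Z Ck_on_add[OF Z c1]])
    fix \<zeta> :: complex assume "\<zeta> \<in> cball 0 1"
    then have hz: "h \<zeta> \<in> ball x r" and zZ: "\<zeta> \<in> Z" using hb by (auto simp: Z_def)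
    have "levi ((*) \<i>) ?u \<zeta> 1 = 4 * \<kappa> * \<epsilon>\<^sup>2 - \<epsilon>\<^sup>2 * levi J f (h \<zeta>) b"
      unfolding levi_add[OF Z c1 zZ] levi_cmult[OF Z sq zZ] levi_cmult[OF Z fh zZ] levi_cmod_square
        holo_curve_levi[OF J hc open_ball fb hz] levi_scaleR[OF J open_ball fb hz] by simp
    also have "\<dots> = \<epsilon>\<^sup>2 * (4 * \<kappa> - levi J f (h \<zeta>) b)" by (simp add: algebra_simps)
    also have "\<dots> \<ge> 0" using r hz by (intro mult_nonneg_nonneg) auto
    finally show "levi ((*) \<i>) ?u \<zeta> 1 \<ge> 0" .
  qed (use hb in \<open>auto simp: Z_def\<close>)
  moreover have "cmean ?u = cmean (\<lambda>\<zeta>. \<kappa> * \<epsilon>\<^sup>2 + (- 1) * f (h \<zeta>))"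
    by (rule cmean_cong) simp
  moreover have "\<dots> = \<kappa> * \<epsilon>\<^sup>2 - cmean (\<lambda>\<zeta>. f (h \<zeta>))"
  proof -
    have "continuous_on (sphere 0 1) (\<lambda>\<zeta>. f (h \<zeta>))"
      using Ck_on_imp_continuous_on[OF fh] by (rule continuous_on_subset) (use hb in \<open>auto simp: Z_def\<close>)
    then show ?thesis by (simp add: cmean_diff)
  qed
  ultimately have "cmean (\<lambda>\<zeta>. f (h \<zeta>)) \<le> f (h 0) + \<kappa> * \<epsilon>\<^sup>2" by simp
  moreover have "h 0 = x" by (simp add: h_def cscale_def)
  ultimately have "c * \<epsilon>\<^sup>2 \<le> \<kappa> * \<epsilon>\<^sup>2" using sub[OF e(1,2)] by (simp add: h_def)
  then show False using k e by simp
qed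

text \<open>The case \<open>c = 0\<close> of \<open>levi_ge_of_submean\<close> for
  \<open>- u\<close>: on small circles around a local maximum, \<open>- u\<close> is at least its
  central value.\<close>

lemma levi_nonpos_of_local_max:
  fixes u :: "complex \<Rightarrow> real"
  assumes "open S" "Ck_on 2 S u" "\<zeta> \<in> S" "d > 0" "\<And>w. w \<in> ball \<zeta> d \<Longrightarrow> u w \<le> u \<zeta>"
  shows "levi ((*) \<i>) u \<zeta> 1 \<le> 0"
proof -
  obtain e where e: "e > 0" "ball \<zeta> e \<subseteq> S" using assms openE by blast
  have u': "Ck_on 2 S (\<lambda>w. (- 1) * u w)"
    using Ck_on_mult[OF assms(1) Ck_on_const[OF assms(1)] assms(2)] .
  have "levi ((*) \<i>) (\<lambda>w. (- 1) * u w) \<zeta> 1 \<ge> 4 * 0"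
  proof (rule levi_ge_of_submean[OF cplx_struct_complex assms(1) u' assms(3), of "min d e"])
    fix \<epsilon> assume eps: "0 < \<epsilon>" "\<epsilon> < min d e"
    have p: "\<zeta> + cscale ((*) \<i>) w (\<epsilon> *\<^sub>R 1) \<in> ball \<zeta> (min d e)" if "w \<in> sphere 0 1" for w
    proof -
      have "cscale ((*) \<i>) w (\<epsilon> *\<^sub>R 1) = \<epsilon> *\<^sub>R w" by (simp add: cscale_def complex_eq_iff)
      then show ?thesis using that eps by (simp add: dist_norm)
    qed
    have "cmean (\<lambda>w. (- 1) * u \<zeta>) \<le> cmean (\<lambda>w. (- 1) * u (\<zeta> + cscale ((*) \<i>) w (\<epsilon> *\<^sub>R 1)))"
    proof (intro cmean_mono continuous_on_const)
      show "continuous_on (sphere 0 1) (\<lambda>w. (- 1) * u (\<zeta> + cscale ((*) \<i>) w (\<epsilon> *\<^sub>R 1)))"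
        by (rule continuous_on_compose2[OF Ck_on_imp_continuous_on[OF u']])
          (use p e in \<open>auto simp: cscale_def intro!: continuous_intros\<close>)
      show "(- 1) * u \<zeta> \<le> (- 1) * u (\<zeta> + cscale ((*) \<i>) w (\<epsilon> *\<^sub>R 1))" if "w \<in> sphere 0 1" for w
        using assms(5)[of "\<zeta> + cscale ((*) \<i>) w (\<epsilon> *\<^sub>R 1)"] p[OF that] by simp
    qed
    then show "(- 1) * u \<zeta> + 0 * \<epsilon>\<^sup>2 \<le> cmean (\<lambda>w. (- 1) * u (\<zeta> + cscale ((*) \<i>) w (\<epsilon> *\<^sub>R 1)))"
      by simp
  qed (use assms e in auto)
  then show ?thesis unfolding levi_cmult[OF assms(1-3)] by simp
qed

section \<open>Plurisubharmonicity on the product in terms of the Levi form\<close>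

definition JP :: "(complex ^ 'n) \<times> (complex ^ 'm) \<Rightarrow> (complex ^ 'n) \<times> (complex ^ 'm)" where
  "JP p = (\<i> *s fst p, \<i> *s snd p)"

lemma linear_vector_smult: "linear ((*s) (c::complex))"
  by (rule linearI) (auto simp: vec_eq_iff algebra_simps)

lemma cplx_struct_vec: "cplx_struct ((*s) \<i>)"
  unfolding cplx_struct_def using linear_vector_smult
  by (auto simp: linear_conv_bounded_linear vec_eq_iff)

lemma cplx_struct_JP: "cplx_struct JP"
  unfolding cplx_struct_def JP_def
  by (auto simp: vec_eq_iff prod_eq_iff intro!: bounded_linear_Pair
      bounded_linear_compose[OF _ bounded_linear_fst] bounded_linear_compose[OF _ bounded_linear_snd]
      linear_vector_smult[unfolded linear_conv_bounded_linear])

lemma cscale_vec: "cscale ((*s) \<i>) \<zeta> b = \<zeta> *s b"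
  by (simp add: cscale_def vec_eq_iff complex_eq_iff)

lemma cscale_JP: "cscale JP \<zeta> p = (\<zeta> *s fst p, \<zeta> *s snd p)"
  by (simp add: cscale_def JP_def vec_eq_iff complex_eq_iff prod_eq_iff)

lemma split_coords_add: "split_coords (x + y) = split_coords x + split_coords y"
  by (simp add: split_coords_def vec_eq_iff)

lemma split_coords_smult: "split_coords (c *s x) = (c *s fst (split_coords x), c *s snd (split_coords x))"
  by (simp add: split_coords_def vec_eq_iff)

lemma linear_split_coords: "linear split_coords"
  by (rule linearI) (auto simp: split_coords_def vec_eq_iff)

lemma surj_split_coords: "surj split_coords"
  unfolding surj_def
proof
  fix p :: "(complex ^ 'a) \<times> (complex ^ 'b)"
  have "p = split_coords (\<chi> i. case i of Inl a \<Rightarrow> fst p $ a | Inr b \<Rightarrow> snd p $ b)"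
    by (simp add: split_coords_def prod_eq_iff vec_eq_iff)
  then show "\<exists>x. p = split_coords x" by blast
qed

text \<open>The definition is tested on small discs only: \<open>split_coords\<close> identifies
  them with discs in C^(n+m), and the resulting inequality is the case \<open>c = 0\<close> of
  \<open>levi_ge_of_submean\<close>.\<close>

lemma plurisubharmonic_prod_on_levi:
  fixes f :: "(complex ^ 'n) \<times> (complex ^ 'm) \<Rightarrow> real"
  assumes "open S" "Ck_on 2 S f" "plurisubharmonic_prod_on S f" "x \<in> S"
  shows "levi JP f x b \<ge> 0"
proof -
  obtain e where e: "e > 0" "ball x e \<subseteq> S" using assms openE by blast
  define N where "N = norm b + norm (JP b) + 1"
  have N: "N > 0" unfolding N_def by (smt (verit) norm_ge_zero)
  have Jl: "JP (c *\<^sub>R b) = c *\<^sub>R JP b" for c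
    using cplx_struct_JP by (metis cplx_struct_def bounded_linear.linear linear_scale)
  have "levi JP f x b \<ge> 4 * 0"
  proof (rule levi_ge_of_submean[OF cplx_struct_JP assms(1,2,4), of "e / N"])
    fix \<epsilon> assume eps: "0 < \<epsilon>" "\<epsilon> < e / N"
    obtain x' b' where x': "x = split_coords x'" "\<epsilon> *\<^sub>R b = split_coords b'"
      using surj_split_coords by (metis surjD)
    have pt: "split_coords (x' + \<zeta> *s b') = x + cscale JP \<zeta> (\<epsilon> *\<^sub>R b)" for \<zeta>
      by (simp add: split_coords_add split_coords_smult cscale_JP flip: x')
    have inb: "x + cscale JP \<zeta> (\<epsilon> *\<^sub>R b) \<in> ball x e" if "cmod \<zeta> \<le> 1" for \<zeta>
    proof -
      have "norm (cscale JP \<zeta> (\<epsilon> *\<^sub>R b)) \<le> \<epsilon> * norm b + \<epsilon> * norm (JP b)"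
        using norm_cscale_le[OF that, of JP "\<epsilon> *\<^sub>R b"] eps by (simp add: Jl)
      also have "\<dots> < \<epsilon> * N" using eps by (simp add: N_def algebra_simps)
      also have "\<dots> < e" using eps N by (simp add: field_simps)
      finally show ?thesis by (simp add: dist_norm)
    qed
    have "\<forall>\<zeta>. cmod \<zeta> \<le> 1 \<longrightarrow> x' + \<zeta> *s b' \<in> split_coords -` S"
      using inb e pt by auto
    then have I: "set_integrable lborel {0..2*pi} (\<lambda>\<theta>. (f \<circ> split_coords) (x' + cis \<theta> *s b'))"
      and le: "f x \<le> 1 / (2*pi) * (LINT \<theta>:{0..2*pi}|lborel. (f \<circ> split_coords) (x' + cis \<theta> *s b'))"
      using assms(3,4) x'(1) unfolding plurisubharmonic_prod_on_def plurisubharmonic_on_def by auto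
    have "(LINT \<theta>:{0..2*pi}|lborel. (f \<circ> split_coords) (x' + cis \<theta> *s b')) =
      integral {0..2*pi} (\<lambda>\<theta>. f (x + cscale JP (cis \<theta>) (\<epsilon> *\<^sub>R b)))"
      using set_borel_integral_eq_integral(2)[OF I] by (simp add: pt)
    then show "f x + 0 * \<epsilon>\<^sup>2 \<le> cmean (\<lambda>\<zeta>. f (x + cscale JP \<zeta> (\<epsilon> *\<^sub>R b)))"
      using le by (simp add: cmean_def)
  qed (use e N in auto)
  then show ?thesis by simp
qed

lemma strictly_plurisubharmonic_prod_on_levi:
  fixes f :: "(complex ^ 'n) \<times> (complex ^ 'm) \<Rightarrow> real"
  assumes "open S" "Ck_on 2 S f" "strictly_plurisubharmonic_prod_on S f" "x \<in> S" "b \<noteq> 0"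
  shows "levi JP f x b > 0"
proof -
  have bl: "bounded_linear split_coords" using linear_split_coords by (simp add: linear_conv_bounded_linear)
  obtain x' b' where x': "x = split_coords x'" "b = split_coords b'"
    using surj_split_coords by (metis surjD)
  have op: "open (split_coords -` S)"
    using open_vimage[OF assms(1) linear_continuous_on[OF bl]] .
  have "b' \<noteq> 0" using assms(5) x'(2) linear_0[OF linear_split_coords] by auto
  have "x' \<in> split_coords -` S" using assms(4) x' by simp
  then have "levi ((*s) \<i>) (f \<circ> split_coords) x' b' > 0"
    using assms(3) positive_definite_complex_Hessian_iff[OF op] \<open>b' \<noteq> 0\<close>
    unfolding strictly_plurisubharmonic_prod_on_def strictly_plurisubharmonic_on_def by blast
  moreover have "split_coords (\<i> *s b') = JP b" by (simp add: JP_def split_coords_smult flip: x')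
  ultimately show ?thesis
    using D2_compose_linear[OF assms(1,2) bl, of x'] assms(4) x' unfolding levi_def o_def by simp
qed

section \<open>Marginals and Prekopa's argument\<close>

lemma integral_has_derivative_interior:
  fixes g :: "real \<Rightarrow> real"
  assumes "continuous_on {a..b} g" "a < v" "v < b"
  shows "((\<lambda>x. integral {a..x} g) has_real_derivative g v) (at v)"
proof -
  have "v \<in> interior {a..b}" using assms by (simp add: interior_atLeastAtMost_real)
  then show ?thesis
    using integral_has_real_derivative[OF assms(1), of v] assms
    by (simp add: at_within_interior[of v "{a..b}"])
qed

text \<open>Testing on the open interval matters: later \<open>v = exp w\<close>, and the endpoint 0
  is not of this form.\<close>

lemma integral_pos_iff_ex:
  fixes g :: "real \<Rightarrow> real"
  assumes "continuous_on {a..b} g" "\<And>v. v \<in> {a..b} \<Longrightarrow> 0 \<le> g v"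
  shows "integral {a..b} g > 0 \<longleftrightarrow> (\<exists>v\<in>{a<..<b}. g v > 0)"
proof
  assume pos: "integral {a..b} g > 0"
  show "\<exists>v\<in>{a<..<b}. g v > 0"
  proof (rule ccontr)
    assume N: "\<not> ?thesis"
    have "g v = 0" if v: "v \<in> {a<..<b}" for v
    proof -
      have "\<not> g v > 0" using N v by blast
      moreover have "g v \<ge> 0" using assms(2)[of v] v by simp
      ultimately show ?thesis by simp
    qed
    then have "integral {a<..<b} g = integral {a<..<b} (\<lambda>_. 0)" by (intro integral_cong)
    then have "integral {a<..<b} g = 0" by simp
    then show False using pos by (simp add: integral_open_interval_real)
  qed
next
  assume "\<exists>v\<in>{a<..<b}. g v > 0"
  then obtain v where v: "v \<in> {a<..<b}" "g v > 0" by blast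
  have int: "g integrable_on {a..b}" using assms(1) by (rule integrable_continuous_real)
  have "integral {a..b} g \<noteq> 0"
  proof
    assume "integral {a..b} g = 0"
    then have "(g has_integral 0) (cbox a b)" using int by (metis box_real(2) has_integral_integral)
    then have "g v = 0"
      using v assms by (intro has_integral_0_cbox_imp_0[of a b g v]) (auto simp: box_real)
    with v show False by simp
  qed
  moreover have "integral {a..b} g \<ge> 0" using int assms(2) by (intro integral_nonneg)
  ultimately show "integral {a..b} g > 0" by simp
qed

text \<open>The mass of \<open>f \<zeta>\<close> is parametrised by \<open>y \<zeta> s\<close> with \<open>\<integral>\<^sub>0\<^sup>y f \<zeta> = s \<integral> f \<zeta>\<close>. The geometric mean over the
  circle of these parametrisations transports the interval \<open>{0..1}\<close> into the support of \<open>f0\<close>, and its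
  Jacobian is controlled by Jensen's inequality.\<close>
lemma circle_transport:
  fixes f :: "complex \<Rightarrow> real \<Rightarrow> real" and f0 :: "real \<Rightarrow> real"
  assumes U: "U > 0"
    and cont: "continuous_on (sphere 0 1 \<times> {0..U}) (\<lambda>(\<zeta>, v). f \<zeta> v)"
    and nonneg: "\<And>\<zeta> v. \<zeta> \<in> sphere 0 1 \<Longrightarrow> v \<in> {0..U} \<Longrightarrow> f \<zeta> v \<ge> 0"
    and conn: "\<And>\<zeta> v1 v v2. \<zeta> \<in> sphere 0 1 \<Longrightarrow> 0 < v1 \<Longrightarrow> v1 \<le> v \<Longrightarrow> v \<le> v2 \<Longrightarrow> v2 < U \<Longrightarrow>
      f \<zeta> v1 > 0 \<Longrightarrow> f \<zeta> v2 > 0 \<Longrightarrow> f \<zeta> v > 0"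
    and pos: "\<And>\<zeta>. \<zeta> \<in> sphere 0 1 \<Longrightarrow> integral {0..U} (f \<zeta>) > 0"
    and cont0: "continuous_on {0..U} f0" and nonneg0: "\<And>v. v \<in> {0..U} \<Longrightarrow> f0 v \<ge> 0"
    and P: "\<And>y. continuous_on (sphere 0 1) y \<Longrightarrow>
      (\<And>\<zeta>. \<zeta> \<in> sphere 0 1 \<Longrightarrow> 0 < y \<zeta> \<and> y \<zeta> < U \<and> f \<zeta> (y \<zeta>) > 0) \<Longrightarrow>
      exp (cmean (\<lambda>\<zeta>. ln (f \<zeta> (y \<zeta>)))) \<le> f0 (exp (cmean (\<lambda>\<zeta>. ln (y \<zeta>))))"
  shows "exp (cmean (\<lambda>\<zeta>. ln (integral {0..U} (f \<zeta>)))) \<le> integral {0..U} f0"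
proof -
  let ?S = "sphere (0::complex) 1"
  define G where "G = (\<lambda>\<zeta> v. integral {0..v} (f \<zeta>))"
  define I where "I = (\<lambda>\<zeta>. integral {0..U} (f \<zeta>))"
  have I: "I \<zeta> > 0" if "\<zeta> \<in> ?S" for \<zeta> using pos[OF that] by (simp add: I_def)
  have contf: "continuous_on {0..U} (f \<zeta>)" if "\<zeta> \<in> ?S" for \<zeta>
    using that by (intro continuous_on_compose2[OF cont, of "{0..U}" "\<lambda>v. (\<zeta>, v)", simplified] continuous_intros) auto
  have int: "f \<zeta> integrable_on {a..b}" if "\<zeta> \<in> ?S" "0 \<le> a" "b \<le> U" for \<zeta> a b
    using contf[OF that(1)] that by (intro integrable_continuous_real) (auto elim: continuous_on_subset)
  have scale_in: "v * \<tau> \<in> {0..U}" if "v \<in> {0..U}" "\<tau> \<in> {0..1}" for v \<tau>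
  proof -
    have "v * \<tau> \<le> v" using that by (simp add: mult_left_le)
    then show ?thesis using that by simp
  qed
  \<comment> \<open>The substitution \<open>v * \<tau>\<close> moves the dependence on
    \<open>v\<close> from the limits into the integrand, so that joint continuity of
    \<open>G\<close> follows from continuity of parameter integrals.\<close>
  have Gscale: "G \<zeta> v = integral (cbox 0 1) (\<lambda>\<tau>. v * f \<zeta> (v * \<tau>))" if z: "\<zeta> \<in> ?S" and v: "v \<in> {0..U}" for \<zeta> v
  proof -
    have "((\<lambda>\<tau>. v * f \<zeta> (v * \<tau>)) has_integral (G \<zeta> (v * 1) - G \<zeta> (v * 0))) {0..1}"
    proof (rule fundamental_theorem_of_calculus_interior)
      have sub: "(\<lambda>\<tau>. v * \<tau>) ` {0..1} \<subseteq> {0..U}" using scale_in[OF v] by blast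
      show "continuous_on {0..1} (\<lambda>\<tau>. G \<zeta> (v * \<tau>))" unfolding G_def
        by (rule continuous_on_compose2[OF indefinite_integral_continuous_1[OF int[OF z order_refl order_refl]] _ sub])
          (auto intro!: continuous_intros)
      fix \<tau> :: real assume t: "\<tau> \<in> {0<..<1}"
      show "((\<lambda>\<tau>. G \<zeta> (v * \<tau>)) has_vector_derivative v * f \<zeta> (v * \<tau>)) (at \<tau>)"
      proof (cases "v = 0")
        case True then show ?thesis by (simp add: G_def)
      next
        case False
        then have "0 < v * \<tau>" "v * \<tau> < U" using v t by (auto intro: less_le_trans[of _ v] simp: mult_less_cancel_left1)
        note d = integral_has_derivative_interior[OF contf[OF z] this]
        have "((\<lambda>\<tau>. integral {0..v * \<tau>} (f \<zeta>)) has_real_derivative f \<zeta> (v * \<tau>) * v) (at \<tau>)"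
          by (rule DERIV_chain2[where g = "\<lambda>\<tau>. v * \<tau>" and f = "\<lambda>x. integral {0..x} (f \<zeta>)", OF d DERIV_cmult_Id])
        then show ?thesis unfolding G_def has_real_derivative_iff_has_vector_derivative[symmetric]
          by (simp add: mult.commute)
      qed
    qed simp
    from integral_unique[OF this] show ?thesis
      by (simp only: mult_1_right mult_zero_right interval_cbox) (simp add: G_def)
  qed
  have "continuous_on (?S \<times> {0..U}) (\<lambda>p. integral (cbox 0 1) (\<lambda>\<tau>. snd p * f (fst p) (snd p * \<tau>)))"
  proof (rule integral_continuous_on_param)
    show "continuous_on ((?S \<times> {0..U}) \<times> cbox 0 1) (\<lambda>(p, \<tau>). snd p * f (fst p) (snd p * \<tau>))"
      unfolding case_prod_beta
      by (intro continuous_intros continuous_on_compose2[OF cont[unfolded case_prod_beta],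
            of _ "\<lambda>x. (fst (fst x), snd (fst x) * snd x)", simplified])
        (use scale_in in auto)
  qed
  then have contG: "continuous_on (?S \<times> {0..U}) (\<lambda>p. G (fst p) (snd p))"
    by (rule continuous_on_eq) (auto simp: Gscale)
  have contI: "continuous_on ?S I"
  proof -
    have "continuous_on ?S (\<lambda>\<zeta>. G \<zeta> U)" using U
      by (intro continuous_on_compose2[OF contG, of _ "\<lambda>\<zeta>. (\<zeta>, U)", simplified] continuous_intros) auto
    then show ?thesis by (simp add: I_def G_def)
  qed
  \<comment> \<open>There is mass on both sides of \<open>v\<close>, hence points
    \<open>v1 < v < v2\<close> with positive values, and \<open>conn\<close> fills the gap.\<close>
  have posf: "0 < v \<and> v < U \<and> f \<zeta> v > 0"
    if z: "\<zeta> \<in> ?S" and v: "v \<in> {0..U}" and G: "0 < G \<zeta> v" "G \<zeta> v < I \<zeta>" for \<zeta> v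
  proof -
    have c: "continuous_on {0..v} (f \<zeta>)" "continuous_on {v..U} (f \<zeta>)"
      using contf[OF z] v by (auto elim: continuous_on_subset)
    have "G \<zeta> v + integral {v..U} (f \<zeta>) = I \<zeta>"
      unfolding G_def I_def using v by (intro Henstock_Kurzweil_Integration.integral_combine int[OF z]) auto
    then have "integral {v..U} (f \<zeta>) > 0" using G by simp
    then obtain v2 where v2: "v2 \<in> {v<..<U}" "f \<zeta> v2 > 0"
      using integral_pos_iff_ex[OF c(2)] nonneg[OF z] v by auto
    obtain v1 where v1: "v1 \<in> {0<..<v}" "f \<zeta> v1 > 0"
      using G integral_pos_iff_ex[OF c(1)] nonneg[OF z] v by (auto simp: G_def)
    show ?thesis using conn[OF z, of v1 v v2] v1 v2 by auto
  qed
  have Gmono: "G \<zeta> v < G \<zeta> w" if z: "\<zeta> \<in> ?S" and v: "v \<in> {0..U}" "0 < G \<zeta> v" "G \<zeta> v < I \<zeta>" and w: "v < w" "w \<le> U" for \<zeta> v w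
  proof -
    have p: "0 < v \<and> v < U \<and> f \<zeta> v > 0" using posf[OF z] v by blast
    have c: "continuous_on {v..w} (f \<zeta>)" using contf[OF z] v w by (auto elim: continuous_on_subset)
    have "integral {v..w} (f \<zeta>) > 0"
    proof -
      have "integral {v..w} (f \<zeta>) \<noteq> 0"
      proof
        assume "integral {v..w} (f \<zeta>) = 0"
        then have "(f \<zeta> has_integral 0) (cbox v w)"
          using int[OF z, of v w] v w by (metis atLeastAtMost_iff box_real(2) has_integral_integral)
        then have "f \<zeta> v = 0"
          using v w c nonneg[OF z] by (intro has_integral_0_cbox_imp_0[of v w "f \<zeta>" v]) (auto simp: box_real)
        with p show False by simp
      qed
      moreover have "integral {v..w} (f \<zeta>) \<ge> 0" using int[OF z, of v w] nonneg[OF z] v w by (intro integral_nonneg) auto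
      ultimately show ?thesis by simp
    qed
    moreover have "G \<zeta> v + integral {v..w} (f \<zeta>) = G \<zeta> w"
      unfolding G_def using v w by (intro Henstock_Kurzweil_Integration.integral_combine int[OF z]) auto
    ultimately show ?thesis by simp
  qed
  have ex: "\<exists>v\<in>{0..U}. G \<zeta> v = s * I \<zeta>" if "\<zeta> \<in> ?S" "0 < s" "s < 1" for \<zeta> s
  proof -
    have "continuous_on {0..U} (G \<zeta>)" unfolding G_def
      by (rule indefinite_integral_continuous_1[OF int[OF that(1) order_refl order_refl]])
    moreover have "G \<zeta> 0 \<le> s * I \<zeta>" "s * I \<zeta> \<le> G \<zeta> U" using that I[OF that(1)] by (simp_all add: G_def I_def)
    ultimately show ?thesis using IVT'[of "G \<zeta>" 0 "s * I \<zeta>" U] U by auto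
  qed
  \<comment> \<open>The \<open>s\<close>-quantile of \<open>f \<zeta>\<close>; for
    \<open>0 < s < 1\<close> it is unique, because \<open>G \<zeta>\<close> strictly increases from
    any point where it is neither 0 nor \<open>I \<zeta>\<close>.\<close>
  define y where "y = (\<lambda>\<zeta> s. SOME v. v \<in> {0..U} \<and> G \<zeta> v = s * I \<zeta>)"
  have y: "y \<zeta> s \<in> {0..U}" "G \<zeta> (y \<zeta> s) = s * I \<zeta>" if "\<zeta> \<in> ?S" "0 < s" "s < 1" for \<zeta> s
    using someI_ex[of "\<lambda>v. v \<in> {0..U} \<and> G \<zeta> v = s * I \<zeta>"] ex[OF that] unfolding y_def by blast+
  have Gs: "0 < s * I \<zeta>" "s * I \<zeta> < I \<zeta>" if "\<zeta> \<in> ?S" "0 < s" "s < 1" for \<zeta> s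
    using I[OF that(1)] that by auto
  have yp: "0 < y \<zeta> s \<and> y \<zeta> s < U \<and> f \<zeta> (y \<zeta> s) > 0" if "\<zeta> \<in> ?S" "0 < s" "s < 1" for \<zeta> s
    using posf[OF that(1) y(1)[OF that]] Gs[OF that] y(2)[OF that] by simp
  have yne: "y \<zeta> s \<noteq> 0" "f \<zeta> (y \<zeta> s) \<noteq> 0" if "\<zeta> \<in> ?S" "0 < s" "s < 1" for \<zeta> s
    using yp[OF that] by auto
  have yuniq: "v = y \<zeta> s" if "\<zeta> \<in> ?S" "0 < s" "s < 1" "v \<in> {0..U}" "G \<zeta> v = s * I \<zeta>" for \<zeta> s v
    using Gmono[OF that(1), of v "y \<zeta> s"] Gmono[OF that(1), of "y \<zeta> s" v] Gs[OF that(1-3)] y[OF that(1-3)] that(4,5)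
    by (cases v "y \<zeta> s" rule: linorder_cases) auto
  \<comment> \<open>A map into the compact interval \<open>{0..U}\<close> with closed graph is
    continuous, and the graph is the zero set of a continuous function.\<close>
  have conty: "continuous_on (?S \<times> {0<..<1}) (\<lambda>p. y (fst p) (snd p))"
  proof -
    have fim: "(\<lambda>p. y (fst p) (snd p)) \<in> ?S \<times> {0<..<1} \<rightarrow> {0..U}" using y(1) by auto
    let ?X = "(?S \<times> {0<..<1}) \<times> {0..U}"
    have "(\<lambda>p. (p, y (fst p) (snd p))) ` (?S \<times> {0<..<1}) =
      {x \<in> ?X. G (fst (fst x)) (snd x) - snd (fst x) * I (fst (fst x)) = 0}"
      using y yuniq by (auto simp: image_iff)
    moreover have cX: "continuous_on ?X (\<lambda>x. G (fst (fst x)) (snd x) - snd (fst x) * I (fst (fst x)))"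
      by (intro continuous_intros continuous_on_compose2[OF contG, of _ "\<lambda>x. (fst (fst x), snd x)", simplified]
          continuous_on_compose2[OF contI]) auto
    ultimately have "closedin (top_of_set ?X) ((\<lambda>p. (p, y (fst p) (snd p))) ` (?S \<times> {0<..<1}))"
      using continuous_closedin_preimage_constant[OF cX, of 0] by simp
    then show ?thesis using continuous_closed_graph_eq[OF _ fim] by simp
  qed
  have conty1: "continuous_on ?S (\<lambda>\<zeta>. y \<zeta> s)" if "0 < s" "s < 1" for s
    using that by (intro continuous_on_compose2[OF conty, of _ "\<lambda>\<zeta>. (\<zeta>, s)", simplified] continuous_intros) auto
  have dy: "((\<lambda>s. y \<zeta> s) has_real_derivative I \<zeta> / f \<zeta> (y \<zeta> s)) (at s)" if z: "\<zeta> \<in> ?S" and s: "0 < s" "s < 1" for \<zeta> s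
  proof -
    have "((\<lambda>v. G \<zeta> v) has_real_derivative f \<zeta> (y \<zeta> s)) (at (y \<zeta> s))"
      unfolding G_def using yp[OF z s] by (intro integral_has_derivative_interior[OF contf[OF z]]) auto
    then have d1: "((\<lambda>v. G \<zeta> v / I \<zeta>) has_real_derivative f \<zeta> (y \<zeta> s) / I \<zeta>) (at (y \<zeta> s))"
      by (rule DERIV_cdivide)
    have cnt: "isCont (\<lambda>s. y \<zeta> s) s"
    proof -
      have "continuous_on {0<..<1} (\<lambda>s. y \<zeta> s)"
        using z by (intro continuous_on_compose2[OF conty, of _ "\<lambda>s. (\<zeta>, s)", simplified] continuous_intros) auto
      then show ?thesis using s by (simp add: continuous_on_eq_continuous_at)
    qed
    have "((\<lambda>s. y \<zeta> s) has_real_derivative inverse (f \<zeta> (y \<zeta> s) / I \<zeta>)) (at s)"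
    proof (rule DERIV_inverse_function[where f = "\<lambda>v. G \<zeta> v / I \<zeta>" and a = 0 and b = 1, OF d1 _ _ _ _ cnt])
      show "f \<zeta> (y \<zeta> s) / I \<zeta> \<noteq> 0" using yp[OF z s] I[OF z] by simp
      show "0 < s" "s < 1" by fact+
      show "G \<zeta> (y \<zeta> s') / I \<zeta> = s'" if "0 < s'" "s' < 1" for s'
        using y(2)[OF z that] I[OF z] by simp
    qed
    then show ?thesis by simp
  qed
  have contfy: "continuous_on (?S \<times> {0<..<1}) (\<lambda>p. f (fst p) (y (fst p) (snd p)))"
    by (intro continuous_on_compose2[OF cont[unfolded case_prod_beta], of _ "\<lambda>p. (fst p, y (fst p) (snd p))", simplified]
        continuous_intros conty) (use yp in \<open>force+\<close>)
  \<comment> \<open>\<open>exp (L s)\<close> is the geometric mean of the quantiles, the transported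
    point; \<open>L'\<close> will be the derivative of \<open>L\<close>.\<close>
  define L where "L = (\<lambda>s. cmean (\<lambda>\<zeta>. ln (y \<zeta> s)))"
  define L' where "L' = (\<lambda>s. cmean (\<lambda>\<zeta>. I \<zeta> / f \<zeta> (y \<zeta> s) / y \<zeta> s))"
  have cis_in: "cis \<theta> \<in> ?S" for \<theta> by simp
  have dL: "(L has_real_derivative L' s) (at s)" if s: "0 < s" "s < 1" for s
  proof -
    have "((\<lambda>s. integral (cbox 0 (2*pi)) (\<lambda>\<theta>. ln (y (cis \<theta>) s))) has_real_derivative
        integral (cbox 0 (2*pi)) (\<lambda>\<theta>. I (cis \<theta>) / f (cis \<theta>) (y (cis \<theta>) s) / y (cis \<theta>) s)) (at s within {0<..<1})"
    proof (rule leibniz_rule_field_derivative)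
      show "((\<lambda>s. ln (y (cis \<theta>) s)) has_real_derivative I (cis \<theta>) / f (cis \<theta>) (y (cis \<theta>) s) / y (cis \<theta>) s) (at s within {0<..<1})"
        if "s \<in> {0<..<1}" for s \<theta>
      proof -
        have s: "0 < s" "s < 1" using that by auto
        have "((\<lambda>s. ln (y (cis \<theta>) s)) has_real_derivative 1 / y (cis \<theta>) s * (I (cis \<theta>) / f (cis \<theta>) (y (cis \<theta>) s))) (at s)"
          by (rule DERIV_chain2[OF DERIV_ln_divide dy[OF cis_in s]]) (use yp[OF cis_in s] in blast)
        then show ?thesis by (rule has_field_derivative_at_within[OF DERIV_cong]) simp
      qed
      show "(\<lambda>\<theta>. ln (y (cis \<theta>) s)) integrable_on cbox 0 (2*pi)" if "s \<in> {0<..<1}" for s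
      proof -
        have s: "0 < s" "s < 1" using that by auto
        have "continuous_on ?S (\<lambda>\<zeta>. ln (y \<zeta> s))"
          by (rule continuous_on_ln[OF conty1[OF s]]) (use yne(1)[OF _ s] in blast)
        from circle_integrable[OF this] show ?thesis by (simp only: interval_cbox)
      qed
      have c: "continuous_on ({0<..<1} \<times> cbox 0 (2*pi)) (\<lambda>p. y (cis (snd p)) (fst p))"
        by (intro continuous_on_compose2[OF conty, of _ "\<lambda>p. (cis (snd p), fst p)", simplified] continuous_intros) auto
      have c2: "continuous_on ({0<..<1} \<times> cbox 0 (2*pi)) (\<lambda>p. f (cis (snd p)) (y (cis (snd p)) (fst p)))"
        by (intro continuous_on_compose2[OF contfy, of _ "\<lambda>p. (cis (snd p), fst p)", simplified] continuous_intros) auto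
      have c3: "continuous_on ({0<..<1} \<times> cbox 0 (2*pi)) (\<lambda>p. I (cis (snd p)))"
        by (intro continuous_on_compose2[OF contI] continuous_intros) auto
      have ne: "y (cis \<theta>) s \<noteq> 0 \<and> f (cis \<theta>) (y (cis \<theta>) s) \<noteq> 0" if "s \<in> {0<..<1}" for s \<theta>
        using yp[OF cis_in[of \<theta>], of s] that by auto
      show "continuous_on ({0<..<1} \<times> cbox 0 (2*pi)) (\<lambda>(s, \<theta>). I (cis \<theta>) / f (cis \<theta>) (y (cis \<theta>) s) / y (cis \<theta>) s)"
        unfolding case_prod_beta by (intro continuous_on_divide c c2 c3) (use ne in auto)
    qed (use s in auto)
    then have "((\<lambda>s. integral (cbox 0 (2*pi)) (\<lambda>\<theta>. ln (y (cis \<theta>) s))) has_real_derivative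
        integral (cbox 0 (2*pi)) (\<lambda>\<theta>. I (cis \<theta>) / f (cis \<theta>) (y (cis \<theta>) s) / y (cis \<theta>) s)) (at s)"
      using s by (simp add: at_within_open[of s "{0<..<1}"])
    from DERIV_cdivide[OF this, of "2 * pi"] show ?thesis
      unfolding L_def L'_def cmean_def interval_cbox .
  qed
  define C where "C = exp (cmean (\<lambda>\<zeta>. ln (I \<zeta>)))"
  define Q where "Q = (\<lambda>v. integral {0..v} f0)"
  have eL: "0 < exp (L s) \<and> exp (L s) < U" if s: "0 < s" "s < 1" for s
  proof -
    have cl: "continuous_on ?S (\<lambda>\<zeta>. ln (y \<zeta> s))"
      by (rule continuous_on_ln[OF conty1[OF s]]) (use yne(1)[OF _ s] in blast)
    have "cmean (\<lambda>\<zeta>. ln U - ln (y \<zeta> s)) > 0"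
      using yp s U by (intro cmean_pos continuous_on_diff continuous_on_const cl) auto
    then have "L s < ln U" using cl by (simp add: cmean_diff L_def)
    then show ?thesis using U by (metis exp_gt_zero exp_less_cancel_iff exp_ln)
  qed
  have dH: "((\<lambda>s. Q (exp (L s))) has_real_derivative f0 (exp (L s)) * (exp (L s) * L' s)) (at s)"
    if s: "0 < s" "s < 1" for s
  proof -
    have "(Q has_real_derivative f0 (exp (L s))) (at (exp (L s)))"
      unfolding Q_def using eL[OF s] by (intro integral_has_derivative_interior[OF cont0]) auto
    moreover have "((\<lambda>s. exp (L s)) has_real_derivative exp (L s) * L' s) (at s)"
      using dL[OF s] by (auto intro!: derivative_eq_intros)
    ultimately show ?thesis by (rule DERIV_chain2)
  qed
  \<comment> \<open>Each factor is at least the exponential of a circle mean of logarithms: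
    \<open>f0\<close> by hypothesis \<open>P\<close>, \<open>exp (L s)\<close> by definition,
    \<open>L' s\<close> by Jensen. In the product the terms with \<open>f\<close> and
    \<open>y\<close> cancel, and only the mean of \<open>ln (I \<zeta>)\<close> remains.\<close>
  have ge: "C \<le> f0 (exp (L s)) * (exp (L s) * L' s)" if s: "0 < s" "s < 1" for s
  proof -
    have cy: "continuous_on ?S (\<lambda>\<zeta>. y \<zeta> s)" by (rule conty1[OF s])
    have cf: "continuous_on ?S (\<lambda>\<zeta>. f \<zeta> (y \<zeta> s))"
      using s by (intro continuous_on_compose2[OF contfy, of _ "\<lambda>\<zeta>. (\<zeta>, s)", simplified] continuous_intros) auto
    have yp': "y \<zeta> s > 0" "f \<zeta> (y \<zeta> s) > 0" "I \<zeta> > 0" if "\<zeta> \<in> ?S" for \<zeta>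
      using yp[OF that s] I[OF that] by auto
    have cln: "continuous_on ?S (\<lambda>\<zeta>. ln (y \<zeta> s))" "continuous_on ?S (\<lambda>\<zeta>. ln (f \<zeta> (y \<zeta> s)))" "continuous_on ?S (\<lambda>\<zeta>. ln (I \<zeta>))"
      by (rule continuous_on_ln[OF cy], use yp'(1) in force)
        (rule continuous_on_ln[OF cf], use yp'(2) in force, rule continuous_on_ln[OF contI], use yp'(3) in force)
    have 1: "exp (cmean (\<lambda>\<zeta>. ln (f \<zeta> (y \<zeta> s)))) \<le> f0 (exp (L s))"
      unfolding L_def using yp[OF _ s] by (intro P cy) auto
    have "exp (cmean (\<lambda>\<zeta>. ln (I \<zeta> / f \<zeta> (y \<zeta> s) / y \<zeta> s))) \<le> L' s"
      unfolding L'_def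
    proof (intro exp_cmean_ln_le continuous_on_divide contI cf cy ballI)
      show "f \<zeta> (y \<zeta> s) \<noteq> 0" "y \<zeta> s \<noteq> 0" if "\<zeta> \<in> ?S" for \<zeta> using yne[OF that s] by auto
      show "0 < I \<zeta> / f \<zeta> (y \<zeta> s) / y \<zeta> s" if "\<zeta> \<in> ?S" for \<zeta> using yp'[OF that] by simp
    qed
    also have "cmean (\<lambda>\<zeta>. ln (I \<zeta> / f \<zeta> (y \<zeta> s) / y \<zeta> s)) = cmean (\<lambda>\<zeta>. ln (I \<zeta>) - ln (f \<zeta> (y \<zeta> s)) - ln (y \<zeta> s))"
    proof (rule cmean_cong)
      fix \<zeta> assume "\<zeta> \<in> ?S"
      then show "ln (I \<zeta> / f \<zeta> (y \<zeta> s) / y \<zeta> s) = ln (I \<zeta>) - ln (f \<zeta> (y \<zeta> s)) - ln (y \<zeta> s)"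
        using yp'[of \<zeta>] by (simp add: ln_divide_pos ln_mult_pos)
    qed
    also have "\<dots> = cmean (\<lambda>\<zeta>. ln (I \<zeta>)) - cmean (\<lambda>\<zeta>. ln (f \<zeta> (y \<zeta> s))) - L s"
      using cln by (simp add: cmean_diff continuous_on_diff L_def)
    finally have 2: "exp (cmean (\<lambda>\<zeta>. ln (I \<zeta>)) - cmean (\<lambda>\<zeta>. ln (f \<zeta> (y \<zeta> s))) - L s) \<le> L' s" .
    have "C = exp (cmean (\<lambda>\<zeta>. ln (f \<zeta> (y \<zeta> s)))) * (exp (L s) *
        exp (cmean (\<lambda>\<zeta>. ln (I \<zeta>)) - cmean (\<lambda>\<zeta>. ln (f \<zeta> (y \<zeta> s))) - L s))"
      unfolding C_def by (simp flip: exp_add)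
    also have "\<dots> \<le> f0 (exp (L s)) * (exp (L s) * L' s)"
      using 1 2 by (intro mult_mono mult_left_mono) (auto intro: order_trans[OF exp_ge_zero])
    finally show ?thesis .
  qed
  have Q: "0 \<le> Q v" "Q v \<le> Q U" if "v \<in> {0..U}" for v
  proof -
    have i: "f0 integrable_on {a..b}" if "0 \<le> a" "b \<le> U" for a b
      using cont0 that by (intro integrable_continuous_real) (auto elim: continuous_on_subset)
    show "0 \<le> Q v" unfolding Q_def using that nonneg0 i by (intro integral_nonneg) auto
    show "Q v \<le> Q U" unfolding Q_def using that nonneg0 i by (intro integral_subset_le) auto
  qed
  \<comment> \<open>The quantiles are controlled only for \<open>0 < s < 1\<close>, so the estimate
    is integrated from \<open>\<epsilon>\<close> to \<open>1 - \<epsilon>\<close>, at the cost of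
    the factor \<open>1 - 2 * \<epsilon> = z\<close>, which is arbitrary below 1.\<close>
  have "C \<le> Q U"
  proof (rule field_le_mult_one_interval)
    fix z :: real assume z: "0 < z" "z < 1"
    define \<epsilon> where "\<epsilon> = (1 - z) / 2"
    have e: "0 < \<epsilon>" "\<epsilon> < 1 - \<epsilon>" "1 - \<epsilon> < 1" "1 - 2 * \<epsilon> = z" using z by (auto simp: \<epsilon>_def field_simps)
    have "Q (exp (L \<epsilon>)) - C * \<epsilon> \<le> Q (exp (L (1 - \<epsilon>))) - C * (1 - \<epsilon>)"
    proof (rule DERIV_nonneg_imp_nondecreasing[of \<epsilon> "1 - \<epsilon>" "\<lambda>s. Q (exp (L s)) - C * s"])
      fix s assume "\<epsilon> \<le> s" "s \<le> 1 - \<epsilon>"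
      then have s: "0 < s" "s < 1" using e by auto
      have "((\<lambda>s. Q (exp (L s)) - C * s) has_real_derivative f0 (exp (L s)) * (exp (L s) * L' s) - C) (at s)"
        by (intro DERIV_diff dH[OF s] DERIV_cmult_Id)
      then show "\<exists>y. ((\<lambda>s. Q (exp (L s)) - C * s) has_real_derivative y) (at s) \<and> 0 \<le> y"
        using ge[OF s] by (intro exI conjI) auto
    qed (use e in auto)
    moreover have "0 \<le> Q (exp (L \<epsilon>))" "Q (exp (L (1 - \<epsilon>))) \<le> Q U"
      using Q eL[of \<epsilon>] eL[of "1 - \<epsilon>"] e by auto
    moreover have "z * C = C * (1 - \<epsilon>) - C * \<epsilon>" using e(4) by (simp add: algebra_simps flip: e(4))
    ultimately show "z * C \<le> Q U" by linarith
  qed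
  then show ?thesis by (simp add: C_def Q_def I_def)
qed

section \<open>Marginals in logarithmic coordinates\<close>

definition expv :: "real ^ 'm \<Rightarrow> real ^ 'm" where
  "expv x = (\<chi> j. exp (x $ j))"

definition vmean :: "(complex \<Rightarrow> real ^ 'm) \<Rightarrow> real ^ 'm" where
  "vmean x = (\<chi> j. cmean (\<lambda>\<zeta>. x \<zeta> $ j))"

definition vupd :: "real ^ 'm \<Rightarrow> 'm \<Rightarrow> real \<Rightarrow> real ^ 'm" where
  "vupd u i v = (\<chi> j. if j = i then v else u $ j)"

lemma vupd_nth [simp]: "vupd u i v $ j = (if j = i then v else u $ j)"
  by (simp add: vupd_def)

lemma expv_nth [simp]: "expv x $ j = exp (x $ j)"
  by (simp add: expv_def)

lemma expv_vupd: "expv (vupd x i w) = vupd (expv x) i (exp w)"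
  by (simp add: vec_eq_iff)

lemma continuous_on_expv: "continuous_on S x \<Longrightarrow> continuous_on S (\<lambda>\<zeta>. expv (x \<zeta>))"
  unfolding expv_def by (intro continuous_intros)

lemma continuous_on_vupd:
  assumes "continuous_on S x" "continuous_on S w"
  shows "continuous_on S (\<lambda>\<zeta>. vupd (x \<zeta>) i (w \<zeta>))"
  unfolding vupd_def
proof (rule continuous_on_vec_lambda)
  show "continuous_on S (\<lambda>\<zeta>. if j = i then w \<zeta> else x \<zeta> $ j)" for j
    using assms by (cases "j = i") (auto intro!: continuous_intros)
qed

text \<open>Here \<open>F (t, u)\<close> is a fibrewise rotation invariant function written in the variables
  \<open>u\<^sub>j = |z\<^sub>j|\<^sup>2\<close>; the last conjunct is plurisubharmonicity of \<open>- ln F\<close> in the variables \<open>t\<close> and \<open>ln z\<close>, in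
  the form which Prekopa's argument consumes and reproduces.\<close>
definition prekopa_class :: "(complex ^ 'n) set \<Rightarrow> ((complex ^ 'n) \<times> (real ^ 'm) \<Rightarrow> real) \<Rightarrow> bool" where
  "prekopa_class B F \<longleftrightarrow> continuous_on (B \<times> UNIV) F \<and> (\<forall>t\<in>B. \<forall>u. F (t, u) \<ge> 0) \<and>
    (\<forall>t\<in>B. convex {x. F (t, expv x) > 0}) \<and>
    (\<forall>a b x. (\<forall>\<zeta>. cmod \<zeta> \<le> 1 \<longrightarrow> a + \<zeta> *s b \<in> B) \<longrightarrow> continuous_on (sphere 0 1) x \<longrightarrow>
      (\<forall>\<zeta>\<in>sphere 0 1. F (a + \<zeta> *s b, expv (x \<zeta>)) > 0) \<longrightarrow>
      exp (cmean (\<lambda>\<zeta>. ln (F (a + \<zeta> *s b, expv (x \<zeta>))))) \<le> F (a, expv (vmean x)))"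

definition marginal :: "real \<Rightarrow> 'm \<Rightarrow> ('a \<times> (real ^ 'm) \<Rightarrow> real) \<Rightarrow> 'a \<times> (real ^ 'm) \<Rightarrow> real" where
  "marginal U i F p = integral {0..U} (\<lambda>v. F (fst p, vupd (snd p) i v))"

lemma continuous_on_smult_vec:
  "continuous_on S g \<Longrightarrow> continuous_on S (\<lambda>x. g x *s (b :: complex ^ 'n))"
  unfolding vector_scalar_mult_def by (intro continuous_intros)

text \<open>On each circle, \<open>circle_transport\<close> is applied to the slices in coordinate
  \<open>i\<close>. Its hypothesis \<open>P\<close> is the inequality of the class for the curve
  whose \<open>i\<close>-th entry is replaced by \<open>ln (y \<zeta>)\<close>; as \<open>y\<close>
  is only continuous, the class has to admit all continuous \<open>x\<close>. Vanishing beyond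
  \<open>U\<close> keeps all the mass in \<open>{0..U}\<close>.\<close>

lemma marginal_prekopa_class:
  fixes F :: "(complex ^ 'n) \<times> (real ^ 'm) \<Rightarrow> real"
  assumes F: "prekopa_class B F" and U: "U > 0"
    and van: "\<And>t u. t \<in> B \<Longrightarrow> u $ i \<ge> U \<Longrightarrow> F (t, u) = 0"
  shows "prekopa_class B (marginal U i F)"
proof -
  have cont: "continuous_on (B \<times> UNIV) F" and nn: "F (t, u) \<ge> 0" if "t \<in> B" for t u
    using F that unfolding prekopa_class_def by auto
  have contF: "continuous_on (B \<times> UNIV) F" using F by (simp add: prekopa_class_def)
  have conv: "convex {x. F (t, expv x) > 0}" if "t \<in> B" for t
    using F that by (simp add: prekopa_class_def)
  have P: "exp (cmean (\<lambda>\<zeta>. ln (F (a + \<zeta> *s b, expv (x \<zeta>))))) \<le> F (a, expv (vmean x))"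
    if "\<And>\<zeta>. cmod \<zeta> \<le> 1 \<Longrightarrow> a + \<zeta> *s b \<in> B" "continuous_on (sphere 0 1) x"
      "\<And>\<zeta>. \<zeta> \<in> sphere 0 1 \<Longrightarrow> F (a + \<zeta> *s b, expv (x \<zeta>)) > 0" for a b x
    using F that unfolding prekopa_class_def by blast
  have slice: "continuous_on {0..U} (\<lambda>v. F (t, vupd u i v))" if "t \<in> B" for t u
    by (rule continuous_on_compose2[OF contF])
      (use that in \<open>auto intro!: continuous_on_Pair continuous_on_vupd continuous_on_const continuous_on_id\<close>)
  \<comment> \<open>The positivity set of the marginal is the projection of that of \<open>F\<close>
    along coordinate \<open>i\<close>; this gives its convexity below.\<close>
  have posI: "marginal U i F (t, expv x) > 0 \<longleftrightarrow> (\<exists>w. F (t, expv (vupd x i w)) > 0)" if t: "t \<in> B" for t x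
  proof -
    have "marginal U i F (t, expv x) > 0 \<longleftrightarrow> (\<exists>v\<in>{0<..<U}. F (t, vupd (expv x) i v) > 0)"
      using integral_pos_iff_ex[OF slice[OF t]] nn[OF t] by (simp add: marginal_def)
    also have "\<dots> \<longleftrightarrow> (\<exists>w. F (t, expv (vupd x i w)) > 0)"
    proof
      assume "\<exists>v\<in>{0<..<U}. F (t, vupd (expv x) i v) > 0"
      then obtain v where "v > 0" "F (t, vupd (expv x) i v) > 0" by auto
      then show "\<exists>w. F (t, expv (vupd x i w)) > 0" by (intro exI[of _ "ln v"]) (simp add: expv_vupd)
    next
      assume "\<exists>w. F (t, expv (vupd x i w)) > 0"
      then obtain w where w: "F (t, vupd (expv x) i (exp w)) > 0" by (auto simp: expv_vupd)
      then have "exp w < U" using van[OF t, of "vupd (expv x) i (exp w)"] by (cases "exp w < U") auto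
      then show "\<exists>v\<in>{0<..<U}. F (t, vupd (expv x) i v) > 0" using w by (intro bexI[of _ "exp w"]) auto
    qed
    finally show ?thesis .
  qed
  show ?thesis
    unfolding prekopa_class_def
  proof (intro conjI ballI allI impI)
    have "continuous_on (B \<times> UNIV) (\<lambda>p. integral (cbox 0 U) (\<lambda>v. F (fst p, vupd (snd p) i v)))"
      by (rule integral_continuous_on_param, unfold case_prod_beta, rule continuous_on_compose2[OF contF])
        (auto intro!: continuous_on_Pair continuous_on_vupd continuous_on_fst continuous_on_snd continuous_on_id)
    then show "continuous_on (B \<times> UNIV) (marginal U i F)" by (simp add: marginal_def[abs_def])
    show "marginal U i F (t, u) \<ge> 0" if "t \<in> B" for t u
      unfolding marginal_def using nn[OF that] slice[OF that]
      by (auto intro!: integral_nonneg integrable_continuous_real)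
    show "convex {x. 0 < marginal U i F (t, expv x)}" if t: "t \<in> B" for t
    proof (rule convexI)
      fix x x' :: "real ^ 'm" and p q :: real
      assume x: "x \<in> {x. 0 < marginal U i F (t, expv x)}" "x' \<in> {x. 0 < marginal U i F (t, expv x)}"
        and pq: "0 \<le> p" "0 \<le> q" "p + q = 1"
      then obtain w w' where "vupd x i w \<in> {x. F (t, expv x) > 0}" "vupd x' i w' \<in> {x. F (t, expv x) > 0}"
        using posI[OF t] by auto
      from convexD[OF conv[OF t] this pq]
      have "F (t, expv (p *\<^sub>R vupd x i w + q *\<^sub>R vupd x' i w')) > 0" by simp
      moreover have "p *\<^sub>R vupd x i w + q *\<^sub>R vupd x' i w' = vupd (p *\<^sub>R x + q *\<^sub>R x') i (p * w + q * w')"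
        by (simp add: vec_eq_iff)
      ultimately show "p *\<^sub>R x + q *\<^sub>R x' \<in> {x. 0 < marginal U i F (t, expv x)}"
        using posI[OF t] by auto
    qed
  next
    fix a b :: "complex ^ 'n" and x :: "complex \<Rightarrow> real ^ 'm"
    assume ab': "\<forall>\<zeta>. cmod \<zeta> \<le> 1 \<longrightarrow> a + \<zeta> *s b \<in> B" and x: "continuous_on (sphere 0 1) x"
      and pos: "\<forall>\<zeta>\<in>sphere 0 1. marginal U i F (a + \<zeta> *s b, expv (x \<zeta>)) > 0"
    have ab: "a + \<zeta> *s b \<in> B" if "cmod \<zeta> \<le> 1" for \<zeta> using ab' that by blast
    have aB: "a \<in> B" using ab[of 0] by simp
    define f where "f = (\<lambda>\<zeta> v. F (a + \<zeta> *s b, vupd (expv (x \<zeta>)) i v))"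
    define f0 where "f0 = (\<lambda>v. F (a, vupd (expv (vmean x)) i v))"
    have "exp (cmean (\<lambda>\<zeta>. ln (integral {0..U} (f \<zeta>)))) \<le> integral {0..U} f0"
    proof (rule circle_transport[OF U])
      show "continuous_on (sphere 0 1 \<times> {0..U}) (\<lambda>(\<zeta>, v). f \<zeta> v)"
        unfolding f_def case_prod_beta
        by (rule continuous_on_compose2[OF contF])
          (use ab in \<open>auto intro!: continuous_on_Pair continuous_on_vupd continuous_on_expv
            continuous_on_compose2[OF x] continuous_on_smult_vec continuous_on_add continuous_on_const
            continuous_on_fst continuous_on_snd continuous_on_id\<close>)
      show "f \<zeta> v \<ge> 0" if "\<zeta> \<in> sphere 0 1" for \<zeta> v using nn ab[of \<zeta>] that by (simp add: f_def)
      show "integral {0..U} (f \<zeta>) > 0" if "\<zeta> \<in> sphere 0 1" for \<zeta>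
        using pos that by (simp add: f_def marginal_def)
      show "continuous_on {0..U} f0" unfolding f0_def using slice[OF aB] .
      show "f0 v \<ge> 0" for v using nn[OF aB] by (simp add: f0_def)
      show "f \<zeta> v > 0" if z: "\<zeta> \<in> sphere 0 1" and v: "0 < v1" "v1 \<le> v" "v \<le> v2" "f \<zeta> v1 > 0" "f \<zeta> v2 > 0" for \<zeta> v1 v v2
      proof -
        have t: "a + \<zeta> *s b \<in> B" using ab z by simp
        let ?A = "{x. F (a + \<zeta> *s b, expv x) > 0}"
        have "vupd (x \<zeta>) i (ln v1) \<in> ?A" "vupd (x \<zeta>) i (ln v2) \<in> ?A"
          using v by (auto simp: expv_vupd f_def)
        then have "closed_segment (vupd (x \<zeta>) i (ln v1)) (vupd (x \<zeta>) i (ln v2)) \<subseteq> ?A"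
          using conv[OF t] by (simp add: convex_contains_segment)
        moreover have "vupd (x \<zeta>) i (ln v) \<in> closed_segment (vupd (x \<zeta>) i (ln v1)) (vupd (x \<zeta>) i (ln v2))"
        proof -
          have "ln v \<in> closed_segment (ln v1) (ln v2)" using v by (simp add: closed_segment_eq_real_ivl)
          then obtain p where p: "0 \<le> p" "p \<le> 1" "ln v = (1 - p) * ln v1 + p * ln v2"
            by (auto simp: in_segment)
          then show ?thesis unfolding in_segment
            by (intro exI[of _ p]) (auto simp: vec_eq_iff algebra_simps)
        qed
        ultimately have "vupd (x \<zeta>) i (ln v) \<in> ?A" by blast
        then show ?thesis using v by (simp add: expv_vupd f_def)
      qed
      fix y assume y: "continuous_on (sphere 0 1) y"
        and yp: "\<And>\<zeta>. \<zeta> \<in> sphere 0 1 \<Longrightarrow> 0 < y \<zeta> \<and> y \<zeta> < U \<and> f \<zeta> (y \<zeta>) > 0"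
      let ?x = "\<lambda>\<zeta>. vupd (x \<zeta>) i (ln (y \<zeta>))"
      have e: "expv (?x \<zeta>) = vupd (expv (x \<zeta>)) i (y \<zeta>)" if "\<zeta> \<in> sphere 0 1" for \<zeta>
        using yp[OF that] by (simp add: expv_vupd)
      have "continuous_on (sphere 0 1) ?x"
        by (intro continuous_on_vupd x continuous_on_ln y) (use yp in force)
      then have "exp (cmean (\<lambda>\<zeta>. ln (F (a + \<zeta> *s b, expv (?x \<zeta>))))) \<le> F (a, expv (vmean ?x))"
        using yp e by (intro P ab) (auto simp: f_def)
      also have "vmean ?x = vupd (vmean x) i (cmean (\<lambda>\<zeta>. ln (y \<zeta>)))"
        by (simp add: vec_eq_iff vmean_def)
      also have "cmean (\<lambda>\<zeta>. ln (F (a + \<zeta> *s b, expv (?x \<zeta>)))) = cmean (\<lambda>\<zeta>. ln (f \<zeta> (y \<zeta>)))"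
        using e by (intro cmean_cong) (simp add: f_def)
      finally show "exp (cmean (\<lambda>\<zeta>. ln (f \<zeta> (y \<zeta>)))) \<le> f0 (exp (cmean (\<lambda>\<zeta>. ln (y \<zeta>))))"
        by (simp add: f0_def expv_vupd)
    qed
    then show "exp (cmean (\<lambda>\<zeta>. ln (marginal U i F (a + \<zeta> *s b, expv (x \<zeta>))))) \<le> marginal U i F (a, expv (vmean x))"
      by (simp add: f_def f0_def marginal_def)
  qed
qed

section \<open>Holomorphic discs in Reinhardt families\<close>

text \<open>After adding a small multiple of \<open>(cmod \<zeta>)\<^sup>2\<close>, an interior
  maximum would carry a positive Levi form.\<close>

lemma max_principle_disc:
  fixes u :: "complex \<Rightarrow> real"
  assumes S: "open S" "Ck_on 2 S u" "cball 0 1 \<subseteq> S"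
    and levi: "\<And>\<zeta>. \<zeta> \<in> ball 0 1 \<Longrightarrow> levi ((*) \<i>) u \<zeta> 1 \<ge> 0"
    and neg: "\<And>\<zeta>. \<zeta> \<in> sphere 0 1 \<Longrightarrow> u \<zeta> < 0" and z: "\<zeta> \<in> cball 0 1"
  shows "u \<zeta> < 0"
proof -
  have cont: "continuous_on (cball 0 1) u"
    using Ck_on_imp_continuous_on[OF S(2)] S(3) by (rule continuous_on_subset)
  have "1 \<in> sphere (0::complex) 1" by simp
  then have "sphere (0::complex) 1 \<noteq> {}" by blast
  then obtain w where w: "w \<in> sphere 0 1" "\<And>\<zeta>. \<zeta> \<in> sphere 0 1 \<Longrightarrow> u \<zeta> \<le> u w"
    using continuous_attains_sup[OF compact_sphere _ continuous_on_subset[OF cont sphere_cball]] by blast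
  \<comment> \<open>Half of the distance from the boundary maximum to 0, so that the perturbed
    function is still negative on the circle.\<close>
  define e where "e = - u w / 2"
  have e: "e > 0" using neg[OF w(1)] by (simp add: e_def)
  let ?v = "\<lambda>\<zeta>. u \<zeta> + e * (cmod \<zeta>)\<^sup>2"
  note sq = Ck_on_cmod_square[OF S(1), of 2]
  note sq' = Ck_on_mult[OF S(1) Ck_on_const[OF S(1)] sq, of e]
  note v2 = Ck_on_add[OF S(1,2) sq']
  have "continuous_on (cball 0 1) ?v" by (intro continuous_intros cont)
  then obtain m where m: "m \<in> cball 0 1" "\<And>\<zeta>. \<zeta> \<in> cball 0 1 \<Longrightarrow> ?v \<zeta> \<le> ?v m"
    using continuous_attains_sup[of "cball (0::complex) 1" ?v] by auto
  have "m \<in> sphere 0 1"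
  proof (rule ccontr)
    assume "m \<notin> sphere 0 1"
    then have mb: "m \<in> ball 0 1" using m(1) by auto
    have mS: "m \<in> S" using m S by blast
    have "levi ((*) \<i>) ?v m 1 \<le> 0"
    proof (rule levi_nonpos_of_local_max[OF S(1) v2])
      show "m \<in> S" using m S by blast
      show "1 - cmod m > 0" using mb by simp
      fix \<zeta> assume "\<zeta> \<in> ball m (1 - cmod m)"
      then have "cmod (\<zeta> - m) < 1 - cmod m" by (simp add: dist_norm norm_minus_commute)
      then have "cmod \<zeta> < 1" using norm_triangle_sub[of \<zeta> m] by simp
      then show "?v \<zeta> \<le> ?v m" using m(2) by simp
    qed
    moreover have "levi ((*) \<i>) ?v m 1 = levi ((*) \<i>) u m 1 + e * 4"
      using levi_add[OF S(1,2) sq' mS] levi_cmult[OF S(1) sq mS] levi_cmod_square by simp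
    ultimately show False using levi[OF mb] e by simp
  qed
  then have "?v m \<le> u w + e" using w(2)[of m] by simp
  then have "?v \<zeta> < 0" using m(2)[OF z] neg[OF w(1)] by (simp add: e_def)
  moreover have "0 \<le> e * (cmod \<zeta>)\<^sup>2" using e by simp
  ultimately show ?thesis by linarith
qed

text \<open>The coordinates are \<open>x\<^sub>j = ln u\<^sub>j\<close> with
  \<open>u\<^sub>j = |z\<^sub>j|\<^sup>2\<close>, hence the exponent \<open>x $ j / 2\<close> for
  the modulus.\<close>

definition logz :: "real ^ 'm \<Rightarrow> complex ^ 'm" where
  "logz x = (\<chi> j. complex_of_real (exp (x $ j / 2)))"

text \<open>Holomorphic discs over affine discs that avoid the coordinate hyperplanes; twice the
  real part of \<open>Q j\<close> is the \<open>j\<close>-th logarithmic coordinate.\<close>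

definition exp_disc :: "complex ^ 'n \<Rightarrow> complex ^ 'n \<Rightarrow> ('m \<Rightarrow> complex poly) \<Rightarrow> complex \<Rightarrow> (complex ^ 'n) \<times> (complex ^ 'm)" where
  "exp_disc a b Q \<zeta> = (a + \<zeta> *s b, \<chi> j. exp (poly (Q j) \<zeta>))"

lemma logz_nth [simp]: "logz x $ j = complex_of_real (exp (x $ j / 2))"
  by (simp add: logz_def)

lemma continuous_on_logz: "continuous_on S x \<Longrightarrow> continuous_on S (\<lambda>\<zeta>. logz (x \<zeta>))"
  unfolding logz_def by (intro continuous_intros) auto

lemma holo_curve_exp_disc: "\<exists>h1 h2. holo_curve JP (exp_disc a b (Q :: 'm::finite \<Rightarrow> _)) h1 h2"
proof -
  let ?q = "\<lambda>j. poly (Q j)" and ?q1 = "\<lambda>j. poly (pderiv (Q j))" and ?q2 = "\<lambda>j. poly (pderiv (pderiv (Q j)))"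
  let ?h1 = "\<lambda>\<zeta>. (b, \<chi> j. ?q1 j \<zeta> * exp (?q j \<zeta>))"
  let ?h2 = "\<lambda>\<zeta>. (0, \<chi> j. (?q2 j \<zeta> + ?q1 j \<zeta> * ?q1 j \<zeta>) * exp (?q j \<zeta>))"
  have cs: "(\<lambda>\<eta>. (cscale JP \<eta> (c, \<chi> j. f j))) = (\<lambda>\<eta>. (\<eta> *s c, \<chi> j. f j * \<eta>))" for c :: "complex ^ 'a" and f :: "'m \<Rightarrow> complex"
    by (simp add: cscale_JP fun_eq_iff vec_eq_iff)
  have sm: "((\<lambda>\<eta>. \<eta> *s b) has_derivative (\<lambda>\<eta>. \<eta> *s b)) (at \<zeta>)" for \<zeta>
    using bounded_linear_imp_has_derivative[OF bounded_linear_cscale_left[of "(*s) \<i>" b]] by (simp add: cscale_vec)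
  have vec: "((\<lambda>\<zeta>. \<chi> j. f j \<zeta>) has_derivative (\<lambda>\<eta>. \<chi> j. f' j * \<eta>)) (at \<zeta>)"
    if "\<And>j. (f j has_field_derivative f' j) (at \<zeta>)" for f :: "'m \<Rightarrow> complex \<Rightarrow> complex" and f' \<zeta>
    using that unfolding has_derivative_componentwise_within[of "\<lambda>\<zeta>. \<chi> j. f j \<zeta>"]
    by (auto simp: Basis_vec_def inner_axis has_field_derivative_def intro!: has_derivative_inner_left)
  have "holo_curve JP (exp_disc a b Q) ?h1 ?h2"
    unfolding holo_curve_def
  proof (intro conjI allI)
    fix \<zeta>
    have "((\<lambda>\<zeta>. a + \<zeta> *s b) has_derivative (\<lambda>\<eta>. 0 + \<eta> *s b)) (at \<zeta>)"
      by (intro has_derivative_add sm has_derivative_const)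
    moreover have "((\<lambda>\<zeta>. \<chi> j. exp (?q j \<zeta>)) has_derivative (\<lambda>\<eta>. \<chi> j. (?q1 j \<zeta> * exp (?q j \<zeta>)) * \<eta>)) (at \<zeta>)"
      by (rule vec) (auto intro!: derivative_eq_intros poly_DERIV)
    ultimately show "(exp_disc a b Q has_derivative (\<lambda>\<eta>. cscale JP \<eta> (?h1 \<zeta>))) (at \<zeta>)"
      unfolding cs exp_disc_def[abs_def] using has_derivative_Pair by fastforce
    have "((\<lambda>\<zeta>. \<chi> j. ?q1 j \<zeta> * exp (?q j \<zeta>)) has_derivative
        (\<lambda>\<eta>. \<chi> j. ((?q2 j \<zeta> + ?q1 j \<zeta> * ?q1 j \<zeta>) * exp (?q j \<zeta>)) * \<eta>)) (at \<zeta>)"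
      by (rule vec) (auto intro!: derivative_eq_intros poly_DERIV simp: algebra_simps)
    moreover have "((\<lambda>\<zeta>. b) has_derivative (\<lambda>\<eta>. \<eta> *s 0)) (at \<zeta>)"
      by (simp add: vector_scalar_mult_def zero_vec_def[symmetric])
    ultimately show "(?h1 has_derivative (\<lambda>\<eta>. cscale JP \<eta> (?h2 \<zeta>))) (at \<zeta>)"
      unfolding cs using has_derivative_Pair by fastforce
    show "continuous_on UNIV ?h2" by (intro continuous_intros)
  qed
  then show ?thesis by blast
qed

lemma continuous_on_exp_disc: "continuous_on UNIV (exp_disc a b (Q :: 'm::finite \<Rightarrow> _))"
  unfolding exp_disc_def by (intro continuous_intros continuous_on_smult_vec)

text \<open>The situation over a small neighbourhood \<open>B\<close> of one parameter: the compact
  \<open>N\<close> contains all fibres in its interior, so that over \<open>B\<close> the family is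
  described by \<open>\<rho>\<close> on \<open>N\<close>, and the common point \<open>c\<close> is
  where the deformation of discs starts.\<close>

locale reinhardt_box =
  fixes \<Omega> W :: "((complex ^ 'n) \<times> (complex ^ 'm)) set" and \<rho> :: "(complex ^ 'n) \<times> (complex ^ 'm) \<Rightarrow> real"
    and B :: "(complex ^ 'n) set" and N :: "(complex ^ 'm) set" and c :: "real ^ 'm"
  assumes open_Omega: "open \<Omega>" and open_W: "open W" and open_B: "open B" and compact_N: "compact N"
    and BN: "B \<times> N \<subseteq> W" and Ck_rho: "Ck_on 2 W \<rho>"
    and levi_rho: "\<And>x b. x \<in> W \<Longrightarrow> levi JP \<rho> x b \<ge> 0"
    and fiber_N: "\<And>t. t \<in> B \<Longrightarrow> fiber \<Omega> t \<subseteq> interior N"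
    and Omega_iff: "\<And>t z. t \<in> B \<Longrightarrow> z \<in> N \<Longrightarrow> (t, z) \<in> \<Omega> \<longleftrightarrow> \<rho> (t, z) < 0"
    and base: "\<And>t. t \<in> B \<Longrightarrow> (t, logz c) \<in> \<Omega>"
    and Reinhardt: "\<And>t. t \<in> B \<Longrightarrow> Reinhardt_domain (fiber \<Omega> t)"
begin

lemma Omega_rho: "t \<in> B \<Longrightarrow> (t, z) \<in> \<Omega> \<longleftrightarrow> z \<in> N \<and> \<rho> (t, z) < 0"
  using Omega_iff[of t z] fiber_N[of t] interior_subset by (fastforce simp: fiber_def)

text \<open>Points with equal moduli lie on one torus orbit: rotate by the differences of the
  arguments, a vanishing coordinate being fixed by any rotation.\<close>

lemma cmod_cong:
  assumes t: "t \<in> B" and "\<And>j. cmod (z $ j) = cmod (w $ j)"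
  shows "(t, z) \<in> \<Omega> \<longleftrightarrow> (t, w) \<in> \<Omega>"
proof -
  have *: "(t, w) \<in> \<Omega>" if "(t, z) \<in> \<Omega>" "\<And>j. cmod (z $ j) = cmod (w $ j)" for z w
  proof -
    define \<theta> :: "real ^ 'm" where "\<theta> = (\<chi> j. Arg (w $ j) - Arg (z $ j))"
    have "torus_act \<theta> z = w"
    proof (rule vec_eq_iff[THEN iffD2], rule allI)
      fix j
      show "torus_act \<theta> z $ j = w $ j"
      proof (cases "z $ j = 0")
        case True then show ?thesis using that(2)[of j] by (simp add: torus_act_def)
      next
        case False
        have "cis (\<theta> $ j) * (z $ j) = cis (\<theta> $ j) * (of_real (cmod (z $ j)) * cis (Arg (z $ j)))"
          using Arg_eq[OF False] by (simp only: cis_conv_exp)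
        also have "\<dots> = of_real (cmod (z $ j)) * cis (\<theta> $ j + Arg (z $ j))"
          unfolding cis_mult[symmetric] by (rule mult.left_commute)
        also have "\<theta> $ j + Arg (z $ j) = Arg (w $ j)" by (simp add: \<theta>_def)
        also have "of_real (cmod (z $ j)) * cis (Arg (w $ j)) = w $ j"
          using Arg_eq[of "w $ j"] False that(2)[of j] by (metis cis_conv_exp norm_eq_zero)
        finally show ?thesis by (simp add: torus_act_def)
      qed
    qed
    moreover have "z \<in> fiber \<Omega> t" using that by (simp add: fiber_def)
    then have "torus_act \<theta> z \<in> fiber \<Omega> t" using Reinhardt[OF t] unfolding Reinhardt_domain_def by blast
    ultimately show ?thesis by (simp add: fiber_def)
  qed
  from *[of z w] *[of w z] assms(2) show ?thesis by auto
qed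

definition lfib :: "complex ^ 'n \<Rightarrow> (real ^ 'm) set" where
  "lfib t = {x. (t, logz x) \<in> \<Omega>}"

lemma base_lfib: "t \<in> B \<Longrightarrow> c \<in> lfib t" using base by (simp add: lfib_def)

lemma open_lfib: "open (lfib t)"
proof -
  have "continuous_on UNIV (\<lambda>x. (t, logz x))"
    by (intro continuous_on_Pair continuous_on_const continuous_on_logz continuous_on_id)
  then show ?thesis using open_vimage[OF open_Omega] by (simp add: lfib_def vimage_def)
qed

text \<open>A connected open Reinhardt set stays connected when the coordinate hyperplanes are removed: around
  every point there is a polyannulus whose logarithmic image is a box.\<close>
lemma connected_lfib:
  assumes t: "t \<in> B"
  shows "connected (lfib t)"
proof (rule ccontr)
  let ?D = "fiber \<Omega> t"
  assume "\<not> connected (lfib t)"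
  then obtain A1 A2 where A: "open A1" "open A2" "A1 \<inter> lfib t \<noteq> {}" "A2 \<inter> lfib t \<noteq> {}"
    "A1 \<inter> A2 \<inter> lfib t = {}" "lfib t \<subseteq> A1 \<union> A2"
    unfolding connected_def by blast
  have D: "open ?D" "connected ?D" using Reinhardt[OF t] by (auto simp: Reinhardt_domain_def is_domain_def)
  \<comment> \<open>\<open>\<Delta> z s\<close> is a product of annuli or discs around the orbit of
    \<open>z\<close>, and \<open>C z s\<close> is its trace in logarithmic coordinates, a product of
    intervals and hence connected.\<close>
  define \<Delta> where "\<Delta> = (\<lambda>z s. {w. \<forall>j. \<bar>cmod (w $ j) - cmod (z $ j)\<bar> < s} :: (complex ^ 'm) set)"
  define C where "C = (\<lambda>z s. {x. \<forall>j. \<bar>exp (x $ j / 2) - cmod (z $ j)\<bar> < s} :: (real ^ 'm) set)"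
  have op\<Delta>: "open (\<Delta> z s)" for z s
  proof -
    have "\<Delta> z s = (\<Inter>j. {w. \<bar>cmod (w $ j) - cmod (z $ j)\<bar> < s})" by (auto simp: \<Delta>_def)
    moreover have "open {w :: complex ^ 'm. \<bar>cmod (w $ j) - cmod (z $ j)\<bar> < s}" for j
      by (intro open_Collect_less continuous_intros)
    ultimately show ?thesis by (simp add: open_INT)
  qed
  have Cconv: "connected (C z s)" for z s
  proof -
    have "{y::real. \<bar>exp (y / 2) - r\<bar> < s} = {y. exp (y/2) < s + r} \<inter> {y. r - s < exp (y/2)}" for r by auto
    moreover have "is_interval {y::real. exp (y/2) < d}" "is_interval {y::real. d < exp (y/2)}" for d
    proof -
      have "exp (x / 2) < d" if "exp (b / 2) < d" "x \<le> b" for b x :: real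
        by (rule le_less_trans[of _ "exp (b / 2)"]) (use that in auto)
      then show "is_interval {y::real. exp (y/2) < d}" unfolding is_interval_1 by blast
      have "d < exp (x / 2)" if "d < exp (a / 2)" "a \<le> x" for a x :: real
        by (rule less_le_trans[of _ "exp (a / 2)"]) (use that in auto)
      then show "is_interval {y::real. d < exp (y/2)}" unfolding is_interval_1 by blast
    qed
    ultimately have cv: "convex {y::real. \<bar>exp (y / 2) - r\<bar> < s}" for r
      by (simp add: convex_Int is_interval_convex)
    have lin: "linear (\<lambda>x::real ^ 'm. x $ j)" for j
      by (simp add: linear_conv_bounded_linear bounded_linear_vec_nth)
    have "convex {x :: real ^ 'm. x $ j \<in> {y. \<bar>exp (y / 2) - cmod (z $ j)\<bar> < s}}" for j
      using convex_linear_vimage[OF lin[of j] cv[of "cmod (z $ j)"]] by (simp add: vimage_def)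
    then have "convex (\<Inter>j. {x :: real ^ 'm. x $ j \<in> {y. \<bar>exp (y / 2) - cmod (z $ j)\<bar> < s}})"
      by (intro convex_INT)
    moreover have "C z s = (\<Inter>j. {x. x $ j \<in> {y. \<bar>exp (y / 2) - cmod (z $ j)\<bar> < s}})" by (auto simp: C_def)
    ultimately show ?thesis by (simp add: convex_connected)
  qed
  have "\<exists>s>0. \<Delta> z s \<subseteq> ?D" if z: "z \<in> ?D" for z
  proof -
    obtain r where r: "r > 0" "ball z r \<subseteq> ?D" using D z openE by blast
    define s where "s = r / (real CARD('m) + 1)"
    have s: "s > 0" using r by (simp add: s_def)
    have "w \<in> ?D" if w: "w \<in> \<Delta> z s" for w
    proof -
      \<comment> \<open>Rotating \<open>w\<close> onto the arguments of \<open>z\<close> turns the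
        distance to \<open>z\<close> into differences of moduli, so that \<open>w'\<close> lies in
        the ball.\<close>
      define w' where "w' = (\<chi> j. of_real (cmod (w $ j)) * (if z $ j = 0 then 1 else sgn (z $ j)))"
      have mod: "cmod (w' $ j) = cmod (w $ j)" for j by (simp add: w'_def norm_mult norm_sgn)
      have "cmod (w' $ j - z $ j) = \<bar>cmod (w $ j) - cmod (z $ j)\<bar>" for j
      proof (cases "z $ j = 0")
        case False
        have "w' $ j - z $ j = of_real (cmod (w $ j) - cmod (z $ j)) * sgn (z $ j)"
          using False by (simp add: w'_def algebra_simps) (simp add: sgn_eq)
        then show ?thesis using False by (simp add: norm_mult norm_sgn del: of_real_diff)
      qed (simp add: w'_def)
      then have "cmod ((w' - z) $ j) \<le> s" for j using w by (auto simp: \<Delta>_def less_imp_le)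
      then have "norm (w' - z) \<le> (\<Sum>j\<in>(UNIV::'m set). s)"
        unfolding norm_vec_def by (intro order_trans[OF L2_set_le_sum] sum_mono) auto
      also have "\<dots> < r" using r by (simp add: s_def field_simps)
      finally have "w' \<in> ball z r" by (simp add: dist_norm norm_minus_commute)
      then have "(t, w') \<in> \<Omega>" using r by (auto simp: fiber_def)
      then show ?thesis using cmod_cong[OF t, of w' w] mod by (simp add: fiber_def)
    qed
    then show ?thesis using s by blast
  qed
  then obtain s where s: "\<And>z. z \<in> ?D \<Longrightarrow> s z > 0 \<and> \<Delta> z (s z) \<subseteq> ?D" by metis
  have Csub: "C z (s z) \<subseteq> lfib t" if "z \<in> ?D" for z
    using s[OF that] by (force simp: C_def \<Delta>_def lfib_def fiber_def)
  have meet: "C z (s z) \<inter> C w (s w) \<noteq> {}" if "w \<in> ?D" "w \<in> \<Delta> z (s z)" for z w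
  proof -
    \<comment> \<open>Slightly enlarging all moduli of \<open>w\<close> gives a point with nonzero
      coordinates, hence with a logarithm, that still lies in both sets.\<close>
    define q where "q = (\<lambda>j. min (s w) (s z - \<bar>cmod (w $ j) - cmod (z $ j)\<bar>) / 2)"
    have q: "q j > 0" "q j < s w" "q j < s z - \<bar>cmod (w $ j) - cmod (z $ j)\<bar>" for j
      using that s[OF that(1)] by (auto simp: q_def \<Delta>_def min_def)
    define x :: "real ^ 'm" where "x = (\<chi> j. 2 * ln (cmod (w $ j) + q j))"
    have ex: "exp (x $ j / 2) = cmod (w $ j) + q j" for j
      using q(1)[of j] by (simp add: x_def add_nonneg_pos)
    have "x \<in> C w (s w)" using q(2) by (auto simp: C_def ex abs_of_pos[OF q(1)])
    moreover have "\<bar>cmod (w $ j) + q j - cmod (z $ j)\<bar> < s z" for j using q(1,3)[of j] by linarith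
    then have "x \<in> C z (s z)" by (auto simp: C_def ex)
    ultimately show ?thesis by blast
  qed
  have zin: "z \<in> \<Delta> z (s z)" if "z \<in> ?D" for z using s[OF that] by (auto simp: \<Delta>_def)
  have dich: "C z (s z) \<subseteq> A1 \<or> C z (s z) \<subseteq> A2" if "z \<in> ?D" for z
    using connectedD[OF Cconv[of z "s z"] A(1,2)] A Csub[OF that] by blast
  have grow: "C w (s w) \<subseteq> A" if "C z (s z) \<subseteq> A" "w \<in> \<Delta> z (s z)" "w \<in> ?D" "z \<in> ?D" "A = A1 \<or> A = A2" for z w A
    using dich[OF that(3)] meet[OF that(3,2)] that(1,5) A(5) Csub[OF that(3)] by blast
  \<comment> \<open>Every trace lies in one of the two pieces, and for \<open>w\<close> in
    \<open>\<Delta> z (s z)\<close> the traces of \<open>w\<close> and \<open>z\<close> lie in the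
    same one; so a separation of \<open>lfib t\<close> would separate the connected fibre.\<close>
  define O1 where "O1 = (\<Union>z\<in>{z \<in> ?D. C z (s z) \<subseteq> A1}. \<Delta> z (s z))"
  define O2 where "O2 = (\<Union>z\<in>{z \<in> ?D. C z (s z) \<subseteq> A2}. \<Delta> z (s z))"
  have "open O1" "open O2" unfolding O1_def O2_def using op\<Delta> by auto
  moreover have "?D \<subseteq> O1 \<union> O2" using dich zin unfolding O1_def O2_def by blast
  moreover have "O1 \<inter> O2 \<inter> ?D = {}"
  proof (rule ccontr)
    assume "O1 \<inter> O2 \<inter> ?D \<noteq> {}"
    then obtain w where w: "w \<in> ?D" "C w (s w) \<subseteq> A1" "C w (s w) \<subseteq> A2"
      using grow by (auto simp: O1_def O2_def) blast
    then show False using meet[OF w(1) zin[OF w(1)]] A(5) Csub[OF w(1)] by blast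
  qed
  moreover have "O1 \<inter> ?D \<noteq> {}" "O2 \<inter> ?D \<noteq> {}"
  proof -
    have *: "logz x \<in> ?D \<and> x \<in> C (logz x) (s (logz x))" if "x \<in> lfib t" for x
    proof -
      have "logz x \<in> ?D" using that by (simp add: lfib_def fiber_def)
      then show ?thesis using s by (simp add: C_def)
    qed
    obtain x1 x2 where x: "x1 \<in> A1" "x1 \<in> lfib t" "x2 \<in> A2" "x2 \<in> lfib t" using A by blast
    have "C (logz x1) (s (logz x1)) \<subseteq> A1" "C (logz x2) (s (logz x2)) \<subseteq> A2"
      using dich *[OF x(2)] *[OF x(4)] x A(5) by blast+
    then have "logz x1 \<in> O1" "logz x2 \<in> O2"
      unfolding O1_def O2_def using *[OF x(2)] *[OF x(4)] zin by blast+
    then show "O1 \<inter> ?D \<noteq> {}" "O2 \<inter> ?D \<noteq> {}"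
      using *[OF x(2)] *[OF x(4)] by blast+
  qed
  ultimately show False using connectedD[OF D(2), of O1 O2] by blast
qed

text \<open>A maximum of \<open>\<rho> + \<epsilon> \<lambda>\<^sup>2\<close> over the tori above a segment, at an interior parameter \<open>\<lambda>\<close>, would be a local
  maximum along the holomorphic curve \<open>\<zeta> \<mapsto> exp (x + \<zeta> (y - x))\<close>, on which this function is strictly
  subharmonic.\<close>
lemma segment_lfib:
  assumes t: "t \<in> B" and xy: "x \<in> lfib t" "y \<in> lfib t" and cl: "closed_segment x y \<subseteq> closure (lfib t)"
  shows "closed_segment x y \<subseteq> lfib t"
proof -
  define l where "l = (\<lambda>r::real. (1 - r) *\<^sub>R x + r *\<^sub>R y)"
  \<comment> \<open>The tori above the points of the segment, together with the parameter; compact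
    because they turn out to lie in \<open>N\<close>.\<close>
  define K where "K = {p :: real \<times> (complex ^ 'm). fst p \<in> {0..1} \<and> (\<forall>j. cmod (snd p $ j) = exp (l (fst p) $ j / 2))}"
  have lcont: "continuous_on UNIV l" unfolding l_def by (intro continuous_intros)
  have zN: "z \<in> N \<and> \<rho> (t, z) \<le> 0" if "(r, z) \<in> K" for r z
  proof -
    have "l r \<in> closure (lfib t)" using that cl by (auto simp: K_def l_def in_segment subset_iff)
    then obtain X where X: "\<And>n. X n \<in> lfib t" "X \<longlonglongrightarrow> l r" unfolding closure_sequential by blast
    \<comment> \<open>Rescaling the moduli of \<open>z\<close> to those of \<open>logz (X n)\<close>
      gives points of \<open>\<Omega>\<close> that converge to \<open>z\<close>.\<close>
    define w where "w = (\<lambda>n. \<chi> j. z $ j * of_real (exp (X n $ j / 2 - l r $ j / 2)))"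
    have "cmod (w n $ j) = cmod (logz (X n) $ j)" for n j
      using that by (simp add: w_def K_def norm_mult norm_divide exp_diff)
    then have wO: "(t, w n) \<in> \<Omega>" for n
      using cmod_cong[OF t, of "w n" "logz (X n)"] X(1)[of n] by (simp add: lfib_def)
    have "w \<longlonglongrightarrow> (\<chi> j. z $ j * of_real (exp (l r $ j / 2 - l r $ j / 2)))"
      unfolding w_def by (intro tendsto_intros X(2)) auto
    then have lim: "w \<longlonglongrightarrow> z" by simp
    have wN: "w n \<in> N" "\<rho> (t, w n) < 0" for n using wO Omega_rho[OF t] by auto
    have zN: "z \<in> N" using closed_sequentially[OF compact_imp_closed[OF compact_N] _ lim] wN by blast
    have "isCont \<rho> (t, z)"
      using Ck_on_imp_continuous_on[OF Ck_rho] open_W BN t zN by (auto simp: continuous_on_eq_continuous_at)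
    then have "(\<lambda>n. \<rho> (t, w n)) \<longlonglongrightarrow> \<rho> (t, z)"
      by (rule isCont_tendsto_compose) (intro tendsto_intros lim)
    then have "\<rho> (t, z) \<le> 0" by (rule LIMSEQ_le_const2) (use wN(2) less_imp_le in blast)
    with zN show ?thesis by blast
  qed
  have K: "compact K"
  proof -
    have "snd p \<in> N" if "p \<in> K" for p using zN[of "fst p" "snd p"] that by simp
    then have "p \<in> K \<longleftrightarrow> p \<in> ({0..1} \<times> N) \<inter> (\<Inter>j. {p. cmod (snd p $ j) = exp (l (fst p) $ j / 2)})" for p
      by (cases "p \<in> K") (auto simp: K_def mem_Times_iff)
    then have "K = ({0..1} \<times> N) \<inter> (\<Inter>j. {p. cmod (snd p $ j) = exp (l (fst p) $ j / 2)})" by blast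
    moreover have "closed {p :: real \<times> (complex ^ 'm). cmod (snd p $ j) = exp (l (fst p) $ j / 2)}" for j
      by (intro closed_Collect_eq continuous_intros continuous_on_compose2[OF lcont]) auto
    ultimately show ?thesis using compact_N by (auto intro!: compact_Int_closed compact_Times closed_INT)
  qed
  have contr: "continuous_on K (\<lambda>p. \<rho> (t, snd p))"
    by (rule continuous_on_compose2[OF Ck_on_imp_continuous_on[OF Ck_rho]])
      (use zN BN t in \<open>force intro!: continuous_intros\<close>)+
  have ends: "\<rho> (t, snd p) < 0" if "p \<in> K" "fst p = 0 \<or> fst p = 1" for p
  proof -
    have "l (fst p) \<in> lfib t" using that xy by (auto simp: l_def)
    then have "(t, snd p) \<in> \<Omega>"
      using cmod_cong[OF t, of "logz (l (fst p))" "snd p"] that by (simp add: lfib_def K_def)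
    then show ?thesis using Omega_rho[OF t] by blast
  qed
  have neg: "\<rho> (t, snd p) < 0" if p: "p \<in> K" for p
  proof (rule ccontr)
    assume "\<not> \<rho> (t, snd p) < 0"
    then have p0: "\<rho> (t, snd p) \<ge> 0" by simp
    define K0 where "K0 = K \<inter> {p. fst p \<in> {0, 1}}"
    have cK0: "compact K0" unfolding K0_def
      by (intro compact_Int_closed K) (auto intro!: closed_Collect_disj closed_Collect_eq continuous_intros)
    have "(0, logz x) \<in> K0" by (simp add: K0_def K_def l_def)
    then have "K0 \<noteq> {}" by blast
    moreover have "continuous_on K0 (\<lambda>p. \<rho> (t, snd p))"
      using contr by (rule continuous_on_subset) (simp add: K0_def)
    ultimately obtain q where q: "q \<in> K0" "\<And>p. p \<in> K0 \<Longrightarrow> \<rho> (t, snd p) \<le> \<rho> (t, snd q)"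
      using continuous_attains_sup[OF cK0, of "\<lambda>p. \<rho> (t, snd p)"] by blast
    \<comment> \<open>As \<open>fst p\<close> is at most 1, the perturbed values over both endpoints
      remain negative, so the maximum is attained at an interior parameter.\<close>
    define e where "e = - \<rho> (t, snd q) / 2"
    have e: "e > 0" using ends[of q] q(1) by (auto simp: e_def K0_def)
    have "continuous_on K (\<lambda>p. \<rho> (t, snd p) + e * (fst p)\<^sup>2)" by (intro continuous_intros contr)
    then obtain m where m: "m \<in> K" "\<And>p. p \<in> K \<Longrightarrow> \<rho> (t, snd p) + e * (fst p)\<^sup>2 \<le> \<rho> (t, snd m) + e * (fst m)\<^sup>2"
      using continuous_attains_sup[OF K, of "\<lambda>p. \<rho> (t, snd p) + e * (fst p)\<^sup>2"] p by blast
    have "m \<notin> K0"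
    proof
      assume "m \<in> K0"
      then have "\<rho> (t, snd m) + e * (fst m)\<^sup>2 \<le> \<rho> (t, snd q) + e * 1"
        using q(2) e by (intro add_mono mult_left_mono) (auto simp: K0_def)
      also have "\<dots> < 0" using e by (simp add: e_def)
      finally show False using m(2)[OF p] p0 e by (smt (verit) mult_nonneg_nonneg zero_le_power2)
    qed
    then have m01: "0 < fst m" "fst m < 1" using m(1) by (auto simp: K0_def K_def less_le)
    \<comment> \<open>The imaginary parts carry the arguments of the maximum point \<open>m\<close>,
      so that the curve passes through it at \<open>\<zeta> = fst m\<close>; the moduli depend on
      \<open>Re \<zeta>\<close> only, so the curve stays in \<open>K\<close> while
      \<open>Re \<zeta>\<close> is in \<open>{0..1}\<close>.\<close>
    define Q :: "'m \<Rightarrow> complex poly" where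
      "Q = (\<lambda>j. [: of_real (x $ j / 2) + \<i> * of_real (Arg (snd m $ j) - 0), of_real ((y $ j - x $ j) / 2) :])"
    have Qm: "exp (poly (Q j) (of_real (fst m))) = snd m $ j" for j
    proof -
      have "poly (Q j) (of_real (fst m)) = of_real (l (fst m) $ j / 2) + \<i> * of_real (Arg (snd m $ j))"
        by (simp add: Q_def l_def algebra_simps add_divide_distrib diff_divide_distrib)
      then have "exp (poly (Q j) (of_real (fst m))) = of_real (cmod (snd m $ j)) * exp (\<i> * of_real (Arg (snd m $ j)))"
        using m(1) by (simp add: exp_add K_def flip: exp_of_real)
      moreover have "snd m $ j \<noteq> 0" using m(1) by (auto simp: K_def) (metis exp_not_eq_zero norm_zero)
      ultimately show ?thesis using Arg_eq by simp
    qed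
    define h where "h = exp_disc t 0 Q"
    have ht: "h \<zeta> = (t, \<chi> j. exp (poly (Q j) \<zeta>))" for \<zeta>
      by (simp add: h_def exp_disc_def vector_scalar_mult_def flip: zero_vec_def)
    have hm: "h (of_real (fst m)) = (t, snd m)" using Qm by (simp add: ht vec_eq_iff)
    have hK: "(Re \<zeta>, snd (h \<zeta>)) \<in> K" if "Re \<zeta> \<in> {0..1}" for \<zeta>
      using that by (simp add: K_def ht Q_def l_def norm_exp_eq_Re algebra_simps add_divide_distrib diff_divide_distrib)
    obtain h1 h2 where hc: "holo_curve JP h h1 h2" using holo_curve_exp_disc unfolding h_def by blast
    have cont: "continuous_on UNIV h" unfolding h_def by (rule continuous_on_exp_disc)
    define Z where "Z = h -` W"
    have Z: "open Z" unfolding Z_def using open_vimage[OF open_W cont] .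
    let ?m = "complex_of_real (fst m)"
    have hmW: "h ?m \<in> W" using hm zN[of "fst m" "snd m"] m(1) BN t by auto
    then have mZ: "?m \<in> Z" by (simp add: Z_def)
    have rh: "Ck_on 2 Z (\<lambda>\<zeta>. \<rho> (h \<zeta>))"
      by (rule Ck_on_compose[OF Z Ck_rho Ck_map_subset[OF holo_curve_Ck_map[OF cplx_struct_JP hc]]]) (auto simp: Z_def)
    have sq: "Ck_on 2 Z (\<lambda>\<zeta>. (Re \<zeta>)\<^sup>2)" by (intro Ck_on_power Ck_on_linear Z bounded_linear_Re)
    note sq' = Ck_on_mult[OF Z Ck_on_const[OF Z] sq, of e]
    have "D2 (\<lambda>\<zeta>. (Re \<zeta>)\<^sup>2) \<zeta> v w = 2 * (Re v * Re w)" for v w \<zeta>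
      by (rule D2_eqI[OF open_UNIV UNIV_I, where D = "\<lambda>y v. 2 * (Re y * Re v)"])
        (auto intro!: derivative_eq_intros simp: algebra_simps)
    then have lsq: "levi ((*) \<i>) (\<lambda>\<zeta>. (Re \<zeta>)\<^sup>2) \<zeta> 1 = 2" for \<zeta> by (simp add: levi_def)
    have "levi ((*) \<i>) (\<lambda>\<zeta>. \<rho> (h \<zeta>) + e * (Re \<zeta>)\<^sup>2) ?m 1 \<le> 0"
    proof (rule levi_nonpos_of_local_max[OF Z Ck_on_add[OF Z rh sq'] mZ])
      show "min (fst m) (1 - fst m) > 0" using m01 by simp
      fix \<zeta> assume "\<zeta> \<in> ball ?m (min (fst m) (1 - fst m))"
      then have "cmod (\<zeta> - ?m) < min (fst m) (1 - fst m)" by (simp add: dist_norm norm_minus_commute)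
      then have "\<bar>Re \<zeta> - fst m\<bar> < min (fst m) (1 - fst m)" using abs_Re_le_cmod[of "\<zeta> - ?m"] by simp
      then have "Re \<zeta> \<in> {0..1}" by auto
      from m(2)[OF hK[OF this]] show "\<rho> (h \<zeta>) + e * (Re \<zeta>)\<^sup>2 \<le> \<rho> (h ?m) + e * (Re ?m)\<^sup>2"
        using hm by (simp add: ht)
    qed
    moreover have "levi ((*) \<i>) (\<lambda>\<zeta>. \<rho> (h \<zeta>) + e * (Re \<zeta>)\<^sup>2) ?m 1 = levi JP \<rho> (h ?m) (h1 ?m) + e * 2"
      using levi_add[OF Z rh sq' mZ] levi_cmult[OF Z sq mZ] lsq holo_curve_levi[OF cplx_struct_JP hc open_W Ck_rho hmW]
      by simp
    ultimately show False using levi_rho[OF hmW, of "h1 ?m"] e by simp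
  qed
  show ?thesis
  proof
    fix w assume "w \<in> closed_segment x y"
    then obtain r where la: "r \<in> {0..1}" "w = l r" by (auto simp: l_def in_segment)
    then have "(r, logz w) \<in> K" by (simp add: K_def)
    then have "logz w \<in> N" "\<rho> (t, logz w) < 0" using neg zN by force+
    then show "w \<in> lfib t" using Omega_rho[OF t] by (simp add: lfib_def)
  qed
qed

text \<open>The points visible from \<open>x\<close> inside the connected set \<open>lfib t\<close>
  form an open set, as segments are compact, and a relatively closed one: a limit of segments lies
  in the closure, where \<open>segment_lfib\<close> applies.\<close>

lemma convex_lfib:
  assumes t: "t \<in> B"
  shows "convex (lfib t)"
proof -
  let ?L = "lfib t"
  have "closed_segment x y \<subseteq> ?L" if x: "x \<in> ?L" and y: "y \<in> ?L" for x y
  proof -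
    define S where "S = {q \<in> ?L. closed_segment x q \<subseteq> ?L}"
    have "open S"
      unfolding open_contains_ball
    proof
      fix q assume q: "q \<in> S"
      then have "closed_segment x q \<subseteq> ?L" by (simp add: S_def)
      then obtain e where e: "e > 0" "(\<Union>z\<in>closed_segment x q. ball z e) \<subseteq> ?L"
        using compact_subset_open_imp_ball_epsilon_subset[OF compact_segment open_lfib] by metis
      have "ball q e \<subseteq> S"
      proof
        fix q' assume q': "q' \<in> ball q e"
        have "z \<in> ?L" if z: "z \<in> closed_segment x q'" for z
        proof -
          obtain p where p: "0 \<le> p" "p \<le> 1" "z = (1 - p) *\<^sub>R x + p *\<^sub>R q'" using z by (auto simp: in_segment)
          define z' where "z' = (1 - p) *\<^sub>R x + p *\<^sub>R q"
          have "z' - z = p *\<^sub>R (q - q')" unfolding z'_def p(3) by (simp add: scaleR_diff_right)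
          then have "dist z' z = norm (p *\<^sub>R (q - q'))" by (simp only: dist_norm)
          also have "\<dots> \<le> norm (q - q')" using p by (simp add: mult_left_le_one_le)
          also have "\<dots> < e" using q' by (simp add: dist_norm)
          finally have "z \<in> ball z' e" by simp
          moreover have "z' \<in> closed_segment x q" using p by (auto simp: in_segment z'_def)
          ultimately show ?thesis using e by blast
        qed
        moreover have "q' \<in> closed_segment x q'" by simp
        ultimately show "q' \<in> S" unfolding S_def by blast
      qed
      then show "\<exists>e>0. ball q e \<subseteq> S" using e by blast
    qed
    then have "openin (top_of_set ?L) S" by (auto simp: S_def openin_open_eq[OF open_lfib])
    moreover have "closedin (top_of_set ?L) S"
      unfolding closedin_limpt
    proof (intro conjI allI impI)
      show "S \<subseteq> ?L" by (auto simp: S_def)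
      fix q assume q: "q islimpt S \<and> q \<in> ?L"
      then obtain X where X: "\<And>n. X n \<in> S" "X \<longlonglongrightarrow> q" unfolding islimpt_sequential by blast
      have "closed_segment x q \<subseteq> closure ?L"
      proof
        fix z assume "z \<in> closed_segment x q"
        then obtain p where p: "0 \<le> p" "p \<le> 1" "z = (1 - p) *\<^sub>R x + p *\<^sub>R q" unfolding in_segment by blast
        have "(1 - p) *\<^sub>R x + p *\<^sub>R X n \<in> ?L" for n
        proof -
          have "(1 - p) *\<^sub>R x + p *\<^sub>R X n \<in> closed_segment x (X n)" unfolding in_segment using p by blast
          then show ?thesis using X(1)[of n] by (auto simp: S_def)
        qed
        moreover have "(\<lambda>n. (1 - p) *\<^sub>R x + p *\<^sub>R X n) \<longlonglongrightarrow> z"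
          unfolding p(3) by (intro tendsto_intros X(2))
        ultimately show "z \<in> closure ?L"
          unfolding closure_sequential by (intro exI[of _ "\<lambda>n. (1 - p) *\<^sub>R x + p *\<^sub>R X n"] conjI allI)
      qed
      from segment_lfib[OF t x _ this] show "q \<in> S" using q by (simp add: S_def)
    qed
    moreover have "x \<in> S" using x by (simp add: S_def)
    ultimately have "S = ?L" using connected_lfib[OF t] unfolding connected_clopen by blast
    then show ?thesis using y by (auto simp: S_def)
  qed
  then show ?thesis unfolding convex_contains_segment by blast
qed

text \<open>Continuity method: deform \<open>Q\<close> linearly to the constant curve through the base point; by logarithmic
  convexity the boundaries of the discs stay in \<open>\<Omega>\<close>.\<close>
lemma exp_disc_in_Omega:
  assumes ab: "\<And>\<zeta>. cmod \<zeta> \<le> 1 \<Longrightarrow> a + \<zeta> *s b \<in> B"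
    and bd: "\<And>\<zeta>. \<zeta> \<in> sphere 0 1 \<Longrightarrow> exp_disc a b Q \<zeta> \<in> \<Omega>"
    and z: "\<zeta> \<in> cball 0 1"
  shows "exp_disc a b Q \<zeta> \<in> \<Omega>"
proof -
  \<comment> \<open>At \<open>\<sigma> = 1\<close> this is \<open>Q\<close>; at
    \<open>\<sigma> = 0\<close> it is the constant \<open>c $ j / 2\<close>, whose disc sits at
    \<open>logz c\<close> over every parameter.\<close>
  define R where "R = (\<lambda>\<sigma> j. smult (of_real \<sigma>) (Q j) + [: of_real ((1 - \<sigma>) * c $ j / 2) :])"
  have pR: "poly (R \<sigma> j) \<zeta> = of_real \<sigma> * poly (Q j) \<zeta> + of_real ((1 - \<sigma>) * c $ j / 2)" for \<sigma> j \<zeta>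
    by (simp add: R_def)
  define f where "f = (\<lambda>\<sigma>. exp_disc a b (R \<sigma>))"
  have f: "f \<sigma> \<zeta> = (a + \<zeta> *s b, \<chi> j. exp (poly (R \<sigma> j) \<zeta>))" for \<sigma> \<zeta> by (simp add: f_def exp_disc_def)
  have contf: "continuous_on UNIV (\<lambda>p. f (fst p) (snd p))"
    unfolding f pR
    by (intro continuous_intros continuous_on_smult_vec) auto
  have bdf: "f \<sigma> \<zeta> \<in> \<Omega>" if "\<sigma> \<in> {0..1}" "\<zeta> \<in> sphere 0 1" for \<sigma> \<zeta>
  proof -
    have t: "a + \<zeta> *s b \<in> B" using ab that(2) by simp
    define x :: "real ^ 'm" where "x = (\<chi> j. 2 * Re (poly (Q j) \<zeta>))"
    have "(a + \<zeta> *s b, logz x) \<in> \<Omega>"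
      using bd[OF that(2)] cmod_cong[OF t, of "\<chi> j. exp (poly (Q j) \<zeta>)" "logz x"]
      by (simp add: exp_disc_def x_def norm_exp_eq_Re)
    then have "x \<in> lfib (a + \<zeta> *s b)" by (simp add: lfib_def)
    then have "\<sigma> *\<^sub>R x + (1 - \<sigma>) *\<^sub>R c \<in> lfib (a + \<zeta> *s b)"
      using convexD[OF convex_lfib[OF t] _ base_lfib[OF t]] that(1) by simp
    then show ?thesis
      using cmod_cong[OF t, of "logz (\<sigma> *\<^sub>R x + (1 - \<sigma>) *\<^sub>R c)" "\<chi> j. exp (poly (R \<sigma> j) \<zeta>)"]
      by (simp add: f lfib_def x_def pR norm_exp_eq_Re add_divide_distrib)
  qed
  define G where "G = {\<sigma> \<in> {0..1}. \<forall>\<zeta>\<in>cball 0 1. f \<sigma> \<zeta> \<in> \<Omega>}"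
  \<comment> \<open>Membership in \<open>G\<close> as a closed condition: if the disc lies in the
    closed region, its boundary values and the maximum principle make \<open>\<rho>\<close> strictly
    negative on it.\<close>
  have G_iff: "\<sigma> \<in> G \<longleftrightarrow> (\<forall>\<zeta>\<in>cball 0 1. snd (f \<sigma> \<zeta>) \<in> N \<and> \<rho> (f \<sigma> \<zeta>) \<le> 0)" if s: "\<sigma> \<in> {0..1}" for \<sigma>
  proof
    assume "\<sigma> \<in> G"
    then show "\<forall>\<zeta>\<in>cball 0 1. snd (f \<sigma> \<zeta>) \<in> N \<and> \<rho> (f \<sigma> \<zeta>) \<le> 0"
      using Omega_rho ab by (force simp: G_def f)
  next
    assume N: "\<forall>\<zeta>\<in>cball 0 1. snd (f \<sigma> \<zeta>) \<in> N \<and> \<rho> (f \<sigma> \<zeta>) \<le> 0"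
    obtain h1 h2 where hc: "holo_curve JP (f \<sigma>) h1 h2" using holo_curve_exp_disc unfolding f_def by blast
    have cont: "continuous_on UNIV (f \<sigma>)" unfolding f_def by (rule continuous_on_exp_disc)
    have inW: "f \<sigma> \<zeta> \<in> W" if "\<zeta> \<in> cball 0 1" for \<zeta>
      using N that BN ab[of \<zeta>] by (auto simp: f)
    have Z: "open (f \<sigma> -` W)" using open_vimage[OF open_W cont] .
    have rh: "Ck_on 2 (f \<sigma> -` W) (\<lambda>\<zeta>. \<rho> (f \<sigma> \<zeta>))"
      by (rule Ck_on_compose[OF Z Ck_rho Ck_map_subset[OF holo_curve_Ck_map[OF cplx_struct_JP hc]]]) auto
    have "\<rho> (f \<sigma> \<zeta>) < 0" if "\<zeta> \<in> cball 0 1" for \<zeta>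
    proof (rule max_principle_disc[OF Z rh _ _ _ that])
      show "levi ((*) \<i>) (\<lambda>\<zeta>. \<rho> (f \<sigma> \<zeta>)) \<zeta> 1 \<ge> 0" if "\<zeta> \<in> ball 0 1" for \<zeta>
        using holo_curve_levi[OF cplx_struct_JP hc open_W Ck_rho, of \<zeta>] inW[of \<zeta>] levi_rho that by simp
      show "\<rho> (f \<sigma> \<zeta>) < 0" if "\<zeta> \<in> sphere 0 1" for \<zeta>
        using bdf[OF s that] Omega_rho[OF ab[of \<zeta>]] that by (simp add: f)
    qed (use inW in auto)
    then show "\<sigma> \<in> G" using N s Omega_rho ab by (force simp: G_def f)
  qed
  \<comment> \<open>The complement of \<open>G\<close> is the projection of a compact set, so
    \<open>G\<close> is relatively open.\<close>
  have clG: "closed ({0..1} - G)"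
  proof -
    have eq: "{0..1} - G = fst ` (({0..1} \<times> cball 0 1) \<inter> (\<lambda>p. f (fst p) (snd p)) -` (- \<Omega>))"
      by (force simp: G_def image_iff)
    have "closed ((\<lambda>p. f (fst p) (snd p)) -` (- \<Omega>))"
      using open_Omega by (intro closed_vimage contf) (simp add: closed_Compl)
    then have cp: "compact (({0..1} \<times> cball 0 1) \<inter> (\<lambda>p. f (fst p) (snd p)) -` (- \<Omega>))"
      by (intro compact_Int_closed compact_Times) auto
    show ?thesis
      unfolding eq by (rule compact_imp_closed[OF compact_continuous_image[OF continuous_on_fst[OF continuous_on_id] cp]])
  qed
  have "G = {0..1} \<inter> - ({0..1} - G)" by (auto simp: G_def)
  then have "openin (top_of_set {0..1}) G"
    unfolding openin_open using open_Compl[OF clG] by blast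
  moreover have "closed G"
  proof -
    define H where "H = (\<lambda>\<zeta>. {\<sigma> \<in> {0..1}. snd (f \<sigma> \<zeta>) \<in> N \<and> \<rho> (f \<sigma> \<zeta>) \<le> 0})"
    have "closed (H \<zeta>)" if z: "\<zeta> \<in> cball 0 1" for \<zeta>
    proof -
      have c1: "continuous_on S (\<lambda>\<sigma>. f \<sigma> \<zeta>)" for S
        by (rule continuous_on_compose2[OF contf, of _ "\<lambda>\<sigma>. (\<sigma>, \<zeta>)", simplified]) (intro continuous_intros)
      have "closed ({0..1} \<inter> (\<lambda>\<sigma>. snd (f \<sigma> \<zeta>)) -` N)"
        by (intro closed_Int closed_vimage compact_imp_closed[OF compact_N] continuous_on_snd c1) simp
      moreover have "continuous_on ({0..1} \<inter> (\<lambda>\<sigma>. snd (f \<sigma> \<zeta>)) -` N) (\<lambda>\<sigma>. \<rho> (f \<sigma> \<zeta>))"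
        by (rule continuous_on_compose2[OF Ck_on_imp_continuous_on[OF Ck_rho] c1])
          (use BN ab[of \<zeta>] z in \<open>auto simp: f\<close>)
      ultimately have "closed {\<sigma> \<in> {0..1} \<inter> (\<lambda>\<sigma>. snd (f \<sigma> \<zeta>)) -` N. \<rho> (f \<sigma> \<zeta>) \<le> 0}"
        by (intro continuous_on_closed_Collect_le continuous_on_const)
      moreover have "H \<zeta> = {\<sigma> \<in> {0..1} \<inter> (\<lambda>\<sigma>. snd (f \<sigma> \<zeta>)) -` N. \<rho> (f \<sigma> \<zeta>) \<le> 0}" by (auto simp: H_def)
      ultimately show ?thesis by simp
    qed
    moreover have "G = (\<Inter>\<zeta>\<in>cball 0 1. H \<zeta>)"
    proof -
      have "\<sigma> \<in> {0..1}" if "\<sigma> \<in> (\<Inter>\<zeta>\<in>cball 0 1. H \<zeta>)" for \<sigma>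
      proof -
        have "\<sigma> \<in> H 0" using that by (rule INT_D) simp
        then show ?thesis by (simp add: H_def)
      qed
      moreover have "\<sigma> \<in> G \<longleftrightarrow> \<sigma> \<in> (\<Inter>\<zeta>\<in>cball 0 1. H \<zeta>)" if "\<sigma> \<in> {0..1}" for \<sigma>
        using G_iff[OF that] that by (auto simp: H_def)
      moreover have "\<sigma> \<in> {0..1}" if "\<sigma> \<in> G" for \<sigma> using that by (simp add: G_def)
      ultimately show ?thesis by blast
    qed
    ultimately show ?thesis by auto
  qed
  then have "closedin (top_of_set {0..1}) G" by (auto simp: closedin_closed_eq G_def)
  moreover have "0 \<in> G"
  proof -
    have "f 0 \<zeta> = (a + \<zeta> *s b, logz c)" for \<zeta> by (simp add: f pR vec_eq_iff flip: exp_of_real)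
    then show ?thesis using base ab by (simp add: G_def)
  qed
  ultimately have "G = {0..1}" using connected_Icc[of 0 "1::real"] unfolding connected_clopen by blast
  then have "1 \<in> G" by simp
  moreover have "f 1 = exp_disc a b Q" by (simp add: fun_eq_iff f pR exp_disc_def)
  ultimately show ?thesis using z by (simp add: G_def)
qed

end

section \<open>Cut-off weights on Reinhardt families\<close>

definition re_poly :: "(complex \<Rightarrow> real) \<Rightarrow> bool" where
  "re_poly g \<longleftrightarrow> (\<exists>Q. \<forall>\<zeta>\<in>sphere 0 1. g \<zeta> = Re (poly Q \<zeta>))"

lemma re_poly_add: "re_poly f \<Longrightarrow> re_poly g \<Longrightarrow> re_poly (\<lambda>\<zeta>. f \<zeta> + g \<zeta>)"
  unfolding re_poly_def
proof (elim exE)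
  fix P Q assume "\<forall>\<zeta>\<in>sphere 0 1. f \<zeta> = Re (poly P \<zeta>)" "\<forall>\<zeta>\<in>sphere 0 1. g \<zeta> = Re (poly Q \<zeta>)"
  then show "\<exists>R. \<forall>\<zeta>\<in>sphere 0 1. f \<zeta> + g \<zeta> = Re (poly R \<zeta>)" by (intro exI[of _ "P + Q"]) simp
qed

lemma re_poly_sum: "finite A \<Longrightarrow> (\<And>i. i \<in> A \<Longrightarrow> re_poly (f i)) \<Longrightarrow> re_poly (\<lambda>\<zeta>. \<Sum>i\<in>A. f i \<zeta>)"
proof (induction A rule: finite_induct)
  case empty
  show ?case unfolding re_poly_def by (intro exI[of _ 0]) simp
next
  case (insert x A)
  then show ?case by (simp add: re_poly_add)
qed

lemma re_poly_cong: "re_poly f \<Longrightarrow> (\<And>\<zeta>. \<zeta> \<in> sphere 0 1 \<Longrightarrow> f \<zeta> = g \<zeta>) \<Longrightarrow> re_poly g"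
  unfolding re_poly_def by metis

lemma re_poly_monom: "re_poly (\<lambda>\<zeta>. Re (c * \<zeta> ^ i))"
  unfolding re_poly_def by (intro exI[of _ "monom c i"]) (simp add: poly_monom)

text \<open>On the circle \<open>\<zeta> * cnj \<zeta> = 1\<close>, so the smaller exponent cancels;
  a remaining power of \<open>cnj \<zeta>\<close> is removed by conjugation, which leaves the real
  part unchanged.\<close>

lemma re_poly_mixed_monom: "re_poly (\<lambda>\<zeta>. Re (c * \<zeta> ^ i * cnj \<zeta> ^ j))"
proof -
  have one: "\<zeta> * cnj \<zeta> = 1" if "\<zeta> \<in> sphere 0 1" for \<zeta> :: complex
    using that by (simp add: complex_norm_square[symmetric])
  show ?thesis
  proof (cases "j \<le> i")
    case True
    show ?thesis
    proof (rule re_poly_cong[OF re_poly_monom[of c "i - j"]])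
      fix \<zeta> :: complex assume z: "\<zeta> \<in> sphere 0 1"
      have "\<zeta> ^ i = \<zeta> ^ j * \<zeta> ^ (i - j)" using True by (simp flip: power_add)
      then have "c * \<zeta> ^ i * cnj \<zeta> ^ j = c * (\<zeta> * cnj \<zeta>) ^ j * \<zeta> ^ (i - j)"
        by (simp add: power_mult_distrib mult_ac)
      then have "c * \<zeta> ^ i * cnj \<zeta> ^ j = c * \<zeta> ^ (i - j)" using one[OF z] by simp
      then show "Re (c * \<zeta> ^ (i - j)) = Re (c * \<zeta> ^ i * cnj \<zeta> ^ j)" by (simp only:)
    qed
  next
    case False
    show ?thesis
    proof (rule re_poly_cong[OF re_poly_monom[of "cnj c" "j - i"]])
      fix \<zeta> :: complex assume z: "\<zeta> \<in> sphere 0 1"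
      have "cnj \<zeta> ^ j = cnj \<zeta> ^ i * cnj \<zeta> ^ (j - i)" using False by (simp flip: power_add)
      then have "c * \<zeta> ^ i * cnj \<zeta> ^ j = c * (\<zeta> * cnj \<zeta>) ^ i * cnj \<zeta> ^ (j - i)"
        by (simp add: power_mult_distrib mult_ac)
      then have "c * \<zeta> ^ i * cnj \<zeta> ^ j = cnj (cnj c * \<zeta> ^ (j - i))" using one[OF z] by simp
      then show "Re (cnj c * \<zeta> ^ (j - i)) = Re (c * \<zeta> ^ i * cnj \<zeta> ^ j)" by (simp only: complex_cnj(1) cnj.simps)
    qed
  qed
qed

text \<open>\<open>Re P * Re Q = Re (P * Q + P * cnj Q) / 2\<close>, and the second product consists
  of mixed monomials.\<close>

lemma re_poly_mult:
  assumes "re_poly f" "re_poly g"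
  shows "re_poly (\<lambda>\<zeta>. f \<zeta> * g \<zeta>)"
proof -
  obtain P Q where P: "\<And>\<zeta>. \<zeta> \<in> sphere 0 1 \<Longrightarrow> f \<zeta> = Re (poly P \<zeta>)"
    and Q: "\<And>\<zeta>. \<zeta> \<in> sphere 0 1 \<Longrightarrow> g \<zeta> = Re (poly Q \<zeta>)"
    using assms unfolding re_poly_def by blast
  have "re_poly (\<lambda>\<zeta>. Re (poly (smult (1/2) (P * Q)) \<zeta>))" unfolding re_poly_def by blast
  moreover have "re_poly (\<lambda>\<zeta>. \<Sum>i\<le>degree P. \<Sum>j\<le>degree Q. Re ((coeff P i * cnj (coeff Q j) / 2) * \<zeta> ^ i * cnj \<zeta> ^ j))"
    by (intro re_poly_sum re_poly_mixed_monom finite_atMost)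
  ultimately have "re_poly (\<lambda>\<zeta>. Re (poly (smult (1/2) (P * Q)) \<zeta>) +
      (\<Sum>i\<le>degree P. \<Sum>j\<le>degree Q. Re ((coeff P i * cnj (coeff Q j) / 2) * \<zeta> ^ i * cnj \<zeta> ^ j)))"
    by (rule re_poly_add)
  then show ?thesis
  proof (rule re_poly_cong)
    fix \<zeta> :: complex assume z: "\<zeta> \<in> sphere 0 1"
    have "(\<Sum>i\<le>degree P. \<Sum>j\<le>degree Q. Re ((coeff P i * cnj (coeff Q j) / 2) * \<zeta> ^ i * cnj \<zeta> ^ j)) =
      Re (\<Sum>i\<le>degree P. \<Sum>j\<le>degree Q. (coeff P i * \<zeta> ^ i) * cnj (coeff Q j * \<zeta> ^ j)) / 2"
      unfolding Re_sum sum_divide_distrib by (intro sum.cong refl) (simp add: mult_ac)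
    also have "(\<Sum>i\<le>degree P. \<Sum>j\<le>degree Q. (coeff P i * \<zeta> ^ i) * cnj (coeff Q j * \<zeta> ^ j)) = poly P \<zeta> * cnj (poly Q \<zeta>)"
      unfolding poly_altdef[of P] poly_altdef[of Q] cnj_sum sum_product ..
    finally have e: "(\<Sum>i\<le>degree P. \<Sum>j\<le>degree Q. Re ((coeff P i * cnj (coeff Q j) / 2) * \<zeta> ^ i * cnj \<zeta> ^ j)) =
      Re (poly P \<zeta> * cnj (poly Q \<zeta>)) / 2" .
    show "Re (poly (smult (1/2) (P * Q)) \<zeta>) +
      (\<Sum>i\<le>degree P. \<Sum>j\<le>degree Q. Re ((coeff P i * cnj (coeff Q j) / 2) * \<zeta> ^ i * cnj \<zeta> ^ j)) = f \<zeta> * g \<zeta>"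
      unfolding e P[OF z] Q[OF z] by (simp add: field_simps)
  qed
qed

lemma re_poly_real_polynomial_function: "real_polynomial_function p \<Longrightarrow> re_poly p"
proof (induction rule: real_polynomial_function.induct)
  case (linear f)
  have "f \<zeta> = Re (poly [: 0, Complex (f 1) (- f \<i>) :] \<zeta>)" for \<zeta>
  proof -
    have "\<zeta> = Re \<zeta> *\<^sub>R 1 + Im \<zeta> *\<^sub>R \<i>" by (simp add: complex_eq_iff)
    then have "f \<zeta> = Re \<zeta> *\<^sub>R f 1 + Im \<zeta> *\<^sub>R f \<i>"
      using linear by (metis bounded_linear.linear linear_add linear_scale)
    then show ?thesis by simp
  qed
  then show ?case unfolding re_poly_def by blast
next
  case (const c)
  show ?case unfolding re_poly_def by (intro exI[of _ "[: of_real c :]"]) simp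
qed (auto intro: re_poly_add re_poly_mult)

text \<open>Stone-Weierstrass gives real polynomial functions of \<open>\<zeta>\<close>; on the
  circle these are real parts of holomorphic polynomials.\<close>

lemma circle_polynomial_approx:
  fixes x :: "complex \<Rightarrow> real ^ 'm"
  assumes "continuous_on (sphere 0 1) x" "e > 0"
  shows "\<exists>Q. \<forall>\<zeta>\<in>sphere 0 1. norm ((\<chi> j. Re (poly (Q j) \<zeta>)) - x \<zeta>) < e"
proof -
  obtain g where g: "polynomial_function g" "\<And>\<zeta>. \<zeta> \<in> sphere 0 1 \<Longrightarrow> norm (x \<zeta> - g \<zeta>) < e"
    using Stone_Weierstrass_polynomial_function[OF compact_sphere assms] by blast
  have "re_poly (\<lambda>\<zeta>. g \<zeta> $ j)" for j
    using g(1) bounded_linear_vec_nth[of j] unfolding polynomial_function_def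
    by (intro re_poly_real_polynomial_function) (auto simp: o_def)
  then have "\<forall>j. \<exists>Q. \<forall>\<zeta>\<in>sphere 0 1. g \<zeta> $ j = Re (poly Q \<zeta>)" unfolding re_poly_def by blast
  then obtain Q where Q: "\<And>j \<zeta>. \<zeta> \<in> sphere 0 1 \<Longrightarrow> g \<zeta> $ j = Re (poly (Q j) \<zeta>)" by metis
  have "norm ((\<chi> j. Re (poly (Q j) \<zeta>)) - x \<zeta>) < e" if "\<zeta> \<in> sphere 0 1" for \<zeta>
  proof -
    have "(\<chi> j. Re (poly (Q j) \<zeta>)) = g \<zeta>" using Q[OF that] by (simp add: vec_eq_iff)
    then show ?thesis using g(2)[OF that] by (simp add: norm_minus_commute)
  qed
  then show ?thesis by blast
qed

text \<open>The submean inequality for both \<open>Re\<close> and \<open>- Re\<close>, whose Levi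
  forms vanish, gives equality.\<close>

lemma cmean_Re_poly: "cmean (\<lambda>\<zeta>. Re (poly Q \<zeta>)) = Re (poly Q 0)"
proof -
  have h: "holo_curve ((*) \<i>) (poly Q) (poly (pderiv Q)) (poly (pderiv (pderiv Q)))"
  proof -
    have "cscale ((*) \<i>) \<eta> w = w * \<eta>" for \<eta> w by (simp add: cscale_def complex_eq_iff)
    then show ?thesis
      unfolding holo_curve_def using poly_DERIV by (auto simp: has_field_derivative_def intro: continuous_intros)
  qed
  have lin: "bounded_linear (\<lambda>z. c * Re z)" for c
    by (intro bounded_linear_mult_right[THEN bounded_linear_compose] bounded_linear_Re)
  have le: "c * Re (poly Q 0) \<le> cmean (\<lambda>\<zeta>. c * Re (poly Q \<zeta>))" for c
  proof (rule submean_holo_curve[OF cplx_struct_complex h open_UNIV])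
    show "Ck_on 2 UNIV (\<lambda>z. c * Re z)" using lin by (intro Ck_on_linear) auto
    have "D2 (\<lambda>z. c * Re z) x v w = 0" for x v w
      by (rule D2_eqI[OF open_UNIV UNIV_I, where D = "\<lambda>y v. c * Re v"])
        (auto intro!: bounded_linear_imp_has_derivative lin)
    then show "levi ((*) \<i>) (\<lambda>z. c * Re z) x b \<ge> 0" for x b by (simp add: levi_def)
  qed auto
  from le[of 1] le[of "-1"] show ?thesis by (simp add: cmean_uminus)
qed

section \<open>The torus-invariant cut-off weight\<close>

definition sqv :: "real ^ 'm \<Rightarrow> complex ^ 'm" where
  "sqv u = (\<chi> j. complex_of_real (sqrt (u $ j)))"

lemma sqv_expv: "sqv (expv x) = logz x"
  by (simp add: sqv_def vec_eq_iff powr_half_sqrt[symmetric] powr_def)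

lemma continuous_on_sqv: "continuous_on S f \<Longrightarrow> continuous_on S (\<lambda>x. sqv (f x))"
  unfolding sqv_def by (intro continuous_intros)

lemma continuous_on_torus_act:
  "continuous_on S f \<Longrightarrow> continuous_on S g \<Longrightarrow> continuous_on S (\<lambda>x. torus_act (f x) (g x))"
  unfolding torus_act_def by (intro continuous_intros)

text \<open>The angles are taken in a compact box, so that extrema over an orbit are
  attained.\<close>

lemma torus_orbit:
  fixes z w :: "complex ^ 'm"
  assumes "\<And>j. cmod (w $ j) = cmod (z $ j)"
  shows "\<exists>\<theta>\<in>cbox 0 (\<chi> j. 2 * pi). w = torus_act \<theta> z"
proof -
  define \<theta> :: "real ^ 'm" where "\<theta> = (\<chi> j. Arg2pi (w $ j / z $ j))"
  have "\<theta> \<in> cbox 0 (\<chi> j. 2 * pi)"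
    using Arg2pi_ge_0 Arg2pi_lt_2pi by (simp add: mem_box_cart \<theta>_def less_imp_le)
  moreover have "w $ j = torus_act \<theta> z $ j" for j
  proof (cases "z $ j = 0")
    case True then show ?thesis using assms[of j] by (simp add: torus_act_def)
  next
    case False
    have "w $ j / z $ j = of_real (cmod (w $ j / z $ j)) * exp (\<i> * of_real (Arg2pi (w $ j / z $ j)))"
      by (rule Arg2pi_eq)
    then have "w $ j / z $ j = cis (\<theta> $ j)" using False assms[of j] by (simp add: norm_divide \<theta>_def cis_conv_exp)
    then show ?thesis using False by (simp add: torus_act_def field_simps)
  qed
  ultimately show ?thesis by (intro bexI[of _ \<theta>]) (simp_all add: vec_eq_iff)
qed

text \<open>Positivity of the Levi form and invariance of \<open>\<phi>\<close> are asked for on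
  \<open>\<Omega>\<close> over \<open>B\<close> only: this is what gets verified for the perturbed
  weight of the strictness argument.\<close>

locale reinhardt_weight = reinhardt_box \<Omega> W \<rho> B N c
  for \<Omega> W :: "((complex ^ 'n) \<times> (complex ^ 'm)) set" and \<rho> B N c +
  fixes V :: "((complex ^ 'n) \<times> (complex ^ 'm)) set" and \<phi> :: "(complex ^ 'n) \<times> (complex ^ 'm) \<Rightarrow> real"
    and k :: "'m \<Rightarrow> nat"
  assumes open_V: "open V" and BN_V: "B \<times> N \<subseteq> V" and Ck_phi: "Ck_on 2 V \<phi>"
    and levi_phi: "\<And>t z b. t \<in> B \<Longrightarrow> (t, z) \<in> \<Omega> \<Longrightarrow> levi JP \<phi> (t, z) b \<ge> 0"
    and phi_inv: "\<And>t z w. t \<in> B \<Longrightarrow> (t, z) \<in> \<Omega> \<Longrightarrow> (\<And>j. cmod (z $ j) = cmod (w $ j)) \<Longrightarrow> \<phi> (t, z) = \<phi> (t, w)"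
begin

definition h0 :: "(complex ^ 'n) \<times> (complex ^ 'm) \<Rightarrow> real" where
  "h0 p = (if snd p \<in> N then max 0 (- \<rho> p) else 0)"

text \<open>\<open>\<rho>\<close> is not assumed torus invariant. The minimum of
  \<open>- \<rho>\<close> over an orbit is, and its negative, a maximum of plurisubharmonic
  functions, still satisfies the submean inequality along discs in \<open>\<Omega>\<close>.\<close>

definition g :: "(complex ^ 'n) \<times> (complex ^ 'm) \<Rightarrow> real" where
  "g p = Inf ((\<lambda>\<theta>. h0 (fst p, torus_act \<theta> (snd p))) ` cbox 0 (\<chi> j. 2 * pi))"

text \<open>The cutoff factor \<open>min 1 (M g)\<close> makes the weight continuous across the boundary; \<open>- ln\<close> of it is
  plurisubharmonic, and it tends to the indicator function of \<open>\<Omega>\<close> as \<open>M \<rightarrow> \<infinity>\<close>.\<close>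
definition H :: "real \<Rightarrow> (complex ^ 'n) \<times> (complex ^ 'm) \<Rightarrow> real" where
  "H M p = (if snd p \<in> N then (\<Prod>j\<in>UNIV. cmod (snd p $ j) ^ k j)\<^sup>2 * exp (- \<phi> p) * min 1 (M * g p) else 0)"

lemma h0_pos_iff: "t \<in> B \<Longrightarrow> h0 (t, z) > 0 \<longleftrightarrow> (t, z) \<in> \<Omega>"
  using Omega_rho[of t z] by (auto simp: h0_def)

lemma h0_nonneg: "h0 p \<ge> 0" by (simp add: h0_def)

text \<open>\<open>B \<times> N\<close> and \<open>B \<times> - interior N\<close> are relatively
  closed and cover everything; they meet only over the frontier of \<open>N\<close>, which no fibre
  reaches.\<close>

lemma continuous_on_extend_zero:
  fixes f :: "(complex ^ 'n) \<times> (complex ^ 'm) \<Rightarrow> real"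
  assumes "continuous_on (B \<times> N) f" "\<And>t z. t \<in> B \<Longrightarrow> z \<in> N \<Longrightarrow> (t, z) \<notin> \<Omega> \<Longrightarrow> f (t, z) = 0"
  shows "continuous_on (B \<times> UNIV) (\<lambda>p. if snd p \<in> N then f p else 0)"
proof -
  have eq: "B \<times> UNIV = (B \<times> N) \<union> (B \<times> - interior N)" using interior_subset[of N] by auto
  have "continuous_on ((B \<times> N) \<union> (B \<times> - interior N)) (\<lambda>p. if snd p \<in> N then f p else 0)"
  proof (rule continuous_on_cases_local)
    have "B \<times> N = ((B \<times> N) \<union> (B \<times> - interior N)) \<inter> (UNIV \<times> N)" by auto
    then show "closedin (top_of_set (B \<times> N \<union> B \<times> - interior N)) (B \<times> N)"
      unfolding closedin_closed using compact_imp_closed[OF compact_N] by (metis closed_Times closed_UNIV)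
    have "B \<times> - interior N = ((B \<times> N) \<union> (B \<times> - interior N)) \<inter> (UNIV \<times> - interior N)" by auto
    then show "closedin (top_of_set (B \<times> N \<union> B \<times> - interior N)) (B \<times> - interior N)"
      unfolding closedin_closed by (metis closed_Times closed_UNIV closed_Compl open_interior)
    show "f p = 0" if "p \<in> B \<times> N \<and> \<not> snd p \<in> N \<or> p \<in> B \<times> - interior N \<and> snd p \<in> N" for p
    proof -
      have p: "fst p \<in> B" "snd p \<in> N" "snd p \<notin> interior N" using that by (auto simp: mem_Times_iff)
      then have "snd p \<notin> fiber \<Omega> (fst p)" using fiber_N[OF p(1)] by blast
      then have "(fst p, snd p) \<notin> \<Omega>" by (simp add: fiber_def)
      from assms(2)[OF p(1,2) this] show ?thesis by simp
    qed
  qed (auto intro: assms(1))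
  then show ?thesis using eq by simp
qed

lemma continuous_on_h0: "continuous_on (B \<times> UNIV) h0"
proof -
  have "continuous_on (B \<times> N) (\<lambda>p. max 0 (- \<rho> p))"
    using continuous_on_subset[OF Ck_on_imp_continuous_on[OF Ck_rho] BN] by (intro continuous_intros)
  then have "continuous_on (B \<times> UNIV) (\<lambda>p. if snd p \<in> N then max 0 (- \<rho> p) else 0)"
    by (rule continuous_on_extend_zero) (use Omega_rho in force)
  then show ?thesis by (simp add: h0_def[abs_def])
qed

lemma continuous_on_h0_torus:
  "continuous_on ((B \<times> UNIV) \<times> S) (\<lambda>x. h0 (fst (fst x), torus_act (snd x) (snd (fst x))))"
  by (rule continuous_on_compose2[OF continuous_on_h0])
    (auto intro!: continuous_on_Pair continuous_on_torus_act continuous_on_fst continuous_on_snd continuous_on_id)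

lemma g_attained:
  assumes "fst p \<in> B"
  shows "\<exists>\<theta>\<in>cbox 0 (\<chi> j. 2 * pi). g p = h0 (fst p, torus_act \<theta> (snd p))"
    "\<theta>' \<in> cbox 0 (\<chi> j. 2 * pi) \<Longrightarrow> g p \<le> h0 (fst p, torus_act \<theta>' (snd p))"
proof -
  let ?T = "cbox 0 (\<chi> j. 2 * pi) :: (real ^ 'm) set" and ?f = "\<lambda>\<theta>. h0 (fst p, torus_act \<theta> (snd p))"
  have c: "continuous_on ?T ?f"
    by (rule continuous_on_compose2[OF continuous_on_h0])
      (use assms in \<open>auto intro!: continuous_on_Pair continuous_on_torus_act continuous_on_const continuous_on_id\<close>)
  have "0 \<in> ?T" by (simp add: mem_box_cart)
  then have "?T \<noteq> {}" by blast
  from continuous_attains_inf[OF compact_cbox this c]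
  obtain \<theta> where t: "\<theta> \<in> ?T" "\<And>\<theta>'. \<theta>' \<in> ?T \<Longrightarrow> ?f \<theta> \<le> ?f \<theta>'" by blast
  have "g p = ?f \<theta>" unfolding g_def using t by (intro cInf_eq_minimum) auto
  with t show "\<exists>\<theta>\<in>?T. g p = ?f \<theta>" "\<theta>' \<in> ?T \<Longrightarrow> g p \<le> ?f \<theta>'" by auto
qed

text \<open>Near \<open>p\<close> the values of \<open>h0\<close> change little, uniformly in the
  angle of the compact box, so evaluating at each other's minimising angles compares the
  minima.\<close>

lemma continuous_on_g: "continuous_on (B \<times> UNIV) g"
  unfolding continuous_on_iff
proof (intro ballI allI impI)
  fix p :: "(complex ^ 'n) \<times> (complex ^ 'm)" and e :: real
  assume p: "p \<in> B \<times> UNIV" and e: "e > 0"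
  let ?T = "cbox 0 (\<chi> j. 2 * pi) :: (real ^ 'm) set"
  have e2: "e / 2 > 0" using e by simp
  obtain X where X: "p \<in> X" "open X" "\<And>q \<theta>. q \<in> X \<inter> (B \<times> UNIV) \<Longrightarrow> \<theta> \<in> ?T \<Longrightarrow>
      dist (h0 (fst q, torus_act \<theta> (snd q))) (h0 (fst p, torus_act \<theta> (snd p))) \<le> e / 2"
    by (rule continuous_on_prod_compactE[OF continuous_on_h0_torus[of ?T] compact_cbox p e2]) auto
  obtain d where d: "d > 0" "ball p d \<subseteq> X" using X openE by blast
  have "dist (g q) (g p) < e" if q: "q \<in> B \<times> UNIV" "dist q p < d" for q
  proof -
    have qX: "q \<in> X \<inter> (B \<times> UNIV)" using d q by (auto simp: dist_commute)
    have qB: "fst q \<in> B" "fst p \<in> B" using q p by auto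
    obtain \<theta> where t: "\<theta> \<in> ?T" "g q = h0 (fst q, torus_act \<theta> (snd q))" using g_attained(1)[OF qB(1)] by blast
    obtain \<theta>' where t': "\<theta>' \<in> ?T" "g p = h0 (fst p, torus_act \<theta>' (snd p))" using g_attained(1)[OF qB(2)] by blast
    show ?thesis
      using g_attained(2)[OF qB(2) t(1)] g_attained(2)[OF qB(1) t'(1)] X(3)[OF qX t(1)] X(3)[OF qX t'(1)] t t' e
      unfolding dist_real_def by linarith
  qed
  then show "\<exists>d>0. \<forall>q\<in>B \<times> UNIV. dist q p < d \<longrightarrow> dist (g q) (g p) < e" using d by blast
qed

lemma torus_Omega: "t \<in> B \<Longrightarrow> (t, torus_act \<theta> z) \<in> \<Omega> \<longleftrightarrow> (t, z) \<in> \<Omega>"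
  by (rule cmod_cong) (simp_all add: torus_act_def norm_mult)

lemma g_invariant:
  assumes "t \<in> B" "\<And>j. cmod (z $ j) = cmod (w $ j)"
  shows "g (t, z) = g (t, w)"
proof -
  have *: "g (t, z) \<le> g (t, w)" if "\<And>j. cmod (z $ j) = cmod (w $ j)" for z w
  proof -
    obtain \<theta> where t: "g (t, w) = h0 (t, torus_act \<theta> w)" using g_attained(1)[of "(t, w)"] assms(1) by auto
    have "cmod (torus_act \<theta> w $ j) = cmod (z $ j)" for j by (simp add: torus_act_def norm_mult that)
    then obtain \<theta>' where "\<theta>' \<in> cbox 0 (\<chi> j. 2 * pi)" "torus_act \<theta> w = torus_act \<theta>' z"
      using torus_orbit by blast
    then show ?thesis using g_attained(2)[of "(t, z)" \<theta>'] assms(1) t by simp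
  qed
  show ?thesis using *[of z w] *[of w z] assms(2) by simp
qed

lemma g_pos_iff:
  assumes t: "t \<in> B"
  shows "g (t, z) > 0 \<longleftrightarrow> (t, z) \<in> \<Omega>" "g (t, z) \<ge> 0"
proof -
  obtain \<theta> where g: "g (t, z) = h0 (t, torus_act \<theta> z)" using g_attained(1)[of "(t, z)"] t by auto
  show "g (t, z) > 0 \<longleftrightarrow> (t, z) \<in> \<Omega>" unfolding g h0_pos_iff[OF t] by (rule torus_Omega[OF t])
  show "g (t, z) \<ge> 0" unfolding g by (rule h0_nonneg)
qed

lemma g_zero: "t \<in> B \<Longrightarrow> (t, z) \<notin> \<Omega> \<Longrightarrow> g (t, z) = 0"
  using g_pos_iff[of t z] by simp

lemma g_pos: "t \<in> B \<Longrightarrow> (t, z) \<in> \<Omega> \<Longrightarrow> g (t, z) > 0"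
  using g_pos_iff[of t z] by simp

lemma g_nonneg: "t \<in> B \<Longrightarrow> g (t, z) \<ge> 0"
  using g_zero[of t z] g_pos[of t z] by (cases "(t, z) \<in> \<Omega>") auto

lemma Omega_N: "t \<in> B \<Longrightarrow> (t, z) \<in> \<Omega> \<Longrightarrow> z \<in> N"
  using Omega_rho by blast

lemma continuous_on_H: "continuous_on (B \<times> UNIV) (H M)"
proof -
  have "continuous_on (B \<times> N) (\<lambda>p. (\<Prod>j\<in>UNIV. cmod (snd p $ j) ^ k j)\<^sup>2 * exp (- \<phi> p) * min 1 (M * g p))"
    using continuous_on_subset[OF Ck_on_imp_continuous_on[OF Ck_phi] BN_V] continuous_on_subset[OF continuous_on_g, of "B \<times> N"]
    by (intro continuous_intros) auto
  then have "continuous_on (B \<times> UNIV) (\<lambda>p. if snd p \<in> N then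
      (\<Prod>j\<in>UNIV. cmod (snd p $ j) ^ k j)\<^sup>2 * exp (- \<phi> p) * min 1 (M * g p) else 0)"
    by (rule continuous_on_extend_zero) (simp add: g_zero)
  then show ?thesis by (simp add: H_def[abs_def])
qed

lemma H_nonneg: "M > 0 \<Longrightarrow> t \<in> B \<Longrightarrow> H M (t, z) \<ge> 0"
  using g_nonneg[of t z] by (simp add: H_def prod_nonneg)

lemma H_pos_iff:
  assumes "M > 0" "t \<in> B"
  shows "H M (t, logz x) > 0 \<longleftrightarrow> x \<in> lfib t"
proof (cases "(t, logz x) \<in> \<Omega>")
  case True
  then have "g (t, logz x) > 0" "logz x \<in> N" using g_pos Omega_N assms by auto
  then show ?thesis using True assms by (simp add: H_def lfib_def prod_pos)
next
  case False
  then show ?thesis using g_zero[OF assms(2) False] by (simp add: H_def lfib_def)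
qed

text \<open>Along the disc, \<open>ln H\<close> is the sum of a harmonic function from the monomial,
  of \<open>- \<phi>\<close>, and of the logarithm of the cut-off; the mean of each summand is at
  most its value at the centre.\<close>

lemma exp_disc_submean:
  assumes M: "M > 0" and ab: "\<And>\<zeta>. cmod \<zeta> \<le> 1 \<Longrightarrow> a + \<zeta> *s b \<in> B"
    and bd: "\<And>\<zeta>. \<zeta> \<in> sphere 0 1 \<Longrightarrow> exp_disc a b Q \<zeta> \<in> \<Omega>"
  shows "exp (cmean (\<lambda>\<zeta>. ln (H M (exp_disc a b Q \<zeta>)))) \<le> H M (exp_disc a b Q 0)"
proof -
  let ?h = "exp_disc a b Q"
  have inO: "?h \<zeta> \<in> \<Omega>" if "cmod \<zeta> \<le> 1" for \<zeta>
    using exp_disc_in_Omega[OF ab bd, of \<zeta>] that by simp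
  have h: "?h \<zeta> = (a + \<zeta> *s b, snd (?h \<zeta>))" for \<zeta> by (simp add: exp_disc_def)
  have inB: "fst (?h \<zeta>) \<in> B" if "cmod \<zeta> \<le> 1" for \<zeta> using ab[OF that] by (simp add: exp_disc_def)
  have inN: "snd (?h \<zeta>) \<in> N" if "cmod \<zeta> \<le> 1" for \<zeta>
    using Omega_N[OF ab[OF that]] inO[OF that] h[of \<zeta>] by metis
  have gp: "g (?h \<zeta>) > 0" if "cmod \<zeta> \<le> 1" for \<zeta>
    using g_pos[OF ab[OF that]] inO[OF that] h[of \<zeta>] by metis
  have ch: "continuous_on S ?h" for S using continuous_on_exp_disc by (rule continuous_on_subset) simp
  have im: "?h ` sphere 0 1 \<subseteq> B \<times> N"
    by (rule image_subsetI) (simp add: mem_Times_iff inB inN)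
  have cg: "continuous_on (sphere 0 1) (\<lambda>\<zeta>. g (?h \<zeta>))"
    by (rule continuous_on_compose2[OF continuous_on_g ch order_trans[OF im Sigma_mono]]) auto
  have cphi: "continuous_on (sphere 0 1) (\<lambda>\<zeta>. \<phi> (?h \<zeta>))"
    by (rule continuous_on_compose2[OF Ck_on_imp_continuous_on[OF Ck_phi] ch order_trans[OF im BN_V]])
  have phi: "\<phi> (?h 0) \<le> cmean (\<lambda>\<zeta>. \<phi> (?h \<zeta>))"
  proof -
    obtain h1 h2 where hc: "holo_curve JP ?h h1 h2" using holo_curve_exp_disc by blast
    have "open (V \<inter> \<Omega> \<inter> (B \<times> UNIV))" using open_V open_Omega open_B by (intro open_Int open_Times) auto
    then show ?thesis
    proof (rule submean_holo_curve[OF cplx_struct_JP hc])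
      show "Ck_on 2 (V \<inter> \<Omega> \<inter> (B \<times> UNIV)) \<phi>" using Ck_phi by (rule Ck_on_subset) auto
      show "?h ` cball 0 1 \<subseteq> V \<inter> \<Omega> \<inter> (B \<times> UNIV)"
        using inO inB inN BN_V by (force simp: mem_Times_iff)
      show "levi JP \<phi> x b \<ge> 0" if "x \<in> V \<inter> \<Omega> \<inter> (B \<times> UNIV)" for x b
        using levi_phi[of "fst x" "snd x" b] that by auto
    qed
  qed
  \<comment> \<open>Rotate the whole disc by the angle that is optimal at the centre: there
    \<open>- \<rho>\<close> equals \<open>g\<close>, and on the circle it is at least
    \<open>g\<close>.\<close>
  have gm: "cmean (\<lambda>\<zeta>. g (?h \<zeta>)) \<le> g (?h 0)"
  proof -
    obtain \<theta> where T: "\<theta> \<in> cbox 0 (\<chi> j. 2 * pi)" and \<theta>: "g (?h 0) = h0 (fst (?h 0), torus_act \<theta> (snd (?h 0)))"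
      using g_attained(1)[OF inB[of 0]] by auto
    let ?Q = "\<lambda>j. Q j + [: \<i> * of_real (\<theta> $ j) :]"
    have eq: "exp_disc a b ?Q \<zeta> = (fst (?h \<zeta>), torus_act \<theta> (snd (?h \<zeta>)))" for \<zeta>
      by (simp add: exp_disc_def torus_act_def vec_eq_iff exp_add cis_conv_exp mult.commute)
    have O: "exp_disc a b ?Q \<zeta> \<in> \<Omega>" if "cmod \<zeta> \<le> 1" for \<zeta>
      unfolding eq using torus_Omega[OF inB[OF that]] inO[OF that] by simp
    have inN': "snd (exp_disc a b ?Q \<zeta>) \<in> N" if "cmod \<zeta> \<le> 1" for \<zeta>
      using O[OF that] Omega_N[OF inB[OF that]] unfolding eq by simp
    have f: "h0 (exp_disc a b ?Q \<zeta>) = - \<rho> (exp_disc a b ?Q \<zeta>)" if "cmod \<zeta> \<le> 1" for \<zeta>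
      using O[OF that] Omega_rho[OF inB[OF that]] unfolding eq h0_def by auto
    have inW: "exp_disc a b ?Q ` cball 0 1 \<subseteq> W"
      by (rule image_subsetI, rule subsetD[OF BN]) (use inN' inB in \<open>simp add: mem_Times_iff eq\<close>)
    obtain h1 h2 where hc: "holo_curve JP (exp_disc a b ?Q) h1 h2" using holo_curve_exp_disc by blast
    have "\<rho> (exp_disc a b ?Q 0) \<le> cmean (\<lambda>\<zeta>. \<rho> (exp_disc a b ?Q \<zeta>))"
      by (rule submean_holo_curve[OF cplx_struct_JP hc open_W Ck_rho levi_rho inW])
    also have "\<dots> \<le> cmean (\<lambda>\<zeta>. - g (?h \<zeta>))"
    proof (rule cmean_mono)
      show "continuous_on (sphere 0 1) (\<lambda>\<zeta>. \<rho> (exp_disc a b ?Q \<zeta>))"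
        by (rule continuous_on_compose2[OF Ck_on_imp_continuous_on[OF Ck_rho]
              continuous_on_subset[OF continuous_on_exp_disc subset_UNIV] order_trans[OF image_mono[OF sphere_cball] inW]])
      show "continuous_on (sphere 0 1) (\<lambda>\<zeta>. - g (?h \<zeta>))" by (intro continuous_intros cg)
      show "\<rho> (exp_disc a b ?Q \<zeta>) \<le> - g (?h \<zeta>)" if "\<zeta> \<in> sphere 0 1" for \<zeta>
        using f[of \<zeta>] g_attained(2)[OF inB T, of \<zeta>] that unfolding eq by simp
    qed
    finally show ?thesis using f[of 0] \<theta> unfolding eq by (simp add: cmean_uminus)
  qed
  let ?m = "\<lambda>\<zeta>. min 1 (M * g (?h \<zeta>))"
  have mp: "?m \<zeta> > 0" if "cmod \<zeta> \<le> 1" for \<zeta> using gp[OF that] M by simp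
  have cm: "continuous_on (sphere 0 1) (\<lambda>\<zeta>. ln (?m \<zeta>))"
  proof (rule continuous_on_ln)
    show "continuous_on (sphere 0 1) ?m" by (intro continuous_intros cg)
    show "\<forall>\<zeta>\<in>sphere 0 1. ?m \<zeta> \<noteq> 0" using mp by (auto simp: less_le)
  qed
  have cMg: "continuous_on (sphere 0 1) (\<lambda>\<zeta>. ln (M * g (?h \<zeta>)))"
  proof (rule continuous_on_ln)
    show "continuous_on (sphere 0 1) (\<lambda>\<zeta>. M * g (?h \<zeta>))" by (intro continuous_intros cg)
    show "\<forall>\<zeta>\<in>sphere 0 1. M * g (?h \<zeta>) \<noteq> 0" using gp M by (auto simp: less_le)
  qed
  \<comment> \<open>The mean of the logarithm is at most 0 and, by Jensen, at most the logarithm of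
    the mean of \<open>M * g\<close>; together these bound it by the logarithm of the minimum at the
    centre.\<close>
  have m: "exp (cmean (\<lambda>\<zeta>. ln (?m \<zeta>))) \<le> ?m 0"
  proof -
    have "cmean (\<lambda>\<zeta>. ln (?m \<zeta>)) \<le> cmean (\<lambda>\<zeta>. 0)"
      using mp by (intro cmean_mono cm continuous_on_const) (simp add: ln_le_zero_iff)
    then have 1: "exp (cmean (\<lambda>\<zeta>. ln (?m \<zeta>))) \<le> 1" by simp
    have "cmean (\<lambda>\<zeta>. ln (?m \<zeta>)) \<le> cmean (\<lambda>\<zeta>. ln (M * g (?h \<zeta>)))"
      using mp gp M by (intro cmean_mono cm cMg) (simp add: ln_le_cancel_iff)
    then have "exp (cmean (\<lambda>\<zeta>. ln (?m \<zeta>))) \<le> exp (cmean (\<lambda>\<zeta>. ln (M * g (?h \<zeta>))))" by simp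
    also have "\<dots> \<le> cmean (\<lambda>\<zeta>. M * g (?h \<zeta>))"
      using gp M by (intro exp_cmean_ln_le continuous_on_mult continuous_on_const cg) simp
    also have "\<dots> \<le> M * g (?h 0)" using gm M by (simp add: cmean_cmult)
    finally show ?thesis using 1 by simp
  qed
  let ?r = "\<lambda>\<zeta>. \<Sum>j\<in>UNIV. (2 * real (k j)) * Re (poly (Q j) \<zeta>)"
  have HH: "H M (?h \<zeta>) = exp (?r \<zeta> - \<phi> (?h \<zeta>)) * ?m \<zeta>" if "cmod \<zeta> \<le> 1" for \<zeta>
  proof -
    have "(\<Prod>j\<in>UNIV. cmod (snd (?h \<zeta>) $ j) ^ k j)\<^sup>2 = exp (?r \<zeta>)"
      unfolding exp_sum[OF finite] power2_eq_square prod.distrib[symmetric]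
      by (intro prod.cong refl)
        (simp add: exp_disc_def norm_exp_eq_Re mult.assoc mult.commute[of "Re _"] flip: exp_of_nat_mult exp_add)
    then show ?thesis using inN[OF that] by (simp add: H_def exp_diff exp_minus divide_inverse)
  qed
  have cr: "continuous_on (sphere 0 1) ?r" by (intro continuous_intros)
  have "cmean (\<lambda>\<zeta>. ln (H M (?h \<zeta>))) = cmean (\<lambda>\<zeta>. ?r \<zeta> - \<phi> (?h \<zeta>) + ln (?m \<zeta>))"
  proof (rule cmean_cong)
    fix \<zeta> :: complex assume "\<zeta> \<in> sphere 0 1"
    then have z: "cmod \<zeta> \<le> 1" by simp
    show "ln (H M (?h \<zeta>)) = ?r \<zeta> - \<phi> (?h \<zeta>) + ln (?m \<zeta>)"
      unfolding HH[OF z] using mp[OF z] by (subst ln_mult_pos) auto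
  qed
  also have "\<dots> = cmean ?r - cmean (\<lambda>\<zeta>. \<phi> (?h \<zeta>)) + cmean (\<lambda>\<zeta>. ln (?m \<zeta>))"
    by (simp only: cmean_add[OF continuous_on_diff[OF cr cphi] cm] cmean_diff[OF cr cphi])
  also have "cmean ?r = ?r 0"
    by (subst cmean_sum) (auto intro!: continuous_intros simp: cmean_cmult cmean_Re_poly)
  finally have "exp (cmean (\<lambda>\<zeta>. ln (H M (?h \<zeta>)))) = exp (?r 0 - cmean (\<lambda>\<zeta>. \<phi> (?h \<zeta>))) * exp (cmean (\<lambda>\<zeta>. ln (?m \<zeta>)))"
    by (simp flip: exp_add)
  also have "\<dots> \<le> exp (?r 0 - \<phi> (?h 0)) * ?m 0"
    using phi m by (intro mult_mono) auto
  also have "\<dots> = H M (?h 0)" using HH[of 0] by simp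
  finally show ?thesis .
qed

definition F :: "real \<Rightarrow> (complex ^ 'n) \<times> (real ^ 'm) \<Rightarrow> real" where
  "F M p = H M (fst p, sqv (snd p))"

lemma F_expv: "F M (t, expv x) = H M (t, logz x)"
  by (simp add: F_def sqv_expv)

lemma H_invariant:
  assumes t: "t \<in> B" and mod: "\<And>j. cmod (z $ j) = cmod (w $ j)"
  shows "H M (t, z) = H M (t, w)"
proof (cases "(t, z) \<in> \<Omega>")
  case True
  then have O: "(t, z) \<in> \<Omega>" "(t, w) \<in> \<Omega>" using cmod_cong[OF t, of z w] mod by auto
  then show ?thesis
    using Omega_N[OF t O(1)] Omega_N[OF t O(2)] phi_inv[OF t O(1) mod] mod g_invariant[OF t mod] by (simp add: H_def)
next
  case False
  then have "(t, w) \<notin> \<Omega>" using cmod_cong[OF t, of z w] mod by auto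
  then show ?thesis using g_zero[OF t] False by (simp add: H_def)
qed

text \<open>Boundary data that are real parts of polynomials bound an exponential disc, to which
  \<open>exp_disc_submean\<close> applies. A continuous \<open>x\<close> is approximated uniformly
  by such data, and the centres converge because the mean of \<open>Re (poly Q \<zeta>)\<close> is
  \<open>Re (poly Q 0)\<close>.\<close>

lemma F_prekopa_class:
  assumes M: "M > 0"
  shows "prekopa_class B (F M)"
  unfolding prekopa_class_def
proof (intro conjI ballI allI impI)
  show cF: "continuous_on (B \<times> UNIV) (F M)"
    unfolding F_def by (rule continuous_on_compose2[OF continuous_on_H])
      (auto intro!: continuous_on_Pair continuous_on_sqv continuous_on_fst continuous_on_snd continuous_on_id)
  show "F M (t, u) \<ge> 0" if "t \<in> B" for t u using H_nonneg[OF M that] by (simp add: F_def)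
  show "convex {x. 0 < F M (t, expv x)}" if "t \<in> B" for t
    unfolding F_expv H_pos_iff[OF M that] using convex_lfib[OF that] by simp
  fix a b :: "complex ^ 'n" and x :: "complex \<Rightarrow> real ^ 'm"
  assume ab': "\<forall>\<zeta>. cmod \<zeta> \<le> 1 \<longrightarrow> a + \<zeta> *s b \<in> B" and x: "continuous_on (sphere 0 1) x"
    and pos: "\<forall>\<zeta>\<in>sphere 0 1. F M (a + \<zeta> *s b, expv (x \<zeta>)) > 0"
  have ab: "a + \<zeta> *s b \<in> B" if "cmod \<zeta> \<le> 1" for \<zeta> using ab' that by blast
  let ?\<Psi> = "\<lambda>p. F M (a + fst p *s b, expv (snd p))"
  let ?X = "exp (cmean (\<lambda>\<zeta>. ln (F M (a + \<zeta> *s b, expv (x \<zeta>)))))"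
  have c\<Psi>: "continuous_on (sphere 0 1 \<times> UNIV) ?\<Psi>"
    by (rule continuous_on_compose2[OF cF])
      (use ab in \<open>auto intro!: continuous_on_Pair continuous_on_add continuous_on_const continuous_on_smult_vec
        continuous_on_expv continuous_on_fst continuous_on_snd continuous_on_id\<close>)
  have cx: "continuous_on (sphere 0 1) (\<lambda>\<zeta>. ?\<Psi> (\<zeta>, x \<zeta>))"
    by (rule continuous_on_compose2[OF c\<Psi>]) (auto intro!: continuous_on_Pair continuous_on_id x)
  have "1 \<in> sphere (0::complex) 1" by simp
  then have ne: "sphere (0::complex) 1 \<noteq> {}" by blast
  obtain \<zeta>0 where z0: "\<zeta>0 \<in> sphere 0 1" "\<And>\<zeta>. \<zeta> \<in> sphere 0 1 \<Longrightarrow> ?\<Psi> (\<zeta>0, x \<zeta>0) \<le> ?\<Psi> (\<zeta>, x \<zeta>)"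
    using continuous_attains_inf[OF compact_sphere ne cx] by blast
  define m where "m = ?\<Psi> (\<zeta>0, x \<zeta>0)"
  have m: "m > 0" using pos z0(1) by (simp add: m_def)
  obtain R where R: "\<And>\<zeta>. \<zeta> \<in> sphere 0 1 \<Longrightarrow> norm (x \<zeta>) \<le> R"
  proof -
    obtain R where "\<forall>y\<in>x ` sphere 0 1. norm y \<le> R"
      using compact_imp_bounded[OF compact_continuous_image[OF x compact_sphere]] unfolding bounded_iff by blast
    then show ?thesis using that by blast
  qed
  have step: "exp (- \<epsilon>) * ?X \<le> F M (a, expv (vmean x))" if e: "\<epsilon> > 0" for \<epsilon>
  proof -
    \<comment> \<open>\<open>m\<close> is the minimum of the weight along the circle, so an additive
      error below \<open>\<eta>\<close> costs at most the factor
      \<open>exp (- \<epsilon>)\<close>.\<close>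
    define \<eta> where "\<eta> = (1 - exp (- \<epsilon>)) * m"
    have eta: "\<eta> > 0" using e m by (simp add: \<eta>_def)
    have "compact (sphere (0::complex) 1 \<times> cball (0 :: real ^ 'm) (R + 1))" by (intro compact_Times compact_sphere compact_cball)
    then have "uniformly_continuous_on (sphere 0 1 \<times> cball 0 (R + 1)) ?\<Psi>"
      by (rule compact_uniformly_continuous[rotated]) (rule continuous_on_subset[OF c\<Psi>], auto)
    then have "\<exists>d>0. \<forall>p\<in>sphere 0 1 \<times> cball 0 (R + 1). \<forall>q\<in>sphere 0 1 \<times> cball 0 (R + 1). dist q p < d \<longrightarrow> dist (?\<Psi> q) (?\<Psi> p) < \<eta>"
      using eta unfolding uniformly_continuous_on_def by blast
    then obtain \<delta> where \<delta>: "\<delta> > 0" "\<And>p q. p \<in> sphere 0 1 \<times> cball 0 (R + 1) \<Longrightarrow> q \<in> sphere 0 1 \<times> cball 0 (R + 1) \<Longrightarrow>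
        dist q p < \<delta> \<Longrightarrow> dist (?\<Psi> q) (?\<Psi> p) < \<eta>"
      by blast
    have near: "?\<Psi> (\<zeta>, y) \<ge> exp (- \<epsilon>) * ?\<Psi> (\<zeta>, x \<zeta>)" if z: "\<zeta> \<in> sphere 0 1" and y: "norm (y - x \<zeta>) < min \<delta> 1" for \<zeta> y
    proof -
      have "norm y \<le> R + 1" using R[OF z] y norm_triangle_sub[of y "x \<zeta>"] by simp
      then have "dist (?\<Psi> (\<zeta>, y)) (?\<Psi> (\<zeta>, x \<zeta>)) < \<eta>"
        using z y R[OF z] by (intro \<delta>(2)) (auto simp: dist_Pair_Pair dist_norm)
      moreover have "\<eta> \<le> (1 - exp (- \<epsilon>)) * ?\<Psi> (\<zeta>, x \<zeta>)"
        unfolding \<eta>_def m_def using z0(2)[OF z] e by (intro mult_left_mono) auto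
      ultimately show ?thesis unfolding dist_real_def by (simp add: algebra_simps)
    qed
    have ineq: "exp (- \<epsilon>) * ?X \<le> F M (a, expv (\<chi> j. Re (poly (Q j) 0)))"
      if Q: "\<And>\<zeta>. \<zeta> \<in> sphere 0 1 \<Longrightarrow> norm ((\<chi> j. Re (poly (Q j) \<zeta>)) - x \<zeta>) < min \<delta> 1" for Q
    proof -
      let ?y = "\<lambda>\<zeta>. (\<chi> j. Re (poly (Q j) \<zeta>)) :: real ^ 'm"
      \<comment> \<open>Halved because the logarithmic coordinates are those of the squared
        moduli.\<close>
      let ?Q = "\<lambda>j. smult (1/2) (Q j)"
      have eq: "F M (a + \<zeta> *s b, expv (?y \<zeta>)) = H M (exp_disc a b ?Q \<zeta>)" if "cmod \<zeta> \<le> 1" for \<zeta>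
        unfolding F_expv exp_disc_def by (rule H_invariant[OF ab[OF that]]) (simp add: norm_exp_eq_Re)
      have pos': "?\<Psi> (\<zeta>, ?y \<zeta>) > 0" if "\<zeta> \<in> sphere 0 1" for \<zeta>
      proof -
        have "0 < exp (- \<epsilon>) * ?\<Psi> (\<zeta>, x \<zeta>)" using pos that by simp
        then show ?thesis using near[OF that Q[OF that]] by linarith
      qed
      have cy: "continuous_on (sphere 0 1) (\<lambda>\<zeta>. ?\<Psi> (\<zeta>, ?y \<zeta>))"
        by (rule continuous_on_compose2[OF c\<Psi>]) (auto intro!: continuous_intros)
      have cl: "continuous_on (sphere 0 1) (\<lambda>\<zeta>. ln (?\<Psi> (\<zeta>, ?y \<zeta>)))" "continuous_on (sphere 0 1) (\<lambda>\<zeta>. ln (?\<Psi> (\<zeta>, x \<zeta>)))"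
        by (rule continuous_on_ln[OF cy], use pos' in force) (rule continuous_on_ln[OF cx], use pos in force)
      have "cmean (\<lambda>\<zeta>. - \<epsilon> + ln (?\<Psi> (\<zeta>, x \<zeta>))) \<le> cmean (\<lambda>\<zeta>. ln (?\<Psi> (\<zeta>, ?y \<zeta>)))"
      proof (intro cmean_mono continuous_on_add continuous_on_const cl)
        fix \<zeta> :: complex assume z: "\<zeta> \<in> sphere 0 1"
        have "ln (exp (- \<epsilon>) * ?\<Psi> (\<zeta>, x \<zeta>)) \<le> ln (?\<Psi> (\<zeta>, ?y \<zeta>))"
          using near[OF z Q[OF z]] pos z by (intro ln_mono) auto
        then show "- \<epsilon> + ln (?\<Psi> (\<zeta>, x \<zeta>)) \<le> ln (?\<Psi> (\<zeta>, ?y \<zeta>))"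
          using pos z by (simp add: ln_mult_pos)
      qed
      then have "exp (- \<epsilon>) * ?X \<le> exp (cmean (\<lambda>\<zeta>. ln (?\<Psi> (\<zeta>, ?y \<zeta>))))"
        using cmean_add[OF continuous_on_const cl(2), of "- \<epsilon>"] by (simp flip: exp_add)
      also have "cmean (\<lambda>\<zeta>. ln (?\<Psi> (\<zeta>, ?y \<zeta>))) = cmean (\<lambda>\<zeta>. ln (H M (exp_disc a b ?Q \<zeta>)))"
        using eq by (intro cmean_cong) simp
      also have "exp \<dots> \<le> H M (exp_disc a b ?Q 0)"
      proof (rule exp_disc_submean[OF M ab])
        fix \<zeta> :: complex assume z: "\<zeta> \<in> sphere 0 1"
        then have t: "a + \<zeta> *s b \<in> B" using ab by simp
        have "?y \<zeta> \<in> lfib (a + \<zeta> *s b)" using pos'[OF z] H_pos_iff[OF M t] by (simp add: F_expv)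
        then show "exp_disc a b ?Q \<zeta> \<in> \<Omega>"
          using cmod_cong[OF t, of "logz (?y \<zeta>)" "\<chi> j. exp (poly (?Q j) \<zeta>)"]
          by (simp add: lfib_def exp_disc_def norm_exp_eq_Re)
      qed simp
      also have "\<dots> = F M (a, expv (?y 0))" using eq[of 0] by simp
      finally show ?thesis .
    qed
    \<comment> \<open>The bound \<open>min \<delta> 1\<close> makes every approximation admissible
      for \<open>ineq\<close>; the second bound makes the centres converge.\<close>
    have "\<forall>n::nat. \<exists>Q. \<forall>\<zeta>\<in>sphere 0 1. norm ((\<chi> j. Re (poly (Q j) \<zeta>)) - x \<zeta>) < min (min \<delta> 1) (inverse (real (Suc n)))"
      using \<delta>(1) by (intro allI circle_polynomial_approx[OF x]) auto
    from choice[OF this] obtain Q where Q: "\<And>n \<zeta>. \<zeta> \<in> sphere 0 1 \<Longrightarrow>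
        norm ((\<chi> j. Re (poly (Q n j) \<zeta>)) - x \<zeta>) < min (min \<delta> 1) (inverse (real (Suc n)))" by blast
    have conv: "(\<lambda>n. (\<chi> j. Re (poly (Q n j) 0)) :: real ^ 'm) \<longlonglongrightarrow> vmean x"
    proof (rule vec_tendstoI)
      fix j
      have cxj: "continuous_on (sphere 0 1) (\<lambda>\<zeta>. x \<zeta> $ j)" by (intro continuous_intros x)
      have "\<bar>Re (poly (Q n j) 0) - vmean x $ j\<bar> \<le> inverse (real (Suc n))" for n
      proof -
        have cq: "continuous_on (sphere 0 1) (\<lambda>\<zeta>. Re (poly (Q n j) \<zeta>))" by (intro continuous_intros)
        have b: "\<bar>Re (poly (Q n j) \<zeta>) - x \<zeta> $ j\<bar> \<le> inverse (real (Suc n))" if "\<zeta> \<in> sphere 0 1" for \<zeta>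
          using component_le_norm_cart[of "(\<chi> j. Re (poly (Q n j) \<zeta>)) - x \<zeta>" j] Q[OF that, of n] by simp
        have "cmean (\<lambda>\<zeta>. Re (poly (Q n j) \<zeta>)) \<le> cmean (\<lambda>\<zeta>. x \<zeta> $ j + inverse (real (Suc n)))"
          using b by (intro cmean_mono cq continuous_on_add cxj continuous_on_const) (smt (verit))
        moreover have "cmean (\<lambda>\<zeta>. x \<zeta> $ j) \<le> cmean (\<lambda>\<zeta>. Re (poly (Q n j) \<zeta>) + inverse (real (Suc n)))"
          using b by (intro cmean_mono cq continuous_on_add cxj continuous_on_const) (smt (verit))
        ultimately show ?thesis
          unfolding cmean_add[OF cxj continuous_on_const] cmean_add[OF cq continuous_on_const] cmean_Re_poly cmean_const
          by (simp add: vmean_def abs_le_iff)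
      qed
      then have "(\<lambda>n. Re (poly (Q n j) 0) - vmean x $ j) \<longlonglongrightarrow> 0"
        by (intro Lim_null_comparison[OF _ LIMSEQ_inverse_real_of_nat]) (auto intro: always_eventually)
      then show "(\<lambda>n. (\<chi> j. Re (poly (Q n j) 0)) $ j) \<longlonglongrightarrow> vmean x $ j"
        by (simp add: LIM_zero_iff)
    qed
    have "continuous_on UNIV (\<lambda>y. F M (a, expv y))"
      by (rule continuous_on_compose2[OF cF])
        (use ab[of 0] in \<open>auto intro!: continuous_on_Pair continuous_on_const continuous_on_expv continuous_on_id\<close>)
    then have "isCont (\<lambda>y. F M (a, expv y)) (vmean x)" by (simp add: continuous_on_eq_continuous_at)
    from isCont_tendsto_compose[OF this conv]
    have lim: "(\<lambda>n. F M (a, expv (\<chi> j. Re (poly (Q n j) 0)))) \<longlonglongrightarrow> F M (a, expv (vmean x))" .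
    have "exp (- \<epsilon>) * ?X \<le> F M (a, expv (\<chi> j. Re (poly (Q n j) 0)))" for n
      by (rule ineq) (use Q in force)
    then show ?thesis by (intro LIMSEQ_le_const[OF lim]) blast
  qed
  have "((\<lambda>\<epsilon>. exp (- \<epsilon>) * ?X) \<longlongrightarrow> exp (- 0) * ?X) (at_right 0)"
    by (intro tendsto_intros)
  then have "exp (- 0) * ?X \<le> F M (a, expv (vmean x))"
    by (rule tendsto_upperbound) (use step in \<open>auto simp: eventually_at_right_less eventually_at_filter\<close>)
  then show "?X \<le> F M (a, expv (vmean x))" by simp
qed

end

section \<open>Reduction to moduli\<close>

text \<open>Both measures are compared on half-lines: for \<open>a \<ge> 0\<close> the preimage of
  \<open>{..a}\<close> is the disc of radius \<open>sqrt a\<close>, of area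
  \<open>pi * a\<close>.\<close>

lemma distr_cmod_square:
  "distr lborel borel (\<lambda>w::complex. (cmod w)\<^sup>2) = density lborel (\<lambda>v. ennreal pi * indicator {0..} v)"
proof (rule measure_eqI_generator_eq[where E = "range (\<lambda>a::real. {..a})" and \<Omega> = UNIV and A = "\<lambda>i::nat. {..real i}"])
  have L: "emeasure (distr lborel borel (\<lambda>w::complex. (cmod w)\<^sup>2)) {..a} = ennreal pi * ennreal (max 0 a)" for a :: real
  proof -
    have "emeasure (distr lborel borel (\<lambda>w::complex. (cmod w)\<^sup>2)) {..a} = emeasure lborel {w::complex. (cmod w)\<^sup>2 \<le> a}"
      by (subst emeasure_distr) (auto simp: vimage_def)
    also have "\<dots> = ennreal pi * ennreal (max 0 a)"
    proof (cases "a \<ge> 0")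
      case True
      have "{w::complex. (cmod w)\<^sup>2 \<le> a} = cball 0 (sqrt a)"
        using True real_le_rsqrt real_sqrt_le_iff by (auto simp: real_le_rsqrt) (metis norm_ge_zero real_sqrt_le_iff real_sqrt_pow2 power_mono)
      then show ?thesis
        using True by (simp add: emeasure_cball unit_ball_vol_2 ennreal_mult)
    next
      case False
      then have "{w::complex. (cmod w)\<^sup>2 \<le> a} = {}" using zero_le_power2 by (auto simp: not_le intro: less_le_trans)
      then show ?thesis using False by (simp add: max_def)
    qed
    finally show ?thesis .
  qed
  have R: "emeasure (density lborel (\<lambda>v. ennreal pi * indicator {0..} v)) {..a} = ennreal pi * ennreal (max 0 a)" for a :: real
  proof -
    have "emeasure (density lborel (\<lambda>v. ennreal pi * indicator {0..} v)) {..a} =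
      (\<integral>\<^sup>+v. ennreal pi * indicator {0..a} v \<partial>lborel)"
      by (subst emeasure_density) (auto intro!: nn_integral_cong split: split_indicator)
    also have "\<dots> = ennreal pi * ennreal (max 0 a)"
      by (subst nn_integral_cmult_indicator) (auto simp: max_def)
    finally show ?thesis .
  qed
  show "emeasure (distr lborel borel (\<lambda>w::complex. (cmod w)\<^sup>2)) X =
      emeasure (density lborel (\<lambda>v. ennreal pi * indicator {0..} v)) X" if "X \<in> range (\<lambda>a::real. {..a})" for X
    using that L R by auto
  show "emeasure (distr lborel borel (\<lambda>w::complex. (cmod w)\<^sup>2)) {..real i} \<noteq> \<infinity>" for i
    unfolding L by (simp add: ennreal_mult_eq_top_iff)
  show "(\<Union>i. {..real i}) = UNIV" using real_arch_simple by auto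
  show "Int_stable (range (\<lambda>a::real. {..a}))"
    by (auto simp: Int_stable_def intro!: image_eqI[of _ _ "min _ _"])
qed (auto simp: borel_eq_atMost)

lemma nn_integral_radial:
  assumes "f \<in> borel_measurable borel"
  shows "(\<integral>\<^sup>+(w::complex). f ((cmod w)\<^sup>2) \<partial>lborel) = ennreal pi * (\<integral>\<^sup>+v. indicator {0..} v * f v \<partial>lborel)"
proof -
  have "(\<integral>\<^sup>+(w::complex). f ((cmod w)\<^sup>2) \<partial>lborel) = (\<integral>\<^sup>+v. f v \<partial>distr lborel borel (\<lambda>w::complex. (cmod w)\<^sup>2))"
    using assms by (subst nn_integral_distr) auto
  also have "\<dots> = (\<integral>\<^sup>+v. ennreal pi * (indicator {0..} v * f v) \<partial>lborel)"
    unfolding distr_cmod_square using assms by (subst nn_integral_density) (auto simp: mult.assoc)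
  also have "\<dots> = ennreal pi * (\<integral>\<^sup>+v. indicator {0..} v * f v \<partial>lborel)"
    using assms by (subst nn_integral_cmult) auto
  finally show ?thesis .
qed

lemma measurable_vec_lambda:
  fixes f :: "'a \<Rightarrow> 'm::finite \<Rightarrow> complex"
  assumes "\<And>j. (\<lambda>x. f x j) \<in> borel_measurable M"
  shows "(\<lambda>x. \<chi> j. f x j) \<in> borel_measurable M"
  unfolding borel_measurable_euclidean_space[of "\<lambda>x. \<chi> j. f x j"]
  using assms by (auto simp: Basis_vec_def inner_axis)

text \<open>Compared on boxes, where both sides are products of side lengths; this makes Fubini
  available one complex coordinate at a time.\<close>

lemma lborel_vec_eq_distr_PiM:
  "(lborel :: (complex ^ 'm) measure) = distr (\<Pi>\<^sub>M j\<in>(UNIV :: 'm set). lborel) borel (\<lambda>f. \<chi> j. f j)"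
proof (rule lborel_eqI)
  interpret product_sigma_finite "\<lambda>_::'m. lborel :: complex measure" by standard
  have meas: "(\<lambda>f. \<chi> j. f j) \<in> borel_measurable (\<Pi>\<^sub>M j\<in>(UNIV :: 'm set). lborel :: complex measure)"
    by (intro measurable_vec_lambda) simp
  fix l u :: "complex ^ 'm"
  assume lu: "\<And>b. b \<in> Basis \<Longrightarrow> l \<bullet> b \<le> u \<bullet> b"
  have lu': "l $ j \<bullet> b \<le> u $ j \<bullet> b" if "b \<in> Basis" for j b
    using lu[of "axis j b"] that by (simp add: inner_axis axis_in_Basis_iff)
  have "(\<lambda>f. \<chi> j. f j) -` box l u \<inter> space (\<Pi>\<^sub>M j\<in>(UNIV :: 'm set). lborel) = (\<Pi>\<^sub>E j\<in>UNIV. box (l $ j) (u $ j))"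
  proof -
    have "(\<chi> j. f j) \<in> box l u \<longleftrightarrow> (\<forall>j. f j \<in> box (l $ j) (u $ j))" for f :: "'m \<Rightarrow> complex"
      by (auto simp: mem_box Basis_vec_def inner_axis)
    then show ?thesis by (auto simp: PiE_def Pi_def extensional_def space_PiM)
  qed
  then have "emeasure (distr (\<Pi>\<^sub>M j\<in>(UNIV :: 'm set). lborel) borel (\<lambda>f. \<chi> j. f j)) (box l u) =
    (\<Prod>j\<in>UNIV. emeasure lborel (box (l $ j) (u $ j)))"
    using meas by (simp add: emeasure_distr emeasure_PiM)
  also have "\<dots> = (\<Prod>j\<in>UNIV. ennreal (\<Prod>b\<in>Basis. (u $ j - l $ j) \<bullet> b))"
    using lu' by (intro prod.cong refl) simp
  also have "\<dots> = ennreal (\<Prod>j\<in>UNIV. \<Prod>b\<in>Basis. (u $ j - l $ j) \<bullet> b)"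
    using lu' by (intro prod_ennreal prod_nonneg) (auto simp: inner_diff_left)
  also have "(\<Prod>j\<in>UNIV. \<Prod>b\<in>Basis. (u $ j - l $ j) \<bullet> b) = (\<Prod>b\<in>Basis. (u - l) \<bullet> b)"
  proof -
    have B: "(Basis :: (complex ^ 'm) set) = (\<lambda>(j, b). axis j b) ` (UNIV \<times> Basis)"
      by (auto simp: Basis_vec_def)
    have inj: "inj_on (\<lambda>(j, b). axis j b :: complex ^ 'm) (UNIV \<times> Basis)"
    proof (rule inj_onI, clarify)
      fix j j' :: 'm and b b' :: complex
      assume "b \<in> Basis" "b' \<in> Basis" "axis j b = (axis j' b' :: complex ^ 'm)"
      then show "j = j' \<and> b = b'" using nonzero_Basis by (auto simp: axis_eq_axis)
    qed
    show ?thesis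
      unfolding B prod.reindex[OF inj] prod.cartesian_product
      by (intro prod.cong refl) (auto simp: inner_axis)
  qed
  finally show "emeasure (distr (\<Pi>\<^sub>M j\<in>(UNIV :: 'm set). lborel) borel (\<lambda>f. \<chi> j. f j)) (box l u) =
    ennreal (\<Prod>b\<in>Basis. (u - l) \<bullet> b)" .
qed simp

section \<open>Iterated marginals and the integral over C^m\<close>

primrec marginals :: "real \<Rightarrow> 'm list \<Rightarrow> ('a \<times> (real ^ 'm) \<Rightarrow> real) \<Rightarrow> 'a \<times> (real ^ 'm) \<Rightarrow> real" where
  "marginals U [] F = F"
| "marginals U (i # xs) F = marginal U i (marginals U xs F)"

lemma marginals_vanish:
  assumes "\<And>u j. u $ j \<ge> U \<Longrightarrow> F (t, u) = 0"
  shows "u $ j \<ge> U \<Longrightarrow> j \<notin> set xs \<Longrightarrow> marginals U xs F (t, u) = 0"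
proof (induction xs arbitrary: u)
  case (Cons i xs)
  then have "marginals U xs F (t, vupd u i v) = 0" for v by (intro Cons.IH) auto
  then show ?case by (simp add: marginal_def)
qed (use assms in auto)

lemma marginals_prekopa_class:
  assumes "prekopa_class B F" "U > 0" "\<And>t u j. t \<in> B \<Longrightarrow> u $ j \<ge> U \<Longrightarrow> F (t, u) = 0" "distinct xs"
  shows "prekopa_class B (marginals U xs F)"
  using assms(4)
proof (induction xs)
  case (Cons i xs)
  then show ?case
    by (auto intro!: marginal_prekopa_class assms(2) marginals_vanish assms(3))
qed (use assms in auto)

definition sqn :: "complex ^ 'm \<Rightarrow> real ^ 'm" where
  "sqn z = (\<chi> j. (cmod (z $ j))\<^sup>2)"

text \<open>Integrating a rotation invariant function over \<open>\<complex>\<^sup>m\<close> amounts, one coordinate at a time, to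
  integrating in \<open>u\<^sub>j = |z\<^sub>j|\<^sup>2\<close> against \<open>\<pi> du\<^sub>j\<close>.\<close>
lemma nn_integral_PiM_marginals:
  fixes F :: "'a \<times> (real ^ 'm) \<Rightarrow> real"
  assumes cont: "\<And>xs. distinct xs \<Longrightarrow> continuous_on UNIV (\<lambda>u. marginals U xs F (t, u))"
    and nn: "\<And>xs u. distinct xs \<Longrightarrow> marginals U xs F (t, u) \<ge> 0"
    and van: "\<And>u j. u $ j \<ge> U \<Longrightarrow> F (t, u) = 0" and U: "U > 0"
    and G: "\<And>z. G z = F (t, sqn z)" "G \<in> borel_measurable borel" and xs: "distinct xs"
  shows "(\<integral>\<^sup>+f. ennreal (G (\<chi> j. if j \<in> set xs then f j else z $ j)) \<partial>(\<Pi>\<^sub>M j\<in>set xs. lborel)) =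
    ennreal (pi ^ length xs * marginals U xs F (t, sqn z))"
  using xs
proof (induction xs arbitrary: z)
  case Nil
  interpret product_sigma_finite "\<lambda>_::'m. lborel :: complex measure" by standard
  show ?case by (simp add: PiM_empty G(1) nn_integral_count_space_finite)
next
  case (Cons i xs)
  interpret product_sigma_finite "\<lambda>_::'m. lborel :: complex measure" by standard
  have ds: "distinct xs" and i: "i \<notin> set xs" using Cons.prems by auto
  let ?F = "marginals U xs F" and ?u = "sqn z"
  have meas: "(\<lambda>f. ennreal (G (\<chi> j. if j \<in> insert i (set xs) then f j else z $ j)))
      \<in> borel_measurable (\<Pi>\<^sub>M j\<in>insert i (set xs). lborel)"
  proof -
    have "(\<lambda>f. \<chi> j. if j \<in> insert i (set xs) then f j else z $ j) \<in> borel_measurable (\<Pi>\<^sub>M j\<in>insert i (set xs). lborel)"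
    proof (rule measurable_vec_lambda)
      fix j
      show "(\<lambda>f. if j \<in> insert i (set xs) then f j else z $ j) \<in> borel_measurable (\<Pi>\<^sub>M j\<in>insert i (set xs). lborel)"
        using measurable_component_singleton[of j "insert i (set xs)" "\<lambda>_. lborel :: complex measure"]
        by (cases "j \<in> insert i (set xs)") simp_all
    qed
    then have "(\<lambda>f. G (\<chi> j. if j \<in> insert i (set xs) then f j else z $ j)) \<in> borel_measurable (\<Pi>\<^sub>M j\<in>insert i (set xs). lborel)"
      using measurable_compose[OF _ G(2)] by blast
    then show ?thesis by simp
  qed
  have "(\<integral>\<^sup>+f. ennreal (G (\<chi> j. if j \<in> insert i (set xs) then f j else z $ j)) \<partial>(\<Pi>\<^sub>M j\<in>insert i (set xs). lborel)) =
    (\<integral>\<^sup>+y. (\<integral>\<^sup>+f. ennreal (G (\<chi> j. if j \<in> insert i (set xs) then (f(i := y)) j else z $ j)) \<partial>(\<Pi>\<^sub>M j\<in>set xs. lborel)) \<partial>lborel)"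
    by (rule product_nn_integral_insert_rev[OF _ i meas]) simp
  also have "\<dots> = (\<integral>\<^sup>+y. ennreal (pi ^ length xs * ?F (t, vupd ?u i ((cmod y)\<^sup>2))) \<partial>lborel)"
  proof (rule nn_integral_cong)
    fix y :: complex
    have e: "(\<chi> j. if j \<in> insert i (set xs) then (f(i := y)) j else z $ j) =
        (\<chi> j. if j \<in> set xs then f j else (\<chi> j. if j = i then y else z $ j) $ j)" for f
      using i by (auto simp: vec_eq_iff)
    have "sqn (\<chi> j. if j = i then y else z $ j) = vupd ?u i ((cmod y)\<^sup>2)"
      by (simp add: sqn_def vec_eq_iff)
    then show "(\<integral>\<^sup>+f. ennreal (G (\<chi> j. if j \<in> insert i (set xs) then (f(i := y)) j else z $ j)) \<partial>(\<Pi>\<^sub>M j\<in>set xs. lborel)) =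
        ennreal (pi ^ length xs * ?F (t, vupd ?u i ((cmod y)\<^sup>2)))"
      unfolding e Cons.IH[OF ds] by simp
  qed
  also have "\<dots> = ennreal pi * (\<integral>\<^sup>+v. indicator {0..} v * ennreal (pi ^ length xs * ?F (t, vupd ?u i v)) \<partial>lborel)"
  proof (rule nn_integral_radial)
    have "continuous_on UNIV (\<lambda>v. ?F (t, vupd ?u i v))"
      by (rule continuous_on_compose2[OF cont[OF ds]])
        (auto intro!: continuous_on_vupd continuous_on_const continuous_on_id)
    then show "(\<lambda>v. ennreal (pi ^ length xs * ?F (t, vupd ?u i v))) \<in> borel_measurable borel"
      by (intro measurable_compose[OF _ measurable_ennreal] borel_measurable_continuous_onI continuous_intros)
  qed
  \<comment> \<open>Coordinate \<open>i\<close> is not among \<open>xs\<close>, so the inner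
    marginal vanishes beyond \<open>U\<close> and the half-line may be cut there.\<close>
  also have "(\<integral>\<^sup>+v. indicator {0..} v * ennreal (pi ^ length xs * ?F (t, vupd ?u i v)) \<partial>lborel) =
    (\<integral>\<^sup>+v. ennreal (indicator {0..U} v *\<^sub>R (pi ^ length xs * ?F (t, vupd ?u i v))) \<partial>lborel)"
  proof (rule nn_integral_cong)
    fix v :: real
    have "?F (t, vupd ?u i v) = 0" if "v > U"
      by (rule marginals_vanish[where j = i]) (use that van i in auto)
    then show "indicator {0..} v * ennreal (pi ^ length xs * ?F (t, vupd ?u i v)) =
      ennreal (indicator {0..U} v *\<^sub>R (pi ^ length xs * ?F (t, vupd ?u i v)))"
      by (cases "v > U") (auto split: split_indicator)
  qed
  also have "\<dots> = ennreal (pi ^ length xs * marginal U i ?F (t, ?u))"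
  proof (rule nn_integral_has_integral_lborel)
    have c: "continuous_on {0..U} (\<lambda>v. pi ^ length xs * ?F (t, vupd ?u i v))"
      by (intro continuous_on_mult continuous_on_const continuous_on_compose2[OF cont[OF ds]])
        (auto intro!: continuous_on_vupd continuous_on_const continuous_on_id)
    then show "(\<lambda>v. indicator {0..U} v *\<^sub>R (pi ^ length xs * ?F (t, vupd ?u i v))) \<in> borel_measurable borel"
      by (intro borel_measurable_continuous_on_indicator) auto
    show "0 \<le> indicator {0..U} v *\<^sub>R (pi ^ length xs * ?F (t, vupd ?u i v))" for v
      using nn[OF ds] by simp
    have "((\<lambda>v. pi ^ length xs * ?F (t, vupd ?u i v)) has_integral
        integral {0..U} (\<lambda>v. pi ^ length xs * ?F (t, vupd ?u i v))) {0..U}"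
      using c by (intro integrable_integral integrable_continuous_real)
    from has_integral_restrict_UNIV[THEN iffD2, OF this]
    have "((\<lambda>v. if v \<in> {0..U} then pi ^ length xs * ?F (t, vupd ?u i v) else 0) has_integral
        pi ^ length xs * marginal U i ?F (t, ?u)) UNIV"
      by (simp add: marginal_def)
    then show "((\<lambda>v. indicator {0..U} v *\<^sub>R (pi ^ length xs * ?F (t, vupd ?u i v))) has_integral
        pi ^ length xs * marginal U i ?F (t, ?u)) UNIV"
      by (rule has_integral_eq[rotated]) (auto split: split_indicator)
  qed
  also have "ennreal pi * \<dots> = ennreal (pi ^ length (i # xs) * marginals U (i # xs) F (t, ?u))"
    using nn[OF Cons.prems] by (simp add: ennreal_mult[symmetric] mult.assoc)
  finally show ?case by simp
qed

section \<open>The fibre integral as a limit of continuous truncations\<close>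

context reinhardt_weight
begin

definition weight :: "(complex ^ 'n) \<times> (complex ^ 'm) \<Rightarrow> real" where
  "weight p = (\<Prod>j\<in>UNIV. cmod (snd p $ j) ^ k j)\<^sup>2 * exp (- \<phi> p)"

text \<open>The integral called \<open>exp (- \<psi>)\<close> in the theorem, here for the weight of
  the locale; \<open>J M\<close> is its truncation, whose integrand \<open>H M\<close> is continuous
  across the boundary.\<close>

definition Iw :: "complex ^ 'n \<Rightarrow> real" where
  "Iw t = (LINT z:fiber \<Omega> t|lborel. weight (t, z))"

definition J :: "real \<Rightarrow> complex ^ 'n \<Rightarrow> real" where
  "J M t = (LINT z|lborel. H M (t, z))"

lemma weight_nonneg: "weight p \<ge> 0" by (simp add: weight_def)

lemma open_fiber: "t \<in> B \<Longrightarrow> open (fiber \<Omega> t)"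
  using Reinhardt by (simp add: Reinhardt_domain_def is_domain_def)

lemma weight_continuous: "t \<in> B \<Longrightarrow> continuous_on N (\<lambda>z. weight (t, z))"
proof -
  assume t: "t \<in> B"
  have "continuous_on N (\<lambda>z. \<phi> (t, z))"
    by (rule continuous_on_compose2[OF Ck_on_imp_continuous_on[OF Ck_phi]])
      (use t BN_V in \<open>auto intro!: continuous_intros\<close>)
  then show ?thesis unfolding weight_def by (intro continuous_intros) auto
qed

lemma weight_integrable:
  assumes t: "t \<in> B"
  shows "integrable lborel (\<lambda>z. indicator (fiber \<Omega> t) z *\<^sub>R weight (t, z))"
proof -
  have "set_integrable lborel N (\<lambda>z. weight (t, z))"
    using borel_integrable_compact[OF compact_N weight_continuous[OF t]] by (simp add: set_integrable_def)
  then have "set_integrable lborel (fiber \<Omega> t) (\<lambda>z. weight (t, z))"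
    by (rule set_integrable_subset) (use open_fiber[OF t] fiber_N[OF t] interior_subset in auto)
  then show ?thesis by (simp add: set_integrable_def)
qed

lemma H_le: "t \<in> B \<Longrightarrow> H M (t, z) \<le> indicator (fiber \<Omega> t) z *\<^sub>R weight (t, z)"
proof (cases "(t, z) \<in> \<Omega>")
  case True
  then show ?thesis using weight_nonneg[of "(t, z)"]
    by (auto simp: H_def fiber_def weight_def mult_left_le)
next
  case False
  assume "t \<in> B"
  then show ?thesis using False g_zero[of t z] by (simp add: H_def fiber_def)
qed

lemma H_mono: "t \<in> B \<Longrightarrow> M \<le> M' \<Longrightarrow> H M (t, z) \<le> H M' (t, z)"
  using g_nonneg[of t z] unfolding H_def
  by (auto intro!: mult_left_mono min.mono mult_right_mono)

lemma H_measurable: "t \<in> B \<Longrightarrow> (\<lambda>z. H M (t, z)) \<in> borel_measurable borel"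
  by (intro borel_measurable_continuous_onI continuous_on_compose2[OF continuous_on_H])
    (auto intro!: continuous_intros)

lemma H_integrable:
  assumes "M > 0" "t \<in> B"
  shows "integrable lborel (\<lambda>z. H M (t, z))"
  by (rule Bochner_Integration.integrable_bound[OF weight_integrable[OF assms(2)]])
    (use H_measurable[OF assms(2)] H_le[OF assms(2)] H_nonneg[OF assms] in \<open>auto simp: abs_of_nonneg weight_nonneg\<close>)

lemma H_limit:
  assumes "t \<in> B"
  shows "(\<lambda>n. H (real (Suc n)) (t, z)) \<longlonglongrightarrow> indicator (fiber \<Omega> t) z *\<^sub>R weight (t, z)"
proof (cases "(t, z) \<in> \<Omega>")
  case True
  obtain n0 where n0: "1 / g (t, z) \<le> real n0" using real_arch_simple by blast
  have "H (real (Suc n)) (t, z) = weight (t, z)" if "n \<ge> n0" for n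
  proof -
    have "1 / g (t, z) \<le> real (Suc n)" using n0 that by simp
    then have "1 \<le> real (Suc n) * g (t, z)" using g_pos[OF assms True] by (simp add: field_simps)
    then show ?thesis using Omega_N[OF assms True] by (simp add: H_def weight_def)
  qed
  then have "(\<lambda>n. H (real (Suc n)) (t, z)) \<longlonglongrightarrow> weight (t, z)"
    by (intro tendsto_eventually) (auto simp: eventually_sequentially)
  then show ?thesis using True by (simp add: fiber_def)
next
  case False
  then have "H M (t, z) = 0" for M using g_zero[OF assms False] by (auto simp: H_def)
  then show ?thesis using False by (simp add: fiber_def)
qed

lemma J_limit: "t \<in> B \<Longrightarrow> (\<lambda>n. J (real (Suc n)) t) \<longlonglongrightarrow> Iw t"
  unfolding J_def Iw_def set_lebesgue_integral_def
  by (rule integral_dominated_convergence[where w = "\<lambda>z. indicator (fiber \<Omega> t) z *\<^sub>R weight (t, z)"])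
    (use weight_integrable H_limit H_measurable H_le H_nonneg in
      \<open>auto simp: borel_measurable_integrable abs_of_nonneg\<close>)

lemma J_mono: "t \<in> B \<Longrightarrow> 0 < M \<Longrightarrow> M \<le> M' \<Longrightarrow> J M t \<le> J M' t"
  unfolding J_def by (intro integral_mono H_integrable H_mono) auto

text \<open>Once all coordinates are integrated, the marginal no longer depends on \<open>u\<close>;
  \<open>expv 0\<close>, the all-ones vector, is a point in the range of \<open>expv\<close>, where
  the inequality of the class can be used. \<open>U\<close> and \<open>xs\<close> do not depend on
  \<open>M\<close>.\<close>

lemma J_eq_marginals:
  "\<exists>U xs. U > 0 \<and> distinct xs \<and> (\<forall>M>0. prekopa_class B (marginals U xs (F M)) \<and>
    (\<forall>t\<in>B. J M t = pi ^ CARD('m) * marginals U xs (F M) (t, expv 0)))"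
proof -
  obtain R where R: "\<And>z. z \<in> N \<Longrightarrow> norm z \<le> R" using compact_imp_bounded[OF compact_N] by (auto simp: bounded_iff)
  \<comment> \<open>Exceeds every \<open>|z\<^sub>j|\<^sup>2\<close> on \<open>N\<close>; the 1
    keeps it positive.\<close>
  define U where "U = (\<bar>R\<bar> + 1)\<^sup>2"
  have U: "U > 0" unfolding U_def by (intro zero_less_power) auto
  obtain xs where xs: "set xs = (UNIV :: 'm set)" "distinct xs" using finite_distinct_list[OF finite] by blast
  have "prekopa_class B (marginals U xs (F M)) \<and> (\<forall>t\<in>B. J M t = pi ^ CARD('m) * marginals U xs (F M) (t, expv 0))"
    if M: "M > 0" for M
  proof -
    have van: "F M (t, u) = 0" if t: "t \<in> B" and u: "u $ j \<ge> U" for t u j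
    proof -
      have "\<bar>R\<bar> + 1 \<le> sqrt (u $ j)" using u by (intro real_le_rsqrt) (simp add: U_def)
      also have "\<dots> \<le> cmod (sqv u $ j)" by (simp add: sqv_def)
      also have "\<dots> \<le> norm (sqv u)" by (rule Finite_Cartesian_Product.norm_nth_le)
      finally have "sqv u \<notin> N" using R[of "sqv u"] by auto
      then show ?thesis by (simp add: F_def H_def)
    qed
    have pc: "prekopa_class B (marginals U ys (F M))" if "distinct ys" for ys
      by (rule marginals_prekopa_class[OF F_prekopa_class[OF M] U van that])
    moreover have "J M t = pi ^ CARD('m) * marginals U xs (F M) (t, expv 0)" if t: "t \<in> B" for t
    proof -
      have c: "continuous_on UNIV (\<lambda>u. marginals U ys (F M) (t, u))" if "distinct ys" for ys
        using pc[OF that] t unfolding prekopa_class_def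
        by (auto intro!: continuous_on_compose2[of "B \<times> UNIV" "marginals U ys (F M)"] continuous_intros)
      have n: "marginals U ys (F M) (t, u) \<ge> 0" if "distinct ys" for ys u
        using pc[OF that] t unfolding prekopa_class_def by blast
      have HF: "H M (t, z) = F M (t, sqn z)" for z
        unfolding F_def fst_conv snd_conv by (rule H_invariant[OF t]) (simp add: sqv_def sqn_def)
      have vz: "sqn (\<chi> j. (1 :: complex)) = (expv 0 :: real ^ 'm)" by (simp add: sqn_def vec_eq_iff)
      have "(\<integral>\<^sup>+z. ennreal (H M (t, z)) \<partial>lborel) =
        (\<integral>\<^sup>+f. ennreal (H M (t, \<chi> j. f j)) \<partial>(\<Pi>\<^sub>M j\<in>(UNIV :: 'm set). lborel))"
        by (subst lborel_vec_eq_distr_PiM, subst nn_integral_distr)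
          (use H_measurable[OF t] in \<open>auto intro!: measurable_vec_lambda\<close>)
      also have "\<dots> = ennreal (pi ^ length xs * marginals U xs (F M) (t, sqn (\<chi> j. 1)))"
        using nn_integral_PiM_marginals[OF c n van[OF t] U HF H_measurable[OF t] xs(2), where z = "\<chi> j. 1"] by (simp add: xs)
      also have "length xs = CARD('m)" using distinct_card[OF xs(2)] xs(1) by simp
      finally have "(\<integral>\<^sup>+z. ennreal (H M (t, z)) \<partial>lborel) = ennreal (pi ^ CARD('m) * marginals U xs (F M) (t, expv 0))"
        unfolding vz .
      moreover have "(\<integral>\<^sup>+z. ennreal (H M (t, z)) \<partial>lborel) = ennreal (J M t)"
        unfolding J_def by (rule nn_integral_eq_integral[OF H_integrable[OF M t]]) (use H_nonneg[OF M t] in auto)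
      ultimately have e: "ennreal (J M t) = ennreal (pi ^ CARD('m) * marginals U xs (F M) (t, expv 0))" by simp
      have "0 \<le> J M t" unfolding J_def using H_nonneg[OF M t] by simp
      moreover have "0 \<le> pi ^ CARD('m) * marginals U xs (F M) (t, expv 0)"
        by (intro mult_nonneg_nonneg n[OF xs(2)]) simp
      ultimately show ?thesis using e ennreal_inj by blast
    qed
    ultimately show ?thesis using xs(2) by blast
  qed
  then show ?thesis using U xs(2) by blast
qed

lemma J_pos:
  assumes M: "M > 0" and t: "t \<in> B"
  shows "J M t > 0"
proof -
  let ?f = "\<lambda>z. H M (t, z)"
  have op: "open {z. 0 < ?f z}"
  proof -
    have "continuous_on UNIV ?f"
      by (rule continuous_on_compose2[OF continuous_on_H]) (use t in \<open>auto intro!: continuous_intros\<close>)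
    then show ?thesis by (intro open_Collect_less continuous_on_const)
  qed
  have "logz c \<in> {z. 0 < ?f z}" using H_pos_iff[OF M t] base_lfib[OF t] by simp
  then have ne: "{z. 0 < ?f z} \<noteq> {}" by blast
  have "J M t \<noteq> 0"
  proof
    assume "J M t = 0"
    then have "AE z in lborel. ?f z = 0"
      unfolding J_def using integral_nonneg_eq_0_iff_AE[OF H_integrable[OF M t]] H_nonneg[OF M t] by simp
    then have "AE z in lborel. z \<notin> {z. 0 < ?f z}" by (auto elim: eventually_mono)
    moreover have "{z. 0 < ?f z} \<in> sets lborel" using op by simp
    ultimately have "{z. 0 < ?f z} \<in> null_sets lborel" using AE_iff_null_sets by blast
    then have "negligible {z. 0 < ?f z}"
      unfolding negligible_iff_null_sets by (rule null_sets_completionI)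
    then show False using open_not_negligible[OF op ne] by simp
  qed
  moreover have "J M t \<ge> 0" unfolding J_def using H_nonneg[OF M t] by simp
  ultimately show ?thesis by simp
qed

lemma J_le_Iw: "t \<in> B \<Longrightarrow> M > 0 \<Longrightarrow> J M t \<le> Iw t"
  unfolding J_def Iw_def set_lebesgue_integral_def
  by (intro integral_mono H_integrable weight_integrable H_le)

lemma Iw_pos: "t \<in> B \<Longrightarrow> Iw t > 0"
  using J_pos[of 1 t] J_le_Iw[of t 1] by simp

text \<open>For \<open>J M\<close> this is the inequality of the class with the constant curve
  \<open>x = 0\<close>. Letting \<open>M\<close> tend to infinity uses monotone convergence on the
  circle, which presupposes no regularity of \<open>Iw\<close> in \<open>t\<close>.\<close>

lemma ln_Iw_submean:
  assumes ab: "\<And>\<zeta>. cmod \<zeta> \<le> 1 \<Longrightarrow> a + \<zeta> *s b \<in> B"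
  shows "cmean (\<lambda>\<zeta>. ln (Iw (a + \<zeta> *s b))) \<le> ln (Iw a)"
proof -
  obtain U xs where X: "\<And>M. M > 0 \<Longrightarrow> prekopa_class B (marginals U xs (F M))"
    "\<And>M t. M > 0 \<Longrightarrow> t \<in> B \<Longrightarrow> J M t = pi ^ CARD('m) * marginals U xs (F M) (t, expv 0)"
    using J_eq_marginals by blast
  have aB: "a \<in> B" using ab[of 0] by simp
  have sB: "a + \<zeta> *s b \<in> B" if "\<zeta> \<in> sphere 0 1" for \<zeta> using ab that by simp
  have contJ: "continuous_on (sphere 0 1) (\<lambda>\<zeta>. J M (a + \<zeta> *s b))" if M: "M > 0" for M
  proof -
    have c: "continuous_on (B \<times> UNIV) (marginals U xs (F M))"
      using X(1)[OF M] by (simp add: prekopa_class_def)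
    have "continuous_on (sphere 0 1) (\<lambda>\<zeta>. pi ^ CARD('m) * marginals U xs (F M) (a + \<zeta> *s b, expv 0))"
      by (intro continuous_on_mult continuous_on_const continuous_on_compose2[OF c])
        (use sB in \<open>auto intro!: continuous_on_Pair continuous_on_add continuous_on_const continuous_on_smult_vec continuous_on_id\<close>)
    then show ?thesis by (rule continuous_on_eq) (use X(2)[OF M] sB in auto)
  qed
  have contlnJ: "continuous_on (sphere 0 1) (\<lambda>\<zeta>. ln (J M (a + \<zeta> *s b)))" if M: "M > 0" for M
  proof (rule continuous_on_ln[OF contJ[OF M]], rule ballI)
    show "J M (a + \<zeta> *s b) \<noteq> 0" if "\<zeta> \<in> sphere 0 1" for \<zeta>
      using J_pos[OF M sB[OF that]] by linarith
  qed
  have JJ: "cmean (\<lambda>\<zeta>. ln (J M (a + \<zeta> *s b))) \<le> ln (J M a)" if M: "M > 0" for M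
  proof -
    let ?G = "marginals U xs (F M)"
    have pos: "?G (t, expv 0) > 0" if "t \<in> B" for t
      using J_pos[OF M that] X(2)[OF M that] by (simp add: zero_less_mult_iff)
    have P: "exp (cmean (\<lambda>\<zeta>. ln (?G (a + \<zeta> *s b, expv (x \<zeta>))))) \<le> ?G (a, expv (vmean x))"
      if "continuous_on (sphere 0 1) x" "\<forall>\<zeta>\<in>sphere 0 1. ?G (a + \<zeta> *s b, expv (x \<zeta>)) > 0" for x
      using X(1)[OF M] ab that unfolding prekopa_class_def by blast
    have "exp (cmean (\<lambda>\<zeta>. ln (?G (a + \<zeta> *s b, expv 0)))) \<le> ?G (a, expv (vmean (\<lambda>_. 0)))"
      by (rule P) (use pos[OF sB] in auto)
    moreover have "vmean (\<lambda>_. 0) = (0 :: real ^ 'm)" by (simp add: vmean_def vec_eq_iff)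
    ultimately have 1: "cmean (\<lambda>\<zeta>. ln (?G (a + \<zeta> *s b, expv 0))) \<le> ln (?G (a, expv 0))"
      using pos[OF aB] by (simp add: ln_ge_iff)
    have "cmean (\<lambda>\<zeta>. ln (J M (a + \<zeta> *s b))) = cmean (\<lambda>\<zeta>. ln (pi ^ CARD('m)) + ln (?G (a + \<zeta> *s b, expv 0)))"
    proof (rule cmean_cong)
      fix \<zeta> :: complex assume "\<zeta> \<in> sphere 0 1"
      from sB[OF this] show "ln (J M (a + \<zeta> *s b)) = ln (pi ^ CARD('m)) + ln (?G (a + \<zeta> *s b, expv 0))"
        using X(2)[OF M] pos by (simp add: ln_mult_pos)
    qed
    also have "\<dots> = ln (pi ^ CARD('m)) + cmean (\<lambda>\<zeta>. ln (?G (a + \<zeta> *s b, expv 0)))"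
    proof -
      have "continuous_on (sphere 0 1) (\<lambda>\<zeta>. ln (J M (a + \<zeta> *s b)) - ln (pi ^ CARD('m)))"
        by (intro continuous_on_diff contlnJ M continuous_on_const)
      then have "continuous_on (sphere 0 1) (\<lambda>\<zeta>. ln (?G (a + \<zeta> *s b, expv 0)))"
        by (rule continuous_on_eq) (use X(2)[OF M] pos sB in \<open>simp add: ln_mult_pos\<close>)
      then show ?thesis by (simp add: cmean_add)
    qed
    also have "\<dots> \<le> ln (J M a)" using 1 X(2)[OF M aB] pos[OF aB] by (simp add: ln_mult_pos)
    finally show ?thesis .
  qed
  let ?f = "\<lambda>n \<theta>. ln (J (real (Suc n)) (a + cis \<theta> *s b))"
  have tB: "a + cis \<theta> *s b \<in> B" for \<theta> using ab[of "cis \<theta>"] by simp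
  have "(\<lambda>\<theta>. ln (Iw (a + cis \<theta> *s b))) integrable_on {0..2*pi} \<and>
    (\<lambda>n. integral {0..2*pi} (?f n)) \<longlonglongrightarrow> integral {0..2*pi} (\<lambda>\<theta>. ln (Iw (a + cis \<theta> *s b)))"
  proof (rule monotone_convergence_increasing)
    show int: "?f n integrable_on {0..2*pi}" for n using circle_integrable[OF contlnJ] by simp
    show "?f n \<theta> \<le> ?f (Suc n) \<theta>" for n \<theta>
      by (rule ln_mono[OF J_mono[OF tB] J_pos[OF _ tB]]) auto
    show "(\<lambda>n. ?f n \<theta>) \<longlonglongrightarrow> ln (Iw (a + cis \<theta> *s b))" for \<theta>
    proof (rule tendsto_ln[OF J_limit[OF tB]])
      show "Iw (a + cis \<theta> *s b) \<noteq> 0" using Iw_pos[OF tB[of \<theta>]] by linarith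
    qed
    have up: "integral {0..2*pi} (?f n) \<le> 2 * pi * ln (Iw a)" for n
    proof -
      have "cmean (\<lambda>\<zeta>. ln (J (real (Suc n)) (a + \<zeta> *s b))) \<le> ln (J (real (Suc n)) a)" by (intro JJ) simp
      also have "\<dots> \<le> ln (Iw a)" by (rule ln_mono[OF J_le_Iw[OF aB] J_pos[OF _ aB]]) auto
      finally show ?thesis by (simp add: cmean_def field_simps)
    qed
    have lo: "integral {0..2*pi} (?f 0) \<le> integral {0..2*pi} (?f n)" for n
      by (rule integral_le[OF int int], rule ln_mono[OF J_mono[OF tB] J_pos[OF _ tB]]) auto
    show "bounded (range (\<lambda>n. integral {0..2*pi} (?f n)))"
      by (rule bounded_subset[of "{integral {0..2*pi} (?f 0)..2 * pi * ln (Iw a)}"]) (use up lo in auto)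
  qed
  then have "(\<lambda>n. cmean (\<lambda>\<zeta>. ln (J (real (Suc n)) (a + \<zeta> *s b)))) \<longlonglongrightarrow> cmean (\<lambda>\<zeta>. ln (Iw (a + \<zeta> *s b)))"
    unfolding cmean_def by (intro tendsto_divide tendsto_const) auto
  moreover have "(\<lambda>n. ln (J (real (Suc n)) a)) \<longlonglongrightarrow> ln (Iw a)"
    by (rule tendsto_ln[OF J_limit[OF aB]]) (use Iw_pos[OF aB] in linarith)
  ultimately show ?thesis by (rule LIMSEQ_le) (use JJ in auto)
qed

end

section \<open>Integrals over sublevel sets\<close>

lemma open_sublevel:
  fixes f :: "'c::topological_space \<Rightarrow> real"
  assumes "open S" "continuous_on S f"
  shows "open {x \<in> S. f x < c}" "open {x \<in> S. c < f x}"
proof -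
  have c: "continuous_on S (\<lambda>_. c)" by (rule continuous_on_const)
  from open_Collect_less_Int[OF assms(2) c] obtain A where "open A" "A \<inter> S = {x \<in> S. f x < c}" by blast
  then show "open {x \<in> S. f x < c}" using open_Int[of A S] assms(1) by simp
  from open_Collect_less_Int[OF c assms(2)] obtain A where "open A" "A \<inter> S = {x \<in> S. c < f x}" by blast
  then show "open {x \<in> S. c < f x}" using open_Int[of A S] assms(1) by simp
qed

lemma nn_integral_cbox_eq_integral:
  fixes q :: "'b::euclidean_space \<Rightarrow> real"
  assumes "continuous_on (cbox a b) q" "\<And>y. y \<in> cbox a b \<Longrightarrow> q y \<ge> 0"
  shows "(\<integral>\<^sup>+y. ennreal (indicator (cbox a b) y * q y) \<partial>lborel) = ennreal (integral (cbox a b) q)"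
proof (rule nn_integral_has_integral_lborel)
  show "(\<lambda>y. indicator (cbox a b) y * q y) \<in> borel_measurable borel"
    using borel_measurable_continuous_on_indicator[OF _ assms(1)] by simp
  show "0 \<le> indicator (cbox a b) y * q y" for y using assms(2) by (auto split: split_indicator)
  have "(q has_integral integral (cbox a b) q) (cbox a b)"
    using assms(1) by (intro integrable_integral integrable_continuous)
  from has_integral_restrict_UNIV[THEN iffD2, OF this]
  show "((\<lambda>y. indicator (cbox a b) y * q y) has_integral integral (cbox a b) q) UNIV"
    by (rule has_integral_eq[rotated]) (auto split: split_indicator)
qed

lemma nn_integral_translate:
  fixes f :: "'b::euclidean_space \<Rightarrow> ennreal"
  assumes "f \<in> borel_measurable borel"
  shows "(\<integral>\<^sup>+z. f (c + z) \<partial>lborel) = (\<integral>\<^sup>+z. f z \<partial>lborel)"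
proof -
  have "(\<integral>\<^sup>+z. f z \<partial>lborel) = (\<integral>\<^sup>+z. f z \<partial>distr lborel borel ((+) c))" by (simp only: lborel_distr_plus)
  also have "\<dots> = (\<integral>\<^sup>+z. f (c + z) \<partial>lborel)" using assms by (subst nn_integral_distr) auto
  finally show ?thesis by simp
qed

text \<open>The density is arbitrary so that the members of a partition of unity can be inserted
  afterwards; its support in the smaller ball leaves room for shifting the domain of
  integration.\<close>

definition sublevel_good ::
  "(('a::euclidean_space \<times> 'b::euclidean_space) \<Rightarrow> real) \<Rightarrow> ('a \<times> 'b) set \<Rightarrow> 'a \<Rightarrow> 'b \<Rightarrow> real \<Rightarrow> real \<Rightarrow> 'a set \<Rightarrow> bool" where
  "sublevel_good \<rho> W t0 z0 r R T \<longleftrightarrow> 0 < r \<and> r < R \<and> open T \<and> t0 \<in> T \<and> T \<times> ball z0 R \<subseteq> W \<and>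
    (\<forall>F. Ck_on 2 (T \<times> UNIV) F \<longrightarrow> (\<forall>p. F p \<ge> 0) \<longrightarrow> (\<forall>t\<in>T. \<forall>z. z \<notin> cball z0 r \<longrightarrow> F (t, z) = 0) \<longrightarrow>
      (\<exists>G. Ck_on 2 T G \<and> (\<forall>t\<in>T. G t \<ge> 0 \<and>
        (\<integral>\<^sup>+z. ennreal (indicator {z \<in> ball z0 R. \<rho> (t, z) < 0} z * F (t, z)) \<partial>lborel) = ennreal (G t))))"

lemma open_prod_nhd:
  assumes "open S" "(t, z) \<in> S"
  obtains T R where "open T" "t \<in> T" "R > 0" "T \<times> ball z R \<subseteq> S"
proof -
  obtain A B where AB: "open A" "open B" "(t, z) \<in> A \<times> B" "A \<times> B \<subseteq> S"
    using open_prod_elim[OF assms] by metis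
  then obtain R where R: "R > 0" "ball z R \<subseteq> B" using openE[of B z] by auto
  show ?thesis by (rule that[of A R]) (use AB R in auto)
qed

text \<open>Where \<open>\<rho>\<close> is negative on the whole patch, the integral is one over a
  fixed box.\<close>

lemma sublevel_good_interior:
  assumes "open W" "Ck_on 2 W \<rho>" "(t0, z0) \<in> W" "\<rho> (t0, z0) < 0"
  shows "\<exists>r R T. sublevel_good \<rho> W t0 z0 r R T"
proof -
  have "open {p \<in> W. \<rho> p < 0}"
    by (rule open_sublevel[OF assms(1) Ck_on_imp_continuous_on[OF assms(2)]])
  moreover have "(t0, z0) \<in> {p \<in> W. \<rho> p < 0}" using assms by simp
  ultimately obtain T R where T: "open T" "t0 \<in> T" "R > 0" "T \<times> ball z0 R \<subseteq> {p \<in> W. \<rho> p < 0}"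
    by (rule open_prod_nhd)
  obtain a b where ab: "z0 \<in> box a b" "cbox a b \<subseteq> ball z0 R"
    using open_contains_cbox[OF open_ball, of z0 z0 R] T(3) by (metis centre_in_ball)
  obtain r' where r': "r' > 0" "cball z0 r' \<subseteq> box a b" using open_contains_cball open_box ab(1) by metis
  define r where "r = min r' (R / 2)"
  have r: "0 < r" "r < R" using r' T(3) by (auto simp: r_def min_def)
  have "cball z0 r \<subseteq> cball z0 r'" by (rule subset_cball) (simp add: r_def)
  then have rab: "cball z0 r \<subseteq> cbox a b" using r'(2) box_subset_cbox[of a b] by (meson order_trans)
  have "\<exists>G. Ck_on 2 T G \<and> (\<forall>t\<in>T. G t \<ge> 0 \<and>
        (\<integral>\<^sup>+z. ennreal (indicator {z \<in> ball z0 R. \<rho> (t, z) < 0} z * F (t, z)) \<partial>lborel) = ennreal (G t))"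
    if F: "Ck_on 2 (T \<times> UNIV) F" "\<And>p. F p \<ge> 0" "\<And>t z. t \<in> T \<Longrightarrow> z \<notin> cball z0 r \<Longrightarrow> F (t, z) = 0" for F
  proof (intro exI conjI ballI)
    show "Ck_on 2 T (\<lambda>t. integral (cbox a b) (\<lambda>z. F (t, z)))"
      by (rule Ck_on_integral[OF T(1) _ _ F(1)]) (use T(1) in \<open>auto intro: open_Times\<close>)
    fix t assume t: "t \<in> T"
    have c: "continuous_on (cbox a b) (\<lambda>z. F (t, z))"
      by (rule continuous_on_compose2[OF Ck_on_imp_continuous_on[OF F(1)]]) (use t in \<open>auto intro!: continuous_intros\<close>)
    show "integral (cbox a b) (\<lambda>z. F (t, z)) \<ge> 0"
      using c F(2) by (intro integral_nonneg integrable_continuous) auto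
    have ind: "indicator {z \<in> ball z0 R. \<rho> (t, z) < 0} z * F (t, z) = indicator (cbox a b) z * F (t, z)" for z
    proof (cases "z \<in> cball z0 r")
      case True
      then have "z \<in> cbox a b" "z \<in> ball z0 R" using rab r ab(2) by (blast, simp)
      moreover have "\<rho> (t, z) < 0" using T(4) t \<open>z \<in> ball z0 R\<close> by blast
      ultimately show ?thesis by simp
    next
      case False then show ?thesis using F(3)[OF t False] by simp
    qed
    show "(\<integral>\<^sup>+z. ennreal (indicator {z \<in> ball z0 R. \<rho> (t, z) < 0} z * F (t, z)) \<partial>lborel) =
        ennreal (integral (cbox a b) (\<lambda>z. F (t, z)))"
      unfolding ind using nn_integral_cbox_eq_integral[OF c] F(2) by blast
  qed
  then have "sublevel_good \<rho> W t0 z0 r R T" unfolding sublevel_good_def using r T by auto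
  then show ?thesis by blast
qed

text \<open>Near a boundary point the sublevel set is \<open>{z + s e | s < g (t, z)}\<close>. Averaging over translates in
  direction \<open>e\<close> with the weight \<open>w\<close> and substituting \<open>s \<mapsto> g (t, z) + s\<close> turns the integral into one over a
  fixed box with an integrand that is \<open>C\<^sup>2\<close> in all variables.\<close>
lemma sublevel_good_boundary:
  fixes \<rho> :: "('a::euclidean_space \<times> 'b::euclidean_space) \<Rightarrow> real"
  assumes W: "open W" and rho: "Ck_on 2 W \<rho>" and z0: "(t0, z0) \<in> W" "\<rho> (t0, z0) = 0"
    and e': "frechet_derivative \<rho> (at (t0, z0)) (0, e') > 0"
  shows "\<exists>r R T. sublevel_good \<rho> W t0 z0 r R T"
proof -
  note lin = frechet_derivative_linear_2[OF rho]
  have "e' \<noteq> 0" using e' linear_0[OF lin[OF z0(1)]] by (auto simp: zero_prod_def)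
  define e where "e = e' /\<^sub>R norm e'"
  have e: "norm e = 1" using \<open>e' \<noteq> 0\<close> by (simp add: e_def)
  have "frechet_derivative \<rho> (at (t0, z0)) (0, e) = frechet_derivative \<rho> (at (t0, z0)) (inverse (norm e') *\<^sub>R (0, e'))"
    by (simp add: e_def)
  also have "\<dots> > 0" using e' \<open>e' \<noteq> 0\<close> by (simp add: linear_scale[OF lin[OF z0(1)]] del: scaleR_Pair)
  finally have e_pos: "frechet_derivative \<rho> (at (t0, z0)) (0, e) > 0" .
  let ?D = "\<lambda>p. frechet_derivative \<rho> (at p) (0, e)"
  have cD: "continuous_on W ?D"
    using Ck_on_SucD rho unfolding Ck_on_2_iff by (blast intro: Ck_on_imp_continuous_on)
  have crho: "continuous_on W \<rho>" using rho by (rule Ck_on_imp_continuous_on)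
  have "open {p \<in> W. 0 < ?D p}" by (rule open_sublevel[OF W cD])
  moreover have "(t0, z0) \<in> {p \<in> W. 0 < ?D p}" using z0 e_pos by simp
  ultimately obtain T1 R where T1: "open T1" "t0 \<in> T1" "R > 0" "T1 \<times> ball z0 R \<subseteq> {p \<in> W. 0 < ?D p}"
    by (rule open_prod_nhd)
  \<comment> \<open>For \<open>z\<close> within \<open>R / 4\<close> of \<open>z0\<close>, shifts by
    at most \<open>R / 2\<close> along the unit vector \<open>e\<close> stay in
    \<open>ball z0 R\<close>, where \<open>\<rho>\<close> increases in direction
    \<open>e\<close>.\<close>
  define s0 where "s0 = R / 2"
  have s0: "s0 > 0" using T1 by (simp add: s0_def)
  have inR: "z + s *\<^sub>R e \<in> ball z0 R" if "dist z0 z < R / 4" "\<bar>s\<bar> \<le> s0" for z s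
  proof -
    have "dist z0 (z + s *\<^sub>R e) \<le> dist z0 z + \<bar>s\<bar>"
      using dist_triangle[of z0 "z + s *\<^sub>R e" z] e by (simp add: dist_norm)
    then show ?thesis using that T1(3) by (simp add: s0_def)
  qed
  have dline: "((\<lambda>s. \<rho> (t, z + s *\<^sub>R e)) has_real_derivative ?D (t, z + s *\<^sub>R e)) (at s)"
    if "(t, z + s *\<^sub>R e) \<in> W" for t z s
    using has_real_derivative_along_line[of \<rho> _ "(t, z)" s "(0, e)"] Ck_on_2_has_derivative(1)[OF rho that] by simp
  have mono: "\<rho> (t, z + s *\<^sub>R e) < \<rho> (t, z + s' *\<^sub>R e)"
    if t: "t \<in> T1" and z: "dist z0 z < R / 4" and s: "- s0 \<le> s" "s < s'" "s' \<le> s0" for t z s s'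
  proof (rule DERIV_pos_imp_increasing[OF s(2), of "\<lambda>s. \<rho> (t, z + s *\<^sub>R e)"])
    fix x assume x: "s \<le> x" "x \<le> s'"
    have "(t, z + x *\<^sub>R e) \<in> T1 \<times> ball z0 R" using t inR[OF z, of x] x s by auto
    then have "(t, z + x *\<^sub>R e) \<in> {p \<in> W. 0 < ?D p}" using T1(4) by blast
    then show "\<exists>y. ((\<lambda>s. \<rho> (t, z + s *\<^sub>R e)) has_real_derivative y) (at x) \<and> 0 < y"
      using dline by blast
  qed
  \<comment> \<open>Base points whose line in direction \<open>e\<close> passes from negative to
    positive \<open>\<rho>\<close> within the admissible range, so that it crosses the boundary
    exactly once.\<close>
  define S where "S = {p \<in> T1 \<times> ball z0 (R / 4). \<rho> (fst p, snd p - s0 *\<^sub>R e) < 0 \<and> 0 < \<rho> (fst p, snd p + s0 *\<^sub>R e)}"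
  have inW: "(t, z + s *\<^sub>R e) \<in> W" if "t \<in> T1" "dist z0 z < R / 4" "\<bar>s\<bar> \<le> s0" for t z s
    using T1(4) inR[OF that(2,3)] that(1) by blast
  have "open S"
  proof -
    let ?X = "T1 \<times> ball z0 (R / 4)"
    have X: "open ?X" using T1 by (auto intro: open_Times)
    have c: "continuous_on ?X (\<lambda>p. \<rho> (fst p, snd p + s *\<^sub>R e))" if "\<bar>s\<bar> \<le> s0" for s
      by (rule continuous_on_compose2[OF crho]) (use inW that in \<open>auto intro!: continuous_intros\<close>)
    have c1: "continuous_on ?X (\<lambda>p. \<rho> (fst p, snd p - s0 *\<^sub>R e))" using c[of "- s0"] s0 by simp
    have c2: "continuous_on ?X (\<lambda>p. \<rho> (fst p, snd p + s0 *\<^sub>R e))" using c[of s0] s0 by simp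
    have "S = {p \<in> ?X. \<rho> (fst p, snd p - s0 *\<^sub>R e) < 0} \<inter> {p \<in> ?X. 0 < \<rho> (fst p, snd p + s0 *\<^sub>R e)}"
      by (auto simp: S_def)
    then show ?thesis using open_Int[OF open_sublevel(1)[OF X c1, of 0] open_sublevel(2)[OF X c2, of 0]] by simp
  qed
  moreover have "(t0, z0) \<in> S"
    using mono[OF T1(2), of z0 "- s0" 0] mono[OF T1(2), of z0 0 s0] T1 s0 z0(2) by (simp add: S_def)
  ultimately obtain T \<delta> where T: "open T" "t0 \<in> T" "\<delta> > 0" "T \<times> ball z0 \<delta> \<subseteq> S"
    by (rule open_prod_nhd)
  have TT1: "T \<subseteq> T1"
  proof
    fix t assume "t \<in> T"
    then have "(t, z0) \<in> S" using T(3) by (intro subsetD[OF T(4)]) auto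
    then show "t \<in> T1" by (simp add: S_def)
  qed
  have dR: "dist z0 z < R / 4" if "z \<in> ball z0 \<delta>" for z
    using T(2,4) that by (auto simp: S_def subset_iff)
  define X where "X = T \<times> ball z0 \<delta>"
  have oX: "open X" unfolding X_def using T by (auto intro: open_Times)
  have "\<exists>s\<in>{-s0<..<s0}. \<rho> (fst x, snd x + s *\<^sub>R e) = 0" if x: "x \<in> X" for x
  proof -
    have xS: "x \<in> S" using T(4) x by (auto simp: X_def)
    then have x': "fst x \<in> T1" "dist z0 (snd x) < R / 4" by (auto simp: S_def)
    have c: "continuous_on {-s0..s0} (\<lambda>s. \<rho> (fst x, snd x + s *\<^sub>R e))"
      by (rule continuous_on_compose2[OF crho]) (use inW[OF x'] in \<open>auto intro!: continuous_intros\<close>)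
    obtain s where s: "-s0 \<le> s" "s \<le> s0" "\<rho> (fst x, snd x + s *\<^sub>R e) = 0"
      using IVT'[of "\<lambda>s. \<rho> (fst x, snd x + s *\<^sub>R e)" "-s0" 0 s0] c xS s0 by (auto simp: S_def)
    then have "s \<noteq> -s0" "s \<noteq> s0" using xS by (auto simp: S_def)
    then show ?thesis using s by force
  qed
  then obtain g where g: "\<And>x. x \<in> X \<Longrightarrow> g x \<in> {-s0<..<s0} \<and> \<rho> (fst x, snd x + g x *\<^sub>R e) = 0" by metis
  define \<Phi> where "\<Phi> = (\<lambda>p :: ('a \<times> 'b) \<times> real. \<rho> (fst (fst p), snd (fst p) + snd p *\<^sub>R e))"
  have oXs: "open (X \<times> {-s0<..<s0})" using oX by (auto intro: open_Times)
  have lin\<Phi>: "bounded_linear (\<lambda>p :: ('a \<times> 'b) \<times> real. (fst (fst p), snd (fst p) + snd p *\<^sub>R e))"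
    by (auto intro!: bounded_linear_intros bounded_linear_Pair
        bounded_linear_compose[OF bounded_linear_fst bounded_linear_fst] bounded_linear_compose[OF bounded_linear_snd bounded_linear_fst])
  have img: "(\<lambda>p. (fst (fst p), snd (fst p) + snd p *\<^sub>R e)) ` (X \<times> {-s0<..<s0}) \<subseteq> W"
  proof (rule image_subsetI)
    fix p assume "p \<in> X \<times> {-s0<..<s0}"
    then have "fst (fst p) \<in> T1" "snd (fst p) \<in> ball z0 \<delta>" "\<bar>snd p\<bar> \<le> s0"
      using TT1 by (auto simp: X_def mem_Times_iff abs_le_iff)
    then show "(fst (fst p), snd (fst p) + snd p *\<^sub>R e) \<in> W" by (intro inW dR)
  qed
  have Ck\<Phi>: "Ck_on (Suc 1) (X \<times> {-s0<..<s0}) \<Phi>"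
    unfolding \<Phi>_def using Ck_on_compose[OF oXs rho Ck_map_linear[OF oXs lin\<Phi>] img] by (simp add: numeral_2_eq_2)
  have gC: "Ck_on 2 X g"
  proof -
    have "Ck_on (Suc 1) X g"
    proof (rule Ck_on_implicit[OF oX _ Ck\<Phi>])
      fix x s assume x: "x \<in> X" "s \<in> {-s0<..<s0}"
      have "\<bar>s\<bar> \<le> s0" using x by (auto simp: abs_le_iff)
      then have "(fst x, snd x + s *\<^sub>R e) \<in> T1 \<times> ball z0 R"
        using TT1 inR[OF dR, of "snd x" s] x by (auto simp: X_def)
      then have xW: "(fst x, snd x + s *\<^sub>R e) \<in> {p \<in> W. 0 < ?D p}" using T1(4) by blast
      have "(\<Phi> has_derivative (\<lambda>h. frechet_derivative \<rho> (at (fst x, snd x + s *\<^sub>R e)) (fst (fst h), snd (fst h) + snd h *\<^sub>R e))) (at (x, s))"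
        using diff_chain_at[OF bounded_linear_imp_has_derivative[OF lin\<Phi>], of \<rho> _ "(x, s)"]
          Ck_on_2_has_derivative(1)[OF rho, of "(fst x, snd x + s *\<^sub>R e)"] xW by (simp add: \<Phi>_def o_def)
      from fun_cong[OF frechet_derivative_at[OF this], of "(0, 1)"]
      show "frechet_derivative \<Phi> (at (x, s)) (0, 1) > 0" using xW by simp
    next
      fix x s s' assume x: "x \<in> X" "s \<in> {-s0<..<s0}" "s' \<in> {-s0<..<s0}" "\<Phi> (x, s) = \<Phi> (x, s')"
      then have "fst x \<in> T1" "dist z0 (snd x) < R / 4" using TT1 dR by (auto simp: X_def)
      from mono[OF this, of s s'] mono[OF this, of s' s] x show "s = s'"
        by (cases s s' rule: linorder_cases) (auto simp: \<Phi>_def)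
    qed (use g in \<open>auto simp: \<Phi>_def\<close>)
    then show ?thesis by (simp add: numeral_2_eq_2)
  qed
  have sign: "\<rho> (t, z + s *\<^sub>R e) < 0 \<longleftrightarrow> s < g (t, z)" if x: "(t, z) \<in> X" and s: "\<bar>s\<bar> < s0" for t z s
  proof -
    have x': "t \<in> T1" "dist z0 z < R / 4" using x TT1 dR by (auto simp: X_def)
    have "\<rho> (t, z + g (t, z) *\<^sub>R e) = 0" "g (t, z) \<in> {-s0<..<s0}" using g[OF x] by auto
    moreover have "- s0 < s" "s < s0" using s by (auto simp: abs_less_iff)
    ultimately show ?thesis
      using mono[OF x', of s "g (t, z)"] mono[OF x', of "g (t, z)" s]
      by (cases s "g (t, z)" rule: linorder_cases) auto
  qed
  obtain a b where ab: "z0 \<in> box a b" "cbox a b \<subseteq> ball z0 \<delta>"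
    using open_contains_cbox[OF open_ball, of z0 z0 \<delta>] T(3) by (metis centre_in_ball)
  obtain r' where r': "r' > 0" "cball z0 r' \<subseteq> box a b" using open_contains_cball open_box ab(1) by metis
  \<comment> \<open>\<open>2 * r \<le> r'\<close> keeps the support inside \<open>cbox a b\<close>
    after a shift by less than \<open>r\<close>; \<open>r < s0\<close> keeps the shifts in the range
    in which \<open>g\<close> decides the sign of \<open>\<rho>\<close>.\<close>
  define r where "r = min (r' / 2) (min (R / 2) (s0 / 2))"
  have r: "0 < r" "r < R" "2 * r \<le> r'" "r < s0" using r' T1(3) s0 by (auto simp: r_def min_def)
  define w where "w = (\<lambda>\<tau>::real. pos_cube (r\<^sup>2 - \<tau>\<^sup>2))"
  have wC: "Ck_on 2 UNIV w" unfolding w_def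
    by (intro Ck_on_pos_cube Ck_on_diff Ck_on_const Ck_on_power Ck_on_linear bounded_linear_ident) auto
  have w0: "w \<tau> = 0" if "\<bar>\<tau>\<bar> \<ge> r" for \<tau>
    unfolding w_def using that r(1) by (intro pos_cube_simps) (simp add: abs_le_square_iff[symmetric])
  have wn: "w \<tau> \<ge> 0" for \<tau> by (simp add: w_def pos_cube_simps)
  have wc: "continuous_on A w" for A using Ck_on_imp_continuous_on[OF wC] by (rule continuous_on_subset) simp
  define C where "C = integral (cbox (-r) r) w"
  have Cpos: "C > 0"
  proof -
    have "w 0 > 0" using r(1) by (simp add: w_def pos_cube_simps)
    then have "\<exists>v\<in>{-r<..<r}. w v > 0" using r(1) by (intro bexI[of _ 0]) auto
    then show ?thesis unfolding C_def interval_cbox[symmetric] using integral_pos_iff_ex[OF wc wn] by blast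
  qed
  have intw: "(\<integral>\<^sup>+\<tau>. ennreal (w \<tau>) \<partial>lborel) = ennreal C"
  proof -
    have wi: "w \<tau> = indicator (cbox (-r) r) \<tau> * w \<tau>" for \<tau>
      using w0[of \<tau>] by (auto split: split_indicator)
    have "(\<integral>\<^sup>+\<tau>. ennreal (w \<tau>) \<partial>lborel) = (\<integral>\<^sup>+\<tau>. ennreal (indicator (cbox (-r) r) \<tau> * w \<tau>) \<partial>lborel)"
      by (rule nn_integral_cong) (simp only: wi[symmetric])
    also have "\<dots> = ennreal C" unfolding C_def using nn_integral_cbox_eq_integral[OF wc wn] .
    finally show ?thesis .
  qed
  have "\<exists>G. Ck_on 2 T G \<and> (\<forall>t\<in>T. G t \<ge> 0 \<and>
        (\<integral>\<^sup>+z. ennreal (indicator {z \<in> ball z0 R. \<rho> (t, z) < 0} z * F (t, z)) \<partial>lborel) = ennreal (G t))"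
    if F: "Ck_on 2 (T \<times> UNIV) F" "\<And>p. F p \<ge> 0" "\<And>t z. t \<in> T \<Longrightarrow> z \<notin> cball z0 r \<Longrightarrow> F (t, z) = 0" for F
  proof -
    \<comment> \<open>Since \<open>|g| < s0\<close> and the weight lives on
      \<open>|g + s| < r < s0\<close>, the new variable \<open>s\<close> stays above
      \<open>- 2 * s0\<close>.\<close>
    define L where "L = 2 * s0"
    define q where "q = (\<lambda>p :: 'a \<times> ('b \<times> real). w (g (fst p, fst (snd p)) + snd (snd p)) *
      F (fst p, fst (snd p) + (g (fst p, fst (snd p)) + snd (snd p)) *\<^sub>R e))"
    define Y where "Y = T \<times> (ball z0 \<delta> \<times> (UNIV :: real set))"
    have oY: "open Y" unfolding Y_def using T(1) by (auto intro!: open_Times)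
    have qC: "Ck_on 2 Y q"
    proof -
      have b1: "bounded_linear (\<lambda>p :: 'a \<times> ('b \<times> real). (fst p, fst (snd p)))"
        by (auto intro!: bounded_linear_Pair bounded_linear_fst bounded_linear_compose[OF bounded_linear_fst bounded_linear_snd])
      have b2: "bounded_linear (\<lambda>p :: 'a \<times> ('b \<times> real). snd (snd p))"
        "bounded_linear (\<lambda>p :: 'a \<times> ('b \<times> real). fst (snd p))"
        by (auto intro!: bounded_linear_compose[OF bounded_linear_snd bounded_linear_snd] bounded_linear_compose[OF bounded_linear_fst bounded_linear_snd])
      have gg: "Ck_on 2 Y (\<lambda>p. g (fst p, fst (snd p)))"
        by (rule Ck_on_compose[OF oY gC Ck_map_linear[OF oY b1]]) (auto simp: Y_def X_def)
      have gs: "Ck_on 2 Y (\<lambda>p. g (fst p, fst (snd p)) + snd (snd p))"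
        by (intro Ck_on_add oY gg Ck_on_linear b2)
      show ?thesis unfolding q_def
      proof (rule Ck_on_mult[OF oY])
        show "Ck_on 2 Y (\<lambda>p. w (g (fst p, fst (snd p)) + snd (snd p)))"
          by (rule Ck_on_compose_real[OF oY wC gs]) simp
        show "Ck_on 2 Y (\<lambda>p. F (fst p, fst (snd p) + (g (fst p, fst (snd p)) + snd (snd p)) *\<^sub>R e))"
          by (rule Ck_on_compose[OF oY F(1)], intro Ck_map_Pair Ck_map_add Ck_map_scaleR oY gs Ck_map_const
              Ck_map_linear b2 bounded_linear_fst) (auto simp: Y_def)
      qed
    qed
    define G where "G = (\<lambda>t. inverse C * integral (cbox (a, -L) (b, 0)) (\<lambda>y. q (t, y)))"
    have sub: "T \<times> cbox (a, -L) (b, 0) \<subseteq> Y" using ab(2) by (auto simp: Y_def cbox_Pair_eq)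
    have GC: "Ck_on 2 T G" unfolding G_def
      by (intro Ck_on_mult Ck_on_const T(1) Ck_on_integral[OF T(1) oY sub qC])
    have "G t \<ge> 0 \<and> (\<integral>\<^sup>+z. ennreal (indicator {z \<in> ball z0 R. \<rho> (t, z) < 0} z * F (t, z)) \<partial>lborel) = ennreal (G t)"
      if t: "t \<in> T" for t
    proof -
      have cq: "continuous_on (cbox (a, -L) (b, 0)) (\<lambda>y. q (t, y))"
        by (rule continuous_on_compose2[OF Ck_on_imp_continuous_on[OF qC]])
          (use sub t in \<open>auto intro!: continuous_intros\<close>)
      have qn: "q p \<ge> 0" for p unfolding q_def using wn F(2) by simp
      have In: "integral (cbox (a, -L) (b, 0)) (\<lambda>y. q (t, y)) \<ge> 0"
        using qn by (intro integral_nonneg integrable_continuous cq)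
      have Gn: "G t \<ge> 0" unfolding G_def using Cpos In by simp
      define A where "A = {z \<in> ball z0 R. \<rho> (t, z) < 0}"
      have oA: "open A"
      proof -
        have "continuous_on (ball z0 R) (\<lambda>z. \<rho> (t, z))"
          by (rule continuous_on_compose2[OF crho]) (use T1(4) TT1 t in \<open>auto intro!: continuous_intros\<close>)
        then show ?thesis unfolding A_def by (rule open_sublevel[OF open_ball])
      qed
      have cFt: "continuous_on UNIV (\<lambda>z. F (t, z))"
        by (rule continuous_on_compose2[OF Ck_on_imp_continuous_on[OF F(1)]]) (use t in \<open>auto intro!: continuous_intros\<close>)
      define h where "h = (\<lambda>z. ennreal (indicator A z * F (t, z)))"
      have hm [measurable]: "h \<in> borel_measurable borel"
      proof -
        have [measurable]: "A \<in> sets borel" "(\<lambda>z. F (t, z)) \<in> borel_measurable borel"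
          using oA borel_measurable_continuous_onI[OF cFt] by auto
        show ?thesis unfolding h_def by measurable
      qed
      have wm [measurable]: "w \<in> borel_measurable borel" using wc by (rule borel_measurable_continuous_onI)
      \<comment> \<open>By translation invariance all shifted integrals have the same value, so
        averaging them with the weight \<open>w\<close> only multiplies by its mass
        \<open>C\<close>.\<close>
      have "ennreal C * (\<integral>\<^sup>+z. h z \<partial>lborel) = (\<integral>\<^sup>+\<tau>. ennreal (w \<tau>) * (\<integral>\<^sup>+z. h z \<partial>lborel) \<partial>lborel)"
        unfolding intw[symmetric] by (subst nn_integral_multc) auto
      also have "\<dots> = (\<integral>\<^sup>+\<tau>. (\<integral>\<^sup>+z. ennreal (w \<tau>) * h (\<tau> *\<^sub>R e + z) \<partial>lborel) \<partial>lborel)"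
      proof (rule nn_integral_cong)
        fix \<tau>
        have "(\<integral>\<^sup>+z. ennreal (w \<tau>) * h (\<tau> *\<^sub>R e + z) \<partial>lborel) = ennreal (w \<tau>) * (\<integral>\<^sup>+z. h (\<tau> *\<^sub>R e + z) \<partial>lborel)"
          by (rule nn_integral_cmult) measurable
        then show "ennreal (w \<tau>) * (\<integral>\<^sup>+z. h z \<partial>lborel) = (\<integral>\<^sup>+z. ennreal (w \<tau>) * h (\<tau> *\<^sub>R e + z) \<partial>lborel)"
          using nn_integral_translate[OF hm] by simp
      qed
      also have "\<dots> = (\<integral>\<^sup>+z. (\<integral>\<^sup>+\<tau>. ennreal (w \<tau>) * h (\<tau> *\<^sub>R e + z) \<partial>lborel) \<partial>lborel)"
        by (rule lborel_pair.Fubini'[of "\<lambda>\<tau> z. ennreal (w \<tau>) * h (\<tau> *\<^sub>R e + z)", symmetric]) measurable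
      also have "\<dots> = (\<integral>\<^sup>+z. (\<integral>\<^sup>+s. ennreal (indicator (cbox (a, -L) (b, 0)) (z, s) * q (t, (z, s))) \<partial>lborel) \<partial>lborel)"
      proof (rule nn_integral_cong)
        fix z
        show "(\<integral>\<^sup>+\<tau>. ennreal (w \<tau>) * h (\<tau> *\<^sub>R e + z) \<partial>lborel) =
          (\<integral>\<^sup>+s. ennreal (indicator (cbox (a, -L) (b, 0)) (z, s) * q (t, (z, s))) \<partial>lborel)"
        proof (cases "z \<in> cbox a b")
          case False
          have ze: "ennreal (w \<tau>) * h (\<tau> *\<^sub>R e + z) = 0" for \<tau>
          proof (cases "\<bar>\<tau>\<bar> < r")
            case True
            have "z \<notin> cball z0 r'" using False r'(2) box_subset_cbox[of a b] by blast
            then have "r' < dist z0 z" by simp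
            also have "dist z0 z \<le> dist z0 (\<tau> *\<^sub>R e + z) + \<bar>\<tau>\<bar>"
              using dist_triangle[of z0 z "\<tau> *\<^sub>R e + z"] e by (simp add: dist_norm)
            finally have "\<tau> *\<^sub>R e + z \<notin> cball z0 r" using True r(3) by simp
            then show ?thesis using F(3)[OF t] by (simp add: h_def)
          qed (simp add: w0)
          show ?thesis unfolding ze using False by (simp add: cbox_Pair_eq)
        next
          case True
          have zX: "(t, z) \<in> X" using True ab(2) t by (auto simp: X_def)
          let ?g = "g (t, z)"
          have gb: "\<bar>?g\<bar> < s0" using g[OF zX] by (auto simp: abs_less_iff)
          have "(\<integral>\<^sup>+\<tau>. ennreal (w \<tau>) * h (\<tau> *\<^sub>R e + z) \<partial>lborel) =
              (\<integral>\<^sup>+s. ennreal (w (?g + s)) * h ((?g + s) *\<^sub>R e + z) \<partial>lborel)"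
            by (rule nn_integral_translate[of "\<lambda>\<tau>. ennreal (w \<tau>) * h (\<tau> *\<^sub>R e + z)" ?g, symmetric]) measurable
          also have "\<dots> = (\<integral>\<^sup>+s. ennreal (indicator (cbox (a, -L) (b, 0)) (z, s) * q (t, (z, s))) \<partial>lborel)"
          proof (rule nn_integral_cong_AE)
            \<comment> \<open>At \<open>s = 0\<close> the point lies on the boundary: it belongs to
              the closed box but not to the sublevel set.\<close>
            have "AE s in lborel. s \<noteq> (0::real)" by (rule AE_lborel_singleton)
            then show "AE s in lborel. ennreal (w (?g + s)) * h ((?g + s) *\<^sub>R e + z) =
              ennreal (indicator (cbox (a, -L) (b, 0)) (z, s) * q (t, (z, s)))"
            proof eventually_elim
              case (elim s)
              have q: "q (t, (z, s)) = w (?g + s) * F (t, z + (?g + s) *\<^sub>R e)" by (simp add: q_def)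
              show ?case
              proof (cases "\<bar>?g + s\<bar> < r")
                case False
                then show ?thesis by (simp add: q w0)
              next
                case gr: True
                have "z + (?g + s) *\<^sub>R e \<in> ball z0 R" using inR[OF dR, of z "?g + s"] zX gr r(4) by (simp add: X_def)
                then have "z + (?g + s) *\<^sub>R e \<in> A \<longleftrightarrow> s < 0"
                  using sign[OF zX, of "?g + s"] gr r(4) by (simp add: A_def)
                moreover have "(z, s) \<in> cbox (a, -L) (b, 0) \<longleftrightarrow> s < 0"
                  using True elim gr gb r(4) by (auto simp: cbox_Pair_eq L_def)
                ultimately show ?thesis
                  by (simp add: q h_def add.commute[of _ z] ennreal_mult wn F(2) split: split_indicator)
              qed
            qed
          qed
          finally show ?thesis .
        qed
      qed
      also have "\<dots> = (\<integral>\<^sup>+y. ennreal (indicator (cbox (a, -L) (b, 0)) y * q (t, y)) \<partial>(lborel \<Otimes>\<^sub>M lborel))"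
      proof -
        have "(\<lambda>y. indicator (cbox (a, -L) (b, 0)) y * q (t, y)) \<in> borel_measurable borel"
          using borel_measurable_continuous_on_indicator[OF _ cq] by simp
        then have "(\<lambda>y. ennreal (indicator (cbox (a, -L) (b, 0)) y * q (t, y))) \<in> borel_measurable (lborel \<Otimes>\<^sub>M lborel)"
          by (simp add: lborel_prod)
        from lborel.nn_integral_fst[OF this] show ?thesis by simp
      qed
      also have "\<dots> = ennreal (integral (cbox (a, -L) (b, 0)) (\<lambda>y. q (t, y)))"
        unfolding lborel_prod using nn_integral_cbox_eq_integral[OF cq] qn by blast
      finally have "ennreal (inverse C) * (ennreal C * (\<integral>\<^sup>+z. h z \<partial>lborel)) = ennreal (G t)"
        using Cpos In by (simp add: G_def ennreal_mult[symmetric])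
      then have "(\<integral>\<^sup>+z. h z \<partial>lborel) = ennreal (G t)"
        using Cpos by (simp add: mult.assoc[symmetric] ennreal_mult[symmetric])
      then show ?thesis using Gn by (simp add: h_def A_def)
    qed
    then show ?thesis using GC by blast
  qed
  moreover have "T \<times> ball z0 R \<subseteq> W" using T1(4) TT1 by blast
  ultimately have "sublevel_good \<rho> W t0 z0 r R T" unfolding sublevel_good_def using r T by auto
  then show ?thesis by blast
qed

section \<open>Gluing the patches by a partition of unity\<close>

lemma Ck_on_norm_square: "open S \<Longrightarrow> Ck_on k S (\<lambda>y. (norm (y - z))\<^sup>2)"
proof -
  assume S: "open S"
  have "(norm (y - z))\<^sup>2 = (\<Sum>i\<in>Basis. (y \<bullet> i - z \<bullet> i) * (y \<bullet> i - z \<bullet> i))" for y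
    unfolding power2_norm_eq_inner by (subst euclidean_inner) (simp add: inner_diff_left)
  then show ?thesis
    by (simp only:) (intro Ck_on_sum Ck_on_mult Ck_on_diff Ck_on_const Ck_on_linear S bounded_linear_inner_left)
qed

lemma measurable_sublevel_piece:
  assumes "open A" "continuous_on UNIV F"
  shows "(\<lambda>z. ennreal (indicator A z * F z)) \<in> borel_measurable lborel"
proof -
  have [measurable]: "A \<in> sets borel" "F \<in> borel_measurable borel"
    using assms by (auto intro: borel_measurable_continuous_onI)
  show ?thesis by measurable
qed

text \<open>The set \<open>\<rho> \<le> 0\<close> over \<open>t0\<close> is compact and covered by
  finitely many good patches; a C^2 partition of unity splits the integral, and for \<open>t\<close>
  near \<open>t0\<close> the sets \<open>D t\<close> stay where the partition sums to 1.\<close>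

lemma sublevel_integral_Ck:
  fixes \<rho> f :: "('a::euclidean_space \<times> 'b::euclidean_space) \<Rightarrow> real"
  assumes W0: "open W0" and rho0: "Ck_on 2 W0 \<rho>" and f0: "Ck_on 2 W0 f" and fn0: "\<And>p. p \<in> W0 \<Longrightarrow> f p \<ge> 0"
    and N: "compact N" and T0: "open T0" "t0 \<in> T0" "T0 \<times> N \<subseteq> W0"
    and DN: "\<And>t. t \<in> T0 \<Longrightarrow> D t \<subseteq> N" and D: "\<And>t z. t \<in> T0 \<Longrightarrow> z \<in> N \<Longrightarrow> z \<in> D t \<longleftrightarrow> \<rho> (t, z) < 0"
    and bd: "\<And>z. z \<in> N \<Longrightarrow> \<rho> (t0, z) \<le> 0 \<Longrightarrow> z \<in> interior N \<and>
      (\<rho> (t0, z) = 0 \<longrightarrow> (\<exists>e. frechet_derivative \<rho> (at (t0, z)) (0, e) > 0))"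
  shows "\<exists>T G. open T \<and> t0 \<in> T \<and> T \<subseteq> T0 \<and> Ck_on 2 T G \<and> (\<forall>t\<in>T. G t \<ge> 0 \<and>
    (\<integral>\<^sup>+z. ennreal (indicator (D t) z * f (t, z)) \<partial>lborel) = ennreal (G t))"
proof -
  define W where "W = W0 \<inter> (T0 \<times> interior N)"
  have W: "open W" unfolding W_def using W0 T0 by (auto intro: open_Times)
  have rho: "Ck_on 2 W \<rho>" and f: "Ck_on 2 W f" using rho0 f0 by (auto intro: Ck_on_subset simp: W_def)
  define K where "K = {z \<in> N. \<rho> (t0, z) \<le> 0}"
  have crt: "continuous_on N (\<lambda>z. \<rho> (t0, z))"
    by (rule continuous_on_compose2[OF Ck_on_imp_continuous_on[OF rho0]]) (use T0 in \<open>auto intro!: continuous_intros\<close>)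
  have "closed K" unfolding K_def
    by (intro continuous_on_closed_Collect_le crt continuous_on_const compact_imp_closed N)
  then have "compact (N \<inter> K)" by (rule compact_Int_closed[OF N])
  moreover have "N \<inter> K = K" by (auto simp: K_def)
  ultimately have K: "compact K" by simp
  have "\<exists>r R T. sublevel_good \<rho> W t0 z r R T" if z: "z \<in> K" for z
  proof -
    have zW: "(t0, z) \<in> W" using bd[of z] z T0 by (auto simp: K_def W_def)
    show ?thesis
    proof (cases "\<rho> (t0, z) < 0")
      case True then show ?thesis by (rule sublevel_good_interior[OF W rho zW])
    next
      case False
      then have "\<rho> (t0, z) = 0" using z by (simp add: K_def)
      then show ?thesis using sublevel_good_boundary[OF W rho zW] bd[of z] z by (auto simp: K_def)
    qed
  qed
  then obtain r R TT where good: "\<And>z. z \<in> K \<Longrightarrow> sublevel_good \<rho> W t0 z (r z) (R z) (TT z)" by metis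
  have rR: "0 < r z" "r z < R z" "open (TT z)" "t0 \<in> TT z" "TT z \<times> ball z (R z) \<subseteq> W" if "z \<in> K" for z
    using good[OF that] by (auto simp: sublevel_good_def)
  have "K \<subseteq> (\<Union>z\<in>K. ball z (r z))" using rR(1) by force
  then obtain C where C: "C \<subseteq> K" "finite C" "K \<subseteq> (\<Union>z\<in>C. ball z (r z))"
    using compactE_image[OF K, of K "\<lambda>z. ball z (r z)"] by auto
  define b where "b = (\<lambda>z y. pos_cube ((r z)\<^sup>2 - (norm (y - z))\<^sup>2))"
  have bC: "Ck_on 2 UNIV (b z)" for z
    unfolding b_def by (intro Ck_on_pos_cube Ck_on_diff Ck_on_const Ck_on_norm_square) auto
  have bn: "b z y \<ge> 0" for z y by (simp add: b_def pos_cube_simps)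
  have b0: "b z y = 0" if "y \<notin> ball z (r z)" "z \<in> K" for z y
    unfolding b_def using that rR(1)[OF that(2)]
    by (intro pos_cube_simps) (auto simp: dist_norm norm_minus_commute intro!: power_mono)
  have bp: "b z y > 0" if "y \<in> ball z (r z)" for z y
    unfolding b_def using that by (intro pos_cube_simps) (auto simp: dist_norm norm_minus_commute intro!: power_strict_mono)
  define Bs where "Bs = (\<lambda>y. \<Sum>z\<in>C. b z y)"
  have BC: "Ck_on 2 UNIV Bs" unfolding Bs_def by (intro Ck_on_sum bC open_UNIV)
  have cB: "continuous_on A Bs" for A using Ck_on_imp_continuous_on[OF BC] by (rule continuous_on_subset) simp
  have Bn: "Bs y \<ge> 0" for y unfolding Bs_def by (intro sum_nonneg bn)
  have Bp: "Bs y > 0" if y: "y \<in> K" for y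
  proof -
    obtain z where z: "z \<in> C" "y \<in> ball z (r z)" using C(3) y by blast
    have "0 < b z y" using bp[OF z(2)] .
    also have "b z y \<le> Bs y" unfolding Bs_def using z(1) C(2) bn by (intro member_le_sum) auto
    finally show ?thesis .
  qed
  obtain \<beta> where \<beta>: "\<beta> > 0" "\<And>y. y \<in> K \<Longrightarrow> \<beta> < Bs y"
  proof (cases "K = {}")
    case True then show ?thesis using that[of 1] by simp
  next
    case False
    obtain m where m: "m \<in> K" "\<And>y. y \<in> K \<Longrightarrow> Bs m \<le> Bs y"
      using continuous_attains_inf[OF K False cB] by blast
    show ?thesis
    proof (rule that[of "Bs m / 2"])
      show "0 < Bs m / 2" using Bp[OF m(1)] by simp
      show "Bs m / 2 < Bs y" if "y \<in> K" for y using m(2)[OF that] Bp[OF m(1)] by simp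
    qed
  qed
  \<comment> \<open>A positive C^2 denominator that agrees with \<open>Bs\<close> where
    \<open>Bs\<close> exceeds \<open>\<beta>\<close>; where \<open>Bs\<close> vanishes it equals
    \<open>\<beta>\<close>.\<close>
  define \<kappa> where "\<kappa> = (\<lambda>y. Bs y + pos_cube (\<beta> - Bs y) / \<beta>\<^sup>2)"
  have kC: "Ck_on 2 UNIV \<kappa>" unfolding \<kappa>_def
    by (intro Ck_on_add Ck_on_divide Ck_on_pos_cube Ck_on_diff Ck_on_const BC open_UNIV) (use \<beta>(1) in auto)
  have kp: "\<kappa> y > 0" for y
  proof (cases "Bs y > 0")
    case True then show ?thesis unfolding \<kappa>_def by (intro add_pos_nonneg) (auto simp: pos_cube_simps)
  next
    case False
    then have "Bs y = 0" using Bn[of y] by simp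
    then show ?thesis using \<beta>(1) pos_cube_simps(2)[of \<beta>] by (simp add: \<kappa>_def)
  qed
  have k1: "\<kappa> y = Bs y" if "Bs y > \<beta>" for y using that by (simp add: \<kappa>_def pos_cube_simps)
  define \<chi>' where "\<chi>' = (\<lambda>z y. b z y / \<kappa> y)"
  have chiC: "Ck_on 2 UNIV (\<chi>' z)" for z unfolding \<chi>'_def
    by (intro Ck_on_divide bC kC open_UNIV) (use kp in \<open>auto simp: less_le\<close>)
  have chin: "\<chi>' z y \<ge> 0" for z y unfolding \<chi>'_def using bn kp[of y] by simp
  have chi0: "\<chi>' z y = 0" if "y \<notin> ball z (r z)" "z \<in> K" for z y using b0[OF that] by (simp add: \<chi>'_def)
  have chi1: "(\<Sum>z\<in>C. \<chi>' z y) = 1" if "Bs y > \<beta>" for y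
    unfolding \<chi>'_def sum_divide_distrib[symmetric] k1[OF that] using that \<beta>(1) by (simp add: Bs_def)
  define Ob where "Ob = {y \<in> interior N. \<beta> < Bs y}"
  have Ob: "open Ob" unfolding Ob_def by (rule open_sublevel(2)[OF open_interior cB])
  have KOb: "K \<subseteq> Ob" using bd \<beta>(2) by (auto simp: Ob_def K_def)
  \<comment> \<open>Off \<open>Ob\<close>, \<open>\<rho>\<close> is positive over \<open>t0\<close>;
    by the tube lemma it stays positive for nearby \<open>t\<close>, so \<open>D t\<close> cannot
    leave \<open>Ob\<close>.\<close>
  have "compact (N - Ob)" using N Ob by (rule compact_diff)
  moreover have "open {p \<in> W0. 0 < \<rho> p}" by (rule open_sublevel(2)[OF W0 Ck_on_imp_continuous_on[OF rho0]])
  moreover have "{t0} \<times> (N - Ob) \<subseteq> {p \<in> W0. 0 < \<rho> p}"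
    using T0 KOb by (auto simp: K_def not_le)
  ultimately obtain T1 where T1: "t0 \<in> T1" "open T1" "T1 \<times> (N - Ob) \<subseteq> {p \<in> W0. 0 < \<rho> p}"
    by (rule exE[OF Elementary_Topology.tube_lemma]) blast
  define T where "T = T0 \<inter> T1 \<inter> (\<Inter>z\<in>C. TT z)"
  have T: "open T" "t0 \<in> T" "T \<subseteq> T0"
    unfolding T_def using T0 T1 C rR by (auto intro!: open_Int open_INT)
  have DOb: "z \<in> Ob" if "t \<in> T" "z \<in> D t" for t z
  proof (rule ccontr)
    assume "z \<notin> Ob"
    moreover have "z \<in> N" using DN[of t] that by (auto simp: T_def)
    ultimately have "(t, z) \<in> {p \<in> W0. 0 < \<rho> p}" using T1(3) that by (auto simp: T_def)
    then show False using D[of t z] that \<open>z \<in> N\<close> by (auto simp: T_def)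
  qed
  define F where "F = (\<lambda>z p. if p \<in> TT z \<times> ball z (R z) then \<chi>' z (snd p) * f p else 0)"
  have FC: "Ck_on 2 (TT z \<times> UNIV) (F z)" if z: "z \<in> K" for z
  proof (rule Ck_on_local)
    fix p assume p: "p \<in> TT z \<times> (UNIV :: 'b set)"
    let ?A = "TT z \<times> ball z (R z)" and ?A' = "TT z \<times> - cball z (r z)"
    have oA: "open ?A" "open ?A'" using rR(3)[OF z] by (auto intro!: open_Times)
    show "\<exists>T. open T \<and> p \<in> T \<and> Ck_on 2 T (F z)"
    proof (cases "p \<in> ?A")
      case True
      have "Ck_on 2 ?A (\<lambda>p. \<chi>' z (snd p) * f p)"
      proof (rule Ck_on_mult[OF oA(1)])
        show "Ck_on 2 ?A f" using f rR(5)[OF z] by (rule Ck_on_subset)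
        show "Ck_on 2 ?A (\<lambda>p. \<chi>' z (snd p))"
          by (rule Ck_on_compose[OF oA(1) chiC Ck_map_linear[OF oA(1) bounded_linear_snd]]) simp
      qed
      then have "Ck_on 2 ?A (F z)" by (rule Ck_on_cong[OF oA(1), rotated]) (simp add: F_def)
      then show ?thesis using True oA(1) by blast
    next
      case False
      then have pA: "p \<in> ?A'" using p rR(2)[OF z] by (cases p) auto
      have "F z q = 0" if "q \<in> ?A'" for q
        using that chi0[OF _ z, of "snd q"] by (auto simp: F_def mem_Times_iff)
      then have "Ck_on 2 ?A' (F z)" by (intro Ck_on_cong[OF oA(2) _ Ck_on_const[OF oA(2), of 2 0]]) simp
      then show ?thesis using pA oA(2) by blast
    qed
  qed
  have Fn: "F z p \<ge> 0" if z: "z \<in> K" for z p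
    using chin fn0 rR(5)[OF z] by (auto simp: F_def W_def intro!: mult_nonneg_nonneg)
  have "\<forall>z\<in>K. \<exists>G. Ck_on 2 (TT z) G \<and> (\<forall>t\<in>TT z. G t \<ge> 0 \<and>
        (\<integral>\<^sup>+y. ennreal (indicator {y \<in> ball z (R z). \<rho> (t, y) < 0} y * F z (t, y)) \<partial>lborel) = ennreal (G t))"
  proof
    fix z assume z: "z \<in> K"
    have F0: "\<forall>t\<in>TT z. \<forall>y. y \<notin> cball z (r z) \<longrightarrow> F z (t, y) = 0"
    proof (intro ballI allI impI)
      fix t y assume "y \<notin> cball z (r z)"
      then have "\<chi>' z y = 0" using chi0[OF _ z, of y] by simp
      then show "F z (t, y) = 0" by (simp add: F_def)
    qed
    have "\<forall>p. F z p \<ge> 0" using Fn[OF z] by simp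
    moreover have "\<forall>F. Ck_on 2 (TT z \<times> UNIV) F \<longrightarrow> (\<forall>p. F p \<ge> 0) \<longrightarrow>
      (\<forall>t\<in>TT z. \<forall>y. y \<notin> cball z (r z) \<longrightarrow> F (t, y) = 0) \<longrightarrow>
      (\<exists>G. Ck_on 2 (TT z) G \<and> (\<forall>t\<in>TT z. G t \<ge> 0 \<and>
        (\<integral>\<^sup>+y. ennreal (indicator {y \<in> ball z (R z). \<rho> (t, y) < 0} y * F (t, y)) \<partial>lborel) = ennreal (G t)))"
      using good[OF z] unfolding sublevel_good_def by simp
    ultimately show "\<exists>G. Ck_on 2 (TT z) G \<and> (\<forall>t\<in>TT z. G t \<ge> 0 \<and>
        (\<integral>\<^sup>+y. ennreal (indicator {y \<in> ball z (R z). \<rho> (t, y) < 0} y * F z (t, y)) \<partial>lborel) = ennreal (G t))"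
      using FC[OF z] F0 by (elim allE[of _ "F z"]) blast
  qed
  from bchoice[OF this] obtain G where G: "\<And>z. z \<in> K \<Longrightarrow> Ck_on 2 (TT z) (G z)" "\<And>z t. z \<in> K \<Longrightarrow> t \<in> TT z \<Longrightarrow> G z t \<ge> 0"
    "\<And>z t. z \<in> K \<Longrightarrow> t \<in> TT z \<Longrightarrow>
        (\<integral>\<^sup>+y. ennreal (indicator {y \<in> ball z (R z). \<rho> (t, y) < 0} y * F z (t, y)) \<partial>lborel) = ennreal (G z t)"
    by blast
  have CK: "z \<in> K" if "z \<in> C" for z using that C by blast
  have TTT: "t \<in> TT z" if "t \<in> T" "z \<in> C" for t z using that by (auto simp: T_def)
  have GC: "Ck_on 2 T (\<lambda>t. \<Sum>z\<in>C. G z t)"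
    by (intro Ck_on_sum T(1) Ck_on_subset[OF G(1)[OF CK]]) (use TTT in auto)
  have "(\<Sum>z\<in>C. G z t) \<ge> 0 \<and> (\<integral>\<^sup>+z. ennreal (indicator (D t) z * f (t, z)) \<partial>lborel) = ennreal (\<Sum>z\<in>C. G z t)"
    if t: "t \<in> T" for t
  proof
    show "(\<Sum>z\<in>C. G z t) \<ge> 0" by (intro sum_nonneg G(2) CK TTT t)
    let ?P = "\<lambda>z y. indicator {y \<in> ball z (R z). \<rho> (t, y) < 0} y * F z (t, y)"
    have t0: "t \<in> T0" using t T(3) by blast
    have Pn: "?P z y \<ge> 0" if "z \<in> C" for z y
      using Fn[OF CK[OF that], of "(t, y)"] by (simp split: split_indicator)
    have pt: "indicator (D t) y * f (t, y) = (\<Sum>z\<in>C. ?P z y)" for y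
    proof (cases "y \<in> D t")
      case True
      have yN: "y \<in> N" using DN[OF t0] True by blast
      have neg: "\<rho> (t, y) < 0" using D[OF t0 yN] True by simp
      have "?P z y = \<chi>' z y * f (t, y)" if z: "z \<in> C" for z
      proof (cases "y \<in> ball z (R z)")
        case True then show ?thesis using neg TTT[OF t z] by (simp add: F_def)
      next
        case False
        then have "y \<notin> ball z (r z)" using rR(2)[OF CK[OF z]] by auto
        then show ?thesis using chi0[OF _ CK[OF z]] False by (simp add: F_def)
      qed
      then have "(\<Sum>z\<in>C. ?P z y) = (\<Sum>z\<in>C. \<chi>' z y) * f (t, y)" by (simp add: sum_distrib_right)
      also have "\<dots> = f (t, y)" using chi1[of y] DOb[OF t True] by (simp add: Ob_def)
      finally show ?thesis using True by simp
    next
      case False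
      have z0: "?P z y = 0" if z: "z \<in> C" for z
      proof (rule ccontr)
        assume "?P z y \<noteq> 0"
        then have y: "y \<in> ball z (R z)" "\<rho> (t, y) < 0" by (auto split: split_indicator_asm)
        then have "(t, y) \<in> W" using rR(5)[OF CK[OF z]] TTT[OF t z] by blast
        then have "y \<in> N" using interior_subset by (auto simp: W_def)
        then show False using D[OF t0] y(2) False by blast
      qed
      have "(\<Sum>z\<in>C. ?P z y) = 0" by (intro sum.neutral ballI z0)
      then show ?thesis using False by simp
    qed
    have meas: "(\<lambda>y. ennreal (?P z y)) \<in> borel_measurable lborel" if z: "z \<in> C" for z
    proof (rule measurable_sublevel_piece)
      have "continuous_on (ball z (R z)) (\<lambda>y. \<rho> (t, y))"
        by (rule continuous_on_compose2[OF Ck_on_imp_continuous_on[OF rho]])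
          (use rR(5)[OF CK[OF z]] TTT[OF t z] in \<open>auto intro!: continuous_intros\<close>)
      then show "open {y \<in> ball z (R z). \<rho> (t, y) < 0}" by (rule open_sublevel(1)[OF open_ball])
      show "continuous_on UNIV (\<lambda>y. F z (t, y))"
        by (rule continuous_on_compose2[OF Ck_on_imp_continuous_on[OF FC[OF CK[OF z]]]])
          (use TTT[OF t z] in \<open>auto intro!: continuous_intros\<close>)
    qed
    have "(\<integral>\<^sup>+y. ennreal (indicator (D t) y * f (t, y)) \<partial>lborel) = (\<integral>\<^sup>+y. (\<Sum>z\<in>C. ennreal (?P z y)) \<partial>lborel)"
    proof (rule nn_integral_cong)
      show "ennreal (indicator (D t) y * f (t, y)) = (\<Sum>z\<in>C. ennreal (?P z y))" for y
        unfolding pt by (rule sum_ennreal[symmetric]) (rule Pn)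
    qed
    also have "\<dots> = (\<Sum>z\<in>C. (\<integral>\<^sup>+y. ennreal (?P z y) \<partial>lborel))" by (rule nn_integral_sum) (rule meas)
    also have "\<dots> = (\<Sum>z\<in>C. ennreal (G z t))" by (rule sum.cong) (use G(3)[OF CK TTT[OF t]] in auto)
    also have "\<dots> = ennreal (\<Sum>z\<in>C. G z t)" by (rule sum_ennreal) (rule G(2)[OF CK TTT[OF t]])
    finally show "(\<integral>\<^sup>+z. ennreal (indicator (D t) z * f (t, z)) \<partial>lborel) = ennreal (\<Sum>z\<in>C. G z t)" .
  qed
  then show ?thesis using T GC by blast
qed

section \<open>The geometry of the family near one fibre\<close>

lemma defining_function_direction:
  fixes \<Omega> :: "((complex ^ 'n) \<times> (complex ^ 'm)) set"
  assumes "defining_function 2 U \<Omega> W \<rho>" "t \<in> U" "z \<in> frontier (fiber \<Omega> t)" "(t, z) \<in> W"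
  shows "\<exists>e. frechet_derivative \<rho> (at (t, z)) (0, e) > 0"
proof -
  have rho: "Ck_on 2 W \<rho>" using assms(1) by (simp add: defining_function_def)
  note D = Ck_on_2_has_derivative(1)[OF rho assms(4)]
  have "((\<lambda>z'. (t, z')) has_derivative (\<lambda>h. (0, h))) (at z)" by (auto intro!: derivative_eq_intros)
  from diff_chain_at[OF this D] have "((\<lambda>z'. \<rho> (t, z')) has_derivative (\<lambda>h. frechet_derivative \<rho> (at (t, z)) (0, h))) (at z)"
    by (simp add: o_def)
  from frechet_derivative_at[OF this]
  have "(\<lambda>h. frechet_derivative \<rho> (at (t, z)) (0, h)) \<noteq> (\<lambda>_. 0)"
    using assms(1-3) unfolding defining_function_def by metis
  then obtain h where h: "frechet_derivative \<rho> (at (t, z)) (0, h) \<noteq> 0" by (auto simp: fun_eq_iff)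
  have "frechet_derivative \<rho> (at (t, z)) (- (0, h)) = - frechet_derivative \<rho> (at (t, z)) (0, h)"
    using has_derivative_linear[OF D] by (rule linear_neg)
  then have "frechet_derivative \<rho> (at (t, z)) (0, - h) = - frechet_derivative \<rho> (at (t, z)) (0, h)" by simp
  then show ?thesis using h by (cases "frechet_derivative \<rho> (at (t, z)) (0, h) > 0") (auto intro: exI[of _ "- h"])
qed

text \<open>Vanishing coordinates are moved slightly off 0, and the result is rotated to positive
  coordinates.\<close>

lemma Reinhardt_domain_has_logz_point:
  fixes D :: "(complex ^ 'm) set"
  assumes "Reinhardt_domain D"
  shows "\<exists>c. logz c \<in> D"
proof -
  have D: "open D" "D \<noteq> {}" using assms by (auto simp: Reinhardt_domain_def is_domain_def)
  then obtain z where z: "z \<in> D" by blast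
  obtain r where r: "r > 0" "ball z r \<subseteq> D" using D z openE by blast
  define s where "s = r / (real CARD('m) + 1)"
  have s: "s > 0" using r by (simp add: s_def)
  define w :: "complex ^ 'm" where "w = (\<chi> j. if z $ j = 0 then of_real s else z $ j)"
  have "cmod ((w - z) $ j) \<le> s" for j using s by (simp add: w_def)
  then have "norm (w - z) \<le> (\<Sum>j\<in>(UNIV::'m set). s)"
    unfolding norm_vec_def by (intro order_trans[OF L2_set_le_sum] sum_mono) auto
  also have "\<dots> < r" using r by (simp add: s_def field_simps)
  finally have wD: "w \<in> D" using r by (auto simp: dist_norm norm_minus_commute)
  have w0: "w $ j \<noteq> 0" for j using s by (simp add: w_def)
  define c :: "real ^ 'm" where "c = (\<chi> j. 2 * ln (cmod (w $ j)))"
  have "cmod (logz c $ j) = cmod (w $ j)" for j using w0[of j] by (simp add: c_def)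
  then obtain \<theta> where "logz c = torus_act \<theta> w" using torus_orbit by blast
  then show ?thesis using assms wD unfolding Reinhardt_domain_def by metis
qed

text \<open>Nearby fibres might a priori reach far away from the fibre over \<open>t0\<close>. They
  cannot: \<open>\<rho>\<close> is positive on a shell around that fibre for all nearby parameters,
  and a connected fibre containing the fixed point \<open>logz c\<close> cannot cross the
  shell.\<close>

lemma local_box:
  fixes \<Omega> :: "((complex ^ 'n) \<times> (complex ^ 'm)) set"
  assumes fam: "family_of_bounded_domains U \<Omega>" and def: "defining_function 2 U \<Omega> W \<rho>"
    and V: "closure_nhd U \<Omega> V" and Re: "\<forall>t\<in>U. Reinhardt_domain (fiber \<Omega> t)" and t0: "t0 \<in> U"
  shows "\<exists>B N c. open B \<and> t0 \<in> B \<and> B \<subseteq> U \<and> compact N \<and> B \<times> N \<subseteq> W \<inter> V \<and>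
    (\<forall>t\<in>B. fiber \<Omega> t \<subseteq> interior N \<and> (t, logz c) \<in> \<Omega>) \<and>
    (\<forall>t\<in>B. \<forall>z\<in>N. (t, z) \<in> \<Omega> \<longleftrightarrow> \<rho> (t, z) < 0) \<and>
    (\<forall>z\<in>N. \<rho> (t0, z) \<le> 0 \<longrightarrow> z \<in> interior N \<and>
      (\<rho> (t0, z) = 0 \<longrightarrow> (\<exists>e. frechet_derivative \<rho> (at (t0, z)) (0, e) > 0)))"
proof -
  have W: "open W" "closure \<Omega> \<inter> (U \<times> UNIV) \<subseteq> W" and rho: "Ck_on 2 W \<rho>" and Om: "\<Omega> = {x \<in> W. \<rho> x < 0}"
    using def by (auto simp: defining_function_def closure_nhd_def)
  have V': "open V" "closure \<Omega> \<inter> (U \<times> UNIV) \<subseteq> V" using V by (auto simp: closure_nhd_def)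
  have U: "open U" and oO: "open \<Omega>" and bdd: "bounded (fiber \<Omega> t0)"
    using fam t0 by (auto simp: family_of_bounded_domains_def family_of_domains_def is_domain_def)
  have crho: "continuous_on W \<rho>" using rho by (rule Ck_on_imp_continuous_on)
  define D0 where "D0 = fiber \<Omega> t0"
  have D0: "open D0" "D0 \<noteq> {}" using bspec[OF Re t0] by (auto simp: D0_def Reinhardt_domain_def is_domain_def)
  define K where "K = closure D0"
  have K: "compact K" "K \<noteq> {}" "D0 \<subseteq> K"
    using bdd D0 closure_subset by (auto simp: K_def D0_def compact_closure)
  have KW: "(t0, z) \<in> W \<inter> V" if z: "z \<in> K" for z
  proof -
    obtain x where x: "\<And>n. x n \<in> D0" "x \<longlonglongrightarrow> z" using z unfolding K_def closure_sequential by blast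
    have "(\<lambda>n. (t0, x n)) \<longlonglongrightarrow> (t0, z)" by (intro tendsto_intros x)
    moreover have "(t0, x n) \<in> \<Omega>" for n using x(1)[of n] by (simp add: D0_def fiber_def)
    ultimately have "(t0, z) \<in> closure \<Omega>"
      unfolding closure_sequential by (intro exI[of _ "\<lambda>n. (t0, x n)"]) simp
    then show ?thesis using W V' t0 by blast
  qed
  have fr: "\<exists>e. frechet_derivative \<rho> (at (t0, z)) (0, e) > 0" if "z \<in> K" "z \<notin> D0" for z
    using defining_function_direction[OF def t0, of z] that KW[OF that(1)] D0(1)
    by (simp add: K_def D0_def frontier_def interior_open)
  \<comment> \<open>Near a boundary point \<open>\<rho>\<close> decreases in direction
    \<open>- e\<close>, so a point with \<open>\<rho> \<le> 0\<close> is a limit of points of the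
    fibre; hence no spurious zeros of \<open>\<rho>\<close> accumulate at the closed fibre.\<close>
  have nhd: "\<exists>Oz. open Oz \<and> z \<in> Oz \<and> (\<forall>y\<in>Oz. (t0, y) \<in> W \<inter> V \<and> (\<rho> (t0, y) \<le> 0 \<longrightarrow> y \<in> K))" if z: "z \<in> K" for z
  proof (cases "z \<in> D0")
    case True then show ?thesis using D0(1) KW K(3) by blast
  next
    case False
    obtain e where e: "frechet_derivative \<rho> (at (t0, z)) (0, e) > 0" using fr[OF z False] by blast
    let ?D = "\<lambda>p. frechet_derivative \<rho> (at p) (0, e)"
    have cD: "continuous_on W ?D"
      using Ck_on_SucD rho unfolding Ck_on_2_iff by (blast intro: Ck_on_imp_continuous_on)
    have "open ({p \<in> W. 0 < ?D p} \<inter> V)" by (intro open_Int open_sublevel W V' cD)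
    moreover have "(t0, z) \<in> {p \<in> W. 0 < ?D p} \<inter> V" using KW[OF z] e by simp
    ultimately obtain T R where T: "open T" "t0 \<in> T" "R > 0" "T \<times> ball z R \<subseteq> {p \<in> W. 0 < ?D p} \<inter> V"
      by (rule open_prod_nhd)
    have "y \<in> K" if y: "y \<in> ball z R" "\<rho> (t0, y) \<le> 0" for y
    proof -
      have yW: "(t0, y) \<in> {p \<in> W. 0 < ?D p} \<inter> V" using T y by blast
      have "((\<lambda>s. \<rho> ((t0, y) + s *\<^sub>R (0, - e))) has_real_derivative frechet_derivative \<rho> (at (t0, y)) (0, - e)) (at 0)"
        using Ck_on_2_has_derivative(1)[OF rho, of "(t0, y)"] yW by (intro has_real_derivative_along_line) simp
      moreover have "frechet_derivative \<rho> (at (t0, y)) (0, - e) = - ?D (t0, y)"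
        using linear_neg[OF frechet_derivative_linear_2[OF rho, of "(t0, y)"], of "(0, e)"] yW by simp
      ultimately have "((\<lambda>s. \<rho> ((t0, y) + s *\<^sub>R (0, - e))) has_real_derivative - ?D (t0, y)) (at 0)" by simp
      from has_real_derivative_neg_dec_right[OF this] yW
      obtain d where d: "d > 0" "\<And>h. 0 < h \<Longrightarrow> h < d \<Longrightarrow> \<rho> (t0, y - h *\<^sub>R e) < \<rho> (t0, y)" by auto
      \<comment> \<open>The summand 2 keeps the step strictly below \<open>d\<close> already for
        \<open>n = 0\<close>.\<close>
      define x where "x = (\<lambda>n::nat. y - (d / real (n + 2)) *\<^sub>R e)"
      have "(\<lambda>n. d / real (n + 2)) \<longlonglongrightarrow> 0"
        using LIMSEQ_ignore_initial_segment[OF lim_const_over_n[of d], of 2] by simp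
      then have "x \<longlonglongrightarrow> y - 0 *\<^sub>R e" unfolding x_def by (intro tendsto_intros)
      then have lim: "x \<longlonglongrightarrow> y" by simp
      have "open ((\<lambda>y. (t0, y)) -` W)" by (intro open_vimage W continuous_intros)
      then have "\<forall>\<^sub>F n in sequentially. x n \<in> (\<lambda>y. (t0, y)) -` W"
        using lim yW by (auto dest!: topological_tendstoD)
      then obtain n0 where n0: "\<And>n. n \<ge> n0 \<Longrightarrow> (t0, x n) \<in> W" by (auto simp: eventually_sequentially)
      have "x (n + n0) \<in> D0" for n
      proof -
        have "\<rho> (t0, x (n + n0)) < \<rho> (t0, y)" 
        proof -
          have "0 < d / real (n + n0 + 2)" using d(1) by simp
          moreover have "d / real (n + n0 + 2) < d / 1" using d(1) by (intro divide_strict_left_mono) auto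
          ultimately show ?thesis unfolding x_def using d(2)[of "d / real (n + n0 + 2)"] by simp
        qed
        then have "(t0, x (n + n0)) \<in> \<Omega>" unfolding Om using n0[of "n + n0"] y(2) by auto
        then show ?thesis by (simp add: D0_def fiber_def)
      qed
      moreover have "(\<lambda>n. x (n + n0)) \<longlonglongrightarrow> y" using lim by (rule LIMSEQ_ignore_initial_segment)
      ultimately show ?thesis unfolding K_def closure_sequential by (intro exI[of _ "\<lambda>n. x (n + n0)"]) simp
    qed
    moreover have "(t0, y) \<in> W \<inter> V" if "y \<in> ball z R" for y using T that by blast
    ultimately show ?thesis using T(3) by (intro exI[of _ "ball z R"]) simp
  qed
  define Ou where "Ou = \<Union>{Oz. open Oz \<and> (\<forall>y\<in>Oz. (t0, y) \<in> W \<inter> V \<and> (\<rho> (t0, y) \<le> 0 \<longrightarrow> y \<in> K))}"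
  have Ou: "open Ou" "K \<subseteq> Ou" "\<And>y. y \<in> Ou \<Longrightarrow> (t0, y) \<in> W \<inter> V \<and> (\<rho> (t0, y) \<le> 0 \<longrightarrow> y \<in> K)"
  proof -
    show "open Ou" unfolding Ou_def by (rule open_Union) simp
    show "K \<subseteq> Ou" using nhd unfolding Ou_def by blast
    show "(t0, y) \<in> W \<inter> V \<and> (\<rho> (t0, y) \<le> 0 \<longrightarrow> y \<in> K)" if "y \<in> Ou" for y using that unfolding Ou_def by blast
  qed
  obtain \<epsilon> where eps: "\<epsilon> > 0" "(\<Union>x\<in>K. ball x \<epsilon>) \<subseteq> Ou"
    using compact_subset_open_imp_ball_epsilon_subset[OF K(1) Ou(1,2)] by blast
  \<comment> \<open>A compact tube around the closed fibre \<open>K\<close>; the open tube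
    \<open>N'\<close> and the shell \<open>S\<close> at distance \<open>\<epsilon> / 2\<close> serve
    to trap the nearby fibres.\<close>
  define N where "N = {y. infdist y K \<le> \<epsilon> / 2}"
  define N' where "N' = {y. infdist y K < \<epsilon> / 2}"
  define S where "S = {y. infdist y K = \<epsilon> / 2}"
  have cinf: "continuous_on UNIV (\<lambda>y. infdist y K)" by (intro continuous_intros)
  have N: "compact N" unfolding N_def using compact_infdist_le[OF K(2,1), of "\<epsilon> / 2"] eps(1) by simp
  have N': "open N'" unfolding N'_def by (intro open_Collect_less cinf continuous_on_const)
  have N'N: "N' \<subseteq> interior N" using N' by (intro interior_maximal) (auto simp: N_def N'_def)
  have KN': "K \<subseteq> N'" using eps(1) by (auto simp: N'_def)
  have NOu: "N \<subseteq> Ou"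
  proof
    fix y assume y: "y \<in> N"
    obtain x where x: "x \<in> K" "infdist y K = dist y x"
      using infdist_attains_inf[OF compact_imp_closed[OF K(1)] K(2), of y] by blast
    then have "y \<in> ball x \<epsilon>" using y eps(1) by (simp add: N_def dist_commute)
    then show "y \<in> Ou" using eps(2) x(1) by blast
  qed
  have S: "compact S"
  proof -
    have "closed S" unfolding S_def by (intro closed_Collect_eq cinf continuous_on_const)
    moreover have "S = N \<inter> S" by (auto simp: S_def N_def)
    ultimately show ?thesis using compact_Int_closed[OF N] by metis
  qed
  have SN: "S \<subseteq> N" by (auto simp: S_def N_def)
  have SK: "S \<inter> K = {}" using eps(1) by (auto simp: S_def)
  obtain c where c: "logz c \<in> D0" using Reinhardt_domain_has_logz_point[OF bspec[OF Re t0]] by (auto simp: D0_def)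
  have "open (W \<inter> V)" using W V' by blast
  moreover have "{t0} \<times> N \<subseteq> W \<inter> V" using Ou(3) NOu by blast
  ultimately obtain X1 where X1: "t0 \<in> X1" "open X1" "X1 \<times> N \<subseteq> W \<inter> V"
    using Elementary_Topology.tube_lemma[OF N] by blast
  have "open {p \<in> W. 0 < \<rho> p}" by (rule open_sublevel(2)[OF W(1) crho])
  moreover have "{t0} \<times> S \<subseteq> {p \<in> W. 0 < \<rho> p}"
    using Ou(3) NOu SN SK by (fastforce simp: not_le[symmetric])
  ultimately obtain X2 where X2: "t0 \<in> X2" "open X2" "X2 \<times> S \<subseteq> {p \<in> W. 0 < \<rho> p}"
    using Elementary_Topology.tube_lemma[OF S] by blast
  define X3 where "X3 = (\<lambda>t. (t, logz c)) -` \<Omega>"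
  have X3: "t0 \<in> X3" "open X3"
    using c by (auto simp: X3_def D0_def fiber_def intro!: open_vimage oO continuous_intros)
  define B where "B = U \<inter> X1 \<inter> X2 \<inter> X3"
  have fib: "fiber \<Omega> t \<subseteq> N'" if t: "t \<in> B" for t
  proof -
    have con: "connected (fiber \<Omega> t)" using Re t by (auto simp: B_def Reinhardt_domain_def is_domain_def)
    have op: "open {y. \<epsilon> / 2 < infdist y K}" by (intro open_Collect_less cinf continuous_on_const)
    have "y \<notin> S" if "y \<in> fiber \<Omega> t" for y
      using X2(3) t that unfolding Om by (auto simp: B_def fiber_def)
    then have cov: "fiber \<Omega> t \<subseteq> N' \<union> {y. \<epsilon> / 2 < infdist y K}" by (force simp: S_def N'_def)
    have "logz c \<in> N' \<inter> fiber \<Omega> t"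
      using c K(3) KN' t by (auto simp: B_def X3_def fiber_def)
    moreover have "N' \<inter> {y. \<epsilon> / 2 < infdist y K} \<inter> fiber \<Omega> t = {}" by (auto simp: N'_def)
    ultimately have "{y. \<epsilon> / 2 < infdist y K} \<inter> fiber \<Omega> t = {}"
      using connectedD[OF con N' op _ cov] by blast
    then show ?thesis using cov by blast
  qed
  have "open B" unfolding B_def using U X1 X2 X3 by auto
  moreover have "t0 \<in> B" unfolding B_def using t0 X1 X2 X3 by auto
  moreover have "B \<subseteq> U" by (auto simp: B_def)
  moreover have BN: "B \<times> N \<subseteq> W \<inter> V" using X1(3) by (auto simp: B_def)
  moreover have "\<forall>t\<in>B. fiber \<Omega> t \<subseteq> interior N \<and> (t, logz c) \<in> \<Omega>"
  proof
    fix t assume t: "t \<in> B"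
    have "fiber \<Omega> t \<subseteq> interior N" using fib[OF t] N'N by (rule order_trans)
    moreover have "(t, logz c) \<in> \<Omega>" using t by (simp add: B_def X3_def)
    ultimately show "fiber \<Omega> t \<subseteq> interior N \<and> (t, logz c) \<in> \<Omega>" by blast
  qed
  moreover have "\<forall>t\<in>B. \<forall>z\<in>N. (t, z) \<in> \<Omega> \<longleftrightarrow> \<rho> (t, z) < 0" using BN unfolding Om by blast
  moreover have "\<forall>z\<in>N. \<rho> (t0, z) \<le> 0 \<longrightarrow> z \<in> interior N \<and>
      (\<rho> (t0, z) = 0 \<longrightarrow> (\<exists>e. frechet_derivative \<rho> (at (t0, z)) (0, e) > 0))"
  proof (intro ballI impI)
    fix z assume z: "z \<in> N" "\<rho> (t0, z) \<le> 0"
    then have zK: "z \<in> K" using Ou(3) NOu by blast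
    have "\<exists>e. frechet_derivative \<rho> (at (t0, z)) (0, e) > 0" if "\<rho> (t0, z) = 0"
    proof (rule fr[OF zK])
      show "z \<notin> D0" using that unfolding D0_def fiber_def Om by simp
    qed
    then show "z \<in> interior N \<and> (\<rho> (t0, z) = 0 \<longrightarrow> (\<exists>e. frechet_derivative \<rho> (at (t0, z)) (0, e) > 0))"
      using zK KN' N'N by blast
  qed
  ultimately show ?thesis using N by blast
qed

section \<open>Strict plurisubharmonicity\<close>

lemma D2_expand:
  assumes "open S" "Ck_on 2 S f" "x \<in> S"
  shows "D2 f x v w = (\<Sum>i\<in>Basis. \<Sum>j\<in>Basis. (v \<bullet> i) * ((w \<bullet> j) * D2 f x i j))"
  unfolding sum_distrib_left[symmetric] linear_eq_sum_Basis[OF D2_linear_right[OF assms(2,3)], symmetric]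
  by (rule linear_eq_sum_Basis[OF D2_linear_left[OF assms]])

text \<open>Joint continuity in point and direction is what allows Levi forms to be compared over a
  compact set of points and unit vectors.\<close>

lemma levi_jointly_continuous:
  assumes L: "bounded_linear L" and S: "open S" "Ck_on 2 S f"
  shows "continuous_on (S \<times> UNIV) (\<lambda>p. levi L f (fst p) (snd p))"
proof -
  have c: "continuous_on (S \<times> UNIV) (\<lambda>p. D2 f (fst p) i j)" for i j
    by (rule continuous_on_compose2[OF D2_continuous_on[OF S(2)]]) (auto intro!: continuous_intros)
  have cL: "continuous_on (S \<times> UNIV) (\<lambda>p. L (snd p))"
    by (intro bounded_linear.continuous_on[OF L] continuous_intros)
  have eq: "levi L f (fst p) (snd p) =
     (\<Sum>i\<in>Basis. \<Sum>j\<in>Basis. (snd p \<bullet> i) * ((snd p \<bullet> j) * D2 f (fst p) i j)) +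
     (\<Sum>i\<in>Basis. \<Sum>j\<in>Basis. (L (snd p) \<bullet> i) * ((L (snd p) \<bullet> j) * D2 f (fst p) i j))"
    if "p \<in> S \<times> UNIV" for p
  proof -
    have p: "fst p \<in> S" using that by auto
    show ?thesis unfolding levi_def
      by (rule arg_cong2[where f="(+)"]; rule D2_expand[OF S p])
  qed
  have "continuous_on (S \<times> UNIV) (\<lambda>p.
     (\<Sum>i\<in>Basis. \<Sum>j\<in>Basis. (snd p \<bullet> i) * ((snd p \<bullet> j) * D2 f (fst p) i j)) +
     (\<Sum>i\<in>Basis. \<Sum>j\<in>Basis. (L (snd p) \<bullet> i) * ((L (snd p) \<bullet> j) * D2 f (fst p) i j)))"
    by (intro continuous_intros c cL)
  then show ?thesis by (rule continuous_on_eq) (rule eq[symmetric])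
qed

lemma levi_compose_linear:
  assumes "open S" "Ck_on 2 S f" "bounded_linear L" "L x \<in> S" "\<And>b. L (J b) = J (L b)"
  shows "levi J (\<lambda>y. f (L y)) x b = levi J f (L x) (L b)"
  unfolding levi_def D2_compose_linear[OF assms(1-4)] assms(5) ..

lemma levi_cong_open:
  assumes "open S" "x \<in> S" "\<And>y. y \<in> S \<Longrightarrow> f y = g y"
  shows "levi J f x b = levi J g x b"
  unfolding levi_def by (simp only: D2_cong_open[OF assms])

lemma bounded_linear_torus_act: "bounded_linear (\<lambda>p. (fst p, torus_act \<theta> (snd p)))"
proof -
  have "linear (torus_act \<theta>)"
    by (rule linearI) (simp_all add: torus_act_def vec_eq_iff algebra_simps)
  then have "bounded_linear (torus_act \<theta>)" by (simp add: linear_conv_bounded_linear)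
  then show ?thesis
    by (intro bounded_linear_Pair bounded_linear_fst bounded_linear_compose[OF _ bounded_linear_snd])
qed

lemma JP_torus_act: "JP (fst b, torus_act \<theta> (snd b)) = (fst (JP b), torus_act \<theta> (snd (JP b)))"
  by (simp add: JP_def torus_act_def vec_eq_iff algebra_simps)

lemma norm_vector_smult: "norm (\<zeta> *s b) = cmod \<zeta> * norm (b :: complex ^ 'n)"
  by (simp add: norm_vec_def norm_mult L2_set_left_distrib[symmetric] L2_set_right_distrib)

text \<open>Squared moduli keep it smooth on the coordinate hyperplanes; its small sublevel sets are
  torus-invariant neighbourhoods of the orbit of \<open>w\<close>.\<close>

definition moddist :: "complex ^ 'm \<Rightarrow> complex ^ 'm \<Rightarrow> real" where
  "moddist w z = (\<Sum>j\<in>UNIV. ((cmod (z $ j))\<^sup>2 - (cmod (w $ j))\<^sup>2)\<^sup>2)"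

lemma Ck_on_moddist: "open S \<Longrightarrow> Ck_on k S (\<lambda>p. moddist w (snd p))"
proof -
  assume S: "open S"
  have 1: "Ck_on k S (\<lambda>p. (cmod (snd p $ j))\<^sup>2)" for j
    by (rule Ck_on_compose[OF S Ck_on_cmod_square[OF open_UNIV] Ck_map_linear[OF S]])
      (auto intro: bounded_linear_compose[OF bounded_linear_vec_nth bounded_linear_snd])
  then show ?thesis unfolding moddist_def
    by (intro Ck_on_sum[OF S] Ck_on_power[OF S Ck_on_diff[OF S 1 Ck_on_const[OF S]]])
qed

lemma continuous_on_moddist: "continuous_on S (moddist w)"
  unfolding moddist_def by (intro continuous_intros)

text \<open>For nonnegative \<open>a\<close> and \<open>b\<close>,
  \<open>(b - a)\<^sup>2 \<le> |b\<^sup>2 - a\<^sup>2|\<close>; hence the fourth power of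
  \<open>\<sigma>\<close>. The point \<open>z'\<close> has the moduli of \<open>z\<close> and the
  arguments of \<open>w\<close>.\<close>

lemma moddist_near:
  fixes w :: "complex ^ 'm"
  assumes R: "R > 0"
  shows "\<exists>s>0. \<forall>z. moddist w z \<le> s \<longrightarrow> (\<exists>z'\<in>ball w R. \<forall>j. cmod (z' $ j) = cmod (z $ j))"
proof -
  define \<sigma> where "\<sigma> = R / (real CARD('m) + 1)"
  have s: "\<sigma> > 0" using R by (simp add: \<sigma>_def)
  have "\<exists>z'\<in>ball w R. \<forall>j. cmod (z' $ j) = cmod (z $ j)" if z: "moddist w z \<le> \<sigma> ^ 4" for z
  proof -
    define z' :: "complex ^ 'm" where "z' = (\<chi> j. of_real (cmod (z $ j)) * cis (Arg (w $ j)))"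
    have "cmod ((w - z') $ j) \<le> \<sigma>" for j
    proof -
      define a b where "a = cmod (z $ j)" and "b = cmod (w $ j)"
      have ab: "a \<ge> 0" "b \<ge> 0" by (simp_all add: a_def b_def)
      have "w $ j = of_real b * cis (Arg (w $ j))" unfolding b_def
        by (simp add: rcis_cmod_Arg[unfolded rcis_def])
      then have "(w - z') $ j = of_real (b - a) * cis (Arg (w $ j))"
        by (simp add: z'_def a_def left_diff_distrib)
      then have eq: "cmod ((w - z') $ j) = \<bar>b - a\<bar>" by (simp only: norm_mult norm_of_real norm_cis mult_1_right)
      have "(b - a)\<^sup>2 = \<bar>b - a\<bar> * \<bar>b - a\<bar>" by (simp add: power2_eq_square)
      also have "\<dots> \<le> \<bar>b - a\<bar> * (b + a)" using ab by (intro mult_left_mono) auto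
      also have "\<dots> = \<bar>b\<^sup>2 - a\<^sup>2\<bar>" using ab
        by (simp add: power2_eq_square square_diff_square_factored abs_mult)
      finally have "((b - a)\<^sup>2)\<^sup>2 \<le> \<bar>b\<^sup>2 - a\<^sup>2\<bar>\<^sup>2" by (intro power_mono) auto
      also have "\<dots> = (a\<^sup>2 - b\<^sup>2)\<^sup>2" by (simp only: power2_abs power2_commute)
      also have "\<dots> \<le> moddist w z" unfolding moddist_def a_def b_def
        by (rule member_le_sum) auto
      finally have le: "((b - a)\<^sup>2)\<^sup>2 \<le> moddist w z" .
      have "\<bar>b - a\<bar> ^ (2 * 2) = ((b - a)\<^sup>2)\<^sup>2" by (simp only: power_mult power2_abs)
      then have A: "\<bar>b - a\<bar> ^ 4 = ((b - a)\<^sup>2)\<^sup>2" by (simp only: mult_2 numeral_Bit0[symmetric] numeral_plus_numeral add_num_simps)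
      have 4: "Suc 3 = (4::nat)" by simp
      have "\<bar>b - a\<bar> ^ Suc 3 \<le> \<sigma> ^ Suc 3" unfolding 4 A using le z by (rule order_trans)
      then show ?thesis unfolding eq by (rule power_le_imp_le_base) (use s in simp)
    qed
    then have "norm (w - z') \<le> (\<Sum>j\<in>(UNIV::'m set). \<sigma>)"
      unfolding norm_vec_def by (intro order_trans[OF L2_set_le_sum] sum_mono) auto
    also have "\<dots> < R" using R by (simp add: \<sigma>_def field_simps)
    finally have "z' \<in> ball w R" by (simp add: dist_norm)
    moreover have "cmod (z' $ j) = cmod (z $ j)" for j by (simp add: z'_def norm_mult)
    ultimately show ?thesis by blast
  qed
  then show ?thesis using s by (intro exI[of _ "\<sigma> ^ 4"]) simp
qed

text \<open>Provides a point at which the monomial in the weight does not vanish, even if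
  \<open>w\<close> has zero coordinates.\<close>

lemma moddist_generic:
  fixes w :: "complex ^ 'm"
  assumes s: "s > 0"
  shows "\<exists>z. moddist w z < s \<and> (\<forall>j. z $ j \<noteq> 0)"
proof -
  define \<sigma> where "\<sigma> = min 1 (s / (real CARD('m) + 1))"
  have \<sigma>: "0 < \<sigma>" "\<sigma> \<le> 1" "\<sigma> \<le> s / (real CARD('m) + 1)" using s by (auto simp: \<sigma>_def)
  define z :: "complex ^ 'm" where "z = (\<chi> j. if w $ j = 0 then of_real \<sigma> else w $ j)"
  have s4: "\<sigma> ^ 4 \<le> \<sigma>" using \<sigma> power_decreasing[of 1 4 \<sigma>] by simp
  have "((cmod (z $ j))\<^sup>2 - (cmod (w $ j))\<^sup>2)\<^sup>2 \<le> \<sigma>" for j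
    using \<sigma> s4 by (simp add: z_def)
  then have "moddist w z \<le> (\<Sum>j\<in>(UNIV::'m set). \<sigma>)" unfolding moddist_def by (intro sum_mono)
  also have "\<dots> = real CARD('m) * \<sigma>" by simp
  also have "\<dots> \<le> real CARD('m) * (s / (real CARD('m) + 1))" using \<sigma> by (intro mult_left_mono) auto
  also have "\<dots> < s" using s by (simp add: field_simps)
  finally show ?thesis using \<sigma> by (intro exI[of _ z]) (simp add: z_def)
qed

section \<open>The perturbation argument at one parameter\<close>

context reinhardt_weight
begin

text \<open>The bump function lives on an invariant set, while \<open>O'\<close> need not be
  invariant. As \<open>\<phi>\<close> is invariant and rotations are complex linear, strict
  positivity of the Levi form spreads along the orbits.\<close>

lemma strict_levi_nhd:
  assumes t0: "t0 \<in> B" and O': "open O'" "O' \<subseteq> \<Omega>" "(t0, z0) \<in> O'"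
    and str: "\<forall>x\<in>O'. \<forall>b. b \<noteq> 0 \<longrightarrow> levi JP \<phi> x b > 0"
  shows "\<exists>s>0. \<exists>T. open T \<and> t0 \<in> T \<and> T \<subseteq> B \<and> (\<forall>t\<in>T. \<forall>z. moddist z0 z \<le> s \<longrightarrow>
    (t, z) \<in> \<Omega> \<and> (\<forall>b. b \<noteq> 0 \<longrightarrow> levi JP \<phi> (t, z) b > 0))"
proof -
  obtain T R where TR: "open T" "t0 \<in> T" "R > 0" "T \<times> ball z0 R \<subseteq> O'" using O'(1,3) by (rule open_prod_nhd)
  obtain s where s: "s > 0" "\<And>z. moddist z0 z \<le> s \<Longrightarrow> \<exists>z'\<in>ball z0 R. \<forall>j. cmod (z' $ j) = cmod (z $ j)"
    using moddist_near[OF TR(3), of z0] by blast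
  have "(t, z) \<in> \<Omega> \<and> (\<forall>b. b \<noteq> 0 \<longrightarrow> levi JP \<phi> (t, z) b > 0)" if t: "t \<in> T \<inter> B" and z: "moddist z0 z \<le> s" for t z
  proof -
    obtain z' where z': "z' \<in> ball z0 R" "\<And>j. cmod (z' $ j) = cmod (z $ j)" using s(2)[OF z] by blast
    have zO: "(t, z') \<in> O'" using TR(4) z'(1) t by blast
    have tB: "t \<in> B" using t by blast
    have zOm': "(t, z') \<in> \<Omega>" using zO O'(2) by blast
    have zOm: "(t, z) \<in> \<Omega>" using cmod_cong[OF tB z'(2)] zOm' by blast
    obtain \<theta> where th: "z = torus_act \<theta> z'" using torus_orbit[of z z'] z'(2) by auto
    define A where "A = (\<lambda>p :: (complex ^ 'n) \<times> (complex ^ 'm). (fst p, torus_act \<theta> (snd p)))"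
    have inV: "x \<in> V" if "x \<in> \<Omega>" "fst x \<in> B" for x
      using BN_V Omega_N[of "fst x" "snd x"] that by (cases x) auto
    define S where "S = \<Omega> \<inter> (B \<times> UNIV)"
    have S: "open S" unfolding S_def using open_Omega open_B by (auto intro: open_Times)
    have phiA: "\<phi> y = \<phi> (A y)" if "y \<in> S" for y
      using that phi_inv[of "fst y" "snd y" "torus_act \<theta> (snd y)"]
      by (cases y) (auto simp: S_def A_def torus_act_def norm_mult)
    have Az: "A (t, z') = (t, z)" by (simp add: A_def th)
    have "levi JP \<phi> (t, z') b = levi JP (\<lambda>y. \<phi> (A y)) (t, z') b" for b
      by (rule levi_cong_open[OF S _ phiA]) (use zOm' tB in \<open>auto simp: S_def\<close>)
    also have "levi JP (\<lambda>y. \<phi> (A y)) (t, z') b = levi JP \<phi> (A (t, z')) (A b)" for b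
    proof (rule levi_compose_linear[OF open_V Ck_phi])
      show "bounded_linear A" unfolding A_def by (rule bounded_linear_torus_act)
      show "A (t, z') \<in> V" unfolding Az using inV[OF zOm] tB by simp
      show "A (JP b) = JP (A b)" for b unfolding A_def by (rule JP_torus_act[symmetric])
    qed
    finally have eq: "levi JP \<phi> (t, z') b = levi JP \<phi> (t, z) (A b)" for b by (simp add: Az)
    have "levi JP \<phi> (t, z) b > 0" if b: "b \<noteq> 0" for b
    proof -
      define b' where "b' = (fst b, torus_act (- \<theta>) (snd b))"
      have "cis (\<theta> $ j) * (cis (- (\<theta> $ j)) * x) = x" for j x
        by (simp add: mult.assoc[symmetric] cis_mult)
      then have Ab: "A b' = b" by (cases b) (simp add: A_def b'_def torus_act_def vec_eq_iff)
      have "A 0 = 0" by (simp add: A_def torus_act_def vec_eq_iff zero_prod_def)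
      then have "b' \<noteq> 0" using b Ab by auto
      then have "levi JP \<phi> (t, z') b' > 0" using str zO by blast
      then show ?thesis using eq[of b'] Ab by simp
    qed
    then show ?thesis using zOm by blast
  qed
  then show ?thesis using s(1) TR(1,2) t0 open_B
    by (intro exI[of _ s] conjI exI[of _ "T \<inter> B"]) auto
qed

text \<open>Squaring the monomial leaves only powers of the smooth functions
  \<open>(cmod z)\<^sup>2\<close>, also for odd exponents.\<close>

lemma Ck_weight: "Ck_on 2 V weight"
proof -
  have 1: "Ck_on 2 V (\<lambda>p. (cmod (snd p $ j))\<^sup>2)" for j
    by (rule Ck_on_compose[OF open_V Ck_on_cmod_square[OF open_UNIV] Ck_map_linear[OF open_V]])
      (auto intro: bounded_linear_compose[OF bounded_linear_vec_nth bounded_linear_snd])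
  have "weight = (\<lambda>p. (\<Prod>j\<in>UNIV. ((cmod (snd p $ j))\<^sup>2) ^ k j) * exp (- \<phi> p))"
    by (simp add: weight_def fun_eq_iff prod_power_distrib power_mult[symmetric] mult.commute)
  then show ?thesis
    by (simp only:) (intro Ck_on_mult Ck_on_prod Ck_on_power Ck_on_exp Ck_on_uminus Ck_phi open_V 1)
qed

lemma nn_integral_weight: "t \<in> B \<Longrightarrow> (\<integral>\<^sup>+z. ennreal (indicator (fiber \<Omega> t) z * weight (t, z)) \<partial>lborel) = ennreal (Iw t)"
  unfolding Iw_def set_lebesgue_integral_def
  using nn_integral_eq_integral[OF weight_integrable] by (simp add: weight_nonneg)

lemma Iw_Ck:
  assumes t0: "t0 \<in> B" and bd: "\<forall>z\<in>N. \<rho> (t0, z) \<le> 0 \<longrightarrow> z \<in> interior N \<and>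
      (\<rho> (t0, z) = 0 \<longrightarrow> (\<exists>e. frechet_derivative \<rho> (at (t0, z)) (0, e) > 0))"
  shows "\<exists>T. open T \<and> t0 \<in> T \<and> T \<subseteq> B \<and> Ck_on 2 T Iw"
proof -
  have "\<exists>T G. open T \<and> t0 \<in> T \<and> T \<subseteq> B \<and> Ck_on 2 T G \<and> (\<forall>t\<in>T. G t \<ge> 0 \<and>
    (\<integral>\<^sup>+z. ennreal (indicator (fiber \<Omega> t) z * weight (t, z)) \<partial>lborel) = ennreal (G t))"
  proof (rule sublevel_integral_Ck[of "W \<inter> V" \<rho> weight N B t0 "fiber \<Omega>"])
    show "open (W \<inter> V)" using open_W open_V by blast
    show "Ck_on 2 (W \<inter> V) \<rho>" using Ck_rho by (rule Ck_on_subset) blast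
    show "Ck_on 2 (W \<inter> V) weight" using Ck_weight by (rule Ck_on_subset) blast
    show "B \<times> N \<subseteq> W \<inter> V" using BN BN_V by blast
    show "fiber \<Omega> t \<subseteq> N" if "t \<in> B" for t using fiber_N[OF that] interior_subset by blast
    show "z \<in> fiber \<Omega> t \<longleftrightarrow> \<rho> (t, z) < 0" if "t \<in> B" "z \<in> N" for t z
      using Omega_iff[OF that] by (simp add: fiber_def)
  qed (use weight_nonneg compact_N open_B t0 bd in auto)
  then obtain T G where T: "open T" "t0 \<in> T" "T \<subseteq> B" "Ck_on 2 T G"
    and G: "\<And>t. t \<in> T \<Longrightarrow> G t \<ge> 0 \<and>
      (\<integral>\<^sup>+z. ennreal (indicator (fiber \<Omega> t) z * weight (t, z)) \<partial>lborel) = ennreal (G t)" by blast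
  have "G t = Iw t" if t: "t \<in> T" for t
  proof -
    have tB: "t \<in> B" using t T(3) by blast
    have "ennreal (G t) = ennreal (Iw t)" using G[OF t] nn_integral_weight[OF tB] by simp
    then show ?thesis using G[OF t] Iw_pos[OF tB] by (simp add: ennreal_inj)
  qed
  then have "Ck_on 2 T Iw" by (rule Ck_on_cong[OF T(1) _ T(4)])
  then show ?thesis using T by blast
qed

lemma Iw_strict:
  assumes t0: "t0 \<in> B" and bd: "\<forall>z\<in>N. \<rho> (t0, z) \<le> 0 \<longrightarrow> z \<in> interior N \<and>
      (\<rho> (t0, z) = 0 \<longrightarrow> (\<exists>e. frechet_derivative \<rho> (at (t0, z)) (0, e) > 0))"
    and O': "open O'" "O' \<subseteq> \<Omega>" "(t0, z0) \<in> O'"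
    and str: "\<forall>x\<in>O'. \<forall>b. b \<noteq> 0 \<longrightarrow> levi JP \<phi> x b > 0"
  shows "\<exists>T. open T \<and> t0 \<in> T \<and> T \<subseteq> B \<and> Ck_on 2 T Iw \<and>
    (\<forall>b. b \<noteq> 0 \<longrightarrow> levi ((*s) \<i>) (\<lambda>t. - ln (Iw t)) t0 b > 0)"
proof -
  obtain s T where s: "s > 0" and T: "open T" "t0 \<in> T" "T \<subseteq> B"
    and nhd: "\<forall>t\<in>T. \<forall>z. moddist z0 z \<le> s \<longrightarrow> (t, z) \<in> \<Omega> \<and> (\<forall>b. b \<noteq> 0 \<longrightarrow> levi JP \<phi> (t, z) b > 0)"
    using strict_levi_nhd[OF t0 O' str] by (elim exE conjE) (rule that)
  have sT: "(t, z) \<in> \<Omega>" "b \<noteq> 0 \<Longrightarrow> levi JP \<phi> (t, z) b > 0" if "t \<in> T" "moddist z0 z \<le> s" for t z b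
    using bspec[OF nhd that(1)] that(2) by blast+
  obtain TI where TI: "open TI" "t0 \<in> TI" "TI \<subseteq> B" "Ck_on 2 TI Iw" using Iw_Ck[OF t0 bd] by blast
  obtain r where r: "r > 0" "cball t0 r \<subseteq> T"
    using T(1,2) open_contains_cball by blast
  define \<xi> where "\<xi> = (\<lambda>z. pos_cube (s - moddist z0 z))"
  \<comment> \<open>Quadratic growth in \<open>t\<close> is the rate that a lower bound for the Levi
    form at \<open>t0\<close> requires.\<close>
  define \<eta> where "\<eta> = (\<lambda>p :: (complex ^ 'n) \<times> (complex ^ 'm). (norm (fst p - t0))\<^sup>2 * \<xi> (snd p))"
  have chiC: "Ck_on 2 S (\<lambda>p. \<xi> (snd p))" if "open S" for S :: "((complex ^ 'n) \<times> (complex ^ 'm)) set"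
    unfolding \<xi>_def by (intro Ck_on_pos_cube Ck_on_diff Ck_on_const Ck_on_moddist that)
  have etaC: "Ck_on 2 S \<eta>" if S: "open S" for S
  proof -
    have "Ck_on 2 S (\<lambda>p. (norm (fst p - t0))\<^sup>2)"
      by (rule Ck_on_compose[OF S Ck_on_norm_square[OF open_UNIV] Ck_map_linear[OF S bounded_linear_fst]]) simp
    then show ?thesis unfolding \<eta>_def by (intro Ck_on_mult S chiC)
  qed
  have chi_nonneg: "\<xi> z \<ge> 0" for z by (simp add: \<xi>_def pos_cube_simps)
  have chi_pos: "\<xi> z > 0 \<longleftrightarrow> moddist z0 z < s" for z
    using pos_cube_simps(1,2)[of "s - moddist z0 z"] by (cases "moddist z0 z < s") (auto simp: \<xi>_def)
  have blJ: "bounded_linear (JP :: (complex ^ 'n) \<times> (complex ^ 'm) \<Rightarrow> _)"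
    using cplx_struct_JP unfolding cplx_struct_def by blast
  define Q where "Q = {z. moddist z0 z \<le> s}"
  have QN: "Q \<subseteq> N" using sT(1)[OF T(2)] Omega_N[OF t0] by (auto simp: Q_def)
  have "closed Q" unfolding Q_def by (intro closed_Collect_le continuous_on_moddist continuous_on_const)
  then have "compact (N \<inter> Q)" by (rule compact_Int_closed[OF compact_N])
  moreover have "N \<inter> Q = Q" using QN by blast
  ultimately have Q: "compact Q" by simp
  \<comment> \<open>By homogeneity only unit vectors matter. On this compact set the Levi form of
    \<open>\<phi>\<close> has a positive minimum and that of \<open>\<eta>\<close> a finite maximum,
    which yields \<open>\<epsilon>\<close>.\<close>
  define Kc where "Kc = (cball t0 r \<times> Q) \<times> sphere (0 :: (complex ^ 'n) \<times> (complex ^ 'm)) 1"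
  have Kc: "compact Kc" unfolding Kc_def by (intro compact_Times Q compact_cball compact_sphere)
  have KcV: "Kc \<subseteq> V \<times> UNIV" using BN_V QN r T(3) unfolding Kc_def by blast
  define lp le where "lp = (\<lambda>p. levi JP \<phi> (fst p) (snd p))" and "le = (\<lambda>p. levi JP \<eta> (fst p) (snd p))"
  have clp: "continuous_on Kc lp" unfolding lp_def
    by (rule continuous_on_subset[OF levi_jointly_continuous[OF blJ open_V Ck_phi] KcV])
  have cle: "continuous_on Kc le" unfolding le_def
    by (rule continuous_on_subset[OF levi_jointly_continuous[OF blJ open_UNIV etaC[OF open_UNIV]]]) simp
  obtain \<epsilon> where eps: "\<epsilon> > 0" "\<And>p. p \<in> Kc \<Longrightarrow> \<epsilon> * le p \<le> lp p"
  proof (cases "Kc = {}")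
    case True then show ?thesis using that[of 1] by simp
  next
    case False
    obtain p0 where p0: "p0 \<in> Kc" "\<And>p. p \<in> Kc \<Longrightarrow> lp p0 \<le> lp p"
      using continuous_attains_inf[OF Kc False clp] by blast
    obtain p1 where p1: "p1 \<in> Kc" "\<And>p. p \<in> Kc \<Longrightarrow> le p \<le> le p1"
      using continuous_attains_sup[OF Kc False cle] by blast
    have m: "lp p0 > 0"
    proof -
      have "fst (fst p0) \<in> T" "moddist z0 (snd (fst p0)) \<le> s" "snd p0 \<noteq> 0"
        using p0(1) r by (auto simp: Kc_def Q_def)
      from sT(2)[OF this] show ?thesis by (simp add: lp_def)
    qed
    define e where "e = lp p0 / (\<bar>le p1\<bar> + 1)"
    have e: "e > 0" using m by (simp add: e_def)
    show ?thesis
    proof (rule that[OF e])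
      fix p assume p: "p \<in> Kc"
      have "e * le p \<le> e * (\<bar>le p1\<bar> + 1)" using p1(2)[OF p] e by (intro mult_left_mono) auto
      also have "\<dots> = lp p0" by (simp add: e_def)
      also have "\<dots> \<le> lp p" by (rule p0(2)[OF p])
      finally show "e * le p \<le> lp p" .
    qed
  qed
  define B' where "B' = ball t0 r"
  have B'T: "t \<in> T" if "t \<in> B'" for t using that r(2) by (auto simp: B'_def)
  have B'B: "t \<in> B" if "t \<in> B'" for t using B'T[OF that] T(3) by blast
  define \<phi>' where "\<phi>' = (\<lambda>p. \<phi> p + (- \<epsilon>) * \<eta> p)"
  have Ck_eta': "Ck_on 2 V (\<lambda>p. (- \<epsilon>) * \<eta> p)" by (intro Ck_on_mult Ck_on_const etaC open_V)
  have levi': "levi JP \<phi>' (t, z) b \<ge> 0" if t: "t \<in> B'" and z: "(t, z) \<in> \<Omega>" for t z b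
  proof -
    have V: "(t, z) \<in> V" using BN_V Omega_N[OF B'B[OF t] z] B'B[OF t] by blast
    have eq: "levi JP \<phi>' (t, z) b = levi JP \<phi> (t, z) b + (- \<epsilon>) * levi JP \<eta> (t, z) b"
      unfolding \<phi>'_def levi_add[OF open_V Ck_phi Ck_eta' V] levi_cmult[OF open_V etaC[OF open_V] V] ..
    show ?thesis
    proof (cases "moddist z0 z \<le> s")
      case True
      have sc: "levi JP f (t, z) b = (norm b)\<^sup>2 * levi JP f (t, z) (sgn b)" if "Ck_on 2 V f" for f
        using levi_scaleR[OF cplx_struct_JP open_V that V, of "norm b" "sgn b"]
        by (cases "b = 0") (simp_all add: sgn_div_norm)
      have "(norm b)\<^sup>2 * (\<epsilon> * levi JP \<eta> (t, z) (sgn b)) \<le> (norm b)\<^sup>2 * levi JP \<phi> (t, z) (sgn b)"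
      proof (cases "b = 0")
        case False
        have "((t, z), sgn b) \<in> Kc" using t True False by (simp add: Kc_def Q_def B'_def norm_sgn)
        then show ?thesis using eps(2)[of "((t, z), sgn b)"] by (intro mult_left_mono) (auto simp: lp_def le_def)
      qed simp
      then show ?thesis unfolding eq sc[OF Ck_phi] sc[OF etaC[OF open_V]] by (simp add: algebra_simps)
    next
      case False
      \<comment> \<open>Off the closed support, \<open>\<eta>\<close> vanishes on a whole
        neighbourhood, and with it its Levi form.\<close>
      define S where "S = {p :: (complex ^ 'n) \<times> (complex ^ 'm). s < moddist z0 (snd p)}"
      have S: "open S" unfolding S_def
        by (intro open_Collect_less continuous_on_const Ck_on_imp_continuous_on[OF Ck_on_moddist[OF open_UNIV, of 0]])
      have zS: "(t, z) \<in> S" using False by (simp add: S_def)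
      have "levi JP \<eta> (t, z) b = levi JP (\<lambda>p. 0 * \<eta> p) (t, z) b"
        by (rule levi_cong_open[OF S zS]) (simp add: \<eta>_def \<xi>_def S_def pos_cube_simps)
      also have "\<dots> = 0" unfolding levi_cmult[OF S etaC[OF S] zS] by simp
      finally show ?thesis unfolding eq using levi_phi[OF B'B[OF t] z] by simp
    qed
  qed
  \<comment> \<open>The perturbed weight satisfies the same hypotheses over \<open>B'\<close>, so
    positivity, smoothness and the submean inequality are available for its integral
    \<open>P.Iw\<close>.\<close>
  interpret P: reinhardt_weight \<Omega> W \<rho> B' N c V \<phi>' k
  proof unfold_locales
    show "open \<Omega>" by (rule open_Omega)
    show "open W" by (rule open_W)
    show "open B'" by (simp add: B'_def)
    show "compact N" by (rule compact_N)
    show "B' \<times> N \<subseteq> W" using BN B'B by blast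
    show "Ck_on 2 W \<rho>" by (rule Ck_rho)
    show "levi JP \<rho> x b \<ge> 0" if "x \<in> W" for x b using that by (rule levi_rho)
    show "fiber \<Omega> t \<subseteq> interior N" if "t \<in> B'" for t using fiber_N[OF B'B[OF that]] .
    show "(t, z) \<in> \<Omega> \<longleftrightarrow> \<rho> (t, z) < 0" if "t \<in> B'" "z \<in> N" for t z
      using Omega_iff[OF B'B[OF that(1)] that(2)] .
    show "(t, logz c) \<in> \<Omega>" if "t \<in> B'" for t using base[OF B'B[OF that]] .
    show "Reinhardt_domain (fiber \<Omega> t)" if "t \<in> B'" for t using Reinhardt[OF B'B[OF that]] .
    show "open V" by (rule open_V)
    show "B' \<times> N \<subseteq> V" using BN_V B'B by blast
    show "Ck_on 2 V \<phi>'" unfolding \<phi>'_def by (rule Ck_on_add[OF open_V Ck_phi Ck_eta'])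
    show "levi JP \<phi>' (t, z) b \<ge> 0" if "t \<in> B'" "(t, z) \<in> \<Omega>" for t z b using that by (rule levi')
    show "\<phi>' (t, z) = \<phi>' (t, w)" if "t \<in> B'" "(t, z) \<in> \<Omega>" "\<And>j. cmod (z $ j) = cmod (w $ j)" for t z w
    proof -
      have "\<phi> (t, z) = \<phi> (t, w)" using phi_inv[OF B'B[OF that(1)] that(2,3)] .
      moreover have "\<xi> z = \<xi> w" using that(3) by (simp add: \<xi>_def moddist_def)
      ultimately show ?thesis by (simp add: \<phi>'_def \<eta>_def)
    qed
  qed
  have t0B': "t0 \<in> B'" using r(1) by (simp add: B'_def)
  obtain TP where TP: "open TP" "t0 \<in> TP" "TP \<subseteq> B'" "Ck_on 2 TP P.Iw" using P.Iw_Ck[OF t0B' bd] by blast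
  have Pw: "P.weight p = weight p * exp (\<epsilon> * \<eta> p)" for p
  proof -
    have "exp (- \<phi>' p) = exp (- \<phi> p) * exp (\<epsilon> * \<eta> p)" by (simp add: \<phi>'_def exp_add[symmetric])
    then show ?thesis unfolding P.weight_def weight_def by (simp only: mult.assoc)
  qed
  have P0: "P.Iw t0 = Iw t0" unfolding P.Iw_def Iw_def Pw by (simp add: \<eta>_def)
  obtain z1 where z1: "moddist z0 z1 < s" "\<And>j. z1 $ j \<noteq> 0" using moddist_generic[OF s] by blast
  define \<omega> where "\<omega> = (\<lambda>p. \<xi> (snd p) * weight p)"
  have com: "continuous_on V \<omega>" unfolding \<omega>_def
    by (intro continuous_on_mult Ck_on_imp_continuous_on[OF Ck_weight] Ck_on_imp_continuous_on[OF chiC[OF open_V]])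
  define w0 where "w0 = \<omega> (t0, z1) / 2"
  have w0: "w0 > 0" using z1 chi_pos[of z1] unfolding w0_def \<omega>_def weight_def
    by (auto intro!: divide_pos_pos mult_pos_pos zero_less_power prod_pos)
  have "z1 \<in> Q" using z1(1) by (simp add: Q_def)
  then have "(t0, z1) \<in> V" using BN_V QN t0 by blast
  then have "(t0, z1) \<in> {p \<in> V. w0 < \<omega> p}" using w0 by (simp add: w0_def)
  with open_sublevel(2)[OF open_V com]
  obtain T2 R where T2: "open T2" "t0 \<in> T2" "R > 0" "T2 \<times> ball z1 R \<subseteq> {p \<in> V. w0 < \<omega> p}"
    by (rule open_prod_nhd)
  \<comment> \<open>From \<open>exp y \<ge> 1 + y\<close> with
    \<open>y = \<epsilon> * \<eta>\<close>: on \<open>ball z1 R\<close> the density grows by at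
    least \<open>\<epsilon> * w0 * (norm (t - t0))\<^sup>2\<close>.\<close>
  define \<kappa> where "\<kappa> = \<epsilon> * w0 * measure lborel (ball z1 R)"
  have kap: "\<kappa> > 0" unfolding \<kappa>_def using eps(1) w0 content_ball_pos[OF T2(3)] by (intro mult_pos_pos)
  have lower: "Iw t + \<kappa> * (norm (t - t0))\<^sup>2 \<le> P.Iw t" if t: "t \<in> B' \<inter> T2" for t
  proof -
    have tB': "t \<in> B'" and tB: "t \<in> B" using t B'B by auto
    define d where "d = \<epsilon> * (norm (t - t0))\<^sup>2"
    have d: "d \<ge> 0" unfolding d_def using eps(1) by simp
    let ?f = "\<lambda>z. indicator (fiber \<Omega> t) z *\<^sub>R weight (t, z)" and ?b = "\<lambda>z. indicator (ball z1 R) z *\<^sub>R (d * w0)"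
    have ib: "integrable lborel ?b" by (intro integrable_scaleR_left integrable_real_indicator)
        (auto simp: emeasure_lborel_ball_finite[unfolded infinity_ennreal_def])
    have "(LINT z|lborel. ?f z + ?b z) \<le> (LINT z|lborel. indicator (fiber \<Omega> t) z *\<^sub>R P.weight (t, z))"
    proof (rule integral_mono[OF Bochner_Integration.integrable_add[OF weight_integrable[OF tB] ib] P.weight_integrable[OF tB']])
      fix z
      have ball: "w0 < \<omega> (t, z)" if "z \<in> ball z1 R" using T2(4) t that by blast
      have fib: "z \<in> fiber \<Omega> t" if z: "z \<in> ball z1 R"
      proof -
        have "\<xi> z \<noteq> 0" using ball[OF z] w0 by (auto simp: \<omega>_def)
        then have "moddist z0 z < s" using chi_pos[of z] chi_nonneg[of z] by simp
        then show ?thesis using sT(1)[OF B'T[OF tB']] by (simp add: fiber_def)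
      qed
      show "?f z + ?b z \<le> indicator (fiber \<Omega> t) z *\<^sub>R P.weight (t, z)"
      proof (cases "z \<in> fiber \<Omega> t")
        case True
        have "weight (t, z) + d * \<omega> (t, z) = weight (t, z) * (1 + \<epsilon> * \<eta> (t, z))"
          by (simp add: d_def \<omega>_def \<eta>_def algebra_simps)
        also have "\<dots> \<le> P.weight (t, z)" unfolding Pw
          by (intro mult_left_mono exp_ge_add_one_self weight_nonneg)
        finally have 1: "weight (t, z) + d * \<omega> (t, z) \<le> P.weight (t, z)" .
        have "0 \<le> d * \<omega> (t, z)" using d chi_nonneg weight_nonneg by (simp add: \<omega>_def)
        moreover have "d * w0 \<le> d * \<omega> (t, z)" if "z \<in> ball z1 R"
          by (rule mult_left_mono[OF less_imp_le[OF ball[OF that]] d])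
        ultimately have "?b z \<le> d * \<omega> (t, z)" by (cases "z \<in> ball z1 R") auto
        then show ?thesis using 1 True by simp
      next
        case False
        then have "z \<notin> ball z1 R" using fib by blast
        then show ?thesis using False by simp
      qed
    qed
    also have "(LINT z|lborel. ?f z + ?b z) = Iw t + measure lborel (ball z1 R) * (d * w0)"
      unfolding Bochner_Integration.integral_add[OF weight_integrable[OF tB] ib]
      by (simp add: Iw_def set_lebesgue_integral_def)
    finally show ?thesis by (simp add: P.Iw_def set_lebesgue_integral_def \<kappa>_def d_def mult_ac)
  qed
  \<comment> \<open>An upper bound for \<open>Iw\<close> near \<open>t0\<close>, by continuity; the
    factor 2 only makes it strict.\<close>
  define M where "M = 2 * Iw t0"
  have M: "M > Iw t0" "M > 0" using Iw_pos[OF t0] by (auto simp: M_def)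
  define X where "X = B' \<inter> T2 \<inter> TP \<inter> {t \<in> TI. Iw t < M}"
  have "open X" unfolding X_def B'_def
    by (intro open_Int open_ball T2 TP open_sublevel(1) TI Ck_on_imp_continuous_on[OF TI(4)])
  moreover have "t0 \<in> X" using t0B' T2 TP TI M by (simp add: X_def)
  ultimately obtain \<delta>1 where d1: "\<delta>1 > 0" "ball t0 \<delta>1 \<subseteq> X" by (rule openE)
  define \<delta> where "\<delta> = min 1 \<delta>1"
  have dl: "\<delta> > 0" "\<delta> \<le> 1" "ball t0 \<delta> \<subseteq> X" using d1 by (auto simp: \<delta>_def)
  \<comment> \<open>From \<open>ln (I + x) - ln I \<ge> x / (I + x) \<ge> x / (M + \<kappa>)\<close>
    with \<open>x = \<kappa> * (norm (t - t0))\<^sup>2\<close>, where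
    \<open>x \<le> \<kappa>\<close> because \<open>\<delta> \<le> 1\<close>.\<close>
  define c0 where "c0 = \<kappa> / (M + \<kappa>)"
  have c0: "c0 > 0" using kap M by (simp add: c0_def)
  have lnl: "ln (Iw t) + c0 * (norm (t - t0))\<^sup>2 \<le> ln (P.Iw t)" if t: "t \<in> ball t0 \<delta>" for t
  proof -
    have tX: "t \<in> X" using dl(3) t by blast
    then have I: "Iw t > 0" "Iw t < M" and tb: "t \<in> B' \<inter> T2" using Iw_pos[OF B'B] by (auto simp: X_def)
    define x where "x = \<kappa> * (norm (t - t0))\<^sup>2"
    have "norm (t - t0) \<le> 1" using t dl(2) by (simp add: dist_norm norm_minus_commute)
    then have "(norm (t - t0))\<^sup>2 \<le> 1\<^sup>2" by (intro power_mono) auto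
    then have x: "x \<ge> 0" "x \<le> \<kappa>" using kap by (simp_all add: x_def mult_left_le)
    have "ln (Iw t / (Iw t + x)) \<le> Iw t / (Iw t + x) - 1" using I x by (intro ln_le_minus_one divide_pos_pos) auto
    also have "\<dots> = - (x / (Iw t + x))" using I x by (simp add: field_simps)
    also have "\<dots> \<le> - (x / (M + \<kappa>))" using I x by (simp add: frac_le)
    also have "x / (M + \<kappa>) = c0 * (norm (t - t0))\<^sup>2" by (simp add: x_def c0_def)
    finally have "ln (Iw t) - ln (Iw t + x) \<le> - (c0 * (norm (t - t0))\<^sup>2)" using I x by (simp add: ln_div)
    moreover have "ln (Iw t + x) \<le> ln (P.Iw t)" using lower[OF tb] I x by (simp add: x_def)
    ultimately show ?thesis by simp
  qed
  have TIp: "Iw t > 0" if "t \<in> TI" for t using Iw_pos TI(3) that by blast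
  have Ckln: "Ck_on 2 TI (\<lambda>t. - ln (Iw t))" by (intro Ck_on_uminus Ck_on_ln TI TIp)
  have "levi ((*s) \<i>) (\<lambda>t. - ln (Iw t)) t0 b > 0" if b: "b \<noteq> 0" for b
  proof -
    have nb: "norm b > 0" using b by simp
    have "levi ((*s) \<i>) (\<lambda>t. - ln (Iw t)) t0 b \<ge> 4 * (c0 * (norm b)\<^sup>2)"
    proof (rule levi_ge_of_submean[OF cplx_struct_vec TI(1) Ckln TI(2)])
      show "\<delta> / norm b > 0" using dl(1) nb by simp
      fix e :: real assume e: "0 < e" "e < \<delta> / norm b"
      define b' where "b' = e *\<^sub>R b"
      have nb': "norm b' = e * norm b" using e by (simp add: b'_def)
      have nb'd: "norm b' < \<delta>" using e nb by (simp add: nb' field_simps)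
      have inb: "t0 + \<zeta> *s b' \<in> ball t0 \<delta>" if "cmod \<zeta> \<le> 1" for \<zeta>
      proof -
        have "norm (\<zeta> *s b') \<le> 1 * norm b'" unfolding norm_vector_smult using that by (intro mult_right_mono) auto
        then show ?thesis using nb'd by (simp add: dist_norm)
      qed
      have inX: "t0 + \<zeta> *s b' \<in> X" if "cmod \<zeta> \<le> 1" for \<zeta> using inb[OF that] dl(3) by blast
      have cc: "continuous_on (sphere 0 1) (\<lambda>\<zeta>. t0 + \<zeta> *s b')"
        by (intro continuous_on_add continuous_on_const continuous_on_smult_vec continuous_on_id)
      have im: "(\<lambda>\<zeta>. t0 + \<zeta> *s b') ` sphere 0 1 \<subseteq> X" using inX by auto
      have cI: "continuous_on (sphere 0 1) (\<lambda>\<zeta>. ln (Iw (t0 + \<zeta> *s b')))"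
      proof (rule continuous_on_ln)
        show "continuous_on (sphere 0 1) (\<lambda>\<zeta>. Iw (t0 + \<zeta> *s b'))"
          by (rule continuous_on_compose2[OF Ck_on_imp_continuous_on[OF TI(4)] cc]) (use im in \<open>auto simp: X_def\<close>)
        show "\<forall>\<zeta>\<in>sphere 0 1. Iw (t0 + \<zeta> *s b') \<noteq> 0"
        proof
          fix \<zeta> :: complex assume "\<zeta> \<in> sphere 0 1"
          then have "t0 + \<zeta> *s b' \<in> TI" using inX[of \<zeta>] by (simp add: X_def)
          from TIp[OF this] show "Iw (t0 + \<zeta> *s b') \<noteq> 0" by simp
        qed
      qed
      have cP: "continuous_on (sphere 0 1) (\<lambda>\<zeta>. ln (P.Iw (t0 + \<zeta> *s b')))"
      proof (rule continuous_on_ln)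
        show "continuous_on (sphere 0 1) (\<lambda>\<zeta>. P.Iw (t0 + \<zeta> *s b'))"
          by (rule continuous_on_compose2[OF Ck_on_imp_continuous_on[OF TP(4)] cc]) (use im in \<open>auto simp: X_def\<close>)
        show "\<forall>\<zeta>\<in>sphere 0 1. P.Iw (t0 + \<zeta> *s b') \<noteq> 0"
        proof
          fix \<zeta> :: complex assume "\<zeta> \<in> sphere 0 1"
          then have "t0 + \<zeta> *s b' \<in> B'" using inX[of \<zeta>] by (simp add: X_def)
          from P.Iw_pos[OF this] show "P.Iw (t0 + \<zeta> *s b') \<noteq> 0" by simp
        qed
      qed
      \<comment> \<open>The distance to \<open>t0\<close> is constant on the circle, so the gain is
        a constant; the submean inequality is then used for \<open>P.Iw\<close>, which agrees with
        \<open>Iw\<close> at the centre.\<close>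
      have "cmean (\<lambda>\<zeta>. ln (Iw (t0 + \<zeta> *s b'))) + c0 * (norm b')\<^sup>2 =
          cmean (\<lambda>\<zeta>. ln (Iw (t0 + \<zeta> *s b')) + c0 * (norm b')\<^sup>2)"
        unfolding cmean_add[OF cI continuous_on_const] by simp
      also have "\<dots> \<le> cmean (\<lambda>\<zeta>. ln (P.Iw (t0 + \<zeta> *s b')))"
      proof (rule cmean_mono[OF continuous_on_add[OF cI continuous_on_const] cP])
        fix \<zeta> :: complex assume z: "\<zeta> \<in> sphere 0 1"
        have "norm (\<zeta> *s b') = norm b'" using z by (simp add: norm_vector_smult)
        then show "ln (Iw (t0 + \<zeta> *s b')) + c0 * (norm b')\<^sup>2 \<le> ln (P.Iw (t0 + \<zeta> *s b'))"
          using lnl[OF inb, of \<zeta>] z by simp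
      qed
      also have "\<dots> \<le> ln (P.Iw t0)" by (rule P.ln_Iw_submean) (use inX in \<open>auto simp: X_def\<close>)
      finally have "- ln (Iw t0) + c0 * (norm b')\<^sup>2 \<le> cmean (\<lambda>\<zeta>. - ln (Iw (t0 + \<zeta> *s b')))"
        unfolding P0 cmean_uminus by simp
      then show "- ln (Iw t0) + c0 * (norm b)\<^sup>2 * e\<^sup>2 \<le> cmean (\<lambda>\<zeta>. - ln (Iw (t0 + cscale ((*s) \<i>) \<zeta> (e *\<^sub>R b))))"
        unfolding cscale_vec b'_def[symmetric] nb' power_mult_distrib by (simp add: mult_ac)
    qed
    moreover have "4 * (c0 * (norm b)\<^sup>2) > 0" using c0 nb by simp
    ultimately show ?thesis by linarith
  qed
  then show ?thesis using TI by blast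
qed

end

section \<open>From one parameter to all of \<open>U\<close>\<close>

lemma closure_nhd_Int: "closure_nhd U \<Omega> V \<Longrightarrow> closure_nhd U \<Omega> W \<Longrightarrow> closure_nhd U \<Omega> (V \<inter> W)"
  unfolding closure_nhd_def by blast

text \<open>\<open>\<psi>\<close> is specified only through its exponential on \<open>U\<close>. The
  first conjunct shows that such a function exists, which amounts to positivity of the integral; the
  second covers every choice, whatever its values off \<open>U\<close>.\<close>

theorem theorem1p11:
  fixes U :: "(complex ^ 'n) set"
    and \<Omega> V O' :: "((complex ^ 'n) \<times> (complex ^ 'm)) set"
    and \<phi> :: "(complex ^ 'n) \<times> (complex ^ 'm) \<Rightarrow> real"
    and k :: "'m \<Rightarrow> nat"
  assumes "is_domain U"
    and "family_of_bounded_domains U \<Omega>"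
    and "has_psh_defining_function U \<Omega>"
    and "closure_nhd U \<Omega> V"
    and "Ck_on 2 V \<phi>"
    and "plurisubharmonic_prod_on V \<phi>"
    and "\<forall>t\<in>U. Reinhardt_domain (fiber \<Omega> t)"
    and "torus_invariant_on V \<phi>"
    and "open O'" and "O' \<subseteq> \<Omega>" and "fst ` O' = U"
    and "strictly_plurisubharmonic_prod_on O' \<phi>"
  shows "(\<exists>\<psi>. \<forall>t\<in>U. exp (- \<psi> t) =
            (LINT z:fiber \<Omega> t|lborel. (cmod (\<Prod>j\<in>UNIV. (z $ j) ^ k j))\<^sup>2 * exp (- \<phi> (t, z)))) \<and>
         (\<forall>\<psi>. (\<forall>t\<in>U. exp (- \<psi> t) =
            (LINT z:fiber \<Omega> t|lborel. (cmod (\<Prod>j\<in>UNIV. (z $ j) ^ k j))\<^sup>2 * exp (- \<phi> (t, z))))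
           \<longrightarrow> strictly_plurisubharmonic_on U \<psi>)"
proof -
  define I where "I = (\<lambda>t. LINT z:fiber \<Omega> t|lborel. (cmod (\<Prod>j\<in>UNIV. (z $ j) ^ k j))\<^sup>2 * exp (- \<phi> (t, z)))"
  have U: "open U" using assms(1) by (simp add: is_domain_def)
  have Om: "open \<Omega>" "\<Omega> \<subseteq> U \<times> UNIV"
    using assms(2) by (auto simp: family_of_bounded_domains_def family_of_domains_def is_domain_def)
  have V: "open V" "\<Omega> \<subseteq> V"
    using assms(4) Om(2) closure_subset[of \<Omega>] unfolding closure_nhd_def by blast+
  have phi: "Ck_on 2 V \<phi>" by (rule assms(5))
  obtain W \<rho> W' where def: "defining_function 2 U \<Omega> W \<rho>" and W': "closure_nhd U \<Omega> W'" "W' \<subseteq> W"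
    and psh: "plurisubharmonic_prod_on W' \<rho>"
    using assms(3) unfolding has_psh_defining_function_def by blast
  have rho: "Ck_on 2 W' \<rho>" using def W'(2) by (auto simp: defining_function_def intro: Ck_on_subset)
  have oW': "open W'" using W'(1) by (simp add: closure_nhd_def)
  \<comment> \<open>Applying \<open>local_box\<close> to this intersection places
    \<open>B \<times> N\<close> where \<open>\<rho>\<close> is plurisubharmonic and
    \<open>\<phi>\<close> is defined.\<close>
  have Vn: "closure_nhd U \<Omega> (W' \<inter> V)" by (rule closure_nhd_Int[OF W'(1) assms(4)])
  have key: "\<exists>T. open T \<and> t0 \<in> T \<and> T \<subseteq> U \<and> (\<forall>t\<in>T. I t > 0) \<and> Ck_on 2 T I \<and>
    (\<forall>b. b \<noteq> 0 \<longrightarrow> levi ((*s) \<i>) (\<lambda>t. - ln (I t)) t0 b > 0)" if t0: "t0 \<in> U" for t0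
  proof -
    from local_box[OF assms(2) def Vn assms(7) t0]
    obtain B N c where B: "open B" "t0 \<in> B" "B \<subseteq> U" and N: "compact N" "B \<times> N \<subseteq> W \<inter> (W' \<inter> V)"
      and L: "\<forall>t\<in>B. fiber \<Omega> t \<subseteq> interior N \<and> (t, logz c) \<in> \<Omega>"
        "\<forall>t\<in>B. \<forall>z\<in>N. (t, z) \<in> \<Omega> \<longleftrightarrow> \<rho> (t, z) < 0"
        "\<forall>z\<in>N. \<rho> (t0, z) \<le> 0 \<longrightarrow> z \<in> interior N \<and>
          (\<rho> (t0, z) = 0 \<longrightarrow> (\<exists>e. frechet_derivative \<rho> (at (t0, z)) (0, e) > 0))"
      by (elim exE conjE) (rule that)
    have fib: "fiber \<Omega> t \<subseteq> interior N \<and> (t, logz c) \<in> \<Omega>" if "t \<in> B" for t using L(1) that by (rule bspec)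
    have iff: "(t, z) \<in> \<Omega> \<longleftrightarrow> \<rho> (t, z) < 0" if "t \<in> B" "z \<in> N" for t z using L(2) that by simp
    interpret R: reinhardt_weight \<Omega> W' \<rho> B N c V \<phi> k
    proof unfold_locales
      show "open \<Omega>" by (rule Om)
      show "open W'" by (rule oW')
      show "open B" by (rule B)
      show "compact N" by (rule N)
      show "B \<times> N \<subseteq> W'" using N by blast
      show "Ck_on 2 W' \<rho>" by (rule rho)
      show "levi JP \<rho> x b \<ge> 0" if "x \<in> W'" for x b by (rule plurisubharmonic_prod_on_levi[OF oW' rho psh that])
      show "fiber \<Omega> t \<subseteq> interior N" if "t \<in> B" for t using fib[OF that] by blast
      show "(t, z) \<in> \<Omega> \<longleftrightarrow> \<rho> (t, z) < 0" if "t \<in> B" "z \<in> N" for t z using that by (rule iff)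
      show "(t, logz c) \<in> \<Omega>" if "t \<in> B" for t using fib[OF that] by blast
      show "Reinhardt_domain (fiber \<Omega> t)" if "t \<in> B" for t using assms(7) that B(3) by blast
      show "open V" by (rule V)
      show "B \<times> N \<subseteq> V" using N by blast
      show "Ck_on 2 V \<phi>" by (rule phi)
      show "levi JP \<phi> (t, z) b \<ge> 0" if "t \<in> B" "(t, z) \<in> \<Omega>" for t z b
        using plurisubharmonic_prod_on_levi[OF V(1) phi assms(6), of "(t, z)" b] V(2) that(2) by blast
      show "\<phi> (t, z) = \<phi> (t, w)" if t: "t \<in> B" and z: "(t, z) \<in> \<Omega>" and m: "\<And>j. cmod (z $ j) = cmod (w $ j)" for t z w
      proof -
        \<comment> \<open>Invariance is assumed only between points of \<open>V\<close>; the rotated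
          point lies in \<open>\<Omega>\<close>, hence in \<open>V\<close>, because the fibre is
          Reinhardt.\<close>
        obtain \<theta> where w: "w = torus_act \<theta> z" using torus_orbit[of w z] m by auto
        have "torus_act \<theta> z \<in> fiber \<Omega> t"
          using assms(7) t B(3) z unfolding Reinhardt_domain_def fiber_def by blast
        then have "(t, torus_act \<theta> z) \<in> V" "(t, z) \<in> V" using V(2) z by (auto simp: fiber_def)
        then show ?thesis using assms(8) unfolding torus_invariant_on_def w by simp
      qed
    qed
    have Iw: "R.Iw = I" by (simp add: fun_eq_iff R.Iw_def I_def R.weight_def prod_norm[symmetric] norm_power)
    obtain z0 where z0: "(t0, z0) \<in> O'" using t0 assms(11) by force
    have "O' \<subseteq> V" using assms(10) V(2) by blast
    from strictly_plurisubharmonic_prod_on_levi[OF assms(9) Ck_on_subset[OF phi this] assms(12)]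
    have str: "\<forall>x\<in>O'. \<forall>b. b \<noteq> 0 \<longrightarrow> levi JP \<phi> x b > 0" by blast
    from R.Iw_strict[OF B(2) L(3) assms(9,10) z0 str]
    obtain T where T: "open T" "t0 \<in> T" "T \<subseteq> B" "Ck_on 2 T I" "\<forall>b. b \<noteq> 0 \<longrightarrow> levi ((*s) \<i>) (\<lambda>t. - ln (I t)) t0 b > 0"
      unfolding Iw by (elim exE conjE) (rule that)
    have "\<forall>t\<in>T. I t > 0" using R.Iw_pos T(3) unfolding Iw by blast
    moreover have "T \<subseteq> U" using T(3) B(3) by blast
    ultimately show ?thesis using T by (intro exI[of _ T]) simp
  qed
  have I_pos: "I t > 0" if "t \<in> U" for t using key[OF that] by blast
  have "strictly_plurisubharmonic_on U \<psi>" if psi: "\<forall>t\<in>U. exp (- \<psi> t) = I t" for \<psi>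
  proof -
    have psi_eq: "- ln (I t) = \<psi> t" if "t \<in> U" for t
    proof -
      have "ln (I t) = ln (exp (- \<psi> t))" using psi that by simp
      then show ?thesis by simp
    qed
    have Ck: "Ck_on 2 U \<psi>"
    proof (rule Ck_on_local)
      fix t0 assume "t0 \<in> U"
      then obtain T where T: "open T" "t0 \<in> T" "T \<subseteq> U" "\<forall>t\<in>T. I t > 0" "Ck_on 2 T I" using key by blast
      have "Ck_on 2 T (\<lambda>t. - ln (I t))" by (intro Ck_on_uminus Ck_on_ln T) (use T(4) in blast)
      then have "Ck_on 2 T \<psi>" by (rule Ck_on_cong[OF T(1), rotated]) (use psi_eq T(3) in blast)
      then show "\<exists>T. open T \<and> t0 \<in> T \<and> Ck_on 2 T \<psi>" using T by blast
    qed
    have "positive_definite (complex_Hessian \<psi> t0)" if t0: "t0 \<in> U" for t0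
    proof -
      have "levi ((*s) \<i>) \<psi> t0 b > 0" if "b \<noteq> 0" for b
        using key[OF t0] that levi_cong_open[OF U t0 psi_eq, where J = "(*s) \<i>" and b = b] by auto
      then show ?thesis unfolding positive_definite_complex_Hessian_iff[OF U Ck t0] by blast
    qed
    then show ?thesis unfolding strictly_plurisubharmonic_on_def using Ck by blast
  qed
  moreover have "\<exists>\<psi>. \<forall>t\<in>U. exp (- \<psi> t) = I t"
    using I_pos by (intro exI[of _ "\<lambda>t. - ln (I t)"]) simp
  ultimately show ?thesis unfolding I_def by blast
qed

end
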